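(* Let $p=3$ and $B,b,\mu>0$. Assume $u_0\in H^1(\mathbb{R})\cap L^1(\mathbb{R})$, $xu_0\in L^1(\mathbb{R})$ and that $E_0:=\|u_0\|_{H^1}+\|u_0\|_{L^1}$ is sufficiently small (i.e. $E_0\le\delta$ for a suitable $\delta>0$ depending only on $B,b,\mu$). Then the solution $u$ of $$u_t+(u^3)_x+\int_{\mathbb{R}}Be^{-b|x-y|}u_y(y,t)\,dy=\mu u_{xx}\quad (x\in\mathbb{R},\ t>0),\qquad u(x,0)=u_0(x)$$ satisfies, for any $2\le q\le\infty$, $$\left\|u(\cdot,t)-MG_0(\cdot,t)+\frac{M^3}{4\sqrt3\,\pi\mu}(\log t)\,\partial_xG_0(\cdot,t)\right\|_{L^q}\le CE_1t^{-\frac12\left(1-\frac1q\right)-\frac12},\qquad t\ge2,$$ where $E_1:=E_0+\|xu_0\|_{L^1}$.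
   Context: Fourier transform: $\hat f(\xi)=\mathcal{F}[f](\xi)=\frac1{\sqrt{2\pi}}\int_{\mathbb{R}}e^{-ix\xi}f(x)dx$, $\mathcal{F}^{-1}[g](x)=\frac1{\sqrt{2\pi}}\int_{\mathbb{R}}e^{ix\xi}g(\xi)d\xi$; $\|f\|_{H^s}=\left(\int_{\mathbb{R}}(1+\xi^2)^s|\hat f(\xi)|^2d\xi\right)^{1/2}$. Functions are real-valued and $*$ denotes convolution in $x$. "The solution" is the global mild solution, i.e. the solution of the integral equation $u(t)=T(t)*u_0-\int_0^t\partial_xT(t-\tau)*u^3(\tau)\,d\tau$ with $T(x,t)=\frac1{\sqrt{2\pi}}\mathcal{F}^{-1}\left[\exp\left(-\mu t\xi^2-\frac{i2Bbt\xi}{b^2+\xi^2}\right)\right](x)$, which for $E_0$ sufficiently small exists uniquely in $C([0,\infty);H^1(\mathbb{R}))$ with $\|\partial_x^lu(\cdot,t)\|_{L^2}\le CE_0(1+t)^{-\frac14-\frac l2}$ ($t\ge0$, $l=0,1$) and satisfies $\|u(\cdot,t)\|_{L^q}\le CE_0(1+t)^{-\frac12(1-\frac1q)}$ ($t\ge0$, $2\le q\le\infty$). Definitions: $G(x,t)=\frac{1}{\sqrt{4\pi\mu t}}\exp\left(-\frac{x^2}{4\mu t}\right)$, $G_0(x,t)=G\left(x-\frac{2B}{b}t,t\right)$, $M=\int_{\mathbb{R}}u_0(x)dx$. $C$ denotes positive constants that may depend on the parameters and on the norm of the initial data, but not on $x$ and $t$. *)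

theory Defs
  imports "HOL-Probability.Essential_Supremum"
begin

text \<open>Elements of function spaces are Borel functions; they are compared up to null sets, so nothing
  below depends on the chosen representative.\<close>

definition Lp :: "ereal \<Rightarrow> (real \<Rightarrow> 'a::{banach,second_countable_topology}) set" where
  "Lp q = {f \<in> borel_measurable lborel.
     if q = \<infinity> then esssup lborel (\<lambda>x. ereal (norm (f x))) < \<infinity>
     else integrable lborel (\<lambda>x. norm (f x) powr real_of_ereal q)}"

text \<open>Meaningful for \<open>f \<in> Lp q\<close> only; elsewhere the value is arbitrary.\<close>

definition Lp_norm :: "ereal \<Rightarrow> (real \<Rightarrow> 'a::{banach,second_countable_topology}) \<Rightarrow> real" where
  "Lp_norm q f =
     (if q = \<infinity> then real_of_ereal (esssup lborel (\<lambda>x. ereal (norm (f x))))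
      else (\<integral>x. norm (f x) powr real_of_ereal q \<partial>lborel) powr (1 / real_of_ereal q))"

definition fourier :: "(real \<Rightarrow> complex) \<Rightarrow> real \<Rightarrow> complex" where
  "fourier f \<xi> = 1 / sqrt (2 * pi) * (\<integral>x. exp (- (\<i> * x * \<xi>)) * f x \<partial>lborel)"

definition inv_fourier :: "(real \<Rightarrow> complex) \<Rightarrow> real \<Rightarrow> complex" where
  "inv_fourier g x = 1 / sqrt (2 * pi) * (\<integral>\<xi>. exp (\<i> * x * \<xi>) * g \<xi> \<partial>lborel)"

text \<open>The Fourier transform on \<open>L\<^sup>2\<close>, where the integral defining \<^const>\<open>fourier\<close> need not
  converge: the \<open>L\<^sup>2\<close> limit of the transforms of the truncations to \<open>[-R, R]\<close>. It exists by
  Plancherel's theorem and is unique almost everywhere.\<close>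

definition fourier_L2 :: "(real \<Rightarrow> complex) \<Rightarrow> real \<Rightarrow> complex" where
  "fourier_L2 f = (SOME g. g \<in> Lp 2 \<and>
     ((\<lambda>R. \<integral>\<^sup>+\<xi>. ennreal ((norm (fourier (\<lambda>x. indicator {-R..R} x * f x) \<xi> - g \<xi>))\<^sup>2) \<partial>lborel)
        \<longlongrightarrow> 0) at_top)"

text \<open>The Sobolev space \<open>H\<^sup>s\<close> of real-valued functions, for \<open>s \<ge> 0\<close> (so that \<open>H\<^sup>s \<subseteq> L\<^sup>2\<close>).\<close>

definition sobolev :: "real \<Rightarrow> (real \<Rightarrow> real) set" where
  "sobolev s = {f \<in> Lp 2.
     integrable lborel (\<lambda>\<xi>. (1 + \<xi>\<^sup>2) powr s * (norm (fourier_L2 (\<lambda>x. complex_of_real (f x)) \<xi>))\<^sup>2)}"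

definition sobolev_norm :: "real \<Rightarrow> (real \<Rightarrow> real) \<Rightarrow> real" where
  "sobolev_norm s f =
     sqrt (\<integral>\<xi>. (1 + \<xi>\<^sup>2) powr s * (norm (fourier_L2 (\<lambda>x. complex_of_real (f x)) \<xi>))\<^sup>2 \<partial>lborel)"

text \<open>\<open>C([0,\<infinity>); H\<^sup>s)\<close>; a function of time and space is written \<open>u t x\<close>.\<close>

definition continuous_sobolev :: "real \<Rightarrow> (real \<Rightarrow> real \<Rightarrow> real) \<Rightarrow> bool" where
  "continuous_sobolev s u \<longleftrightarrow>
     (\<forall>t\<ge>0. u t \<in> sobolev s \<and>
        ((\<lambda>r. sobolev_norm s (\<lambda>x. u r x - u t x)) \<longlongrightarrow> 0) (at t within {0..}))"

definition convol :: "(real \<Rightarrow> real) \<Rightarrow> (real \<Rightarrow> real) \<Rightarrow> real \<Rightarrow> real" where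
  "convol f g x = (\<integral>y. f (x - y) * g y \<partial>lborel)"

text \<open>The fundamental solution of the linear part of
  \<open>u\<^sub>t + (u\<^sup>3)\<^sub>x + \<integral> B e\<^bsup>-b|x-y|\<^esup> u\<^sub>y(y,t) dy = \<mu> u\<^sub>x\<^sub>x\<close>, for \<open>t > 0\<close>. The inverse transform is already
  real, its argument being Hermitian in \<open>\<xi>\<close>; \<^const>\<open>Re\<close> only adjusts the type.\<close>

definition T_kernel :: "real \<Rightarrow> real \<Rightarrow> real \<Rightarrow> real \<Rightarrow> real \<Rightarrow> real" where
  "T_kernel B b \<mu> x t = 1 / sqrt (2 * pi) *
     Re (inv_fourier (\<lambda>\<xi>. exp (- (\<mu> * t * \<xi>\<^sup>2) - \<i> * 2 * B * b * t * \<xi> / (b\<^sup>2 + \<xi>\<^sup>2))) x)"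

text \<open>Global mild solutions in \<open>C([0,\<infinity>); H\<^sup>1)\<close>. Since \<open>T(\<cdot>,0)\<close> is the Dirac measure, the integral
  equation at \<open>t = 0\<close> is the initial condition. For \<open>u\<close> in this class the integrals are absolutely
  convergent.\<close>

definition mild_solution ::
  "real \<Rightarrow> real \<Rightarrow> real \<Rightarrow> (real \<Rightarrow> real) \<Rightarrow> (real \<Rightarrow> real \<Rightarrow> real) \<Rightarrow> bool" where
  "mild_solution B b \<mu> u\<^sub>0 u \<longleftrightarrow>
     continuous_sobolev 1 u \<and>
     (AE x in lborel. u 0 x = u\<^sub>0 x) \<and>
     (\<forall>t>0. AE x in lborel.
        u t x = convol (\<lambda>y. T_kernel B b \<mu> y t) u\<^sub>0 x
          - (LINT \<tau>:{0..t}|lborel.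
               convol (\<lambda>y. deriv (\<lambda>z. T_kernel B b \<mu> z (t - \<tau>)) y) (\<lambda>y. (u \<tau> y) ^ 3) x))"

definition G :: "real \<Rightarrow> real \<Rightarrow> real \<Rightarrow> real" where
  "G \<mu> x t = 1 / sqrt (4 * pi * \<mu> * t) * exp (- (x\<^sup>2 / (4 * \<mu> * t)))"

definition G\<^sub>0 :: "real \<Rightarrow> real \<Rightarrow> real \<Rightarrow> real \<Rightarrow> real \<Rightarrow> real" where
  "G\<^sub>0 B b \<mu> x t = G \<mu> (x - 2 * B / b * t) t"

end

theory Submission
  imports Defs "HOL-Probability.Probability"
begin

text \<open>For an integrable and square-integrable symbol \<open>k\<close>, the
  \<open>L\<^sup>1\<close> norm of \<open>k\<close> bounds the supremum of its inverse transform and the \<open>L\<^sup>2\<close> norm of \<open>k\<close> its \<open>L\<^sup>2\<close>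
  norm; the other \<open>L\<^sup>q\<close> norms follow by interpolation. So it suffices to estimate the transform of the
  remainder, mostly by multiples of \<open>t\<^bsup>-1/2\<^esup> / (1 + t \<xi>\<^sup>2)\<close>. The decay rates of \<open>u\<close> in \<open>L\<^sup>2\<close> and in
  \<open>L\<^sup>\<infinity>\<close> come from a continuity argument, since with these rates the transform of \<open>u\<^sup>3\<close> is \<open>O(1/\<tau>)\<close>
  and the Duhamel term closes with a cubic power of the size of \<open>u\<close>. They give
  \<open>\<parallel>u - M G\<^sub>0\<parallel>\<^sub>2 = O(\<tau>\<^bsup>-1/2\<^esup>)\<close>, hence the transform of \<open>u\<^sup>3\<close> differs from that of \<open>(M G\<^sub>0)\<^sup>3\<close>,
  which is nearly \<open>c/\<tau>\<close> times the linear propagator, by an integrable \<open>O(\<tau>\<^bsup>-5/4\<^esup>)\<close>. Integrating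
  \<open>c/\<tau>\<close> over \<open>[1, t/2]\<close> produces the logarithm.\<close>

section \<open>Square-integrable functions and the Fourier integral\<close>

text \<open>A symbol bounded by 1/(1 + t \<xi>^2) has L^1 norm of order t^(-1/2) and L^2 norm of
  order t^(-1/4), and under heat damping each further factor |\<xi>| is worth t^(-1/2). The
  derivative in the Duhamel term thus supplies the extra t^(-1/2) of the claim, provided that the
  rest of the source is integrable in time. The obstacle is that it decays like 1/\<tau>, which just
  fails, so this part is computed and not estimated: its coefficient is the integral of the cubed
  profile, M^3 / (4 sqrt 3 pi \<mu> \<tau>). The cubed Gaussian is damped by exp(-\<mu> \<tau>
  \<xi>^2 / 3) instead of exp(-\<mu> \<tau> \<xi>^2); the mismatch in the source is O(\<xi>^2), and
  over a time of order t it costs t \<xi>^2, again O(1) after damping. Time is cut at 1 because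
  1/\<tau> is not integrable at 0, and at t/2 because before t/2 the propagator still has time t/2
  to damp, whereas after t/2 the source is already small. Every mild solution is covered, since its
  decay is derived from smallness, the integral equation and continuity in H^1.\<close>

definition sq_integrable :: "(real \<Rightarrow> 'a::{banach,second_countable_topology}) \<Rightarrow> bool" where
  "sq_integrable f \<longleftrightarrow> f \<in> borel_measurable lborel \<and> integrable lborel (\<lambda>x. (norm (f x))\<^sup>2)"

lemma sq_integrable_measurable [measurable_dest]:
  "sq_integrable f \<Longrightarrow> f \<in> borel_measurable borel"
  by (simp add: sq_integrable_def)

lemma sq_integrableD: "sq_integrable f \<Longrightarrow> integrable lborel (\<lambda>x. (norm (f x))\<^sup>2)"
  by (simp add: sq_integrable_def)

lemma sq_integrable_bound:
  assumes "sq_integrable f" "g \<in> borel_measurable lborel" "AE x in lborel. norm (g x) \<le> norm (f x)"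
  shows "sq_integrable g"
  unfolding sq_integrable_def
proof
  show "integrable lborel (\<lambda>x. (norm (g x))\<^sup>2)"
    by (rule Bochner_Integration.integrable_bound[OF sq_integrableD[OF assms(1)]])
       (use assms in \<open>auto intro: power_mono\<close>)
qed (use assms in auto)

lemma square_add_le: "(a + b)\<^sup>2 \<le> 2 * a\<^sup>2 + 2 * (b::real)\<^sup>2"
  using zero_le_power2[of "a - b"] by (simp add: power2_sum power2_diff)

lemma norm_add_square_le:
  "(norm (a + b))\<^sup>2 \<le> 2 * (norm a)\<^sup>2 + 2 * (norm (b::'a::real_normed_vector))\<^sup>2"
proof -
  have "(norm (a + b))\<^sup>2 \<le> (norm a + norm b)\<^sup>2"
    by (intro power_mono norm_triangle_ineq) auto
  with square_add_le show ?thesis by (rule order_trans[rotated])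
qed

lemma sq_integrable_add:
  assumes "sq_integrable f" "sq_integrable g"
  shows "sq_integrable (\<lambda>x. f x + g x)"
  unfolding sq_integrable_def
proof
  note [measurable] = sq_integrable_measurable[OF assms(1)] sq_integrable_measurable[OF assms(2)]
  show "integrable lborel (\<lambda>x. (norm (f x + g x))\<^sup>2)"
    by (rule Bochner_Integration.integrable_bound
          [of _ "\<lambda>x. 2 * (norm (f x))\<^sup>2 + 2 * (norm (g x))\<^sup>2"])
       (use assms norm_add_square_le[of "f _" "g _"] in \<open>auto simp: sq_integrable_def\<close>)
qed (use assms in \<open>auto simp: sq_integrable_def\<close>)

lemma sq_integrable_scaleR:
  "sq_integrable f \<Longrightarrow> sq_integrable (\<lambda>x. c *\<^sub>R f x)"
  unfolding sq_integrable_def by (auto simp: power_mult_distrib)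

lemma sq_integrable_minus: "sq_integrable f \<Longrightarrow> sq_integrable (\<lambda>x. - f x)"
  using sq_integrable_scaleR[of f "-1"] by simp

lemma sq_integrable_diff:
  "sq_integrable f \<Longrightarrow> sq_integrable g \<Longrightarrow> sq_integrable (\<lambda>x. f x - g x)"
  using sq_integrable_add[of f "\<lambda>x. - g x"] sq_integrable_minus[of g] by simp

lemma sq_integrable_of_real:
  "sq_integrable f \<Longrightarrow> sq_integrable (\<lambda>x. complex_of_real (f x))"
  unfolding sq_integrable_def by auto

lemma integrable_mult_sq:
  fixes f g :: "real \<Rightarrow> 'a::{real_normed_algebra,banach,second_countable_topology}"
  assumes "sq_integrable f" "sq_integrable g"
  shows "integrable lborel (\<lambda>x. f x * g x)"
proof (rule Bochner_Integration.integrable_bound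
    [of _ "\<lambda>x. (norm (f x))\<^sup>2 + (norm (g x))\<^sup>2"])
  note [measurable] = sq_integrable_measurable[OF assms(1)] sq_integrable_measurable[OF assms(2)]
  show "(\<lambda>x. f x * g x) \<in> borel_measurable lborel" by measurable
  have "norm (f x * g x) \<le> (norm (f x))\<^sup>2 + (norm (g x))\<^sup>2" for x
    using sum_squares_bound[of "norm (f x)" "norm (g x)"] norm_mult_ineq[of "f x" "g x"]
      mult_nonneg_nonneg[OF norm_ge_zero[of "f x"] norm_ge_zero[of "g x"]] by linarith
  then show "AE x in lborel. norm (f x * g x) \<le> norm ((norm (f x))\<^sup>2 + (norm (g x))\<^sup>2)"
    by auto
qed (use assms in \<open>auto simp: sq_integrable_def\<close>)

lemma Cauchy_Schwarz_integral:
  fixes f g :: "real \<Rightarrow> 'a::{real_normed_algebra,banach,second_countable_topology}"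
  assumes f: "sq_integrable f" and g: "sq_integrable g"
  shows "(\<integral>x. norm (f x) * norm (g x) \<partial>lborel)
    \<le> sqrt (\<integral>x. (norm (f x))\<^sup>2 \<partial>lborel) * sqrt (\<integral>x. (norm (g x))\<^sup>2 \<partial>lborel)"
proof -
  note [measurable] = sq_integrable_measurable[OF f] sq_integrable_measurable[OF g]
  have int: "integrable lborel (\<lambda>x. norm (f x) * norm (g x))"
    using integrable_mult_sq[of "\<lambda>x. norm (f x)" "\<lambda>x. norm (g x)"] f g
    by (simp add: sq_integrable_def)
  have "(\<integral>\<^sup>+x. ennreal (norm (f x)) * ennreal (norm (g x)) \<partial>lborel)\<^sup>2
      \<le> (\<integral>\<^sup>+x. ennreal (norm (f x)) ^ 2 \<partial>lborel) * (\<integral>\<^sup>+x. ennreal (norm (g x)) ^ 2 \<partial>lborel)"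
    by (rule Cauchy_Schwarz_nn_integral) auto
  then have "(ennreal (\<integral>x. norm (f x) * norm (g x) \<partial>lborel))\<^sup>2
      \<le> ennreal (\<integral>x. (norm (f x))\<^sup>2 \<partial>lborel) * ennreal (\<integral>x. (norm (g x))\<^sup>2 \<partial>lborel)"
    using int f g
    by (simp add: sq_integrable_def nn_integral_eq_integral ennreal_power flip: ennreal_mult)
  then have "(\<integral>x. norm (f x) * norm (g x) \<partial>lborel)\<^sup>2
      \<le> (\<integral>x. (norm (f x))\<^sup>2 \<partial>lborel) * (\<integral>x. (norm (g x))\<^sup>2 \<partial>lborel)"
    by (simp add: ennreal_power flip: ennreal_mult)
  then show ?thesis
    using real_le_rsqrt real_sqrt_mult by force
qed

lemma L2_triangle:
  fixes f g :: "real \<Rightarrow> real"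
  assumes f: "sq_integrable f" and g: "sq_integrable g"
  shows "sqrt (\<integral>x. (f x + g x)\<^sup>2 \<partial>lborel) \<le> sqrt (\<integral>x. (f x)\<^sup>2 \<partial>lborel) + sqrt (\<integral>x. (g x)\<^sup>2 \<partial>lborel)"
proof -
  have i: "integrable lborel (\<lambda>x. (f x)\<^sup>2)" "integrable lborel (\<lambda>x. (g x)\<^sup>2)"
    using f g by (auto simp: sq_integrable_def)
  have fg: "integrable lborel (\<lambda>x. f x * g x)"
    by (rule integrable_mult_sq[OF f g])
  have "(\<integral>x. f x * g x \<partial>lborel) \<le> (\<integral>x. norm (f x) * norm (g x) \<partial>lborel)"
    by (rule integral_mono[OF fg]) (use integrable_norm[OF fg] in \<open>auto simp: abs_mult[symmetric]\<close>)
  also note Cauchy_Schwarz_integral[OF f g]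
  finally have "(\<integral>x. (f x + g x)\<^sup>2 \<partial>lborel)
      \<le> (sqrt (\<integral>x. (f x)\<^sup>2 \<partial>lborel) + sqrt (\<integral>x. (g x)\<^sup>2 \<partial>lborel))\<^sup>2"
    using i fg by (simp add: power2_sum Bochner_Integration.integral_add mult.assoc)
  then show ?thesis
    by (rule real_le_lsqrt[rotated -1]) auto
qed

lemma norm_exp_minus_i [simp]: "norm (exp (- (\<i> * complex_of_real x * complex_of_real y))) = 1"
  by (simp add: norm_exp_eq_Re)

lemma norm_exp_i [simp]: "norm (exp (\<i> * complex_of_real x * complex_of_real y)) = 1"
  by (simp add: norm_exp_eq_Re)

lemma integrable_bounded_mult:
  fixes c f :: "real \<Rightarrow> complex"
  assumes "integrable lborel f" "c \<in> borel_measurable lborel" "\<And>x. norm (c x) \<le> 1"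
  shows "integrable lborel (\<lambda>x. c x * f x)"
  by (rule Bochner_Integration.integrable_bound[OF assms(1)])
     (use assms in \<open>auto simp: norm_mult intro!: mult_left_le_one_le\<close>)

lemma integrable_fourier:
  "integrable lborel f \<Longrightarrow> integrable lborel (\<lambda>x. exp (- (\<i> * complex_of_real x * complex_of_real \<xi>)) * f x)"
  by (rule integrable_bounded_mult) auto

lemma integrable_inv_fourier:
  "integrable lborel f \<Longrightarrow> integrable lborel (\<lambda>x. exp (\<i> * complex_of_real y * complex_of_real x) * f x)"
  by (rule integrable_bounded_mult) auto

lemma inv_fourier_eq: "inv_fourier g x = fourier g (- x)"
  unfolding inv_fourier_def fourier_def by (simp add: mult.commute mult.left_commute)

lemma measurable_fourier [measurable]:
  assumes [measurable]: "f \<in> borel_measurable borel"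
  shows "fourier f \<in> borel_measurable borel"
  unfolding fourier_def[abs_def] by measurable

lemma measurable_inv_fourier [measurable]:
  assumes [measurable]: "f \<in> borel_measurable borel"
  shows "inv_fourier f \<in> borel_measurable borel"
  unfolding inv_fourier_eq[abs_def] by measurable

lemma sqrt_2pi_ge_1: "1 \<le> sqrt (2 * pi)"
  using pi_gt3 by simp

lemma norm_fourier_le: "norm (fourier f \<xi>) \<le> (\<integral>x. norm (f x) \<partial>lborel)"
proof -
  have "norm (\<integral>x. exp (- (\<i> * complex_of_real x * complex_of_real \<xi>)) * f x \<partial>lborel)
      \<le> (\<integral>x. norm (f x) \<partial>lborel)"
    using integral_norm_bound[of lborel "\<lambda>x. exp (- (\<i> * complex_of_real x * complex_of_real \<xi>)) * f x"]
    by (simp add: norm_mult)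
  then have "norm (\<integral>x. exp (- (\<i> * complex_of_real x * complex_of_real \<xi>)) * f x \<partial>lborel)
      \<le> (\<integral>x. norm (f x) \<partial>lborel) * sqrt (2 * pi)"
  proof (rule order_trans)
    have "0 \<le> (\<integral>x. norm (f x) \<partial>lborel)" by simp
    from mult_left_mono[OF sqrt_2pi_ge_1 this]
    show "(\<integral>x. norm (f x) \<partial>lborel) \<le> (\<integral>x. norm (f x) \<partial>lborel) * sqrt (2 * pi)" by simp
  qed
  then show ?thesis
    unfolding fourier_def by (simp add: norm_mult norm_divide divide_le_eq)
qed

lemma norm_inv_fourier_le: "norm (inv_fourier f x) \<le> (\<integral>\<xi>. norm (f \<xi>) \<partial>lborel)"
  unfolding inv_fourier_eq by (rule norm_fourier_le)

lemma fourier_add: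
  "integrable lborel f \<Longrightarrow> integrable lborel g \<Longrightarrow> fourier (\<lambda>x. f x + g x) \<xi> = fourier f \<xi> + fourier g \<xi>"
  unfolding fourier_def
  by (simp add: distrib_left integrable_fourier)

lemma fourier_diff:
  "integrable lborel f \<Longrightarrow> integrable lborel g \<Longrightarrow> fourier (\<lambda>x. f x - g x) \<xi> = fourier f \<xi> - fourier g \<xi>"
  unfolding fourier_def
  by (simp add: right_diff_distrib integrable_fourier)

lemma inv_fourier_add:
  "integrable lborel f \<Longrightarrow> integrable lborel g \<Longrightarrow>
   inv_fourier (\<lambda>x. f x + g x) \<xi> = inv_fourier f \<xi> + inv_fourier g \<xi>"
  unfolding inv_fourier_eq by (rule fourier_add)

lemma inv_fourier_diff:
  "integrable lborel f \<Longrightarrow> integrable lborel g \<Longrightarrow>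
   inv_fourier (\<lambda>x. f x - g x) \<xi> = inv_fourier f \<xi> - inv_fourier g \<xi>"
  unfolding inv_fourier_eq by (rule fourier_diff)

lemma fourier_cmult: "fourier (\<lambda>x. c * f x) \<xi> = c * fourier f \<xi>"
  unfolding fourier_def by (simp add: mult.left_commute[of _ c])

lemma inv_fourier_cmult: "inv_fourier (\<lambda>x. c * f x) \<xi> = c * inv_fourier f \<xi>"
  unfolding inv_fourier_eq by (rule fourier_cmult)

interpretation lborel_pair: pair_sigma_finite lborel lborel ..

text \<open>With c an oscillating factor such as exp(-i x y), this licenses Fubini in the
  multiplication formula.\<close>

lemma integrable_product_bounded:
  fixes c :: "real \<times> real \<Rightarrow> complex" and f k :: "real \<Rightarrow> complex"
  assumes f: "integrable lborel f" and k: "integrable lborel k"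
    and c [measurable]: "c \<in> borel_measurable (borel \<Otimes>\<^sub>M borel)" and c1: "\<And>p. norm (c p) \<le> 1"
  shows "integrable (lborel \<Otimes>\<^sub>M lborel) (\<lambda>(x, y). c (x, y) * f x * k y)"
proof (rule lborel_pair.Fubini_integrable)
  note [measurable] = borel_measurable_integrable[OF f] borel_measurable_integrable[OF k]
  show "(\<lambda>(x, y). c (x, y) * f x * k y) \<in> borel_measurable (lborel \<Otimes>\<^sub>M lborel)"
    by measurable
  have i: "integrable lborel (\<lambda>y. c (x, y) * f x * k y)" for x
    using integrable_mult_right[OF integrable_bounded_mult[OF k, of "\<lambda>y. c (x, y)"], of "f x"] c1
    by (simp add: mult_ac)
  then show "AE x in lborel. integrable lborel (\<lambda>y. case (x, y) of (x, y) \<Rightarrow> c (x, y) * f x * k y)"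
    by simp
  show "integrable lborel (\<lambda>x. \<integral>y. norm (case (x, y) of (x, y) \<Rightarrow> c (x, y) * f x * k y) \<partial>lborel)"
  proof (rule Bochner_Integration.integrable_bound[of _ "\<lambda>x. norm (f x) * (\<integral>y. norm (k y) \<partial>lborel)"])
    show "integrable lborel (\<lambda>x. norm (f x) * (\<integral>y. norm (k y) \<partial>lborel))" using f by auto
    have "(\<integral>y. norm (c (x, y) * f x * k y) \<partial>lborel) \<le> (\<integral>y. norm (f x) * norm (k y) \<partial>lborel)" for x
    proof (rule integral_mono[OF integrable_norm[OF i]])
      show "norm (c (x, y) * f x * k y) \<le> norm (f x) * norm (k y)" for y
        using c1[of "(x, y)"] by (auto simp: norm_mult mult.assoc intro!: mult_left_le_one_le)
    qed (use k in auto)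
    then show "AE x in lborel. norm (\<integral>y. norm (case (x, y) of (x, y) \<Rightarrow> c (x, y) * f x * k y) \<partial>lborel)
        \<le> norm (norm (f x) * (\<integral>y. norm (k y) \<partial>lborel))"
      by (auto simp: abs_mult)
  qed measurable
qed

text \<open>The multiplication formula: by Fubini both sides are the same double integral, because
  the kernel exp(-i x \<xi>) is symmetric in its arguments. The L^2 theory and the Fourier form of
  convolutions are both derived from it.\<close>

lemma fourier_duality:
  assumes f: "integrable lborel f" and k: "integrable lborel k"
  shows "(\<integral>\<xi>. fourier f \<xi> * k \<xi> \<partial>lborel) = (\<integral>x. f x * fourier k x \<partial>lborel)"
proof -
  have int: "integrable (lborel \<Otimes>\<^sub>M lborel)
      (\<lambda>(x, \<xi>). exp (- (\<i> * complex_of_real x * complex_of_real \<xi>)) * f x * k \<xi>)"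
    using integrable_product_bounded[OF f k,
        of "\<lambda>(x, \<xi>). exp (- (\<i> * complex_of_real x * complex_of_real \<xi>))"]
    by (simp add: split_beta' )
  have "(\<integral>\<xi>. fourier f \<xi> * k \<xi> \<partial>lborel) =
      1 / sqrt (2 * pi) * (\<integral>\<xi>. \<integral>x. exp (- (\<i> * complex_of_real x * complex_of_real \<xi>)) * f x * k \<xi> \<partial>lborel \<partial>lborel)"
    unfolding fourier_def
    by (subst integral_mult_right_zero[symmetric], intro Bochner_Integration.integral_cong refl)
       (simp only: integral_mult_left_zero, simp only: mult.assoc)
  also have "\<dots> = 1 / sqrt (2 * pi) * (\<integral>x. \<integral>\<xi>. exp (- (\<i> * complex_of_real x * complex_of_real \<xi>)) * f x * k \<xi> \<partial>lborel \<partial>lborel)"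
    by (subst lborel_pair.Fubini_integral[OF int]) simp
  also have "(\<lambda>x. \<integral>\<xi>. exp (- (\<i> * complex_of_real x * complex_of_real \<xi>)) * f x * k \<xi> \<partial>lborel)
      = (\<lambda>x. f x * (\<integral>\<xi>. exp (- (\<i> * complex_of_real \<xi> * complex_of_real x)) * k \<xi> \<partial>lborel))"
    by (subst integral_mult_right_zero[symmetric]) (simp add: mult_ac)
  finally show ?thesis
    unfolding fourier_def by (simp add: mult.left_commute)
qed

section \<open>Gaussians and the Bessel inequality\<close>

text \<open>All three facts come from the characteristic function of the standard normal law: c =
  sqrt (2 s) turns exp(-s x^2) into sqrt (2 pi) times the normal density at c x.\<close>

lemma gaussian_fourier_integral:
  assumes s: "s > 0"
  shows "integrable lborel (\<lambda>x. exp (- (s * x\<^sup>2)) :: real)"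
    "(\<integral>x. exp (\<i> * complex_of_real x * complex_of_real \<xi>) * complex_of_real (exp (- (s * x\<^sup>2))) \<partial>lborel)
      = complex_of_real (sqrt (pi / s) * exp (- (\<xi>\<^sup>2 / (4 * s))))"
    "(\<integral>x. exp (- (s * x\<^sup>2)) \<partial>lborel) = sqrt (pi / s)"
proof -
  define c where "c = sqrt (2 * s)"
  have c: "c > 0" "c\<^sup>2 = 2 * s" using s by (auto simp: c_def)
  have eq: "exp (- (s * x\<^sup>2)) = sqrt (2 * pi) * std_normal_density (0 + c * x)" for x
    using c by (simp add: std_normal_density_def power_mult_distrib mult_ac)
  show "integrable lborel (\<lambda>x. exp (- (s * x\<^sup>2)) :: real)"
    unfolding eq using c
    by (intro integrable_mult_right lborel_integrable_real_affine) auto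
  have g: "(\<integral>x. exp (\<i> * complex_of_real x * complex_of_real t) * complex_of_real (exp (- (s * x\<^sup>2))) \<partial>lborel)
      = complex_of_real (sqrt (pi / s) * exp (- (t\<^sup>2 / (4 * s))))" for t
  proof -
    have "complex_of_real (exp (- ((t / c)\<^sup>2) / 2)) = char std_normal_distribution (t / c)"
      by (simp add: char_std_normal_distribution)
    also have "\<dots> = (\<integral>y. std_normal_density y *\<^sub>R exp (\<i> * complex_of_real (t / c * y)) \<partial>lborel)"
      unfolding char_def by (subst integral_density) auto
    also have "\<dots> = \<bar>c\<bar> *\<^sub>R (\<integral>x. std_normal_density (0 + c * x) *\<^sub>R
        exp (\<i> * complex_of_real (t / c * (0 + c * x))) \<partial>lborel)"
      using c by (intro lborel_integral_real_affine) auto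
    also have "(\<lambda>x. std_normal_density (0 + c * x) *\<^sub>R exp (\<i> * complex_of_real (t / c * (0 + c * x))))
       = (\<lambda>x. (1 / sqrt (2 * pi)) *\<^sub>R (exp (\<i> * complex_of_real x * complex_of_real t) * complex_of_real (exp (- (s * x\<^sup>2)))))"
      unfolding eq using c by (auto simp: scaleR_conv_of_real mult_ac fun_eq_iff)
    finally have "complex_of_real (exp (- ((t / c)\<^sup>2) / 2)) = (c / sqrt (2 * pi)) *\<^sub>R
        (\<integral>x. exp (\<i> * complex_of_real x * complex_of_real t) * complex_of_real (exp (- (s * x\<^sup>2))) \<partial>lborel)"
      using c by simp
    moreover have "(sqrt (2 * pi) / c) * (c / sqrt (2 * pi)) = 1" using c by simp
    ultimately have "(sqrt (2 * pi) / c) *\<^sub>R complex_of_real (exp (- ((t / c)\<^sup>2) / 2)) =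
        (\<integral>x. exp (\<i> * complex_of_real x * complex_of_real t) * complex_of_real (exp (- (s * x\<^sup>2))) \<partial>lborel)"
      by simp
    moreover have "sqrt (2 * pi) / c = sqrt (pi / s)"
      by (simp add: c_def flip: real_sqrt_divide)
    moreover have "- ((t / c)\<^sup>2) / 2 = - (t\<^sup>2 / (4 * s))" using c by (simp add: power_divide)
    ultimately show ?thesis by (simp add: scaleR_conv_of_real)
  qed
  show "(\<integral>x. exp (\<i> * complex_of_real x * complex_of_real \<xi>) * complex_of_real (exp (- (s * x\<^sup>2))) \<partial>lborel)
      = complex_of_real (sqrt (pi / s) * exp (- (\<xi>\<^sup>2 / (4 * s))))" by (rule g)
  have "complex_of_real (\<integral>x. exp (- (s * x\<^sup>2)) \<partial>lborel) = complex_of_real (sqrt (pi / s))"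
    using g[of 0] by simp
  then show "(\<integral>x. exp (- (s * x\<^sup>2)) \<partial>lborel) = sqrt (pi / s)"
    using of_real_eq_iff by blast
qed

lemma integrable_gaussian_complex:
  "s > 0 \<Longrightarrow> integrable lborel (\<lambda>x. complex_of_real (exp (- (s * x\<^sup>2))))"
  using gaussian_fourier_integral(1)[of s] by simp

text \<open>Modulated Gaussians are the test functions of the L^2 theory: frequency x on one side
  becomes the centre x on the other.\<close>

lemma fourier_modulated_gaussian:
  assumes s: "s > 0"
  shows "fourier (\<lambda>\<xi>. exp (\<i> * complex_of_real x * complex_of_real \<xi>) * complex_of_real (exp (- (s * \<xi>\<^sup>2)))) y
    = complex_of_real (1 / sqrt (2 * s) * exp (- ((x - y)\<^sup>2 / (4 * s))))"
proof -
  have "exp (- (\<i> * complex_of_real t * complex_of_real y)) *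
      (exp (\<i> * complex_of_real x * complex_of_real t) * complex_of_real (exp (- (s * t\<^sup>2))))
     = exp (\<i> * complex_of_real t * complex_of_real (x - y)) * complex_of_real (exp (- (s * t\<^sup>2)))" for t
    by (simp add: exp_diff exp_minus field_simps)
  then have "fourier (\<lambda>\<xi>. exp (\<i> * complex_of_real x * complex_of_real \<xi>) * complex_of_real (exp (- (s * \<xi>\<^sup>2)))) y
    = complex_of_real (1 / sqrt (2 * pi) * (sqrt (pi / s) * exp (- ((x - y)\<^sup>2 / (4 * s)))))"
    unfolding fourier_def by (simp only: gaussian_fourier_integral(2)[OF s] of_real_mult)
  moreover have "1 / sqrt (2 * pi) * sqrt (pi / s) = 1 / sqrt (2 * s)"
    by (simp add: real_sqrt_mult real_sqrt_divide)
  ultimately show ?thesis by (simp only: mult.assoc[symmetric])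
qed

lemma cnj_fourier: "cnj (fourier f \<xi>) = fourier (\<lambda>x. cnj (f x)) (- \<xi>)"
  unfolding fourier_def by (simp add: exp_cnj flip: Bochner_Integration.integral_cnj)

text \<open>Regularising with a Gaussian turns \<open>\<integral>|f^|\<^sup>2\<close> into a double integral against a probability density
  in \<open>x - y\<close>, and \<open>2|f(x) f(y)| \<le> |f(x)|\<^sup>2 + |f(y)|\<^sup>2\<close> is then enough for the inequality.\<close>

lemma Bessel_gaussian:
  fixes f :: "real \<Rightarrow> complex"
  assumes f: "integrable lborel f" and f2: "sq_integrable f" and s: "s > 0"
  shows "integrable lborel (\<lambda>\<xi>. (norm (fourier f \<xi>))\<^sup>2 * exp (- (s * \<xi>\<^sup>2)))"
    "(\<integral>\<xi>. (norm (fourier f \<xi>))\<^sup>2 * exp (- (s * \<xi>\<^sup>2)) \<partial>lborel) \<le> (\<integral>x. (norm (f x))\<^sup>2 \<partial>lborel)"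
proof -
  note [measurable] = borel_measurable_integrable[OF f]
  define g where "g \<xi> = complex_of_real (exp (- (s * \<xi>\<^sup>2)))" for \<xi>
  \<comment> \<open>The heat kernel at time s: the weight exp(-s \<xi>^2) acts in x as convolution
    with this probability density.\<close>
  define \<Phi> where "\<Phi> z = 1 / sqrt (4 * pi * s) * exp (- (z\<^sup>2 / (4 * s)))" for z :: real
  have gi: "integrable lborel g" unfolding g_def by (rule integrable_gaussian_complex[OF s])
  let ?I = "\<integral>x. norm (f x) \<partial>lborel"
  have I0: "0 \<le> ?I" by simp
  have fg: "integrable lborel (\<lambda>\<xi>. fourier f \<xi> * g \<xi>)"
  proof (rule Bochner_Integration.integrable_bound[of _ "\<lambda>\<xi>. ?I * norm (g \<xi>)"])
    show "AE \<xi> in lborel. norm (fourier f \<xi> * g \<xi>) \<le> norm (?I * norm (g \<xi>))"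
      using norm_fourier_le[of f] I0 by (auto simp: norm_mult abs_mult intro!: mult_right_mono)
  qed (use integrable_norm[OF gi] in \<open>auto simp: g_def simp del: norm_of_real\<close>)
  have i1: "integrable lborel (\<lambda>\<xi>. cnj (fourier f \<xi>) * g \<xi>)"
    using integrable_cnj[OF fg] by (simp add: g_def exp_cnj)
  have i2: "integrable lborel (\<lambda>\<xi>. fourier f \<xi> * (cnj (fourier f \<xi>) * g \<xi>))"
  proof (rule Bochner_Integration.integrable_bound[of _ "\<lambda>\<xi>. ?I * norm (cnj (fourier f \<xi>) * g \<xi>)"])
    show "AE \<xi> in lborel. norm (fourier f \<xi> * (cnj (fourier f \<xi>) * g \<xi>)) \<le> norm (?I * norm (cnj (fourier f \<xi>) * g \<xi>))"
      using norm_fourier_le[of f] I0 by (auto simp: norm_mult abs_mult intro!: mult_right_mono)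
  qed (use i1 in \<open>auto simp: g_def\<close>)
  have eq: "fourier f \<xi> * (cnj (fourier f \<xi>) * g \<xi>) = complex_of_real ((norm (fourier f \<xi>))\<^sup>2 * exp (- (s * \<xi>\<^sup>2)))" for \<xi>
    by (simp only: g_def mult.assoc[symmetric] complex_norm_square[symmetric] of_real_mult)
  show A: "integrable lborel (\<lambda>\<xi>. (norm (fourier f \<xi>))\<^sup>2 * exp (- (s * \<xi>\<^sup>2)))"
    using i2 unfolding eq complex_of_real_integrable_eq .
  \<comment> \<open>The multiplication formula with a modulated Gaussian moves the transform off f
    and leaves the convolution of f with \<Phi>.\<close>
  have inner: "fourier (\<lambda>\<xi>. cnj (fourier f \<xi>) * g \<xi>) x = cnj (\<integral>y. f y * complex_of_real (\<Phi> (x - y)) \<partial>lborel)" for x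
  proof -
    have gm: "integrable lborel (\<lambda>\<xi>. exp (\<i> * complex_of_real x * complex_of_real \<xi>) * g \<xi>)"
      by (rule integrable_inv_fourier[OF gi])
    have "cnj (fourier (\<lambda>\<xi>. cnj (fourier f \<xi>) * g \<xi>) x) = fourier (\<lambda>\<xi>. fourier f \<xi> * g \<xi>) (- x)"
      by (simp add: cnj_fourier g_def)
    also have "\<dots> = 1 / sqrt (2 * pi) * (\<integral>\<xi>. fourier f \<xi> * (exp (\<i> * complex_of_real x * complex_of_real \<xi>) * g \<xi>) \<partial>lborel)"
      unfolding fourier_def[of "\<lambda>\<xi>. fourier f \<xi> * g \<xi>"] by (simp add: mult_ac)
    also have "\<dots> = 1 / sqrt (2 * pi) * (\<integral>y. f y * fourier (\<lambda>\<xi>. exp (\<i> * complex_of_real x * complex_of_real \<xi>) * g \<xi>) y \<partial>lborel)"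
      by (subst fourier_duality[OF f gm]) simp
    also have "\<dots> = (\<integral>y. complex_of_real (1 / sqrt (2 * pi)) * (f y * complex_of_real (1 / sqrt (2 * s) * exp (- ((x - y)\<^sup>2 / (4 * s))))) \<partial>lborel)"
      unfolding g_def fourier_modulated_gaussian[OF s] by simp
    also have "\<dots> = (\<integral>y. f y * complex_of_real (\<Phi> (x - y)) \<partial>lborel)"
    proof (intro Bochner_Integration.integral_cong refl)
      have "sqrt (4 * pi * s) = sqrt (2 * pi) * sqrt (2 * s)" by (simp flip: real_sqrt_mult)
      then show "complex_of_real (1 / sqrt (2 * pi)) * (f y * complex_of_real (1 / sqrt (2 * s) * exp (- ((x - y)\<^sup>2 / (4 * s)))))
        = f y * complex_of_real (\<Phi> (x - y))" for y
        by (simp add: \<Phi>_def)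
    qed
    finally show ?thesis by (metis complex_cnj_cnj)
  qed
  have \<Phi>0: "0 \<le> \<Phi> z" for z using s by (simp add: \<Phi>_def)
  have \<Phi>m [measurable]: "\<Phi> \<in> borel_measurable borel" unfolding \<Phi>_def by measurable
  have \<Phi>i: "integrable lborel \<Phi>"
    using gaussian_fourier_integral(1)[of "1 / (4 * s)"] s unfolding \<Phi>_def by simp
  have \<Phi>1: "(\<integral>z. \<Phi> z \<partial>lborel) = 1"
    using gaussian_fourier_integral(3)[of "1 / (4 * s)"] s unfolding \<Phi>_def
    by (simp add: mult_ac)
  have \<Phi>a: "integrable lborel (\<lambda>y. \<Phi> (x - y))" "(\<integral>y. \<Phi> (x - y) \<partial>lborel) = 1"
     "integrable lborel (\<lambda>x. \<Phi> (x - y))" "(\<integral>x. \<Phi> (x - y) \<partial>lborel) = 1" for x y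
    using lborel_integrable_real_affine[OF \<Phi>i, of "-1" x] lborel_integral_real_affine[of "-1" \<Phi> x]
      lborel_integrable_real_affine[OF \<Phi>i, of 1 "-y"] lborel_integral_real_affine[of 1 \<Phi> "-y"] \<Phi>1
    by (auto simp: add.commute)
  define N where "N x = (norm (f x))\<^sup>2" for x
  have Ni: "integrable lborel N" using f2 unfolding N_def sq_integrable_def by auto
  have N0: "0 \<le> N x" for x by (simp add: N_def)
  have [measurable]: "N \<in> borel_measurable borel" using Ni by auto
  have J1: "integrable (lborel \<Otimes>\<^sub>M lborel) (\<lambda>(x, y). N x * \<Phi> (x - y))"
  proof (rule lborel_pair.Fubini_integrable)
    show "integrable lborel (\<lambda>x. \<integral>y. norm (case (x, y) of (x, y) \<Rightarrow> N x * \<Phi> (x - y)) \<partial>lborel)"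
      using Ni \<Phi>a \<Phi>0 N0 by (simp add: abs_mult)
  qed (use \<Phi>a in auto)
  have J2: "integrable (lborel \<Otimes>\<^sub>M lborel) (\<lambda>(x, y). N y * \<Phi> (x - y))"
  proof -
    have "integrable (lborel \<Otimes>\<^sub>M lborel) (\<lambda>(x, y). N x * \<Phi> (y - x))"
    proof (rule lborel_pair.Fubini_integrable)
      show "integrable lborel (\<lambda>x. \<integral>y. norm (case (x, y) of (x, y) \<Rightarrow> N x * \<Phi> (y - x)) \<partial>lborel)"
        using Ni \<Phi>a \<Phi>0 N0 by (simp add: abs_mult)
    qed (use \<Phi>a in auto)
    from lborel_pair.integrable_product_swap[OF this] show ?thesis by (simp add: split_beta')
  qed
  have K1: "integrable lborel (\<lambda>x. \<integral>y. N x * \<Phi> (x - y) \<partial>lborel)"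
    "(\<integral>x. \<integral>y. N x * \<Phi> (x - y) \<partial>lborel \<partial>lborel) = (\<integral>x. N x \<partial>lborel)"
    using \<Phi>a Ni by simp_all
  have K2: "integrable lborel (\<lambda>x. \<integral>y. N y * \<Phi> (x - y) \<partial>lborel)"
    by (rule lborel_pair.integrable_fst[OF J2])
  have K3: "(\<integral>x. \<integral>y. N y * \<Phi> (x - y) \<partial>lborel \<partial>lborel) = (\<integral>x. N x \<partial>lborel)"
    by (subst lborel_pair.Fubini_integral[symmetric, OF J2]) (simp add: \<Phi>a)
  have AEy: "AE x in lborel. integrable lborel (\<lambda>y. N y * \<Phi> (x - y))"
    by (rule lborel_pair.AE_integrable_fst[OF J2])
  have pt: "AE x in lborel. norm (f x * fourier (\<lambda>\<xi>. cnj (fourier f \<xi>) * g \<xi>) x)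
     \<le> (1/2) * (\<integral>y. N x * \<Phi> (x - y) \<partial>lborel) + (1/2) * (\<integral>y. N y * \<Phi> (x - y) \<partial>lborel)"
    using AEy
  proof eventually_elim
    fix x assume ix: "integrable lborel (\<lambda>y. N y * \<Phi> (x - y))"
    have "norm (f x * fourier (\<lambda>\<xi>. cnj (fourier f \<xi>) * g \<xi>) x)
       = norm (\<integral>y. f x * (f y * complex_of_real (\<Phi> (x - y))) \<partial>lborel)"
      by (simp add: inner norm_mult)
    also have "\<dots> \<le> (\<integral>y. norm (f x * (f y * complex_of_real (\<Phi> (x - y)))) \<partial>lborel)"
      by (rule integral_norm_bound)
    also have "\<dots> \<le> (\<integral>y. (1/2) * (N x * \<Phi> (x - y)) + (1/2) * (N y * \<Phi> (x - y)) \<partial>lborel)"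
    proof (rule integral_mono_AE')
      show "integrable lborel (\<lambda>y. (1/2) * (N x * \<Phi> (x - y)) + (1/2) * (N y * \<Phi> (x - y)))"
        using ix \<Phi>a by (intro Bochner_Integration.integrable_add integrable_mult_right) auto
      have "norm (f x * (f y * complex_of_real (\<Phi> (x - y)))) \<le> ((1/2) * N x + (1/2) * N y) * \<Phi> (x - y)" for y
        using \<Phi>0[of "x - y"] sum_squares_bound[of "norm (f x)" "norm (f y)"]
        unfolding norm_mult N_def mult.assoc[symmetric] by (auto intro!: mult_right_mono)
      then show "AE y in lborel. norm (f x * (f y * complex_of_real (\<Phi> (x - y))))
          \<le> (1/2) * (N x * \<Phi> (x - y)) + (1/2) * (N y * \<Phi> (x - y))"
        by (auto simp: algebra_simps)
    qed (use N0 \<Phi>0 in auto)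
    also have "\<dots> = (1/2) * (\<integral>y. N x * \<Phi> (x - y) \<partial>lborel) + (1/2) * (\<integral>y. N y * \<Phi> (x - y) \<partial>lborel)"
      using ix \<Phi>a by (subst Bochner_Integration.integral_add) auto
    finally show "norm (f x * fourier (\<lambda>\<xi>. cnj (fourier f \<xi>) * g \<xi>) x)
     \<le> (1/2) * (\<integral>y. N x * \<Phi> (x - y) \<partial>lborel) + (1/2) * (\<integral>y. N y * \<Phi> (x - y) \<partial>lborel)" .
  qed
  \<comment> \<open>The multiplication formula once more: the weighted integral of |f^|^2 is a
    pairing in x, whose integrand \<open>pt\<close> bounds.\<close>
  have "complex_of_real (\<integral>\<xi>. (norm (fourier f \<xi>))\<^sup>2 * exp (- (s * \<xi>\<^sup>2)) \<partial>lborel)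
      = (\<integral>x. f x * fourier (\<lambda>\<xi>. cnj (fourier f \<xi>) * g \<xi>) x \<partial>lborel)"
    using fourier_duality[OF f i1] unfolding eq by (simp only: integral_complex_of_real)
  from arg_cong[OF this, of norm] have "\<bar>\<integral>\<xi>. (norm (fourier f \<xi>))\<^sup>2 * exp (- (s * \<xi>\<^sup>2)) \<partial>lborel\<bar>
      = norm (\<integral>x. f x * fourier (\<lambda>\<xi>. cnj (fourier f \<xi>) * g \<xi>) x \<partial>lborel)"
    by (simp only: norm_of_real)
  also have "\<dots> \<le> (\<integral>x. norm (f x * fourier (\<lambda>\<xi>. cnj (fourier f \<xi>) * g \<xi>) x) \<partial>lborel)"
    by (rule integral_norm_bound)
  also have "\<dots> \<le> (\<integral>x. (1/2) * (\<integral>y. N x * \<Phi> (x - y) \<partial>lborel) + (1/2) * (\<integral>y. N y * \<Phi> (x - y) \<partial>lborel) \<partial>lborel)"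
  proof (rule integral_mono_AE'[OF _ pt])
    have "0 \<le> (\<integral>y. N x * \<Phi> (x - y) \<partial>lborel)" "0 \<le> (\<integral>y. N y * \<Phi> (x - y) \<partial>lborel)" for x
      using N0 \<Phi>0 by (auto intro!: integral_nonneg_AE)
    then show "AE x in lborel. 0 \<le> 1 / 2 * (\<integral>y. N x * \<Phi> (x - y) \<partial>lborel) + 1 / 2 * (\<integral>y. N y * \<Phi> (x - y) \<partial>lborel)"
      by (intro AE_I2 add_nonneg_nonneg mult_nonneg_nonneg) auto
  qed (intro Bochner_Integration.integrable_add integrable_mult_right K1(1) K2)
  also have "\<dots> = (1/2) * (\<integral>x. \<integral>y. N x * \<Phi> (x - y) \<partial>lborel \<partial>lborel) + (1/2) * (\<integral>x. \<integral>y. N y * \<Phi> (x - y) \<partial>lborel \<partial>lborel)"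
    by (subst Bochner_Integration.integral_add) (intro integrable_mult_right K1(1) K2, intro integrable_mult_right K1(1) K2, simp only: integral_mult_right_zero)
  also have "\<dots> = (\<integral>x. N x \<partial>lborel)" unfolding K1 K3 by simp
  finally show "(\<integral>\<xi>. (norm (fourier f \<xi>))\<^sup>2 * exp (- (s * \<xi>\<^sup>2)) \<partial>lborel) \<le> (\<integral>x. (norm (f x))\<^sup>2 \<partial>lborel)"
    by (simp add: N_def)
qed

text \<open>The Gaussian weight tends to 1 along s = 1/(n+1), and Fatou's lemma keeps the bound;
  integrability of |f^|^2 comes with it. This inequality is the half of Plancherel's theorem on
  which the L^2 theory rests.\<close>

lemma Bessel:
  fixes f :: "real \<Rightarrow> complex"
  assumes f: "integrable lborel f" and f2: "sq_integrable f"
  shows "sq_integrable (fourier f)" "(\<integral>\<xi>. (norm (fourier f \<xi>))\<^sup>2 \<partial>lborel) \<le> (\<integral>x. (norm (f x))\<^sup>2 \<partial>lborel)"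
proof -
  note [measurable] = borel_measurable_integrable[OF f]
  let ?g = "\<lambda>n \<xi>. ennreal ((norm (fourier f \<xi>))\<^sup>2 * exp (- (1 / real (Suc n) * \<xi>\<^sup>2)))"
  have lim: "(\<lambda>n. ?g n \<xi>) \<longlonglongrightarrow> ennreal ((norm (fourier f \<xi>))\<^sup>2)" for \<xi>
  proof -
    have "(\<lambda>n. 1 / real (Suc n)) \<longlonglongrightarrow> 0"
      using LIMSEQ_inverse_real_of_nat by (simp add: inverse_eq_divide)
    then have "(\<lambda>n. (norm (fourier f \<xi>))\<^sup>2 * exp (- (1 / real (Suc n) * \<xi>\<^sup>2))) \<longlonglongrightarrow> (norm (fourier f \<xi>))\<^sup>2 * exp (- (0 * \<xi>\<^sup>2))"
      by (intro tendsto_intros)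
    then show ?thesis by (intro tendsto_ennrealI) simp
  qed
  have "(\<integral>\<^sup>+\<xi>. ennreal ((norm (fourier f \<xi>))\<^sup>2) \<partial>lborel) = (\<integral>\<^sup>+\<xi>. liminf (\<lambda>n. ?g n \<xi>) \<partial>lborel)"
    by (intro nn_integral_cong lim_imp_Liminf[symmetric] lim) simp
  also have "\<dots> \<le> liminf (\<lambda>n. \<integral>\<^sup>+\<xi>. ?g n \<xi> \<partial>lborel)"
    by (rule nn_integral_liminf) simp
  also have "\<dots> \<le> liminf (\<lambda>n::nat. ennreal (\<integral>x. (norm (f x))\<^sup>2 \<partial>lborel))"
  proof (rule Liminf_mono, rule always_eventually, rule allI)
    fix n show "(\<integral>\<^sup>+\<xi>. ?g n \<xi> \<partial>lborel) \<le> ennreal (\<integral>x. (norm (f x))\<^sup>2 \<partial>lborel)"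
      using Bessel_gaussian[OF f f2, of "1 / real (Suc n)"]
      by (subst nn_integral_eq_integral) (auto intro: ennreal_leI)
  qed
  finally have le: "(\<integral>\<^sup>+\<xi>. ennreal ((norm (fourier f \<xi>))\<^sup>2) \<partial>lborel) \<le> ennreal (\<integral>x. (norm (f x))\<^sup>2 \<partial>lborel)"
    by (simp add: Liminf_const)
  then have i: "integrable lborel (\<lambda>\<xi>. (norm (fourier f \<xi>))\<^sup>2)"
    by (intro integrableI_bounded) (auto simp: le_less_trans)
  then show "sq_integrable (fourier f)" by (simp add: sq_integrable_def)
  show "(\<integral>\<xi>. (norm (fourier f \<xi>))\<^sup>2 \<partial>lborel) \<le> (\<integral>x. (norm (f x))\<^sup>2 \<partial>lborel)"
    using le i by (simp add: nn_integral_eq_integral)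
qed

lemma Bessel_inv:
  fixes f :: "real \<Rightarrow> complex"
  assumes f: "integrable lborel f" and f2: "sq_integrable f"
  shows "sq_integrable (inv_fourier f)"
    "(\<integral>\<xi>. (norm (inv_fourier f \<xi>))\<^sup>2 \<partial>lborel) \<le> (\<integral>x. (norm (f x))\<^sup>2 \<partial>lborel)"
proof -
  have i: "integrable lborel (\<lambda>\<xi>. (norm (fourier f \<xi>))\<^sup>2)"
    by (rule sq_integrableD[OF Bessel(1)[OF f f2]])
  have eq: "inv_fourier f x = fourier f (0 + (-1) * x)" for x by (simp add: inv_fourier_eq)
  have "integrable lborel (\<lambda>x. (norm (inv_fourier f x))\<^sup>2)"
    unfolding eq by (rule lborel_integrable_real_affine[OF i]) simp
  moreover have "inv_fourier f \<in> borel_measurable lborel"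
    using measurable_inv_fourier borel_measurable_integrable[OF f] by simp
  ultimately show "sq_integrable (inv_fourier f)" unfolding sq_integrable_def by blast
  have "(\<integral>\<xi>. (norm (inv_fourier f \<xi>))\<^sup>2 \<partial>lborel) = (\<integral>\<xi>. (norm (fourier f \<xi>))\<^sup>2 \<partial>lborel)"
    unfolding eq
    by (subst (2) lborel_integral_real_affine[where c = "-1" and t = 0]) simp_all
  with Bessel(2)[OF f f2]
  show "(\<integral>\<xi>. (norm (inv_fourier f \<xi>))\<^sup>2 \<partial>lborel) \<le> (\<integral>x. (norm (f x))\<^sup>2 \<partial>lborel)"
    by simp
qed

section \<open>Uniqueness and inversion\<close>

text \<open>The positive and negative parts of f have equal transforms, hence equal mass c, read off
  at frequency 0. If c is not 0, division by c gives two probability densities with the same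
  characteristic function, and Levy's uniqueness theorem applies.\<close>

lemma fourier_eq_0_real:
  fixes f :: "real \<Rightarrow> real"
  assumes f: "integrable lborel f" and z: "\<And>\<xi>. fourier (\<lambda>x. complex_of_real (f x)) \<xi> = 0"
  shows "AE x in lborel. f x = 0"
proof -
  define p where "p x = max 0 (f x)" for x
  define n where "n x = max 0 (- f x)" for x
  have f_eq: "f x = p x - n x" for x by (auto simp: p_def n_def)
  have pi: "integrable lborel p" and ni: "integrable lborel n"
    unfolding p_def n_def using f by auto
  note [measurable] = borel_measurable_integrable[OF pi] borel_measurable_integrable[OF ni]
  have p0: "0 \<le> p x" and n0: "0 \<le> n x" for x by (auto simp: p_def n_def)
  have pn: "fourier (\<lambda>x. complex_of_real (p x)) \<xi> = fourier (\<lambda>x. complex_of_real (n x)) \<xi>" for \<xi>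
    using z[of \<xi>] fourier_diff[of "\<lambda>x. complex_of_real (p x)" "\<lambda>x. complex_of_real (n x)" \<xi>] pi ni
    by (simp add: f_eq)
  define c where "c = (\<integral>x. p x \<partial>lborel)"
  have "complex_of_real (\<integral>x. p x \<partial>lborel) = complex_of_real (\<integral>x. n x \<partial>lborel)"
    using pn[of 0] by (simp add: fourier_def)
  then have c': "c = (\<integral>x. n x \<partial>lborel)" by (simp add: c_def)
  show ?thesis
  proof (cases "c = 0")
    case True
    have "AE x in lborel. p x = 0"
      using True integral_nonneg_eq_0_iff_AE[OF pi] p0 unfolding c_def by auto
    moreover have "AE x in lborel. n x = 0"
      using True c' integral_nonneg_eq_0_iff_AE[OF ni] n0 by auto
    ultimately show ?thesis by eventually_elim (simp add: f_eq)
  next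
    case False
    moreover have "c \<ge> 0" unfolding c_def using p0 by simp
    ultimately have c: "c > 0" by simp
    have dist: "real_distribution (density lborel (\<lambda>x. ennreal (h x / c)))"
      if h: "integrable lborel h" "\<And>x. 0 \<le> h x" "(\<integral>x. h x \<partial>lborel) = c" for h :: "real \<Rightarrow> real"
    proof -
      note [measurable] = borel_measurable_integrable[OF h(1)]
      have "(\<integral>\<^sup>+x. ennreal (h x / c) \<partial>lborel) = ennreal (\<integral>x. h x / c \<partial>lborel)"
        using h c by (intro nn_integral_eq_integral) auto
      also have "\<dots> = 1" using h(3) c by simp
      finally have "prob_space (density lborel (\<lambda>x. ennreal (h x / c)))"
        by (intro prob_spaceI) (simp add: emeasure_density)
      then show ?thesis by (simp add: real_distribution_def real_distribution_axioms_def)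
    qed
    have ch: "char (density lborel (\<lambda>x. ennreal (h x / c))) t
        = sqrt (2 * pi) / c * fourier (\<lambda>x. complex_of_real (h x)) (- t)"
      if h: "integrable lborel h" "\<And>x. 0 \<le> h x" for h :: "real \<Rightarrow> real" and t
    proof -
      note [measurable] = borel_measurable_integrable[OF h(1)]
      have "char (density lborel (\<lambda>x. ennreal (h x / c))) t = (\<integral>x. (h x / c) *\<^sub>R exp (\<i> * complex_of_real (t * x)) \<partial>lborel)"
        unfolding char_def using h c by (subst integral_density) auto
      also have "\<dots> = (\<integral>x. (1 / c) *\<^sub>R (exp (- (\<i> * complex_of_real x * complex_of_real (- t))) * complex_of_real (h x)) \<partial>lborel)"
        by (intro Bochner_Integration.integral_cong refl) (simp add: scaleR_conv_of_real mult_ac)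
      finally show ?thesis by (simp add: fourier_def scaleR_conv_of_real)
    qed
    have "density lborel (\<lambda>x. ennreal (p x / c)) = density lborel (\<lambda>x. ennreal (n x / c))"
    proof (rule Levy_uniqueness)
      show "char (density lborel (\<lambda>x. ennreal (p x / c))) = char (density lborel (\<lambda>x. ennreal (n x / c)))"
        using ch[OF pi p0] ch[OF ni n0] pn by (simp add: fun_eq_iff)
    qed (use dist pi p0 ni n0 c_def c' in auto)
    then have "AE x in lborel. ennreal (p x / c) = ennreal (n x / c)"
      by (intro sigma_finite_measure.density_unique[OF sigma_finite_lborel]) auto
    then show ?thesis
      by eventually_elim (use c p0 n0 in \<open>auto simp: f_eq\<close>)
  qed
qed

text \<open>The conjugate of f also has zero transform, so the real and imaginary parts do, and the
  real case applies to each.\<close>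

lemma fourier_eq_0:
  fixes f :: "real \<Rightarrow> complex"
  assumes f: "integrable lborel f" and z: "\<And>\<xi>. fourier f \<xi> = 0"
  shows "AE x in lborel. f x = 0"
proof -
  have z': "fourier (\<lambda>x. cnj (f x)) \<xi> = 0" for \<xi>
    using cnj_fourier[of f "- \<xi>"] z by simp
  have ci: "integrable lborel (\<lambda>x. cnj (f x))" using f by simp
  have "fourier (\<lambda>x. complex_of_real (Re (f x))) \<xi> = 0" for \<xi>
  proof -
    have "(\<lambda>x. complex_of_real (Re (f x))) = (\<lambda>x. (1/2) * (f x + cnj (f x)))"
      by (simp add: complex_add_cnj)
    then show ?thesis by (simp only: fourier_cmult fourier_add[OF f ci] z z') simp
  qed
  then have R: "AE x in lborel. Re (f x) = 0" using f by (intro fourier_eq_0_real) auto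
  have "fourier (\<lambda>x. complex_of_real (Im (f x))) \<xi> = 0" for \<xi>
  proof -
    have "(\<lambda>x. complex_of_real (Im (f x))) = (\<lambda>x. (- \<i> / 2) * (f x - cnj (f x)))"
      by (auto simp: complex_eq_iff)
    then show ?thesis by (simp only: fourier_cmult fourier_diff[OF f ci] z z') simp
  qed
  then have I: "AE x in lborel. Im (f x) = 0" using f by (intro fourier_eq_0_real) auto
  from R I show ?thesis by eventually_elim (simp add: complex_eq_iff)
qed

lemma sq_integrable_gaussian:
  assumes "s > 0"
  shows "sq_integrable (\<lambda>x. exp (- (\<i> * complex_of_real x * complex_of_real y)) * complex_of_real (exp (- (s * x\<^sup>2))))"
proof -
  have "(norm (exp (- (\<i> * complex_of_real x * complex_of_real y)) * complex_of_real (exp (- (s * x\<^sup>2)))))\<^sup>2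
      = exp (- (2 * s * x\<^sup>2))" for x
    by (simp only: norm_mult norm_exp_minus_i norm_of_real) (simp add: power2_eq_square flip: exp_add)
  then show ?thesis
    using gaussian_fourier_integral(1)[of "2 * s"] assms unfolding sq_integrable_def by simp
qed

text \<open>The functions g and h need only become integrable after multiplication by a Gaussian.
  Testing by modulated Gaussians amounts to the Fourier transform of these products, and the
  Gaussian factor has no zeros.\<close>

lemma gaussian_test_eq:
  fixes g h :: "real \<Rightarrow> complex"
  assumes [measurable]: "g \<in> borel_measurable borel" "h \<in> borel_measurable borel"
    and g: "integrable lborel (\<lambda>x. g x * complex_of_real (exp (- (s * x\<^sup>2))))"
    and h: "integrable lborel (\<lambda>x. h x * complex_of_real (exp (- (s * x\<^sup>2))))"
    and eq: "\<And>y. (\<integral>x. g x * (exp (- (\<i> * complex_of_real x * complex_of_real y)) * complex_of_real (exp (- (s * x\<^sup>2)))) \<partial>lborel)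
       = (\<integral>x. h x * (exp (- (\<i> * complex_of_real x * complex_of_real y)) * complex_of_real (exp (- (s * x\<^sup>2)))) \<partial>lborel)"
  shows "AE x in lborel. g x = h x"
proof -
  have "fourier (\<lambda>x. g x * complex_of_real (exp (- (s * x\<^sup>2))) - h x * complex_of_real (exp (- (s * x\<^sup>2)))) \<xi> = 0" for \<xi>
    using eq[of \<xi>] by (subst fourier_diff[OF g h]) (simp add: fourier_def mult_ac)
  then have "AE x in lborel. g x * complex_of_real (exp (- (s * x\<^sup>2))) - h x * complex_of_real (exp (- (s * x\<^sup>2))) = 0"
    using g h by (intro fourier_eq_0) auto
  then show ?thesis
    by eventually_elim auto
qed

text \<open>The L^2 transform characterised weakly, by the multiplication formula.
  \<open>fourier_L2\<close> is a choice fixed only almost everywhere; this relation is compatible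
  with differences and determines g almost everywhere, so it replaces every computation with the
  choice.\<close>

definition is_fourier_L2 :: "(real \<Rightarrow> complex) \<Rightarrow> (real \<Rightarrow> complex) \<Rightarrow> bool" where
  "is_fourier_L2 f g \<longleftrightarrow> sq_integrable f \<and> sq_integrable g \<and>
    (\<forall>\<phi>. integrable lborel \<phi> \<longrightarrow> sq_integrable \<phi> \<longrightarrow>
       (\<integral>\<xi>. g \<xi> * \<phi> \<xi> \<partial>lborel) = (\<integral>x. f x * fourier \<phi> x \<partial>lborel))"

lemma is_fourier_L2_unique:
  assumes "is_fourier_L2 f g" "is_fourier_L2 f h"
  shows "AE \<xi> in lborel. g \<xi> = h \<xi>"
proof (rule gaussian_test_eq[where s = 1])
  have gh: "sq_integrable g" "sq_integrable h" using assms by (auto simp: is_fourier_L2_def)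
  show "g \<in> borel_measurable borel" "h \<in> borel_measurable borel" using gh by auto
  have G: "sq_integrable (\<lambda>x. complex_of_real (exp (- (1 * x\<^sup>2))))"
    using sq_integrable_gaussian[of 1 0] by simp
  show "integrable lborel (\<lambda>x. g x * complex_of_real (exp (- (1 * x\<^sup>2))))"
    "integrable lborel (\<lambda>x. h x * complex_of_real (exp (- (1 * x\<^sup>2))))"
    using gh G by (auto intro!: integrable_mult_sq simp del: of_real_exp)
  fix y
  let ?\<phi> = "\<lambda>x. exp (- (\<i> * complex_of_real x * complex_of_real y)) * complex_of_real (exp (- (1 * x\<^sup>2)))"
  have "integrable lborel ?\<phi>" by (intro integrable_fourier integrable_gaussian_complex) simp
  then show "(\<integral>x. g x * ?\<phi> x \<partial>lborel) = (\<integral>x. h x * ?\<phi> x \<partial>lborel)"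
    using assms sq_integrable_gaussian[of 1 y] unfolding is_fourier_L2_def by auto
qed

lemma is_fourier_L2_diff:
  assumes "is_fourier_L2 f g" "is_fourier_L2 f' g'"
  shows "is_fourier_L2 (\<lambda>x. f x - f' x) (\<lambda>x. g x - g' x)"
  unfolding is_fourier_L2_def
proof (intro conjI allI impI)
  fix \<phi> :: "real \<Rightarrow> complex" assume \<phi>: "integrable lborel \<phi>" "sq_integrable \<phi>"
  note F = Bessel(1)[OF \<phi>]
  have s: "sq_integrable f" "sq_integrable g" "sq_integrable f'" "sq_integrable g'"
    using assms by (auto simp: is_fourier_L2_def)
  have "(\<integral>\<xi>. g \<xi> * \<phi> \<xi> \<partial>lborel) = (\<integral>x. f x * fourier \<phi> x \<partial>lborel)"
    "(\<integral>\<xi>. g' \<xi> * \<phi> \<xi> \<partial>lborel) = (\<integral>x. f' x * fourier \<phi> x \<partial>lborel)"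
    using assms \<phi> by (auto simp: is_fourier_L2_def)
  then show "(\<integral>\<xi>. (g \<xi> - g' \<xi>) * \<phi> \<xi> \<partial>lborel) = (\<integral>x. (f x - f' x) * fourier \<phi> x \<partial>lborel)"
    using integrable_mult_sq[OF s(1) F] integrable_mult_sq[OF s(3) F]
      integrable_mult_sq[OF s(2) \<phi>(2)] integrable_mult_sq[OF s(4) \<phi>(2)]
    by (simp add: left_diff_distrib)
qed (use assms in \<open>auto simp: is_fourier_L2_def intro!: sq_integrable_diff\<close>)

lemma is_fourier_L2_L1:
  assumes "integrable lborel f" "sq_integrable f"
  shows "is_fourier_L2 f (fourier f)"
  unfolding is_fourier_L2_def using assms Bessel(1)[OF assms] fourier_duality[OF assms(1)] by auto

text \<open>Both sides are tested against a modulated Gaussian. It is a multiple of the transform of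
  a shifted Gaussian \<phi>, and its inverse transform is a multiple of the same \<phi>; both
  pairings therefore reduce to the same multiple of the integral of g \<phi>.\<close>

lemma is_fourier_L2_inversion:
  assumes fg: "is_fourier_L2 f g" and g: "integrable lborel g"
  shows "AE x in lborel. f x = inv_fourier g x"
proof (rule gaussian_test_eq[where s = 1])
  have fg': "sq_integrable f" "sq_integrable g" using fg by (auto simp: is_fourier_L2_def)
  note [measurable] = borel_measurable_integrable[OF g]
  show "f \<in> borel_measurable borel" "inv_fourier g \<in> borel_measurable borel" using fg' by auto
  have G: "sq_integrable (\<lambda>x. complex_of_real (exp (- (1 * x\<^sup>2))))"
    using sq_integrable_gaussian[of 1 0] by simp
  show "integrable lborel (\<lambda>x. f x * complex_of_real (exp (- (1 * x\<^sup>2))))"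
    "integrable lborel (\<lambda>x. inv_fourier g x * complex_of_real (exp (- (1 * x\<^sup>2))))"
    using fg' G Bessel_inv(1)[OF g fg'(2)] by (auto intro!: integrable_mult_sq simp del: of_real_exp)
  fix y
  let ?\<psi> = "\<lambda>x. exp (- (\<i> * complex_of_real x * complex_of_real y)) * complex_of_real (exp (- (1 * x\<^sup>2)))"
  define \<phi> where "\<phi> \<xi> = complex_of_real (exp (- ((\<xi> - y)\<^sup>2 / 4)))" for \<xi>
  have \<psi>: "integrable lborel ?\<psi>" by (intro integrable_fourier integrable_gaussian_complex) simp
  have \<phi>: "integrable lborel \<phi>" "sq_integrable \<phi>"
    using lborel_integrable_real_affine[OF integrable_gaussian_complex[of "1/4"], of 1 "- y"]
      lborel_integrable_real_affine[OF gaussian_fourier_integral(1)[of "1/2"], of 1 "- y"]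
    by (simp_all add: \<phi>_def[abs_def] sq_integrable_def power2_eq_square[of "exp _"] flip: exp_add)
  have F\<phi>: "fourier \<phi> x = sqrt 2 * ?\<psi> x" for x
  proof -
    have "(\<integral>\<xi>. exp (- (\<i> * complex_of_real \<xi> * complex_of_real x)) * \<phi> \<xi> \<partial>lborel)
      = (\<integral>\<xi>. exp (- (\<i> * complex_of_real (y + 1 * \<xi>) * complex_of_real x)) * \<phi> (y + 1 * \<xi>) \<partial>lborel)"
      using lborel_integral_real_affine[of 1 "\<lambda>\<xi>. exp (- (\<i> * complex_of_real \<xi> * complex_of_real x)) * \<phi> \<xi>" y]
      by simp
    also have "\<dots> = (\<integral>\<xi>. exp (- (\<i> * complex_of_real x * complex_of_real y)) *
        (exp (\<i> * complex_of_real \<xi> * complex_of_real (- x)) * complex_of_real (exp (- (1/4 * \<xi>\<^sup>2)))) \<partial>lborel)"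
      by (intro Bochner_Integration.integral_cong refl)
         (simp add: \<phi>_def field_simps exp_diff exp_minus exp_add)
    also have "\<dots> = exp (- (\<i> * complex_of_real x * complex_of_real y)) *
        complex_of_real (sqrt (pi / (1/4)) * exp (- ((- x)\<^sup>2 / (4 * (1/4)))))"
      by (simp only: integral_mult_right_zero gaussian_fourier_integral(2)[of "1/4"])
    finally have "fourier \<phi> x = complex_of_real (1 / sqrt (2 * pi) * sqrt (pi / (1/4))) * ?\<psi> x"
      unfolding fourier_def by (simp only: of_real_mult mult_ac) simp
    moreover have "1 / sqrt (2 * pi) * sqrt (pi / (1/4)) = sqrt 2"
      by (simp add: real_sqrt_mult real_div_sqrt)
    ultimately show ?thesis by (simp only:)
  qed
  have I: "inv_fourier ?\<psi> \<xi> = 1 / sqrt 2 * \<phi> \<xi>" for \<xi>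
  proof -
    have "(\<integral>x. exp (\<i> * complex_of_real \<xi> * complex_of_real x) * ?\<psi> x \<partial>lborel)
      = (\<integral>x. exp (\<i> * complex_of_real x * complex_of_real (\<xi> - y)) * complex_of_real (exp (- (1 * x\<^sup>2))) \<partial>lborel)"
      by (intro Bochner_Integration.integral_cong refl)
         (simp add: field_simps exp_diff exp_minus)
    also have "\<dots> = complex_of_real (sqrt (pi / 1) * exp (- ((\<xi> - y)\<^sup>2 / (4 * 1))))"
      by (rule gaussian_fourier_integral(2)) simp
    finally show ?thesis unfolding inv_fourier_def by (simp add: \<phi>_def real_sqrt_mult)
  qed
  have "(\<integral>x. f x * fourier \<phi> x \<partial>lborel) = (\<integral>\<xi>. g \<xi> * \<phi> \<xi> \<partial>lborel)"
    using fg \<phi> by (auto simp: is_fourier_L2_def)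
  then have 1: "sqrt 2 * (\<integral>x. f x * ?\<psi> x \<partial>lborel) = (\<integral>\<xi>. g \<xi> * \<phi> \<xi> \<partial>lborel)"
    by (simp only: F\<phi> mult.left_commute[of _ "complex_of_real (sqrt 2)"] integral_mult_right_zero)
  \<comment> \<open>The reflection x to -x turns \<open>inv_fourier g\<close> into
    \<open>fourier g\<close>, to which the multiplication formula applies.\<close>
  have "(\<integral>x. inv_fourier g x * ?\<psi> x \<partial>lborel) = (\<integral>x. fourier g x * ?\<psi> (- x) \<partial>lborel)"
    using lborel_integral_real_affine[of "-1" "\<lambda>x. inv_fourier g x * ?\<psi> x" 0]
    by (simp add: inv_fourier_eq)
  also have "\<dots> = (\<integral>x. g x * fourier (\<lambda>x. ?\<psi> (- x)) x \<partial>lborel)"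
    using lborel_integrable_real_affine[OF \<psi>, of "-1" 0] by (intro fourier_duality g) simp
  also have "(\<lambda>x. fourier (\<lambda>x. ?\<psi> (- x)) x) = inv_fourier ?\<psi>"
  proof
    fix \<xi>
    show "fourier (\<lambda>x. ?\<psi> (- x)) \<xi> = inv_fourier ?\<psi> \<xi>"
      unfolding fourier_def inv_fourier_def
      using lborel_integral_real_affine[of "-1" "\<lambda>x. exp (- (\<i> * complex_of_real x * complex_of_real \<xi>)) * ?\<psi> (- x)" 0]
      by (simp add: mult_ac)
  qed
  finally have 2: "(\<integral>x. inv_fourier g x * ?\<psi> x \<partial>lborel) = 1 / sqrt 2 * (\<integral>x. g x * \<phi> x \<partial>lborel)"
    by (simp only: I mult.left_commute[of _ "complex_of_real (1 / sqrt 2)"] integral_mult_right_zero)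
  show "(\<integral>x. f x * ?\<psi> x \<partial>lborel) = (\<integral>x. inv_fourier g x * ?\<psi> x \<partial>lborel)"
    unfolding 2 1[symmetric] by simp
qed

section \<open>The Fourier transform on the space of square-integrable functions\<close>

abbreviation truncation :: "(real \<Rightarrow> complex) \<Rightarrow> real \<Rightarrow> real \<Rightarrow> complex" where
  "truncation f R \<equiv> (\<lambda>x. indicator {-R..R} x * f x)"

lemma truncation_integrable:
  assumes f: "sq_integrable f"
  shows "integrable lborel (truncation f R)" "sq_integrable (truncation f R)"
proof -
  have "sq_integrable (\<lambda>x. indicator {-R..R} x :: complex)"
    unfolding sq_integrable_def
  proof
    have "(\<lambda>x. (norm (indicator {-R..R} x :: complex))\<^sup>2) = indicator {-R..R}"
      by (auto simp: indicator_def)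
    then show "integrable lborel (\<lambda>x. (norm (indicator {-R..R} x :: complex))\<^sup>2)"
      by (auto intro!: integrable_real_indicator simp: emeasure_lborel_Icc_eq)
  qed simp
  then show "integrable lborel (truncation f R)" using f by (rule integrable_mult_sq)
  show "sq_integrable (truncation f R)"
    by (rule sq_integrable_bound[OF f]) (use f in \<open>auto simp: indicator_def\<close>)
qed

lemma truncation_tail_tendsto_0:
  fixes f :: "real \<Rightarrow> complex"
  assumes f: "sq_integrable f"
  shows "(\<lambda>n. \<integral>x. indicator (- {- real n..real n}) x * (norm (f x))\<^sup>2 \<partial>lborel) \<longlonglongrightarrow> 0"
proof -
  have "(\<lambda>n. \<integral>x. indicator (- {- real n..real n}) x * (norm (f x))\<^sup>2 \<partial>lborel) \<longlonglongrightarrow> integral\<^sup>L lborel (\<lambda>x::real. 0)"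
  proof (rule Bochner_Integration.integral_dominated_convergence)
    show "integrable lborel (\<lambda>x. (norm (f x))\<^sup>2)" by (rule sq_integrableD[OF f])
    show "AE x in lborel. (\<lambda>n. indicator (- {- real n..real n}) x * (norm (f x))\<^sup>2) \<longlonglongrightarrow> 0"
    proof (rule AE_I2, rule tendsto_eventually)
      fix x :: real
      show "eventually (\<lambda>n. indicator (- {- real n..real n}) x * (norm (f x))\<^sup>2 = 0) sequentially"
        using eventually_ge_at_top[of "nat \<lceil>\<bar>x\<bar>\<rceil>"]
        by eventually_elim (auto simp: indicator_def; linarith)
    qed
  qed (use f sq_integrableD[OF f] in \<open>auto simp: indicator_def\<close>)
  then show ?thesis by simp
qed

text \<open>The truncations to [-R,R] and [-S,S] agree on [-r,r], so their difference lives in the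
  tail of f, where the Bessel inequality applies. This is the Cauchy property of the truncated
  transforms.\<close>

lemma fourier_truncation_diff:
  assumes f: "sq_integrable f" and r: "0 \<le> r" "r \<le> R" "r \<le> S"
  shows "(\<integral>\<^sup>+\<xi>. ennreal ((norm (fourier (truncation f R) \<xi> - fourier (truncation f S) \<xi>))\<^sup>2) \<partial>lborel)
    \<le> ennreal (\<integral>x. indicator (- {-r..r}) x * (norm (f x))\<^sup>2 \<partial>lborel)"
proof -
  note T = truncation_integrable[OF f]
  let ?d = "\<lambda>x. truncation f R x - truncation f S x"
  have d: "integrable lborel ?d" "sq_integrable ?d"
    using T by (auto intro: sq_integrable_diff)
  have "(\<integral>\<^sup>+\<xi>. ennreal ((norm (fourier (truncation f R) \<xi> - fourier (truncation f S) \<xi>))\<^sup>2) \<partial>lborel)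
     = (\<integral>\<^sup>+\<xi>. ennreal ((norm (fourier ?d \<xi>))\<^sup>2) \<partial>lborel)"
    by (simp add: fourier_diff[OF T(1) T(1)])
  also have "\<dots> = ennreal (\<integral>\<xi>. (norm (fourier ?d \<xi>))\<^sup>2 \<partial>lborel)"
    using Bessel(1)[OF d] by (intro nn_integral_eq_integral) (auto simp: sq_integrable_def)
  also have "\<dots> \<le> ennreal (\<integral>x. (norm (?d x))\<^sup>2 \<partial>lborel)"
    by (intro ennreal_leI Bessel(2)[OF d])
  also have "\<dots> \<le> ennreal (\<integral>x. indicator (- {-r..r}) x * (norm (f x))\<^sup>2 \<partial>lborel)"
  proof (intro ennreal_leI integral_mono)
    show "integrable lborel (\<lambda>x. indicator (- {-r..r}) x * (norm (f x))\<^sup>2)"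
      using integrable_mult_indicator[of "- {-r..r}" lborel "\<lambda>x. (norm (f x))\<^sup>2"] sq_integrableD[OF f] by simp
    show "(norm (?d x))\<^sup>2 \<le> indicator (- {-r..r}) x * (norm (f x))\<^sup>2" for x
      using r by (auto simp: indicator_def)
  qed (use d in \<open>auto simp: sq_integrable_def\<close>)
  finally show ?thesis .
qed

lemma tail_mono:
  assumes f: "sq_integrable f" and r: "0 \<le> r" "r \<le> s"
  shows "(\<integral>x. indicator (- {-s..s}) x * (norm (f x))\<^sup>2 \<partial>lborel) \<le> (\<integral>x. indicator (- {-r..r}) x * (norm (f x))\<^sup>2 \<partial>lborel)"
proof (rule integral_mono)
  show "integrable lborel (\<lambda>x. indicator (- {-s..s}) x * (norm (f x))\<^sup>2)" for s
    using integrable_mult_indicator[of "- {-s..s}" lborel "\<lambda>x. (norm (f x))\<^sup>2"] sq_integrableD[OF f] by simp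
  show "indicator (- {-s..s}) x * (norm (f x))\<^sup>2 \<le> indicator (- {-r..r}) x * (norm (f x))\<^sup>2" for x
    using r by (auto simp: indicator_def)
  show "integrable lborel (\<lambda>x. indicator (- {-r..r}) x * (norm (f x))\<^sup>2)"
    using integrable_mult_indicator[of "- {-r..r}" lborel "\<lambda>x. (norm (f x))\<^sup>2"] sq_integrableD[OF f] by simp
qed

text \<open>The completeness argument of Riesz and Fischer by hand: along radii whose tails decay
  like 8^(-k) the transforms converge almost everywhere, and Fatou's lemma turns this into L^2
  convergence as R tends to infinity.\<close>

lemma fourier_L2_exists:
  fixes f :: "real \<Rightarrow> complex"
  assumes f: "sq_integrable f"
  obtains g where "sq_integrable g"
    "((\<lambda>R. \<integral>\<^sup>+\<xi>. ennreal ((norm (fourier (truncation f R) \<xi> - g \<xi>))\<^sup>2) \<partial>lborel) \<longlongrightarrow> 0) at_top"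
proof -
  define F where "F R = fourier (truncation f R)" for R
  define T where "T r = (\<integral>x. indicator (- {-r..r}) x * (norm (f x))\<^sup>2 \<partial>lborel)" for r
  have Tm: "T s \<le> T r" if "0 \<le> r" "r \<le> s" for r s unfolding T_def by (rule tail_mono[OF f that])
  have T0: "0 \<le> T r" for r unfolding T_def by simp
  have D: "(\<integral>\<^sup>+\<xi>. ennreal ((norm (F R \<xi> - F S \<xi>))\<^sup>2) \<partial>lborel) \<le> ennreal (T r)" if "0 \<le> r" "r \<le> R" "r \<le> S" for r R S
    unfolding F_def T_def by (rule fourier_truncation_diff[OF f that])
  have [measurable]: "F R \<in> borel_measurable borel" for R
    using truncation_integrable(1)[OF f] unfolding F_def by measurable
  have "\<exists>n. T (real n) < (1/8) ^ k" for k
  proof -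
    have "eventually (\<lambda>n. T (real n) < (1/8) ^ k) sequentially"
      using truncation_tail_tendsto_0[OF f] unfolding T_def by (rule order_tendstoD) simp
    then show ?thesis by (auto simp: eventually_sequentially)
  qed
  then obtain m where m: "\<And>k. T (real (m k)) < (1/8) ^ k" by metis
  \<comment> \<open>Partial sums of the \<open>m j\<close>, so that the radii increase while each
    still dominates \<open>m k\<close>.\<close>
  define r where "r k = real (\<Sum>j\<le>k. m j)" for k
  have r_mono: "r k \<le> r l" if "k \<le> l" for k l
    unfolding r_def using that by (intro of_nat_mono sum_mono2) auto
  have r0: "0 \<le> r k" for k by (simp add: r_def sum_nonneg)
  have Tr: "T (r k) \<le> (1/8) ^ k" for k
  proof -
    have "real (m k) \<le> r k" unfolding r_def by (intro of_nat_mono member_le_sum) auto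
    then show ?thesis using Tm[of "real (m k)" "r k"] m[of k] by simp
  qed
  \<comment> \<open>The weight 4^k is chosen between two needs: times the tail 8^(-k) it is still
    summable, and finiteness of the weighted sum forces the increments to be O(2^(-k)).\<close>
  have "AE \<xi> in lborel. (\<Sum>k. ennreal (4 ^ k * (norm (F (r (Suc k)) \<xi> - F (r k) \<xi>))\<^sup>2)) \<noteq> \<infinity>"
  proof (rule nn_integral_noteq_infinite)
    have "(\<integral>\<^sup>+\<xi>. (\<Sum>k. ennreal (4 ^ k * (norm (F (r (Suc k)) \<xi> - F (r k) \<xi>))\<^sup>2)) \<partial>lborel)
        = (\<Sum>k. \<integral>\<^sup>+\<xi>. ennreal (4 ^ k * (norm (F (r (Suc k)) \<xi> - F (r k) \<xi>))\<^sup>2) \<partial>lborel)"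
      by (rule nn_integral_suminf) simp
    also have "\<dots> \<le> (\<Sum>k. ennreal ((1/2) ^ k))"
    proof (intro suminf_le allI summableI)
      fix k
      have "(\<integral>\<^sup>+\<xi>. ennreal (4 ^ k * (norm (F (r (Suc k)) \<xi> - F (r k) \<xi>))\<^sup>2) \<partial>lborel)
        = ennreal (4 ^ k) * (\<integral>\<^sup>+\<xi>. ennreal ((norm (F (r (Suc k)) \<xi> - F (r k) \<xi>))\<^sup>2) \<partial>lborel)"
        by (subst nn_integral_cmult[symmetric]) (auto simp: ennreal_mult)
      also have "\<dots> \<le> ennreal (4 ^ k) * ennreal ((1/8) ^ k)"
        by (intro mult_left_mono order_trans[OF D[OF r0[of k]]] ennreal_leI Tr r_mono) auto
      also have "\<dots> = ennreal ((1/2) ^ k)"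
        by (subst ennreal_mult[symmetric], simp, simp, subst power_mult_distrib[symmetric], simp)
      finally show "(\<integral>\<^sup>+\<xi>. ennreal (4 ^ k * (norm (F (r (Suc k)) \<xi> - F (r k) \<xi>))\<^sup>2) \<partial>lborel) \<le> ennreal ((1/2) ^ k)" .
    qed
    also have "\<dots> = ennreal (\<Sum>k. (1/2) ^ k)"
      by (rule suminf_ennreal2) (auto intro: summable_geometric)
    finally have A: "(\<integral>\<^sup>+\<xi>. (\<Sum>k. ennreal (4 ^ k * (norm (F (r (Suc k)) \<xi> - F (r k) \<xi>))\<^sup>2)) \<partial>lborel) \<le> ennreal (\<Sum>k. (1/2) ^ k)" .
    show "(\<integral>\<^sup>+\<xi>. (\<Sum>k. ennreal (4 ^ k * (norm (F (r (Suc k)) \<xi> - F (r k) \<xi>))\<^sup>2)) \<partial>lborel) \<noteq> \<infinity>"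
      using le_less_trans[OF A ennreal_less_top] by auto
  qed simp
  then have conv: "AE \<xi> in lborel. convergent (\<lambda>k. F (r k) \<xi>)"
  proof eventually_elim
    fix \<xi> assume fin: "(\<Sum>k. ennreal (4 ^ k * (norm (F (r (Suc k)) \<xi> - F (r k) \<xi>))\<^sup>2)) \<noteq> \<infinity>"
    define K where "K = enn2real (\<Sum>k. ennreal (4 ^ k * (norm (F (r (Suc k)) \<xi> - F (r k) \<xi>))\<^sup>2))"
    have K: "(\<Sum>k. ennreal (4 ^ k * (norm (F (r (Suc k)) \<xi> - F (r k) \<xi>))\<^sup>2)) = ennreal K" "K \<ge> 0"
      using fin unfolding K_def by (simp_all add: ennreal_enn2real_if)
    have le: "norm (F (r (Suc k)) \<xi> - F (r k) \<xi>) \<le> sqrt K * (1/2) ^ k" for k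
    proof -
      have "(\<Sum>j\<in>{k}. ennreal (4 ^ j * (norm (F (r (Suc j)) \<xi> - F (r j) \<xi>))\<^sup>2)) \<le> ennreal K"
        by (subst K(1)[symmetric], rule sum_le_suminf) (auto intro: summableI)
      then have "4 ^ k * (norm (F (r (Suc k)) \<xi> - F (r k) \<xi>))\<^sup>2 \<le> K"
        using ennreal_le_iff[OF K(2)] by simp
      moreover have "((2::real) ^ k)\<^sup>2 = 4 ^ k"
        using power_mult[of "2::real" 2 k] power_mult[of "2::real" k 2] by (simp add: mult.commute)
      ultimately have "(2 ^ k * norm (F (r (Suc k)) \<xi> - F (r k) \<xi>))\<^sup>2 \<le> K"
        by (simp only: power_mult_distrib)
      then have "2 ^ k * norm (F (r (Suc k)) \<xi> - F (r k) \<xi>) \<le> sqrt K"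
        by (rule real_le_rsqrt)
      from mult_right_mono[OF this, of "(1/2) ^ k"]
      have "(2 ^ k * (1/2) ^ k) * norm (F (r (Suc k)) \<xi> - F (r k) \<xi>) \<le> sqrt K * (1/2) ^ k"
        by (simp add: mult_ac)
      then show ?thesis by (subst (asm) power_mult_distrib[symmetric]) simp
    qed
    have "summable (\<lambda>k. F (r (Suc k)) \<xi> - F (r k) \<xi>)"
      by (rule summable_comparison_test'[OF _ le]) (intro summable_mult summable_geometric, simp)
    then have "convergent (\<lambda>n. \<Sum>k<n. F (r (Suc k)) \<xi> - F (r k) \<xi>)"
      by (simp add: summable_iff_convergent)
    then have "convergent (\<lambda>n. F (r n) \<xi> - F (r 0) \<xi>)"
      using sum_lessThan_telescope[of "\<lambda>n. F (r n) \<xi>"] by simp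
    then have "convergent (\<lambda>n. (F (r n) \<xi> - F (r 0) \<xi>) + F (r 0) \<xi>)"
      by (intro convergent_add convergent_const)
    then show "convergent (\<lambda>k. F (r k) \<xi>)" by simp
  qed
  define g where "g \<xi> = lim (\<lambda>k. F (r k) \<xi>)" for \<xi>
  have [measurable]: "g \<in> borel_measurable borel" unfolding g_def by measurable
  have lim: "AE \<xi> in lborel. (\<lambda>k. F (r k) \<xi>) \<longlonglongrightarrow> g \<xi>"
    using conv by eventually_elim (simp add: g_def convergent_LIMSEQ_iff)
  \<comment> \<open>Compare \<open>F R\<close> with \<open>F (r n)\<close> by \<open>D\<close>,
    uniformly in n >= k, and let n tend to infinity inside the integral.\<close>
  have close: "(\<integral>\<^sup>+\<xi>. ennreal ((norm (F R \<xi> - g \<xi>))\<^sup>2) \<partial>lborel) \<le> ennreal ((1/8) ^ k)" if R: "R \<ge> r k" for R k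
  proof -
    have "(\<integral>\<^sup>+\<xi>. ennreal ((norm (F R \<xi> - g \<xi>))\<^sup>2) \<partial>lborel)
        = (\<integral>\<^sup>+\<xi>. liminf (\<lambda>n. ennreal ((norm (F R \<xi> - F (r n) \<xi>))\<^sup>2)) \<partial>lborel)"
    proof (rule nn_integral_cong_AE, use lim in eventually_elim)
      fix \<xi> assume "(\<lambda>k. F (r k) \<xi>) \<longlonglongrightarrow> g \<xi>"
      then have "(\<lambda>n. ennreal ((norm (F R \<xi> - F (r n) \<xi>))\<^sup>2)) \<longlonglongrightarrow> ennreal ((norm (F R \<xi> - g \<xi>))\<^sup>2)"
        by (intro tendsto_intros)
      then show "ennreal ((norm (F R \<xi> - g \<xi>))\<^sup>2) = liminf (\<lambda>n. ennreal ((norm (F R \<xi> - F (r n) \<xi>))\<^sup>2))"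
        by (intro lim_imp_Liminf[symmetric]) auto
    qed
    also have "\<dots> \<le> liminf (\<lambda>n. \<integral>\<^sup>+\<xi>. ennreal ((norm (F R \<xi> - F (r n) \<xi>))\<^sup>2) \<partial>lborel)"
      by (rule nn_integral_liminf) simp
    also have "\<dots> \<le> liminf (\<lambda>n::nat. ennreal ((1/8) ^ k))"
    proof (rule Liminf_mono)
      show "eventually (\<lambda>n. (\<integral>\<^sup>+\<xi>. ennreal ((norm (F R \<xi> - F (r n) \<xi>))\<^sup>2) \<partial>lborel) \<le> ennreal ((1/8) ^ k)) sequentially"
        using eventually_ge_at_top[of k]
      proof eventually_elim
        fix n assume "k \<le> n"
        show "(\<integral>\<^sup>+\<xi>. ennreal ((norm (F R \<xi> - F (r n) \<xi>))\<^sup>2) \<partial>lborel) \<le> ennreal ((1/8) ^ k)"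
          by (rule order_trans[OF D[OF r0[of k] R r_mono[OF \<open>k \<le> n\<close>]] ennreal_leI[OF Tr]])
      qed
    qed
    finally show ?thesis by (simp add: Liminf_const)
  qed
  have d0: "sq_integrable (\<lambda>\<xi>. F (r 0) \<xi> - g \<xi>)"
    unfolding sq_integrable_def
  proof
    show "integrable lborel (\<lambda>x. (norm (F (r 0) x - g x))\<^sup>2)"
      using close[of 0 "r 0"] by (intro integrableI_bounded) (auto simp: le_less_trans)
  qed simp
  have "sq_integrable (F (r 0))"
    unfolding F_def by (intro Bessel(1) truncation_integrable f)
  from sq_integrable_diff[OF this d0] have "sq_integrable g" by simp
  moreover have "((\<lambda>R. \<integral>\<^sup>+\<xi>. ennreal ((norm (F R \<xi> - g \<xi>))\<^sup>2) \<partial>lborel) \<longlongrightarrow> 0) at_top"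
  proof (rule order_tendstoI)
    fix e :: ennreal assume "0 < e"
    \<comment> \<open>The bound e may be infinite; a smaller q is finite and corresponds to a
      positive real.\<close>
    obtain q where q: "0 < q" "q < e" using dense[OF \<open>0 < e\<close>] by auto
    define e' where "e' = enn2real q"
    have "q = ennreal e'" using ennreal_enn2real[OF order.strict_trans2[OF q(2) top_greatest]] unfolding e'_def by simp
    with q have e': "0 < e'" "ennreal e' < e" by (simp_all add: ennreal_less_zero_iff)
    obtain k where k0: "(1/8::real) ^ k < e'" using real_arch_pow_inv[OF e'(1), of "1/8"] by auto
    have k: "ennreal ((1/8) ^ k) < e" by (intro le_less_trans[OF ennreal_leI[OF less_imp_le[OF k0]] e'(2)])
    show "eventually (\<lambda>R. (\<integral>\<^sup>+\<xi>. ennreal ((norm (F R \<xi> - g \<xi>))\<^sup>2) \<partial>lborel) < e) at_top"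
      using eventually_ge_at_top[of "r k"] by eventually_elim (rule le_less_trans[OF close k])
  qed simp
  ultimately show thesis using that unfolding F_def by blast
qed

text \<open>Squares in place of \<open>powr\<close> keep the algebra of L^2 norms free of real
  exponents; here the two formulations meet.\<close>

lemma Lp_2_iff: "f \<in> Lp 2 \<longleftrightarrow> sq_integrable f"
  unfolding Lp_def sq_integrable_def by (auto simp: powr_numeral)

text \<open>The multiplication formula for the truncations passes to the limit: by dominated
  convergence on the side of f, by Cauchy-Schwarz on the side of the transforms.\<close>

lemma is_fourier_L2_limit:
  assumes f: "sq_integrable f" and g: "sq_integrable g"
    and lim: "((\<lambda>R. \<integral>\<^sup>+\<xi>. ennreal ((norm (fourier (truncation f R) \<xi> - g \<xi>))\<^sup>2) \<partial>lborel) \<longlongrightarrow> 0) at_top"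
  shows "is_fourier_L2 f g"
  unfolding is_fourier_L2_def
proof (intro conjI allI impI f g)
  fix \<phi> :: "real \<Rightarrow> complex" assume \<phi>: "integrable lborel \<phi>" "sq_integrable \<phi>"
  define F where "F n = fourier (truncation f (real n))" for n
  note T = truncation_integrable[OF f]
  have F2: "sq_integrable (F n)" for n unfolding F_def by (intro Bessel(1) T)
  note \<phi>F = Bessel(1)[OF \<phi>]
  have 1: "(\<integral>\<xi>. F n \<xi> * \<phi> \<xi> \<partial>lborel) = (\<integral>x. truncation f (real n) x * fourier \<phi> x \<partial>lborel)" for n
    unfolding F_def by (rule fourier_duality[OF T(1) \<phi>(1)])
  have "(\<lambda>n. \<integral>x. truncation f (real n) x * fourier \<phi> x \<partial>lborel) \<longlonglongrightarrow> (\<integral>x. f x * fourier \<phi> x \<partial>lborel)"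
  proof (rule Bochner_Integration.integral_dominated_convergence)
    show "integrable lborel (\<lambda>x. norm (f x * fourier \<phi> x))"
      by (intro integrable_norm integrable_mult_sq f \<phi>F)
    show "AE x in lborel. (\<lambda>n. truncation f (real n) x * fourier \<phi> x) \<longlonglongrightarrow> f x * fourier \<phi> x"
    proof (rule AE_I2, rule tendsto_eventually)
      fix x :: real
      show "eventually (\<lambda>n. truncation f (real n) x * fourier \<phi> x = f x * fourier \<phi> x) sequentially"
        using eventually_ge_at_top[of "nat \<lceil>\<bar>x\<bar>\<rceil>"]
        by eventually_elim (auto simp: indicator_def; linarith)
    qed
    show "AE x in lborel. norm (truncation f (real n) x * fourier \<phi> x) \<le> norm (f x * fourier \<phi> x)" for n
      by (auto simp: indicator_def)
    have [measurable]: "f \<in> borel_measurable borel" "fourier \<phi> \<in> borel_measurable borel"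
      by (rule sq_integrable_measurable f \<phi>F)+
    show "(\<lambda>x. f x * fourier \<phi> x) \<in> borel_measurable lborel" by measurable
    show "(\<lambda>x. truncation f (real n) x * fourier \<phi> x) \<in> borel_measurable lborel" for n by measurable
  qed
  then have A: "(\<lambda>n. \<integral>\<xi>. F n \<xi> * \<phi> \<xi> \<partial>lborel) \<longlonglongrightarrow> (\<integral>x. f x * fourier \<phi> x \<partial>lborel)"
    unfolding 1 .
  have d: "sq_integrable (\<lambda>\<xi>. F n \<xi> - g \<xi>)" for n by (intro sq_integrable_diff F2 g)
  have "(\<lambda>n. \<integral>\<^sup>+\<xi>. ennreal ((norm (F n \<xi> - g \<xi>))\<^sup>2) \<partial>lborel) \<longlonglongrightarrow> 0"
    unfolding F_def by (rule filterlim_compose[OF lim filterlim_real_sequentially])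
  moreover have "(\<integral>\<^sup>+\<xi>. ennreal ((norm (F n \<xi> - g \<xi>))\<^sup>2) \<partial>lborel) = ennreal (\<integral>\<xi>. (norm (F n \<xi> - g \<xi>))\<^sup>2 \<partial>lborel)" for n
    using sq_integrableD[OF d] by (intro nn_integral_eq_integral) auto
  ultimately have "(\<lambda>n. \<integral>\<xi>. (norm (F n \<xi> - g \<xi>))\<^sup>2 \<partial>lborel) \<longlonglongrightarrow> 0"
    by (simp add: tendsto_ennreal_iff[where x=0, simplified])
  then have "(\<lambda>n. sqrt (\<integral>\<xi>. (norm (F n \<xi> - g \<xi>))\<^sup>2 \<partial>lborel) * sqrt (\<integral>\<xi>. (norm (\<phi> \<xi>))\<^sup>2 \<partial>lborel))
      \<longlonglongrightarrow> sqrt 0 * sqrt (\<integral>\<xi>. (norm (\<phi> \<xi>))\<^sup>2 \<partial>lborel)"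
    by (intro tendsto_intros)
  then have z: "(\<lambda>n. sqrt (\<integral>\<xi>. (norm (F n \<xi> - g \<xi>))\<^sup>2 \<partial>lborel) * sqrt (\<integral>\<xi>. (norm (\<phi> \<xi>))\<^sup>2 \<partial>lborel)) \<longlonglongrightarrow> 0"
    by simp
  have "(\<lambda>n. (\<integral>\<xi>. F n \<xi> * \<phi> \<xi> \<partial>lborel) - (\<integral>\<xi>. g \<xi> * \<phi> \<xi> \<partial>lborel)) \<longlonglongrightarrow> 0"
  proof (rule Lim_null_comparison[OF always_eventually z], rule allI)
    fix n
    have "(\<integral>\<xi>. F n \<xi> * \<phi> \<xi> \<partial>lborel) - (\<integral>\<xi>. g \<xi> * \<phi> \<xi> \<partial>lborel) = (\<integral>\<xi>. (F n \<xi> - g \<xi>) * \<phi> \<xi> \<partial>lborel)"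
      using integrable_mult_sq[OF F2[of n] \<phi>(2)] integrable_mult_sq[OF g \<phi>(2)]
      by (simp add: left_diff_distrib)
    also have "norm \<dots> \<le> (\<integral>\<xi>. norm (F n \<xi> - g \<xi>) * norm (\<phi> \<xi>) \<partial>lborel)"
      using integral_norm_bound[of lborel "\<lambda>\<xi>. (F n \<xi> - g \<xi>) * \<phi> \<xi>"] by (simp add: norm_mult)
    also note Cauchy_Schwarz_integral[OF d \<phi>(2)]
    finally show "norm ((\<integral>\<xi>. F n \<xi> * \<phi> \<xi> \<partial>lborel) - (\<integral>\<xi>. g \<xi> * \<phi> \<xi> \<partial>lborel))
      \<le> sqrt (\<integral>\<xi>. (norm (F n \<xi> - g \<xi>))\<^sup>2 \<partial>lborel) * sqrt (\<integral>\<xi>. (norm (\<phi> \<xi>))\<^sup>2 \<partial>lborel)" .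
  qed
  then have "(\<lambda>n. \<integral>\<xi>. F n \<xi> * \<phi> \<xi> \<partial>lborel) \<longlonglongrightarrow> (\<integral>\<xi>. g \<xi> * \<phi> \<xi> \<partial>lborel)"
    by (rule LIM_zero_cancel)
  from LIMSEQ_unique[OF this A]
  show "(\<integral>\<xi>. g \<xi> * \<phi> \<xi> \<partial>lborel) = (\<integral>x. f x * fourier \<phi> x \<partial>lborel)" .
qed

lemma is_fourier_L2_fourier_L2:
  assumes f: "sq_integrable f"
  shows "is_fourier_L2 f (fourier_L2 f)"
proof -
  let ?P = "\<lambda>g. g \<in> Lp 2 \<and>
     ((\<lambda>R. \<integral>\<^sup>+\<xi>. ennreal ((norm (fourier (\<lambda>x. indicator {-R..R} x * f x) \<xi> - g \<xi>))\<^sup>2) \<partial>lborel) \<longlongrightarrow> 0) at_top"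
  obtain g where "sq_integrable g"
    "((\<lambda>R. \<integral>\<^sup>+\<xi>. ennreal ((norm (fourier (truncation f R) \<xi> - g \<xi>))\<^sup>2) \<partial>lborel) \<longlongrightarrow> 0) at_top"
    by (rule fourier_L2_exists[OF f])
  then have "?P g" using Lp_2_iff by blast
  then have "?P (fourier_L2 f)" unfolding fourier_L2_def by (rule someI[of ?P])
  then show ?thesis
    using f unfolding Lp_2_iff by (intro is_fourier_L2_limit) auto
qed

section \<open>Sobolev functions and kernel estimates\<close>

lemma integral_inverse_1_plus_square:
  "integrable lborel (\<lambda>x::real. 1 / (1 + x\<^sup>2))" "(\<integral>x. 1 / (1 + x\<^sup>2) \<partial>lborel) = pi"
proof -
  note FTC = interval_integral_FTC_nonneg[where F = arctan and a = "-\<infinity>" and b = "\<infinity>"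
      and f = "\<lambda>x. 1 / (1 + x\<^sup>2)" and A = "- (pi / 2)" and B = "pi / 2"]
  have 1: "DERIV arctan x :> 1 / (1 + x\<^sup>2)" for x
    using DERIV_arctan[of x] by (simp add: inverse_eq_divide)
  have "1 + x\<^sup>2 \<noteq> 0" for x :: real using zero_le_power2[of x] by linarith
  then have 2: "isCont (\<lambda>x::real. 1 / (1 + x\<^sup>2)) x" for x
    by (intro continuous_intros) auto
  have 3: "((arctan \<circ> real_of_ereal) \<longlongrightarrow> - (pi / 2)) (at_right (-\<infinity>))"
    by (simp add: ereal_tendsto_simps tendsto_arctan_at_bot)
  have 4: "((arctan \<circ> real_of_ereal) \<longlongrightarrow> pi / 2) (at_left \<infinity>)"
    by (simp add: ereal_tendsto_simps tendsto_arctan_at_top)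
  have 5: "AE x in lborel. - \<infinity> < ereal x \<longrightarrow> ereal x < \<infinity> \<longrightarrow> 0 \<le> 1 / (1 + x\<^sup>2)"
    by (intro AE_I2) (simp add: add_nonneg_nonneg)
  show "integrable lborel (\<lambda>x::real. 1 / (1 + x\<^sup>2))"
    using FTC(1)[OF _ 1 2 5 3 4] by (simp add: set_integrable_def)
  show "(\<integral>x. 1 / (1 + x\<^sup>2) \<partial>lborel) = pi"
    using FTC(2)[OF _ 1 2 5 3 4] by (simp add: interval_lebesgue_integral_def set_lebesgue_integral_def)
qed

lemma integral_inverse_1_plus_scaled_square:
  assumes t: "t > 0"
  shows "integrable lborel (\<lambda>x::real. 1 / (1 + t * x\<^sup>2))"
    "(\<integral>x. 1 / (1 + t * x\<^sup>2) \<partial>lborel) = pi / sqrt t"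
    "integrable lborel (\<lambda>x::real. (1 / (1 + t * x\<^sup>2))\<^sup>2)"
    "(\<integral>x. (1 / (1 + t * x\<^sup>2))\<^sup>2 \<partial>lborel) \<le> pi / sqrt t"
proof -
  have eq: "1 / (1 + t * x\<^sup>2) = 1 / (1 + (0 + sqrt t * x)\<^sup>2)" for x
    using t by (simp add: power_mult_distrib)
  show i: "integrable lborel (\<lambda>x::real. 1 / (1 + t * x\<^sup>2))"
    unfolding eq using t integral_inverse_1_plus_square(1)
    by (intro lborel_integrable_real_affine[where f = "\<lambda>x. 1 / (1 + x\<^sup>2)"]) auto
  show v: "(\<integral>x. 1 / (1 + t * x\<^sup>2) \<partial>lborel) = pi / sqrt t"
    using lborel_integral_real_affine[of "sqrt t" "\<lambda>x. 1 / (1 + x\<^sup>2)" 0] t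
    unfolding eq integral_inverse_1_plus_square(2) by (simp add: field_simps)
  have le: "(1 / (1 + t * x\<^sup>2))\<^sup>2 \<le> 1 / (1 + t * x\<^sup>2)" for x
    using t by (simp add: power2_eq_square divide_simps add_pos_nonneg)
  show j: "integrable lborel (\<lambda>x::real. (1 / (1 + t * x\<^sup>2))\<^sup>2)"
    by (rule Bochner_Integration.integrable_bound[OF i]) (use le t in auto)
  show "(\<integral>x. (1 / (1 + t * x\<^sup>2))\<^sup>2 \<partial>lborel) \<le> pi / sqrt t"
    unfolding v[symmetric] by (rule integral_mono[OF j i le])
qed

text \<open>In the scaled variable s = sqrt t \<xi> the claim is that |s|^j (1 + s^2) exp(-c s^2) is
  bounded. It exchanges each power of |\<xi>| for t^(-1/2) and keeps a factor 1/(1 + t \<xi>^2) for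
  integration.\<close>

lemma power_exp_bound:
  fixes c :: real
  assumes c: "c > 0"
  obtains C where "C > 0" "\<And>t \<xi>. t > 0 \<Longrightarrow> \<bar>\<xi>\<bar> ^ j * exp (- (c * t * \<xi>\<^sup>2)) \<le> C * (1 / sqrt t) ^ j / (1 + t * \<xi>\<^sup>2)"
proof
  define n where "n = Suc j"
  \<comment> \<open>For |s| <= 1 the value 2 is enough; beyond that, (c s^2 / n)^n <= exp(c s^2)
    with n = j + 1 gives the second term.\<close>
  define C where "C = 2 + 2 * (real n / c) ^ n"
  show "C > 0" unfolding C_def using c by (intro add_pos_nonneg) (auto simp: n_def)
  have main: "\<bar>s\<bar> ^ j * (1 + s\<^sup>2) \<le> C * exp (c * s\<^sup>2)" for s :: real
  proof (cases "\<bar>s\<bar> \<le> 1")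
    case True
    have "\<bar>s\<bar> ^ j * (1 + s\<^sup>2) \<le> 1 * 2"
      using True by (intro mult_mono power_le_one) (auto simp: abs_square_le_1)
    also have "\<dots> \<le> C * 1" unfolding C_def using c by simp
    also have "\<dots> \<le> C * exp (c * s\<^sup>2)" using c \<open>C > 0\<close> by (intro mult_left_mono) auto
    finally show ?thesis .
  next
    case False
    then have s1: "1 \<le> \<bar>s\<bar>" by simp
    then have s2: "1 \<le> s\<^sup>2" by (metis one_le_power power2_abs)
    have "\<bar>s\<bar> ^ j * (1 + s\<^sup>2) \<le> \<bar>s\<bar> ^ (2 * j) * (2 * s\<^sup>2)"
      using s1 s2 by (intro mult_mono power_increasing) auto
    also have "\<dots> = 2 * (s\<^sup>2) ^ n" by (simp add: n_def power_mult)
    also have "\<dots> = 2 * (real n / c) ^ n * (c * s\<^sup>2 / real n) ^ n"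
      using c by (simp add: n_def power_divide power_mult_distrib)
    also have "(c * s\<^sup>2 / real n) ^ n \<le> exp (c * s\<^sup>2 / real n) ^ n"
      using c by (intro power_mono) (auto intro: less_imp_le[OF exp_gt_self] simp: n_def)
    also have "exp (c * s\<^sup>2 / real n) ^ n = exp (c * s\<^sup>2)"
      by (simp only: exp_of_nat_mult[symmetric]) (simp add: n_def del: of_nat_Suc)
    finally have "\<bar>s\<bar> ^ j * (1 + s\<^sup>2) \<le> 2 * (real n / c) ^ n * exp (c * s\<^sup>2)"
      using c by (simp add: mult_left_mono)
    also have "\<dots> \<le> C * exp (c * s\<^sup>2)" unfolding C_def by (intro mult_right_mono) auto
    finally show ?thesis .
  qed
  fix t \<xi> :: real assume t: "t > 0"
  have "\<bar>\<xi>\<bar> ^ j = \<bar>sqrt t * \<xi>\<bar> ^ j * (1 / sqrt t) ^ j"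
    using t by (simp add: abs_mult power_mult_distrib power_divide)
  moreover have "(sqrt t * \<xi>)\<^sup>2 = t * \<xi>\<^sup>2" using t by (simp add: power_mult_distrib)
  ultimately have "\<bar>\<xi>\<bar> ^ j * (1 + t * \<xi>\<^sup>2) \<le> (C * exp (c * t * \<xi>\<^sup>2)) * (1 / sqrt t) ^ j"
    using mult_right_mono[OF main[of "sqrt t * \<xi>"], of "(1 / sqrt t) ^ j"] t by (simp add: mult_ac)
  then have "\<bar>\<xi>\<bar> ^ j \<le> (C * exp (c * t * \<xi>\<^sup>2)) * (1 / sqrt t) ^ j / (1 + t * \<xi>\<^sup>2)"
    using t by (subst pos_le_divide_eq) (auto simp: add_pos_nonneg)
  from mult_right_mono[OF this, of "exp (- (c * t * \<xi>\<^sup>2))"]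
  have "\<bar>\<xi>\<bar> ^ j * exp (- (c * t * \<xi>\<^sup>2))
      \<le> C * (1 / sqrt t) ^ j / (1 + t * \<xi>\<^sup>2) * (exp (c * t * \<xi>\<^sup>2) * exp (- (c * t * \<xi>\<^sup>2)))"
    by (simp add: mult_ac)
  then show "\<bar>\<xi>\<bar> ^ j * exp (- (c * t * \<xi>\<^sup>2)) \<le> C * (1 / sqrt t) ^ j / (1 + t * \<xi>\<^sup>2)"
    by (simp flip: exp_add)
qed

text \<open>Integrability of the transform, hence the embedding of H^1 into bounded functions, is
  Cauchy-Schwarz with the weight sqrt (1 + \<xi>^2) and its inverse. The inverse weight has L^2 norm
  sqrt pi, rounded up to 2.\<close>

lemma sobolevD:
  assumes f: "f \<in> sobolev 1"
  defines "g \<equiv> fourier_L2 (\<lambda>x. complex_of_real (f x))"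
  shows "is_fourier_L2 (\<lambda>x. complex_of_real (f x)) g" "sq_integrable f"
    "integrable lborel (\<lambda>\<xi>. (1 + \<xi>\<^sup>2) * (norm (g \<xi>))\<^sup>2)"
    "(\<integral>\<xi>. (1 + \<xi>\<^sup>2) * (norm (g \<xi>))\<^sup>2 \<partial>lborel) = (sobolev_norm 1 f)\<^sup>2" "0 \<le> sobolev_norm 1 f"
    "integrable lborel g" "(\<integral>\<xi>. norm (g \<xi>) \<partial>lborel) \<le> 2 * sobolev_norm 1 f"
    "sq_integrable g" "(\<integral>\<xi>. (norm (g \<xi>))\<^sup>2 \<partial>lborel) \<le> (sobolev_norm 1 f)\<^sup>2"
proof -
  have p: "(1 + \<xi>\<^sup>2) powr 1 = 1 + \<xi>\<^sup>2" for \<xi> :: real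
    by (simp add: add_nonneg_nonneg)
  show sf: "sq_integrable f" using f by (simp only: sobolev_def Lp_2_iff mem_Collect_eq)
  show F: "is_fourier_L2 (\<lambda>x. complex_of_real (f x)) g"
    unfolding g_def by (intro is_fourier_L2_fourier_L2 sq_integrable_of_real sf)
  show I: "integrable lborel (\<lambda>\<xi>. (1 + \<xi>\<^sup>2) * (norm (g \<xi>))\<^sup>2)"
    using f unfolding sobolev_def g_def p by simp
  have n0: "0 \<le> (\<integral>\<xi>. (1 + \<xi>\<^sup>2) * (norm (g \<xi>))\<^sup>2 \<partial>lborel)"
    by (intro integral_nonneg_AE AE_I2 mult_nonneg_nonneg add_nonneg_nonneg) auto
  have S: "sobolev_norm 1 f = sqrt (\<integral>\<xi>. (1 + \<xi>\<^sup>2) * (norm (g \<xi>))\<^sup>2 \<partial>lborel)"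
    unfolding sobolev_norm_def g_def p ..
  show N: "(\<integral>\<xi>. (1 + \<xi>\<^sup>2) * (norm (g \<xi>))\<^sup>2 \<partial>lborel) = (sobolev_norm 1 f)\<^sup>2"
    unfolding S using n0 by simp
  show nn: "0 \<le> sobolev_norm 1 f" unfolding S using n0 by simp
  show sg: "sq_integrable g" using F by (simp add: is_fourier_L2_def)
  note [measurable] = sq_integrable_measurable[OF sg]
  show "(\<integral>\<xi>. (norm (g \<xi>))\<^sup>2 \<partial>lborel) \<le> (sobolev_norm 1 f)\<^sup>2"
    unfolding N[symmetric] using sq_integrableD[OF sg] I
    by (intro integral_mono) (auto simp: distrib_right)
  define h where "h \<xi> = sqrt (1 + \<xi>\<^sup>2) * norm (g \<xi>)" for \<xi>
  define k where "k \<xi> = 1 / sqrt (1 + \<xi>\<^sup>2)" for \<xi> :: real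
  have [measurable]: "h \<in> borel_measurable borel" "k \<in> borel_measurable borel"
    unfolding h_def k_def by measurable
  have h2: "(norm (h \<xi>))\<^sup>2 = (1 + \<xi>\<^sup>2) * (norm (g \<xi>))\<^sup>2" and k2: "(norm (k \<xi>))\<^sup>2 = 1 / (1 + \<xi>\<^sup>2)" for \<xi>
    by (simp_all add: h_def k_def power_mult_distrib power_divide add_nonneg_nonneg)
  have hk: "norm (h \<xi>) * norm (k \<xi>) = norm (g \<xi>)" for \<xi>
  proof -
    have "0 < sqrt (1 + \<xi>\<^sup>2)" by (simp add: add_pos_nonneg)
    then show ?thesis by (simp add: h_def k_def abs_mult)
  qed
  have sh: "sq_integrable h" "sq_integrable k"
    unfolding sq_integrable_def h2 k2 using I integral_inverse_1_plus_square(1) by auto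
  have "integrable lborel (\<lambda>\<xi>. norm (h \<xi> * k \<xi>))"
    by (intro integrable_norm integrable_mult_sq sh)
  then have "integrable lborel (\<lambda>\<xi>. norm (g \<xi>))" by (simp only: norm_mult hk)
  then show "integrable lborel g" by (subst (asm) integrable_norm_iff) auto
  have "(\<integral>\<xi>. norm (g \<xi>) \<partial>lborel) \<le> sobolev_norm 1 f * sqrt pi"
    using Cauchy_Schwarz_integral[OF sh] unfolding hk h2 k2 N integral_inverse_1_plus_square(2)
    using nn by simp
  also have "\<dots> \<le> sobolev_norm 1 f * sqrt 4"
    using nn pi_less_4 by (intro mult_left_mono real_sqrt_le_mono) auto
  finally show "(\<integral>\<xi>. norm (g \<xi>) \<partial>lborel) \<le> 2 * sobolev_norm 1 f" by simp
qed

lemma Re_inv_fourier_bounds: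
  assumes k: "integrable lborel k" "sq_integrable k"
  shows "\<bar>Re (inv_fourier k x)\<bar> \<le> (\<integral>\<xi>. norm (k \<xi>) \<partial>lborel)"
    "sq_integrable (\<lambda>x. Re (inv_fourier k x))"
    "(\<integral>x. (Re (inv_fourier k x))\<^sup>2 \<partial>lborel) \<le> (\<integral>\<xi>. (norm (k \<xi>))\<^sup>2 \<partial>lborel)"
proof -
  show "\<bar>Re (inv_fourier k x)\<bar> \<le> (\<integral>\<xi>. norm (k \<xi>) \<partial>lborel)"
    by (rule order_trans[OF abs_Re_le_cmod norm_inv_fourier_le])
  note B = Bessel_inv[OF k]
  have [measurable]: "inv_fourier k \<in> borel_measurable borel" by (rule sq_integrable_measurable[OF B(1)])
  have le: "(Re z)\<^sup>2 \<le> (norm z)\<^sup>2" for z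
    using power_mono[OF abs_Re_le_cmod[of z], of 2] by simp
  show s: "sq_integrable (\<lambda>x. Re (inv_fourier k x))"
    unfolding sq_integrable_def
  proof
    show "integrable lborel (\<lambda>x. (norm (Re (inv_fourier k x)))\<^sup>2)"
      by (rule Bochner_Integration.integrable_bound[OF sq_integrableD[OF B(1)]]) (auto simp: le)
  qed simp
  have "(\<integral>x. (Re (inv_fourier k x))\<^sup>2 \<partial>lborel) \<le> (\<integral>x. (norm (inv_fourier k x))\<^sup>2 \<partial>lborel)"
    using sq_integrableD[OF s] by (intro integral_mono sq_integrableD[OF B(1)] le) auto
  with B(2) show "(\<integral>x. (Re (inv_fourier k x))\<^sup>2 \<partial>lborel) \<le> (\<integral>\<xi>. (norm (k \<xi>))\<^sup>2 \<partial>lborel)"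
    by (rule order_trans[rotated])
qed

lemma sobolev_embedding:
  assumes f: "f \<in> sobolev 1"
  shows "AE x in lborel. \<bar>f x\<bar> \<le> 2 * sobolev_norm 1 f"
    "(\<integral>x. (f x)\<^sup>2 \<partial>lborel) \<le> (sobolev_norm 1 f)\<^sup>2"
proof -
  note D = sobolevD[OF f]
  define g where "g = fourier_L2 (\<lambda>x. complex_of_real (f x))"
  note D = D[folded g_def]
  have ae: "AE x in lborel. f x = Re (inv_fourier g x)"
    using is_fourier_L2_inversion[OF D(1,6)] by eventually_elim (metis Re_complex_of_real)
  note R = Re_inv_fourier_bounds[OF D(6,8)]
  show "AE x in lborel. \<bar>f x\<bar> \<le> 2 * sobolev_norm 1 f"
    using ae by eventually_elim (use R(1) D(7) in \<open>auto intro: order_trans\<close>)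
  have "(\<integral>x. (f x)\<^sup>2 \<partial>lborel) = (\<integral>x. (Re (inv_fourier g x))\<^sup>2 \<partial>lborel)"
  proof (rule integral_cong_AE)
    show "AE x in lborel. (f x)\<^sup>2 = (Re (inv_fourier g x))\<^sup>2" using ae by eventually_elim simp
  qed (use sq_integrable_measurable[OF D(2)] sq_integrable_measurable[OF R(2)] in auto)
  with R(3) D(9) show "(\<integral>x. (f x)\<^sup>2 \<partial>lborel) \<le> (sobolev_norm 1 f)\<^sup>2" by simp
qed

text \<open>\<open>fourier_L2\<close> is not literally additive; additivity almost everywhere comes
  from uniqueness in the weak characterisation.\<close>

lemma sobolev_diff:
  assumes f: "f \<in> sobolev 1" and h: "h \<in> sobolev 1"
  shows "(\<lambda>x. f x - h x) \<in> sobolev 1"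
proof -
  note F = sobolevD[OF f] and H = sobolevD[OF h]
  define f' where "f' = fourier_L2 (\<lambda>x. complex_of_real (f x))"
  define h' where "h' = fourier_L2 (\<lambda>x. complex_of_real (h x))"
  define d' where "d' = fourier_L2 (\<lambda>x. complex_of_real (f x - h x))"
  note F = F[folded f'_def] and H = H[folded h'_def]
  have d: "sq_integrable (\<lambda>x. f x - h x)" by (intro sq_integrable_diff F H)
  have D: "is_fourier_L2 (\<lambda>x. complex_of_real (f x - h x)) d'"
    unfolding d'_def by (intro is_fourier_L2_fourier_L2 sq_integrable_of_real d)
  have "is_fourier_L2 (\<lambda>x. complex_of_real (f x - h x)) (\<lambda>\<xi>. f' \<xi> - h' \<xi>)"
    using is_fourier_L2_diff[OF F(1) H(1)] by simp
  from is_fourier_L2_unique[OF D this] have ae: "AE \<xi> in lborel. d' \<xi> = f' \<xi> - h' \<xi>" .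
  have sd: "sq_integrable d'" using D by (simp add: is_fourier_L2_def)
  note [measurable] = sq_integrable_measurable[OF sd]
  have "integrable lborel (\<lambda>\<xi>. (1 + \<xi>\<^sup>2) * (norm (d' \<xi>))\<^sup>2)"
  proof (rule Bochner_Integration.integrable_bound
      [of _ "\<lambda>\<xi>. 2 * ((1 + \<xi>\<^sup>2) * (norm (f' \<xi>))\<^sup>2) + 2 * ((1 + \<xi>\<^sup>2) * (norm (h' \<xi>))\<^sup>2)"])
    show "integrable lborel (\<lambda>\<xi>. 2 * ((1 + \<xi>\<^sup>2) * (norm (f' \<xi>))\<^sup>2) + 2 * ((1 + \<xi>\<^sup>2) * (norm (h' \<xi>))\<^sup>2))"
      using F(3) H(3) by (intro Bochner_Integration.integrable_add integrable_mult_right)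
    show "AE \<xi> in lborel. norm ((1 + \<xi>\<^sup>2) * (norm (d' \<xi>))\<^sup>2)
        \<le> norm (2 * ((1 + \<xi>\<^sup>2) * (norm (f' \<xi>))\<^sup>2) + 2 * ((1 + \<xi>\<^sup>2) * (norm (h' \<xi>))\<^sup>2))"
      using ae
    proof eventually_elim
      fix \<xi> assume *: "d' \<xi> = f' \<xi> - h' \<xi>"
      have "(norm (d' \<xi>))\<^sup>2 \<le> 2 * (norm (f' \<xi>))\<^sup>2 + 2 * (norm (h' \<xi>))\<^sup>2"
        using norm_add_square_le[of "f' \<xi>" "- h' \<xi>"] by (simp add: *)
      from mult_left_mono[OF this, of "1 + \<xi>\<^sup>2"]
      have "(1 + \<xi>\<^sup>2) * (norm (d' \<xi>))\<^sup>2 \<le> 2 * ((1 + \<xi>\<^sup>2) * (norm (f' \<xi>))\<^sup>2) + 2 * ((1 + \<xi>\<^sup>2) * (norm (h' \<xi>))\<^sup>2)"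
        by (simp add: algebra_simps)
      moreover have "0 \<le> (1 + \<xi>\<^sup>2) * (norm (d' \<xi>))\<^sup>2" by simp
      ultimately show "norm ((1 + \<xi>\<^sup>2) * (norm (d' \<xi>))\<^sup>2)
        \<le> norm (2 * ((1 + \<xi>\<^sup>2) * (norm (f' \<xi>))\<^sup>2) + 2 * ((1 + \<xi>\<^sup>2) * (norm (h' \<xi>))\<^sup>2))"
        unfolding real_norm_def by linarith
    qed
  qed measurable
  then have "integrable lborel (\<lambda>\<xi>. (1 + \<xi>\<^sup>2) powr 1 * (norm (d' \<xi>))\<^sup>2)"
    by (simp add: add_nonneg_nonneg)
  with d show ?thesis unfolding sobolev_def d'_def Lp_2_iff mem_Collect_eq by blast
qed

text \<open>Differentiation under the integral: the difference quotients of exp(i x \<xi>) are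
  bounded by |\<xi>|, so the function in \<open>k1\<close> dominates them.\<close>

lemma DERIV_inv_fourier:
  assumes k: "integrable lborel k" and k1: "integrable lborel (\<lambda>\<xi>. complex_of_real \<xi> * k \<xi>)"
  shows "((\<lambda>x. Re (inv_fourier k x)) has_real_derivative Re (inv_fourier (\<lambda>\<xi>. \<i> * complex_of_real \<xi> * k \<xi>) x)) (at x)"
proof -
  note [measurable] = borel_measurable_integrable[OF k]
  define c where "c = complex_of_real (1 / sqrt (2 * pi))"
  define q where "q h \<xi> = complex_of_real (1 / h) * ((exp (\<i> * complex_of_real (x + h) * complex_of_real \<xi>) -
      exp (\<i> * complex_of_real x * complex_of_real \<xi>)) * k \<xi>)" for h \<xi>
  have qm [measurable]: "q h \<in> borel_measurable borel" for h unfolding q_def by measurable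
  have diff: "(Re (inv_fourier k (x + h)) - Re (inv_fourier k x)) / h = Re (c * (\<integral>\<xi>. q h \<xi> \<partial>lborel))" for h
  proof -
    have "(\<integral>\<xi>. q h \<xi> \<partial>lborel) = complex_of_real (1 / h) *
        ((\<integral>\<xi>. exp (\<i> * complex_of_real (x + h) * complex_of_real \<xi>) * k \<xi> \<partial>lborel) -
         (\<integral>\<xi>. exp (\<i> * complex_of_real x * complex_of_real \<xi>) * k \<xi> \<partial>lborel))"
      unfolding q_def integral_mult_right_zero left_diff_distrib
      by (subst Bochner_Integration.integral_diff) (intro integrable_inv_fourier k refl)+
    then have "c * (\<integral>\<xi>. q h \<xi> \<partial>lborel) = complex_of_real (1 / h) * (inv_fourier k (x + h) - inv_fourier k x)"
      unfolding inv_fourier_def c_def[symmetric] by (simp only: right_diff_distrib mult.left_commute)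
    then show ?thesis by (simp only: Re_complex_of_real times_complex.sel Im_complex_of_real minus_complex.sel) simp
  qed
  have bnd: "norm (q h \<xi>) \<le> norm (complex_of_real \<xi> * k \<xi>)" for h \<xi>
  proof (cases "h = 0")
    case False
    have "exp (\<i> * complex_of_real (x + h) * complex_of_real \<xi>) - exp (\<i> * complex_of_real x * complex_of_real \<xi>)
       = exp (\<i> * complex_of_real x * complex_of_real \<xi>) * (exp (\<i> * complex_of_real (h * \<xi>)) - 1)"
      by (simp add: algebra_simps exp_add)
    then have "norm (exp (\<i> * complex_of_real (x + h) * complex_of_real \<xi>) - exp (\<i> * complex_of_real x * complex_of_real \<xi>))
       = norm (exp (\<i> * complex_of_real (h * \<xi>)) - 1)"
      by (simp only: norm_mult norm_exp_i mult_1_left)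
    also have "\<dots> \<le> \<bar>h * \<xi>\<bar>" using iexp_approx1[of "h * \<xi>" 0] by simp
    finally have "norm (q h \<xi>) \<le> \<bar>1 / h\<bar> * (\<bar>h * \<xi>\<bar> * norm (k \<xi>))"
      unfolding q_def norm_mult norm_of_real by (intro mult_left_mono mult_right_mono) auto
    also have "\<dots> = norm (complex_of_real \<xi> * k \<xi>)"
      using False by (simp add: abs_mult norm_mult)
    finally show ?thesis .
  qed (simp add: q_def)
  have "((\<lambda>h. Re (c * (\<integral>\<xi>. q h \<xi> \<partial>lborel))) \<longlongrightarrow> Re (inv_fourier (\<lambda>\<xi>. \<i> * complex_of_real \<xi> * k \<xi>) x)) (at 0)"
    unfolding tendsto_at_iff_sequentially comp_def
  proof (intro allI impI)
    fix X :: "nat \<Rightarrow> real" assume X0: "\<forall>i. X i \<in> UNIV - {0}" and X: "X \<longlonglongrightarrow> 0"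
    have "(\<lambda>n. \<integral>\<xi>. q (X n) \<xi> \<partial>lborel) \<longlonglongrightarrow>
        (\<integral>\<xi>. exp (\<i> * complex_of_real x * complex_of_real \<xi>) * (\<i> * complex_of_real \<xi> * k \<xi>) \<partial>lborel)"
    proof (rule Bochner_Integration.integral_dominated_convergence)
      show "integrable lborel (\<lambda>\<xi>. norm (complex_of_real \<xi> * k \<xi>))" using k1 by (rule integrable_norm)
      show "AE \<xi> in lborel. (\<lambda>n. q (X n) \<xi>) \<longlonglongrightarrow> exp (\<i> * complex_of_real x * complex_of_real \<xi>) * (\<i> * complex_of_real \<xi> * k \<xi>)"
      proof (rule AE_I2)
        fix \<xi> :: real
        let ?D = "exp (\<i> * complex_of_real x * complex_of_real \<xi>) * (\<i> * complex_of_real \<xi>)"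
        have "DERIV (\<lambda>z. exp (\<i> * z * complex_of_real \<xi>)) (complex_of_real x) :> ?D"
          by (auto intro!: derivative_eq_intros)
        then have D: "((\<lambda>h. (exp (\<i> * (complex_of_real x + h) * complex_of_real \<xi>) -
            exp (\<i> * complex_of_real x * complex_of_real \<xi>)) / h) \<longlongrightarrow> ?D) (at 0)"
          by (simp only: DERIV_def)
        have "filterlim (\<lambda>n. complex_of_real (X n)) (at 0) sequentially"
          using X0 tendsto_of_real[OF X, where 'a=complex] by (intro filterlim_atI) auto
        from tendsto_mult[OF filterlim_compose[OF D this] tendsto_const[of "k \<xi>"]]
        show "(\<lambda>n. q (X n) \<xi>) \<longlonglongrightarrow> exp (\<i> * complex_of_real x * complex_of_real \<xi>) * (\<i> * complex_of_real \<xi> * k \<xi>)"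
          by (simp add: q_def mult_ac)
      qed
    qed (use bnd in auto)
    then show "(\<lambda>n. Re (c * (\<integral>\<xi>. q (X n) \<xi> \<partial>lborel))) \<longlonglongrightarrow> Re (inv_fourier (\<lambda>\<xi>. \<i> * complex_of_real \<xi> * k \<xi>) x)"
      unfolding inv_fourier_def c_def by (intro tendsto_intros)
  qed
  then show ?thesis unfolding DERIV_def diff .
qed

text \<open>For fixed x, modulating k by exp(i x \<xi>) shifts and reflects its transform to
  \<open>inv_fourier k (x - y)\<close>, and the multiplication formula then moves the transform onto
  h. The factor 1 / sqrt (2 pi), which \<open>T_kernel\<close> carries, makes all constants
  cancel.\<close>

lemma convol_inv_fourier:
  fixes h :: "real \<Rightarrow> real"
  assumes k: "integrable lborel k" and h: "integrable lborel h"
  shows "convol (\<lambda>y. 1 / sqrt (2 * pi) * Re (inv_fourier k y)) h x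
    = Re (inv_fourier (\<lambda>\<xi>. k \<xi> * fourier (\<lambda>x. complex_of_real (h x)) \<xi>) x)"
proof -
  note [measurable] = borel_measurable_integrable[OF k] borel_measurable_integrable[OF h]
  let ?h = "\<lambda>x. complex_of_real (h x)"
  let ?k = "\<lambda>\<xi>. exp (\<i> * complex_of_real x * complex_of_real \<xi>) * k \<xi>"
  have h': "integrable lborel ?h" using h by simp
  have k': "integrable lborel ?k" by (rule integrable_inv_fourier[OF k])
  have shift: "fourier ?k y = inv_fourier k (x - y)" for y
  proof -
    have "exp (- (\<i> * complex_of_real \<xi> * complex_of_real y)) * exp (\<i> * complex_of_real x * complex_of_real \<xi>)
      = exp (- (\<i> * complex_of_real \<xi> * complex_of_real (- (x - y))))" for \<xi>
      by (simp add: algebra_simps flip: exp_add)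
    then show ?thesis
      unfolding inv_fourier_eq fourier_def by (simp only: mult.assoc[symmetric])
  qed
  have i: "integrable lborel (\<lambda>y. ?h y * fourier ?k y)"
  proof (rule Bochner_Integration.integrable_bound[of _ "\<lambda>y. h y * (\<integral>\<xi>. norm (?k \<xi>) \<partial>lborel)"])
    define I where "I = (\<integral>\<xi>. norm (?k \<xi>) \<partial>lborel)"
    have "I \<ge> 0" unfolding I_def by (rule Bochner_Integration.integral_nonneg_AE) auto
    have "norm (?h y * fourier ?k y) \<le> norm (h y * I)" for y
    proof -
      have "\<bar>h y\<bar> * norm (fourier ?k y) \<le> \<bar>h y\<bar> * I"
        unfolding I_def by (intro mult_left_mono norm_fourier_le) auto
      with \<open>I \<ge> 0\<close> show ?thesis by (simp only: norm_mult norm_of_real real_norm_def abs_of_nonneg)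
    qed
    then show "AE y in lborel. norm (?h y * fourier ?k y) \<le> norm (h y * (\<integral>\<xi>. norm (?k \<xi>) \<partial>lborel))"
      unfolding I_def by (rule AE_I2)
  qed (use h in auto)
  have "convol (\<lambda>y. 1 / sqrt (2 * pi) * Re (inv_fourier k y)) h x
      = 1 / sqrt (2 * pi) * (\<integral>y. Re (?h y * fourier ?k y) \<partial>lborel)"
    unfolding convol_def shift
    by (subst integral_mult_right_zero[symmetric]) (simp add: mult_ac)
  also have "\<dots> = 1 / sqrt (2 * pi) * Re (\<integral>y. ?h y * fourier ?k y \<partial>lborel)"
    by (simp only: integral_Re[OF i])
  also have "\<dots> = 1 / sqrt (2 * pi) * Re (\<integral>\<xi>. fourier ?h \<xi> * ?k \<xi> \<partial>lborel)"
    by (simp only: fourier_duality[OF h' k'])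
  also have "\<dots> = Re (complex_of_real (1 / sqrt (2 * pi)) * (\<integral>\<xi>. fourier ?h \<xi> * ?k \<xi> \<partial>lborel))"
    by (simp only: Re_complex_of_real times_complex.sel Im_complex_of_real mult_zero_left diff_zero)
  finally show ?thesis unfolding inv_fourier_def by (simp only: mult_ac)
qed

section \<open>The linear propagator\<close>

text \<open>The numbers \<alpha> and \<beta> bound the L^1 and L^2 norms of a symbol, hence the
  supremum and the L^2 norm of its inverse transform. All decay estimates are carried as such pairs,
  which add up like norms.\<close>

definition L12 :: "(real \<Rightarrow> complex) \<Rightarrow> real \<Rightarrow> real \<Rightarrow> bool" where
  "L12 k \<alpha> \<beta> \<longleftrightarrow> integrable lborel k \<and> sq_integrable k \<and> 0 \<le> \<beta> \<and>
     (\<integral>\<xi>. norm (k \<xi>) \<partial>lborel) \<le> \<alpha> \<and> (\<integral>\<xi>. (norm (k \<xi>))\<^sup>2 \<partial>lborel) \<le> \<beta>\<^sup>2"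

lemma L12_mono: "L12 k \<alpha> \<beta> \<Longrightarrow> \<alpha> \<le> \<alpha>' \<Longrightarrow> \<beta> \<le> \<beta>' \<Longrightarrow> L12 k \<alpha>' \<beta>'"
  unfolding L12_def by (auto intro: order_trans power_mono)

lemma L12_add:
  assumes "L12 k \<alpha> \<beta>" "L12 k' \<alpha>' \<beta>'"
  shows "L12 (\<lambda>\<xi>. k \<xi> + k' \<xi>) (\<alpha> + \<alpha>') (\<beta> + \<beta>')"
proof -
  have k: "integrable lborel k" "sq_integrable k" "0 \<le> \<beta>" "(\<integral>\<xi>. norm (k \<xi>) \<partial>lborel) \<le> \<alpha>"
      "(\<integral>\<xi>. (norm (k \<xi>))\<^sup>2 \<partial>lborel) \<le> \<beta>\<^sup>2"
    and k': "integrable lborel k'" "sq_integrable k'" "0 \<le> \<beta>'" "(\<integral>\<xi>. norm (k' \<xi>) \<partial>lborel) \<le> \<alpha>'"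
      "(\<integral>\<xi>. (norm (k' \<xi>))\<^sup>2 \<partial>lborel) \<le> \<beta>'\<^sup>2"
    using assms by (auto simp: L12_def)
  have s: "sq_integrable (\<lambda>\<xi>. norm (k \<xi>))" "sq_integrable (\<lambda>\<xi>. norm (k' \<xi>))"
    using k(2) k'(2) by (auto simp: sq_integrable_def)
  have sk: "sq_integrable (\<lambda>\<xi>. k \<xi> + k' \<xi>)" by (rule sq_integrable_add[OF k(2) k'(2)])
  have "(\<integral>\<xi>. norm (k \<xi> + k' \<xi>) \<partial>lborel) \<le> (\<integral>\<xi>. norm (k \<xi>) + norm (k' \<xi>) \<partial>lborel)"
    using k(1) k'(1) by (intro integral_mono) (auto intro: norm_triangle_ineq)
  also have "\<dots> \<le> \<alpha> + \<alpha>'" using k k' by simp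
  finally have 1: "(\<integral>\<xi>. norm (k \<xi> + k' \<xi>) \<partial>lborel) \<le> \<alpha> + \<alpha>'" .
  have "(\<integral>\<xi>. (norm (k \<xi> + k' \<xi>))\<^sup>2 \<partial>lborel) \<le> (\<integral>\<xi>. (norm (k \<xi>) + norm (k' \<xi>))\<^sup>2 \<partial>lborel)"
    using sq_integrableD[OF sk] sq_integrableD[OF sq_integrable_add[OF s]]
    by (intro integral_mono) (auto intro: power_mono norm_triangle_ineq)
  also have "\<dots> = (sqrt (\<integral>\<xi>. (norm (k \<xi>) + norm (k' \<xi>))\<^sup>2 \<partial>lborel))\<^sup>2"
    by (intro real_sqrt_pow2[symmetric] Bochner_Integration.integral_nonneg_AE) auto
  also have "\<dots> \<le> (sqrt (\<integral>\<xi>. (norm (k \<xi>))\<^sup>2 \<partial>lborel) + sqrt (\<integral>\<xi>. (norm (k' \<xi>))\<^sup>2 \<partial>lborel))\<^sup>2"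
    by (intro power_mono L2_triangle s) (auto intro!: Bochner_Integration.integral_nonneg_AE)
  also have "\<dots> \<le> (\<beta> + \<beta>')\<^sup>2"
    using k k' by (intro power_mono add_mono real_le_lsqrt) (auto intro!: add_nonneg_nonneg Bochner_Integration.integral_nonneg_AE)
  finally have 2: "(\<integral>\<xi>. (norm (k \<xi> + k' \<xi>))\<^sup>2 \<partial>lborel) \<le> (\<beta> + \<beta>')\<^sup>2" .
  from 1 2 sk k k' show ?thesis unfolding L12_def by auto
qed

lemma powr_sqrt:
  assumes "t > 0"
  shows "1 / sqrt t = t powr (-1/2)" "sqrt (1 / sqrt t) = t powr (-1/4)"
proof -
  show 1: "1 / sqrt t = t powr (-1/2)"
    using assms by (simp add: powr_minus inverse_eq_divide powr_half_sqrt flip: powr_minus_divide)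
  have "sqrt (t powr (-1/2)) = (t powr (-1/2)) powr (1/2)" by (simp add: powr_half_sqrt)
  then show "sqrt (1 / sqrt t) = t powr (-1/4)" unfolding 1 by (simp add: powr_powr)
qed

text \<open>The two powers are the orders of the L^1 and L^2 norms of 1/(1 + t \<xi>^2); the
  constants 4 and 2 come from pi < 4.\<close>

lemma L12_dominated:
  assumes [measurable]: "k \<in> borel_measurable borel" and t: "t > 0" and A: "A \<ge> 0"
    and le: "\<And>\<xi>. norm (k \<xi>) \<le> A / (1 + t * \<xi>\<^sup>2)"
  shows "L12 k (4 * A * t powr (-1/2)) (2 * A * t powr (-1/4))"
proof -
  note I = integral_inverse_1_plus_scaled_square[OF t]
  have den: "0 < 1 + t * \<xi>\<^sup>2" for \<xi> using t by (simp add: add_pos_nonneg)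
  note iA = integrable_mult_right[OF I(1), of A]
  have nA: "norm (A * (1 / (1 + t * \<xi>\<^sup>2))) = A / (1 + t * \<xi>\<^sup>2)" for \<xi>
    using A den[of \<xi>] by simp
  have i: "integrable lborel k"
    by (rule Bochner_Integration.integrable_bound[of _ "\<lambda>\<xi>. A * (1 / (1 + t * \<xi>\<^sup>2))"])
       (use iA le in \<open>simp_all only: nA, auto\<close>)
  have le2: "(norm (k \<xi>))\<^sup>2 \<le> A\<^sup>2 * (1 / (1 + t * \<xi>\<^sup>2))\<^sup>2" for \<xi>
    using power_mono[OF le[of \<xi>] norm_ge_zero, of 2] by (simp add: power_divide)
  have s: "sq_integrable k"
    unfolding sq_integrable_def
  proof
    show "integrable lborel (\<lambda>x. (norm (k x))\<^sup>2)"
      by (rule Bochner_Integration.integrable_bound[of _ "\<lambda>\<xi>. A\<^sup>2 * (1 / (1 + t * \<xi>\<^sup>2))\<^sup>2"])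
         (use I(3) le2 in auto)
  qed simp
  have "(\<integral>\<xi>. norm (k \<xi>) \<partial>lborel) \<le> (\<integral>\<xi>. A * (1 / (1 + t * \<xi>\<^sup>2)) \<partial>lborel)"
    using i le by (intro integral_mono[OF _ iA]) auto
  also have "\<dots> = A * (pi * (1 / sqrt t))" by (simp only: integral_mult_right_zero I(2)) simp
  also have "\<dots> \<le> A * (4 * (1 / sqrt t))"
    using A t pi_less_4 by (intro mult_left_mono mult_right_mono) auto
  finally have 1: "(\<integral>\<xi>. norm (k \<xi>) \<partial>lborel) \<le> 4 * A * t powr (-1/2)"
    by (simp only: powr_sqrt(1)[OF t] mult_ac)
  have "(\<integral>\<xi>. (norm (k \<xi>))\<^sup>2 \<partial>lborel) \<le> (\<integral>\<xi>. A\<^sup>2 * (1 / (1 + t * \<xi>\<^sup>2))\<^sup>2 \<partial>lborel)"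
    using sq_integrableD[OF s] I(3) le2 by (intro integral_mono) auto
  also have "\<dots> \<le> A\<^sup>2 * (pi / sqrt t)"
    using mult_left_mono[OF I(4), of "A\<^sup>2"] by simp
  also have "\<dots> \<le> A\<^sup>2 * (4 / sqrt t)"
    using t pi_less_4 by (intro mult_left_mono divide_right_mono) auto
  also have "\<dots> = (2 * A * sqrt (1 / sqrt t))\<^sup>2"
    using t by (simp add: power_mult_distrib)
  finally have 2: "(\<integral>\<xi>. (norm (k \<xi>))\<^sup>2 \<partial>lborel) \<le> (2 * A * t powr (-1/4))\<^sup>2"
    by (simp only: powr_sqrt(2)[OF t])
  from i s 1 2 A show ?thesis unfolding L12_def by simp
qed

text \<open>The exponent -3/4 is the time singularity in \<open>kernel_L1_bound\<close>. It is
  integrable up to \<tau> = t, by the fundamental theorem with a limit at the singular end.\<close>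

lemma integral_power_singular:
  assumes "r < (t::real)"
  shows "integrable lborel (\<lambda>\<tau>. indicator {r..<t} \<tau> * (t - \<tau>) powr (-3/4))"
    "(\<integral>\<tau>. indicator {r..<t} \<tau> * (t - \<tau>) powr (-3/4) \<partial>lborel) = 4 * (t - r) powr (1/4)"
proof -
  define F where "F \<tau> = - 4 * (t - \<tau>) powr (1/4)" for \<tau>
  note FTC = interval_integral_FTC_nonneg[where F = F and a = "ereal r" and b = "ereal t"
      and f = "\<lambda>\<tau>. (t - \<tau>) powr (-3/4)" and A = "F r" and B = 0]
  have 1: "DERIV F \<tau> :> (t - \<tau>) powr (-3/4)" if "ereal r < ereal \<tau>" "ereal \<tau> < ereal t" for \<tau>
    unfolding F_def using that by (auto intro!: derivative_eq_intros)
  have 2: "isCont (\<lambda>\<tau>. (t - \<tau>) powr (-3/4)) \<tau>" if "ereal r < ereal \<tau>" "ereal \<tau> < ereal t" for \<tau>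
    using that by (intro continuous_intros) auto
  have 3: "((F \<circ> real_of_ereal) \<longlongrightarrow> F r) (at_right (ereal r))"
    unfolding ereal_tendsto_simps F_def using assms
    by (intro tendsto_intros) auto
  have "((\<lambda>\<tau>. - 4 * (t - \<tau>) powr (1/4)) \<longlongrightarrow> - 4 * (t - t) powr (1/4)) (at_left t)"
    by (intro tendsto_intros tendsto_powr2 eventually_at_leftI[of "t-1"]) auto
  then have 4: "((F \<circ> real_of_ereal) \<longlongrightarrow> 0) (at_left (ereal t))"
    unfolding ereal_tendsto_simps F_def by simp
  have 5: "AE x in lborel. ereal r < ereal x \<longrightarrow> ereal x < ereal t \<longrightarrow> 0 \<le> (t - x) powr (-3/4)" by simp
  have rt: "ereal r < ereal t" using assms by simp
  have i: "integrable lborel (\<lambda>\<tau>. indicator {r<..<t} \<tau> * (t - \<tau>) powr (-3/4))"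
    using FTC(1)[OF rt 1 2 5 3 4] by (simp add: set_integrable_def)
  have v: "(\<integral>\<tau>. indicator {r<..<t} \<tau> * (t - \<tau>) powr (-3/4) \<partial>lborel) = 4 * (t - r) powr (1/4)"
    using FTC(2)[OF rt 1 2 5 3 4] assms
    by (simp add: interval_lebesgue_integral_def set_lebesgue_integral_def F_def)
  have ae: "AE \<tau> in lborel. indicator {r<..<t} \<tau> * (t - \<tau>) powr (-3/4) = (indicator {r..<t} \<tau> * (t - \<tau>) powr (-3/4) :: real)"
    using AE_lborel_singleton[of r] by eventually_elim (auto simp: indicator_def)
  show "integrable lborel (\<lambda>\<tau>. indicator {r..<t} \<tau> * (t - \<tau>) powr (-3/4))"
    using i by (rule integrable_cong_AE_imp) (use ae in auto)
  show "(\<integral>\<tau>. indicator {r..<t} \<tau> * (t - \<tau>) powr (-3/4) \<partial>lborel) = 4 * (t - r) powr (1/4)"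
    unfolding v[symmetric] by (rule integral_cong_AE) (use ae in auto)
qed

section \<open>The symbol of the linear equation and its linearisation at low frequency\<close>

locale dispersive =
  fixes B b \<mu> :: real
  assumes B_pos: "B > 0" and b_pos: "b > 0" and \<mu>_pos: "\<mu> > 0"
begin

definition propagator :: "real \<Rightarrow> real \<Rightarrow> complex" where
  "propagator t \<xi> = exp (- (\<mu> * t * \<xi>\<^sup>2) - \<i> * 2 * B * b * t * \<xi> / (b\<^sup>2 + \<xi>\<^sup>2))"

text \<open>The symbol of \<open>G\<^sub>0\<close> up to a constant: the phase 2 B b \<xi> / (b^2 +
  \<xi>^2) is replaced by its tangent (2 B / b) \<xi> at 0.\<close>

definition propagator\<^sub>0 :: "real \<Rightarrow> real \<Rightarrow> complex" where
  "propagator\<^sub>0 t \<xi> = exp (- (\<mu> * t * \<xi>\<^sup>2) - \<i> * (2 * B / b) * t * \<xi>)"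

lemma measurable_propagator [measurable]: "(\<lambda>p. propagator (f p) (g p)) \<in> borel_measurable M"
  if [measurable]: "f \<in> borel_measurable M" "g \<in> borel_measurable M"
  unfolding propagator_def by measurable

lemma measurable_propagator\<^sub>0 [measurable]: "(\<lambda>p. propagator\<^sub>0 (f p) (g p)) \<in> borel_measurable M"
  if [measurable]: "f \<in> borel_measurable M" "g \<in> borel_measurable M"
  unfolding propagator\<^sub>0_def by measurable

lemma propagator_polar:
  "propagator t \<xi> = complex_of_real (exp (- (\<mu> * t * \<xi>\<^sup>2))) * exp (\<i> * complex_of_real (- (2 * B * b * t * \<xi> / (b\<^sup>2 + \<xi>\<^sup>2))))"
  "propagator\<^sub>0 t \<xi> = complex_of_real (exp (- (\<mu> * t * \<xi>\<^sup>2))) * exp (\<i> * complex_of_real (- (2 * B / b * t * \<xi>)))"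
  unfolding propagator_def propagator\<^sub>0_def exp_of_real[symmetric] exp_add[symmetric]
  by (simp_all add: mult_ac)

lemma norm_propagator [simp]: "norm (propagator t \<xi>) = exp (- (\<mu> * t * \<xi>\<^sup>2))"
  "norm (propagator\<^sub>0 t \<xi>) = exp (- (\<mu> * t * \<xi>\<^sup>2))"
  unfolding propagator_polar by (simp_all only: norm_mult norm_exp_i_times norm_of_real abs_exp_cancel mult_1_right)

text \<open>The phases differ by 2 B t \<xi>^3 / (b (b^2 + \<xi>^2)), so linearising costs t
  |\<xi>|^3, which the damping turns into t^(-1/2).\<close>

lemma propagator_diff:
  assumes "t \<ge> 0"
  shows "norm (propagator t \<xi> - propagator\<^sub>0 t \<xi>) \<le> 2 * B / b ^ 3 * t * (\<bar>\<xi>\<bar> ^ 3 * exp (- (\<mu> * t * \<xi>\<^sup>2)))"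
proof -
  define p where "p = - (2 * B * b * t * \<xi> / (b\<^sup>2 + \<xi>\<^sup>2))"
  define q where "q = - (2 * B / b * t * \<xi>)"
  have "exp (\<i> * complex_of_real p) - exp (\<i> * complex_of_real q) = exp (\<i> * complex_of_real q) * (exp (\<i> * complex_of_real (p - q)) - 1)"
    by (simp add: algebra_simps exp_add exp_diff)
  then have "norm (exp (\<i> * complex_of_real p) - exp (\<i> * complex_of_real q)) = norm (exp (\<i> * complex_of_real (p - q)) - 1)"
    by (simp only: norm_mult norm_exp_i_times mult_1_left)
  also have "\<dots> \<le> \<bar>p - q\<bar>" using iexp_approx1[of "p - q" 0] by simp
  also have "p - q = 2 * B * t * \<xi> * (\<xi>\<^sup>2 / (b * (b\<^sup>2 + \<xi>\<^sup>2)))"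
  proof -
    have "b\<^sup>2 + \<xi>\<^sup>2 \<noteq> 0" using b_pos by (simp add: add_nonneg_eq_0_iff)
    then show ?thesis using b_pos unfolding p_def q_def by (simp add: divide_simps) (simp add: algebra_simps power2_eq_square)
  qed
  also have "\<bar>2 * B * t * \<xi> * (\<xi>\<^sup>2 / (b * (b\<^sup>2 + \<xi>\<^sup>2)))\<bar> = 2 * B * t * (\<bar>\<xi>\<bar> * (\<xi>\<^sup>2 / (b * (b\<^sup>2 + \<xi>\<^sup>2))))"
    using B_pos b_pos assms by (simp add: abs_mult)
  also have "\<dots> \<le> 2 * B * t * (\<bar>\<xi>\<bar> * (\<xi>\<^sup>2 / (b * b\<^sup>2)))"
    using B_pos b_pos assms by (intro mult_left_mono divide_left_mono) (auto simp: add_pos_nonneg)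
  also have "\<dots> = 2 * B / b ^ 3 * t * \<bar>\<xi>\<bar> ^ 3"
    using b_pos by (simp add: power3_eq_cube power2_eq_square abs_mult)
  finally have "norm (exp (\<i> * complex_of_real p) - exp (\<i> * complex_of_real q)) \<le> 2 * B / b ^ 3 * t * \<bar>\<xi>\<bar> ^ 3" .
  from mult_left_mono[OF this, of "exp (- (\<mu> * t * \<xi>\<^sup>2))"]
  have "exp (- (\<mu> * t * \<xi>\<^sup>2)) * norm (exp (\<i> * complex_of_real p) - exp (\<i> * complex_of_real q))
      \<le> 2 * B / b ^ 3 * t * (\<bar>\<xi>\<bar> ^ 3 * exp (- (\<mu> * t * \<xi>\<^sup>2)))"
    by (simp add: mult_ac)
  moreover have "propagator t \<xi> - propagator\<^sub>0 t \<xi> = complex_of_real (exp (- (\<mu> * t * \<xi>\<^sup>2))) * (exp (\<i> * complex_of_real p) - exp (\<i> * complex_of_real q))"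
    unfolding propagator_polar p_def q_def by (simp only: right_diff_distrib)
  ultimately show ?thesis by (simp only: norm_mult norm_of_real abs_exp_cancel)
qed

lemma integrable_power_exp:
  fixes c :: real
  assumes c: "c > 0"
  shows "integrable lborel (\<lambda>\<xi>::real. \<bar>\<xi>\<bar> ^ j * exp (- (c * \<xi>\<^sup>2)))"
proof -
  obtain C where C: "C > 0" "\<And>t \<xi>. t > 0 \<Longrightarrow> \<bar>\<xi>\<bar> ^ j * exp (- (c * t * \<xi>\<^sup>2)) \<le> C * (1 / sqrt t) ^ j / (1 + t * \<xi>\<^sup>2)"
    using power_exp_bound[OF c] by blast
  show ?thesis
  proof (rule Bochner_Integration.integrable_bound[of _ "\<lambda>\<xi>. C * (1 / (1 + 1 * \<xi>\<^sup>2))"])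
    show "integrable lborel (\<lambda>\<xi>. C * (1 / (1 + 1 * \<xi>\<^sup>2)))"
      by (intro integrable_mult_right integral_inverse_1_plus_scaled_square) simp
    have "norm (\<bar>\<xi>\<bar> ^ j * exp (- (c * \<xi>\<^sup>2))) \<le> C * (1 / (1 + 1 * \<xi>\<^sup>2))" for \<xi>
      using C(2)[of 1 \<xi>] by (simp add: abs_mult)
    then show "AE \<xi> in lborel. norm (\<bar>\<xi>\<bar> ^ j * exp (- (c * \<xi>\<^sup>2))) \<le> norm (C * (1 / (1 + 1 * \<xi>\<^sup>2)))"
      by (intro AE_I2) (metis abs_ge_self order_trans real_norm_def)
  qed simp
qed

lemma integrable_propagator:
  assumes t: "t > 0"
  shows "integrable lborel (propagator t)" "integrable lborel (\<lambda>\<xi>. complex_of_real \<xi> * propagator t \<xi>)"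
    "integrable lborel (propagator\<^sub>0 t)" "integrable lborel (\<lambda>\<xi>. complex_of_real \<xi> * propagator\<^sub>0 t \<xi>)"
proof -
  have c: "\<mu> * t > 0" using \<mu>_pos t by simp
  note I = integrable_power_exp[OF c, of 0] integrable_power_exp[OF c, of 1]
  show "integrable lborel (propagator t)"
    by (rule Bochner_Integration.integrable_bound[OF I(1)]) (auto simp: measurable_propagator)
  show "integrable lborel (propagator\<^sub>0 t)"
    by (rule Bochner_Integration.integrable_bound[OF I(1)]) (auto simp: measurable_propagator\<^sub>0)
  show "integrable lborel (\<lambda>\<xi>. complex_of_real \<xi> * propagator t \<xi>)"
    by (rule Bochner_Integration.integrable_bound[OF I(2)]) (auto simp: norm_mult)
  show "integrable lborel (\<lambda>\<xi>. complex_of_real \<xi> * propagator\<^sub>0 t \<xi>)"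
    by (rule Bochner_Integration.integrable_bound[OF I(2)]) (auto simp: norm_mult)
qed

lemma T_kernel_eq: "T_kernel B b \<mu> x t = 1 / sqrt (2 * pi) * Re (inv_fourier (propagator t) x)"
  unfolding T_kernel_def propagator_def[abs_def] ..

lemma deriv_T_kernel:
  assumes t: "t > 0"
  shows "deriv (\<lambda>z. T_kernel B b \<mu> z t) y
    = 1 / sqrt (2 * pi) * Re (inv_fourier (\<lambda>\<xi>. \<i> * complex_of_real \<xi> * propagator t \<xi>) y)"
  unfolding T_kernel_eq
  by (intro DERIV_imp_deriv DERIV_cmult DERIV_inv_fourier integrable_propagator t)

lemma convol_T_kernel:
  assumes t: "t > 0" and h: "integrable lborel h"
  shows "convol (\<lambda>y. T_kernel B b \<mu> y t) h x
      = Re (inv_fourier (\<lambda>\<xi>. propagator t \<xi> * fourier (\<lambda>x. complex_of_real (h x)) \<xi>) x)"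
    "convol (\<lambda>y. deriv (\<lambda>z. T_kernel B b \<mu> z t) y) h x
      = Re (inv_fourier (\<lambda>\<xi>. \<i> * complex_of_real \<xi> * propagator t \<xi> * fourier (\<lambda>x. complex_of_real (h x)) \<xi>) x)"
  unfolding T_kernel_eq[abs_def] deriv_T_kernel[OF t, unfolded T_kernel_eq[abs_def]]
  using convol_inv_fourier[OF integrable_propagator(1)[OF t] h]
    convol_inv_fourier[OF integrable_mult_right[OF integrable_propagator(2)[OF t], of \<i>] h]
  by (simp_all only: mult.assoc)

end

section \<open>The Duhamel term\<close>

lemma norm_le_normI: "0 \<le> a \<Longrightarrow> a \<le> b \<Longrightarrow> norm a \<le> norm (b::real)"
  by simp

context dispersive begin

text \<open>The rates of the transform of u^3 if u is O((1+\<tau>)^(-1/2)) in sup norm and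
  O((1+\<tau>)^(-1/4)) in L^2. Its supremum is bounded by the L^1 norm of u^3, with rate -1/2 - 2/4
  = -1; its L^2 norm has rate -1 - 1/4 = -5/4. A general H separates the kernel estimates from the
  solution.\<close>

definition source_bound :: "(real \<Rightarrow> real \<Rightarrow> complex) \<Rightarrow> real \<Rightarrow> real \<Rightarrow> bool" where
  "source_bound H Q t \<longleftrightarrow> case_prod H \<in> borel_measurable (borel \<Otimes>\<^sub>M borel) \<and> 0 \<le> Q \<and>
     (\<forall>\<tau>\<in>{0..<t}. (\<forall>\<xi>. norm (H \<tau> \<xi>) \<le> Q / (1 + \<tau>)) \<and> sq_integrable (H \<tau>) \<and>
        (\<integral>\<xi>. (norm (H \<tau> \<xi>))\<^sup>2 \<partial>lborel) \<le> (Q * (1 + \<tau>) powr (-5/4))\<^sup>2)"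

text \<open>The contribution of the source times in [r, s) to the symbol at time t. The interval is
  open at s, so that for s <= t the time \<tau> = t, at which there is no damping, does not
  occur.\<close>

definition duhamel :: "(real \<Rightarrow> real \<Rightarrow> complex) \<Rightarrow> real \<Rightarrow> real \<Rightarrow> real \<Rightarrow> real \<Rightarrow> complex" where
  "duhamel H t r s \<xi> = (LINT \<tau>:{r..<s}|lborel. \<i> * complex_of_real \<xi> * propagator (t - \<tau>) \<xi> * H \<tau> \<xi>)"

lemma source_bound_measurable:
  assumes "source_bound H Q t" "f \<in> borel_measurable M" "g \<in> borel_measurable M"
  shows "(\<lambda>p. H (f p) (g p)) \<in> borel_measurable M"
  using measurable_compose[OF measurable_Pair[OF assms(2,3)], of "case_prod H"] assms(1)
  by (simp add: source_bound_def)

lemma measurable_duhamel: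
  assumes "source_bound H Q t'"
  shows "duhamel H t r s \<in> borel_measurable borel"
proof -
  have [measurable]: "(\<lambda>p. H (f p) (g p)) \<in> borel_measurable M"
    if "f \<in> borel_measurable M" "g \<in> borel_measurable M" for f g and M :: "'a measure"
    using source_bound_measurable[OF assms that] .
  have [measurable]: "(\<lambda>p. H (snd p) (fst p)) \<in> borel_measurable (borel \<Otimes>\<^sub>M lborel)"
    by (rule source_bound_measurable[OF assms]) auto
  have "(\<lambda>\<xi>. \<integral>\<tau>. indicator {r..<s} \<tau> *\<^sub>R (\<i> * complex_of_real \<xi> * propagator (t - \<tau>) \<xi> * H \<tau> \<xi>) \<partial>lborel) \<in> borel_measurable borel"
    by (rule lborel.borel_measurable_lebesgue_integral) (simp add: split_beta')
  then show ?thesis unfolding duhamel_def[abs_def] set_lebesgue_integral_def .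
qed

lemma norm_duhamel_integrand:
  "norm (\<i> * complex_of_real \<xi> * propagator (t - \<tau>) \<xi> * H \<tau> \<xi>) = \<bar>\<xi>\<bar> * exp (- (\<mu> * (t - \<tau>) * \<xi>\<^sup>2)) * norm (H \<tau> \<xi>)"
  by (simp add: norm_mult)

text \<open>Cauchy-Schwarz: the L^2 norm of |\<xi>| exp(-\<mu> s \<xi>^2) is O(s^(-3/4)). Pairing
  with the L^2 norm of the source is what keeps the singularity integrable in time; a sup bound on
  the source would give 1/s.\<close>

lemma kernel_L1_bound:
  obtains C where "C > 0"
    "\<And>s q h. s > 0 \<Longrightarrow> q \<ge> 0 \<Longrightarrow> sq_integrable (h :: real \<Rightarrow> complex) \<Longrightarrow> (\<integral>\<xi>. (norm (h \<xi>))\<^sup>2 \<partial>lborel) \<le> q\<^sup>2 \<Longrightarrow>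
       integrable lborel (\<lambda>\<xi>. \<bar>\<xi>\<bar> * exp (- (\<mu> * s * \<xi>\<^sup>2)) * norm (h \<xi>)) \<and>
       (\<integral>\<xi>. \<bar>\<xi>\<bar> * exp (- (\<mu> * s * \<xi>\<^sup>2)) * norm (h \<xi>) \<partial>lborel) \<le> C * q * s powr (-3/4)"
proof -
  obtain C where C: "C > 0"
    "\<And>t \<xi>. t > 0 \<Longrightarrow> \<bar>\<xi>\<bar> ^ 2 * exp (- (2 * \<mu> * t * \<xi>\<^sup>2)) \<le> C * (1 / sqrt t) ^ 2 / (1 + t * \<xi>\<^sup>2)"
    using power_exp_bound[of "2 * \<mu>" 2] \<mu>_pos by auto
  show thesis
  proof (rule that[of "2 * sqrt C"])
    show "2 * sqrt C > 0" using C by simp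
    fix s q :: real and h :: "real \<Rightarrow> complex"
    assume s: "s > 0" and q: "q \<ge> 0" and h: "sq_integrable h" and hq: "(\<integral>\<xi>. (norm (h \<xi>))\<^sup>2 \<partial>lborel) \<le> q\<^sup>2"
    define f where "f \<xi> = \<bar>\<xi>\<bar> * exp (- (\<mu> * s * \<xi>\<^sup>2))" for \<xi>
    have [measurable]: "f \<in> borel_measurable borel" unfolding f_def by measurable
    have f2: "(norm (f \<xi>))\<^sup>2 \<le> C / s * (1 / (1 + s * \<xi>\<^sup>2))" for \<xi>
    proof -
      have "(norm (f \<xi>))\<^sup>2 = \<bar>\<xi>\<bar> ^ 2 * exp (- (2 * \<mu> * s * \<xi>\<^sup>2))"
        unfolding f_def by (simp add: power_mult_distrib power2_eq_square[of "exp _"] flip: exp_add)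
      also have "\<dots> \<le> C * (1 / sqrt s) ^ 2 / (1 + s * \<xi>\<^sup>2)" by (rule C(2)[OF s])
      finally show ?thesis using s by (simp add: power_divide)
    qed
    note I = integral_inverse_1_plus_scaled_square[OF s]
    note iC = integrable_mult_right[OF I(1), of "C / s"]
    have sf: "sq_integrable f"
      unfolding sq_integrable_def
    proof
      show "integrable lborel (\<lambda>x. (norm (f x))\<^sup>2)"
      proof (rule Bochner_Integration.integrable_bound[OF iC])
        show "AE x in lborel. norm ((norm (f x))\<^sup>2) \<le> norm (C / s * (1 / (1 + s * x\<^sup>2)))"
          by (intro AE_I2 norm_le_normI f2) simp
      qed simp
    qed simp
    have "(\<integral>\<xi>. (norm (f \<xi>))\<^sup>2 \<partial>lborel) \<le> (\<integral>\<xi>. C / s * (1 / (1 + s * \<xi>\<^sup>2)) \<partial>lborel)"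
      by (rule integral_mono[OF sq_integrableD[OF sf] iC f2])
    also have "\<dots> = C / s * (pi / sqrt s)" by (simp only: integral_mult_right_zero I(2))
    also have "\<dots> \<le> C / s * (4 / sqrt s)"
      using C s pi_less_4 by (intro mult_left_mono divide_right_mono) auto
    also have "\<dots> = (2 * sqrt C * s powr (-3/4))\<^sup>2"
    proof -
      have "(s powr (-3/4))\<^sup>2 = s powr (-3/2)" using s by (simp add: powr_power)
      also have "\<dots> = s powr (-1 + -1/2)" by simp
      also have "\<dots> = 1 / s * (1 / sqrt s)"
        unfolding powr_add powr_sqrt(1)[OF s] using s by (simp add: powr_minus_divide)
      finally show ?thesis using C by (simp add: power_mult_distrib)
    qed
    finally have F: "(\<integral>\<xi>. (norm (f \<xi>))\<^sup>2 \<partial>lborel) \<le> (2 * sqrt C * s powr (-3/4))\<^sup>2" .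
    have sh: "sq_integrable (\<lambda>\<xi>. norm (h \<xi>))" using h by (auto simp: sq_integrable_def)
    have f0: "norm (f \<xi>) = f \<xi>" and nn: "norm (norm (h \<xi>)) = norm (h \<xi>)" for \<xi> by (simp_all add: f_def)
    have "integrable lborel (\<lambda>\<xi>. f \<xi> * norm (h \<xi>))" by (rule integrable_mult_sq[OF sf sh])
    moreover have "(\<integral>\<xi>. f \<xi> * norm (h \<xi>) \<partial>lborel) \<le> sqrt (\<integral>\<xi>. (norm (f \<xi>))\<^sup>2 \<partial>lborel) * sqrt (\<integral>\<xi>. (norm (h \<xi>))\<^sup>2 \<partial>lborel)"
      using Cauchy_Schwarz_integral[OF sf sh] by (simp only: f0 nn)
    moreover have "\<dots> \<le> (2 * sqrt C * s powr (-3/4)) * q"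
      using F hq q C by (intro mult_mono real_le_lsqrt) (auto intro!: Bochner_Integration.integral_nonneg_AE)
    ultimately show "integrable lborel (\<lambda>\<xi>. \<bar>\<xi>\<bar> * exp (- (\<mu> * s * \<xi>\<^sup>2)) * norm (h \<xi>)) \<and>
       (\<integral>\<xi>. \<bar>\<xi>\<bar> * exp (- (\<mu> * s * \<xi>\<^sup>2)) * norm (h \<xi>) \<partial>lborel) \<le> 2 * sqrt C * q * s powr (-3/4)"
      unfolding f_def by (simp add: mult_ac)
  qed
qed

lemma integrable_indicator_Ico: "integrable lborel (\<lambda>\<tau>. indicator {r..<t::real} \<tau> :: real)"
proof (rule Bochner_Integration.integrable_bound)
  show "integrable lborel (\<lambda>\<tau>. indicator {r..t} \<tau> :: real)"
    by (auto intro!: integrable_real_indicator simp: emeasure_lborel_Icc_eq)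
qed (auto simp: indicator_def)

text \<open>The last bound is an exact integration: \<mu> \<xi>^2 exp(-\<mu> (t - \<tau>) \<xi>^2)
  is the derivative of the exponential in \<tau>. Integrating in time first thus gains two powers of
  \<xi>.\<close>

lemma time_kernel_bound:
  assumes rt: "r \<le> (t::real)"
  shows "integrable lborel (\<lambda>\<tau>. indicator {r..<t} \<tau> * exp (- (\<mu> * (t - \<tau>) * \<xi>\<^sup>2)))"
    "(\<integral>\<tau>. indicator {r..<t} \<tau> * exp (- (\<mu> * (t - \<tau>) * \<xi>\<^sup>2)) \<partial>lborel) \<le> t - r"
    "\<mu> * \<xi>\<^sup>2 * (\<integral>\<tau>. indicator {r..<t} \<tau> * exp (- (\<mu> * (t - \<tau>) * \<xi>\<^sup>2)) \<partial>lborel) \<le> 1"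
proof -
  note i1 = integrable_indicator_Ico[of r t]
  show i: "integrable lborel (\<lambda>\<tau>. indicator {r..<t} \<tau> * exp (- (\<mu> * (t - \<tau>) * \<xi>\<^sup>2)))"
    by (rule Bochner_Integration.integrable_bound[OF i1])
       (use \<mu>_pos in \<open>auto simp: indicator_def\<close>)
  have "(\<integral>\<tau>. indicator {r..<t} \<tau> * exp (- (\<mu> * (t - \<tau>) * \<xi>\<^sup>2)) \<partial>lborel) \<le> (\<integral>\<tau>. indicator {r..<t} \<tau> \<partial>lborel)"
    by (rule integral_mono[OF i i1]) (use \<mu>_pos in \<open>auto simp: indicator_def\<close>)
  then show "(\<integral>\<tau>. indicator {r..<t} \<tau> * exp (- (\<mu> * (t - \<tau>) * \<xi>\<^sup>2)) \<partial>lborel) \<le> t - r"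
    using rt by simp
  show "\<mu> * \<xi>\<^sup>2 * (\<integral>\<tau>. indicator {r..<t} \<tau> * exp (- (\<mu> * (t - \<tau>) * \<xi>\<^sup>2)) \<partial>lborel) \<le> 1"
  proof -
    define F where "F \<tau> = exp (- (\<mu> * (t - \<tau>) * \<xi>\<^sup>2))" for \<tau>
    define f where "f \<tau> = \<mu> * \<xi>\<^sup>2 * exp (- (\<mu> * (t - \<tau>) * \<xi>\<^sup>2))" for \<tau>
    have D: "DERIV F x :> f x" for x unfolding F_def f_def by (auto intro!: derivative_eq_intros)
    have c: "isCont f x" for x unfolding f_def by (intro continuous_intros)
    have hb: "has_bochner_integral lborel (\<lambda>\<tau>. f \<tau> * indicator {r..t} \<tau>) (F t - F r)"
      using has_bochner_integral_FTC_Icc_real[OF rt, of F f] D c by auto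
    have "\<mu> * \<xi>\<^sup>2 * (\<integral>\<tau>. indicator {r..<t} \<tau> * exp (- (\<mu> * (t - \<tau>) * \<xi>\<^sup>2)) \<partial>lborel)
        = (\<integral>\<tau>. \<mu> * \<xi>\<^sup>2 * (indicator {r..<t} \<tau> * exp (- (\<mu> * (t - \<tau>) * \<xi>\<^sup>2))) \<partial>lborel)"
      by (rule integral_mult_right_zero[symmetric])
    also have "\<dots> \<le> (\<integral>\<tau>. f \<tau> * indicator {r..t} \<tau> \<partial>lborel)"
      using hb \<mu>_pos by (intro integral_mono integrable_mult_right[OF i])
        (auto simp: has_bochner_integral_iff f_def indicator_def)
    also have "\<dots> = F t - F r" using hb by (simp add: has_bochner_integral_iff)
    also have "\<dots> \<le> 1" unfolding F_def by simp
    finally show ?thesis .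
  qed
qed

lemma duhamel_integrable_time:
  assumes H: "source_bound H Q t" and r: "0 \<le> r" "s \<le> t"
  shows "set_integrable lborel {r..<s} (\<lambda>\<tau>. \<i> * complex_of_real \<xi> * propagator (t - \<tau>) \<xi> * H \<tau> \<xi>)"
  unfolding set_integrable_def
proof (rule Bochner_Integration.integrable_bound)
  have [measurable]: "(\<lambda>\<tau>. H \<tau> \<xi>) \<in> borel_measurable borel" by (rule source_bound_measurable[OF H]) auto
  show "integrable lborel (\<lambda>\<tau>. indicator {r..<s} \<tau> * (\<bar>\<xi>\<bar> * Q))"
    by (rule integrable_mult_left[OF integrable_indicator_Ico])
  show "(\<lambda>\<tau>. indicator {r..<s} \<tau> *\<^sub>R (\<i> * complex_of_real \<xi> * propagator (t - \<tau>) \<xi> * H \<tau> \<xi>)) \<in> borel_measurable lborel"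
    by measurable
  show "AE \<tau> in lborel. norm (indicator {r..<s} \<tau> *\<^sub>R (\<i> * complex_of_real \<xi> * propagator (t - \<tau>) \<xi> * H \<tau> \<xi>))
      \<le> norm (indicator {r..<s} \<tau> * (\<bar>\<xi>\<bar> * Q))"
  proof (rule AE_I2)
    fix \<tau>
    have "\<bar>\<xi>\<bar> * exp (- (\<mu> * (t - \<tau>) * \<xi>\<^sup>2)) * norm (H \<tau> \<xi>) \<le> \<bar>\<xi>\<bar> * 1 * Q" if "r \<le> \<tau>" "\<tau> < s"
    proof (intro mult_mono)
      have "Q \<ge> 0" using H by (auto simp: source_bound_def)
      have "norm (H \<tau> \<xi>) \<le> Q / (1 + \<tau>)" using H r that by (auto simp: source_bound_def)
      also have "Q / (1 + \<tau>) \<le> Q / 1" using \<open>Q \<ge> 0\<close> r that by (intro divide_left_mono) auto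
      finally show "norm (H \<tau> \<xi>) \<le> Q" by simp
    qed (use \<mu>_pos r that in auto)
    moreover have "Q \<ge> 0" using H by (auto simp: source_bound_def)
    ultimately show "norm (indicator {r..<s} \<tau> *\<^sub>R (\<i> * complex_of_real \<xi> * propagator (t - \<tau>) \<xi> * H \<tau> \<xi>))
        \<le> norm (indicator {r..<s} \<tau> * (\<bar>\<xi>\<bar> * Q))"
      unfolding norm_scaleR norm_duhamel_integrand by (auto simp: indicator_def)
  qed
qed

lemma duhamel_split:
  assumes H: "source_bound H Q t" and r: "0 \<le> r" "r \<le> s" "s \<le> u" "u \<le> t"
  shows "duhamel H t r u \<xi> = duhamel H t r s \<xi> + duhamel H t s u \<xi>"
proof -
  have "{r..<u} = {r..<s} \<union> {s..<u}" using r by auto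
  then show ?thesis unfolding duhamel_def
    using r by (simp only:) (intro set_integral_Un duhamel_integrable_time[OF H], auto)
qed

lemma norm_duhamel_le:
  assumes H: "source_bound H Q t" and r: "0 \<le> r" "s \<le> t"
    and g: "integrable lborel (\<lambda>\<tau>. indicator {r..<s} \<tau> * g \<tau>)"
    and le: "\<And>\<tau>. r \<le> \<tau> \<Longrightarrow> \<tau> < s \<Longrightarrow> exp (- (\<mu> * (t - \<tau>) * \<xi>\<^sup>2)) * norm (H \<tau> \<xi>) \<le> g \<tau>"
  shows "norm (duhamel H t r s \<xi>) \<le> \<bar>\<xi>\<bar> * (\<integral>\<tau>. indicator {r..<s} \<tau> * g \<tau> \<partial>lborel)"
proof -
  have "norm (duhamel H t r s \<xi>) \<le> (\<integral>\<tau>. norm (indicator {r..<s} \<tau> *\<^sub>R (\<i> * complex_of_real \<xi> * propagator (t - \<tau>) \<xi> * H \<tau> \<xi>)) \<partial>lborel)"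
    unfolding duhamel_def set_lebesgue_integral_def by (rule integral_norm_bound)
  also have "\<dots> \<le> (\<integral>\<tau>. \<bar>\<xi>\<bar> * (indicator {r..<s} \<tau> * g \<tau>) \<partial>lborel)"
  proof (rule integral_mono)
    show "integrable lborel (\<lambda>\<tau>. norm (indicator {r..<s} \<tau> *\<^sub>R (\<i> * complex_of_real \<xi> * propagator (t - \<tau>) \<xi> * H \<tau> \<xi>)))"
      using duhamel_integrable_time[OF H r] unfolding set_integrable_def by (rule integrable_norm)
    show "norm (indicator {r..<s} \<tau> *\<^sub>R (\<i> * complex_of_real \<xi> * propagator (t - \<tau>) \<xi> * H \<tau> \<xi>)) \<le> \<bar>\<xi>\<bar> * (indicator {r..<s} \<tau> * g \<tau>)" for \<tau>
      unfolding norm_scaleR norm_duhamel_integrand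
      using mult_left_mono[OF le[of \<tau>], of "\<bar>\<xi>\<bar>"] by (auto simp: indicator_def mult.assoc)
  qed (intro integrable_mult_right g)
  finally show ?thesis by simp
qed

text \<open>The two norms need different arguments. The L^1 bound uses Fubini, the L^2 rate of the
  source and the singularity (t - \<tau>)^(-3/4). The L^2 bound is pointwise in \<xi>: it uses the
  sup rate of the source and integrates the damping in time first. Joint integrability is part of
  the conclusion because \<open>inv_fourier_duhamel\<close> exchanges the integrals.\<close>

lemma duhamel_tail:
  obtains C where "C > 0"
    "\<And>H Q t r. 0 \<le> r \<Longrightarrow> r < t \<Longrightarrow> source_bound H Q t \<Longrightarrow>
       integrable (lborel \<Otimes>\<^sub>M lborel) (\<lambda>(\<tau>, \<xi>). indicator {r..<t} \<tau> *\<^sub>R (\<i> * complex_of_real \<xi> * propagator (t - \<tau>) \<xi> * H \<tau> \<xi>))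
     \<and> L12 (duhamel H t r t) (C * Q * (1 + r) powr (-5/4) * (t - r) powr (1/4)) (C * Q / (1 + r) * (t - r) powr (1/4))"
proof -
  obtain C0 where C0: "C0 > 0"
    "\<And>s q h. s > 0 \<Longrightarrow> q \<ge> 0 \<Longrightarrow> sq_integrable (h :: real \<Rightarrow> complex) \<Longrightarrow> (\<integral>\<xi>. (norm (h \<xi>))\<^sup>2 \<partial>lborel) \<le> q\<^sup>2 \<Longrightarrow>
       integrable lborel (\<lambda>\<xi>. \<bar>\<xi>\<bar> * exp (- (\<mu> * s * \<xi>\<^sup>2)) * norm (h \<xi>)) \<and>
       (\<integral>\<xi>. \<bar>\<xi>\<bar> * exp (- (\<mu> * s * \<xi>\<^sup>2)) * norm (h \<xi>) \<partial>lborel) \<le> C0 * q * s powr (-3/4)"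
    using kernel_L1_bound by blast
  \<comment> \<open>The two summands bound y K / (t - r) and y^2 in the L^2 part below, where y =
    \<xi>^2 K <= 1/\<mu>.\<close>
  define c where "c = 1 / \<mu> + 1 / \<mu>\<^sup>2"
  have c: "c > 0" unfolding c_def using \<mu>_pos by (intro add_pos_pos) auto
  define C where "C = 4 * C0 + 2 * sqrt c"
  have C: "C > 0" "4 * C0 \<le> C" "2 * sqrt c \<le> C" unfolding C_def using C0 c by (auto intro: add_pos_pos)
  show thesis
  proof (rule that[OF C(1)])
    fix H Q and t r :: real
    assume r: "0 \<le> r" "r < t" and H: "source_bound H Q t"
    have Q: "Q \<ge> 0" using H by (auto simp: source_bound_def)
    define \<phi> where "\<phi> \<tau> \<xi> = indicator {r..<t} \<tau> *\<^sub>R (\<i> * complex_of_real \<xi> * propagator (t - \<tau>) \<xi> * H \<tau> \<xi>)" for \<tau> \<xi>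
    \<comment> \<open>The L^2 rate at the left end r, which dominates on [r, t) because the rate
      decreases in time.\<close>
    define q where "q = Q * (1 + r) powr (-5/4)"
    have q: "q \<ge> 0" unfolding q_def using Q by simp
    have Hb: "sq_integrable (H \<tau>)" "(\<integral>\<xi>. (norm (H \<tau> \<xi>))\<^sup>2 \<partial>lborel) \<le> q\<^sup>2" "norm (H \<tau> \<xi>) \<le> Q / (1 + r)"
      if \<tau>: "r \<le> \<tau>" "\<tau> < t" for \<tau> \<xi>
    proof -
      have *: "sq_integrable (H \<tau>)" "(\<integral>\<xi>. (norm (H \<tau> \<xi>))\<^sup>2 \<partial>lborel) \<le> (Q * (1 + \<tau>) powr (-5/4))\<^sup>2" "norm (H \<tau> \<xi>) \<le> Q / (1 + \<tau>)"
        using H r \<tau> by (auto simp: source_bound_def)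
      show "sq_integrable (H \<tau>)" by fact
      show "norm (H \<tau> \<xi>) \<le> Q / (1 + r)"
        using *(3) by (rule order_trans) (use Q r \<tau> in \<open>auto intro!: divide_left_mono\<close>)
      have "(1 + \<tau>) powr (-5/4) \<le> (1 + r) powr (-5/4)"
        using r \<tau> by (intro powr_mono2') auto
      then have "(Q * (1 + \<tau>) powr (-5/4))\<^sup>2 \<le> q\<^sup>2"
        unfolding q_def using Q by (intro power_mono mult_left_mono) auto
      with *(2) show "(\<integral>\<xi>. (norm (H \<tau> \<xi>))\<^sup>2 \<partial>lborel) \<le> q\<^sup>2" by (rule order_trans)
    qed
    have inner: "integrable lborel (\<phi> \<tau>)" "(\<integral>\<xi>. norm (\<phi> \<tau> \<xi>) \<partial>lborel) \<le> C0 * q * (indicator {r..<t} \<tau> * (t - \<tau>) powr (-3/4))" for \<tau>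
    proof -
      have [measurable]: "H \<tau> \<in> borel_measurable borel"
        by (rule source_bound_measurable[OF H, of "\<lambda>_. \<tau>" borel "\<lambda>x. x"]) auto
      have m: "\<phi> \<tau> \<in> borel_measurable lborel" unfolding \<phi>_def by measurable
      have "integrable lborel (\<lambda>\<xi>. norm (\<phi> \<tau> \<xi>)) \<and> (\<integral>\<xi>. norm (\<phi> \<tau> \<xi>) \<partial>lborel) \<le> C0 * q * (indicator {r..<t} \<tau> * (t - \<tau>) powr (-3/4))"
      proof (cases "\<tau> \<in> {r..<t}")
        case True
        then have "norm (\<phi> \<tau> \<xi>) = \<bar>\<xi>\<bar> * exp (- (\<mu> * (t - \<tau>) * \<xi>\<^sup>2)) * norm (H \<tau> \<xi>)" for \<xi>
          unfolding \<phi>_def norm_scaleR norm_duhamel_integrand by simp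
        with C0(2)[of "t - \<tau>" q "H \<tau>"] Hb[of \<tau>] q True show ?thesis by simp
      qed (simp add: \<phi>_def)
      then show "integrable lborel (\<phi> \<tau>)" "(\<integral>\<xi>. norm (\<phi> \<tau> \<xi>) \<partial>lborel) \<le> C0 * q * (indicator {r..<t} \<tau> * (t - \<tau>) powr (-3/4))"
        using m by (simp_all add: integrable_norm_iff)
    qed
    have [measurable]: "(\<lambda>p. H (fst p) (snd p)) \<in> borel_measurable (lborel \<Otimes>\<^sub>M lborel)"
      by (rule source_bound_measurable[OF H]) auto
    have \<phi>m [measurable]: "(\<lambda>p. \<phi> (fst p) (snd p)) \<in> borel_measurable (lborel \<Otimes>\<^sub>M lborel)" unfolding \<phi>_def by measurable
    note sing = integral_power_singular[OF r(2)]
    note iS = integrable_mult_right[OF sing(1), of "C0 * q"]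
    have in1: "integrable lborel (\<lambda>\<tau>. \<integral>\<xi>. norm (\<phi> \<tau> \<xi>) \<partial>lborel)"
    proof (rule Bochner_Integration.integrable_bound[OF iS])
      have "(\<lambda>\<tau>. \<integral>\<xi>. norm (\<phi> (fst (\<tau>, \<xi>)) (snd (\<tau>, \<xi>))) \<partial>lborel) \<in> borel_measurable lborel"
        by measurable
      then show "(\<lambda>\<tau>. \<integral>\<xi>. norm (\<phi> \<tau> \<xi>) \<partial>lborel) \<in> borel_measurable lborel" by simp
      show "AE \<tau> in lborel. norm (\<integral>\<xi>. norm (\<phi> \<tau> \<xi>) \<partial>lborel) \<le> norm (C0 * q * (indicator {r..<t} \<tau> * (t - \<tau>) powr (-3/4)))"
        by (intro AE_I2 norm_le_normI inner(2)) simp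
    qed
    have pair: "integrable (lborel \<Otimes>\<^sub>M lborel) (case_prod \<phi>)"
      by (rule lborel_pair.Fubini_integrable) (use in1 inner(1) \<phi>m in \<open>auto simp: split_beta'\<close>)
    have Dd: "duhamel H t r t = (\<lambda>\<xi>. \<integral>\<tau>. \<phi> \<tau> \<xi> \<partial>lborel)"
      unfolding duhamel_def[abs_def] set_lebesgue_integral_def \<phi>_def ..
    have iD: "integrable lborel (duhamel H t r t)"
      unfolding Dd by (rule lborel_pair.integrable_snd[OF pair])
    have pairn: "integrable (lborel \<Otimes>\<^sub>M lborel) (case_prod (\<lambda>\<tau> \<xi>. norm (\<phi> \<tau> \<xi>)))"
      using integrable_norm[OF pair] by (simp add: split_beta')
    have "(\<integral>\<xi>. norm (duhamel H t r t \<xi>) \<partial>lborel) \<le> (\<integral>\<xi>. \<integral>\<tau>. norm (\<phi> \<tau> \<xi>) \<partial>lborel \<partial>lborel)"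
      using iD lborel_pair.integrable_snd[OF pairn] by (intro integral_mono) (auto simp: Dd integral_norm_bound)
    also have "\<dots> = (\<integral>\<tau>. \<integral>\<xi>. norm (\<phi> \<tau> \<xi>) \<partial>lborel \<partial>lborel)"
      by (rule lborel_pair.Fubini_integral[OF pairn])
    also have "\<dots> \<le> (\<integral>\<tau>. C0 * q * (indicator {r..<t} \<tau> * (t - \<tau>) powr (-3/4)) \<partial>lborel)"
      by (rule integral_mono[OF in1 iS inner(2)])
    also have "\<dots> = C0 * q * (4 * (t - r) powr (1/4))" by (simp only: integral_mult_right_zero sing(2))
    also have "\<dots> = (4 * C0) * (Q * (1 + r) powr (-5/4) * (t - r) powr (1/4))" by (simp add: q_def)
    also have "\<dots> \<le> C * (Q * (1 + r) powr (-5/4) * (t - r) powr (1/4))"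
      using C Q by (intro mult_right_mono) auto
    finally have L1: "(\<integral>\<xi>. norm (duhamel H t r t \<xi>) \<partial>lborel) \<le> C * Q * (1 + r) powr (-5/4) * (t - r) powr (1/4)"
      by (simp add: mult.assoc)
    define K where "K \<xi> = (\<integral>\<tau>. indicator {r..<t} \<tau> * exp (- (\<mu> * (t - \<tau>) * \<xi>\<^sup>2)) \<partial>lborel)" for \<xi>
    note TK = time_kernel_bound[OF less_imp_le[OF r(2)], folded K_def]
    have K0: "0 \<le> K \<xi>" for \<xi> unfolding K_def by (intro Bochner_Integration.integral_nonneg) auto
    define p where "p = Q / (1 + r)"
    have p: "p \<ge> 0" unfolding p_def using Q r by simp
    have pt: "norm (duhamel H t r t \<xi>) \<le> \<bar>\<xi>\<bar> * (p * K \<xi>)" for \<xi>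
    proof -
      have "norm (duhamel H t r t \<xi>) \<le> \<bar>\<xi>\<bar> * (\<integral>\<tau>. indicator {r..<t} \<tau> * (p * exp (- (\<mu> * (t - \<tau>) * \<xi>\<^sup>2))) \<partial>lborel)"
      proof (rule norm_duhamel_le[OF H r(1) order_refl])
        show "integrable lborel (\<lambda>\<tau>. indicator {r..<t} \<tau> * (p * exp (- (\<mu> * (t - \<tau>) * \<xi>\<^sup>2))))"
          using integrable_mult_right[OF TK(1), of p \<xi>] by (simp add: mult.left_commute)
        show "exp (- (\<mu> * (t - \<tau>) * \<xi>\<^sup>2)) * norm (H \<tau> \<xi>) \<le> p * exp (- (\<mu> * (t - \<tau>) * \<xi>\<^sup>2))"
          if "r \<le> \<tau>" "\<tau> < t" for \<tau>
          using mult_right_mono[OF Hb(3)[OF that, of \<xi>], of "exp (- (\<mu> * (t - \<tau>) * \<xi>\<^sup>2))"] by (simp add: p_def mult.commute)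
      qed
      also have "(\<integral>\<tau>. indicator {r..<t} \<tau> * (p * exp (- (\<mu> * (t - \<tau>) * \<xi>\<^sup>2))) \<partial>lborel) = p * K \<xi>"
        unfolding K_def by (simp only: mult.left_commute[of _ p] integral_mult_right_zero)
      finally show ?thesis .
    qed
    have tr: "t - r > 0" using r by simp
    have sq: "(norm (duhamel H t r t \<xi>))\<^sup>2 \<le> p\<^sup>2 * (t - r) * c * (1 / (1 + (t - r) * \<xi>\<^sup>2))" for \<xi>
    proof -
      \<comment> \<open>Two powers of \<xi> are absorbed by the time integral, so y is bounded; then
        y K and (t - r) y^2 are both O(t - r).\<close>
      define y where "y = \<xi>\<^sup>2 * K \<xi>"
      have y: "0 \<le> y" "y \<le> 1 / \<mu>"
        using TK(3)[of \<xi>] K0[of \<xi>] \<mu>_pos unfolding y_def by (auto simp: field_simps)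
      have den: "0 < 1 + (t - r) * \<xi>\<^sup>2" using tr by (simp add: add_pos_nonneg)
      have "(norm (duhamel H t r t \<xi>))\<^sup>2 \<le> (\<bar>\<xi>\<bar> * (p * K \<xi>))\<^sup>2"
        by (intro power_mono pt) auto
      also have "\<dots> = p\<^sup>2 * (y * K \<xi>)" by (simp add: y_def power_mult_distrib power2_eq_square mult_ac)
      finally have "(norm (duhamel H t r t \<xi>))\<^sup>2 * (1 + (t - r) * \<xi>\<^sup>2) \<le> p\<^sup>2 * (y * K \<xi>) * (1 + (t - r) * \<xi>\<^sup>2)"
        using den by (intro mult_right_mono) auto
      also have "\<dots> = p\<^sup>2 * (y * K \<xi> + (t - r) * (y * y))" by (simp add: y_def algebra_simps)
      also have "\<dots> \<le> p\<^sup>2 * (1 / \<mu> * (t - r) + (t - r) * (1 / \<mu> * (1 / \<mu>)))"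
        using y TK(2)[of \<xi>] K0[of \<xi>] tr \<mu>_pos by (intro mult_left_mono add_mono mult_mono) auto
      also have "\<dots> = p\<^sup>2 * (t - r) * c" by (simp add: c_def power2_eq_square distrib_left mult_ac)
      finally show ?thesis using den by (simp add: field_simps)
    qed
    note I = integral_inverse_1_plus_scaled_square[OF tr]
    note iK = integrable_mult_right[OF I(1), of "p\<^sup>2 * (t - r) * c"]
    have [measurable]: "duhamel H t r t \<in> borel_measurable borel" by (rule measurable_duhamel[OF H])
    have sD: "sq_integrable (duhamel H t r t)"
      unfolding sq_integrable_def
    proof
      show "integrable lborel (\<lambda>x. (norm (duhamel H t r t x))\<^sup>2)"
      proof (rule Bochner_Integration.integrable_bound[OF iK])
        show "AE x in lborel. norm ((norm (duhamel H t r t x))\<^sup>2) \<le> norm (p\<^sup>2 * (t - r) * c * (1 / (1 + (t - r) * x\<^sup>2)))"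
          by (intro AE_I2 norm_le_normI sq) simp
      qed simp
    qed simp
    have "(\<integral>\<xi>. (norm (duhamel H t r t \<xi>))\<^sup>2 \<partial>lborel) \<le> (\<integral>\<xi>. p\<^sup>2 * (t - r) * c * (1 / (1 + (t - r) * \<xi>\<^sup>2)) \<partial>lborel)"
      by (rule integral_mono[OF sq_integrableD[OF sD] iK sq])
    also have "\<dots> = p\<^sup>2 * (t - r) * c * (pi / sqrt (t - r))" by (simp only: integral_mult_right_zero I(2))
    also have "\<dots> \<le> p\<^sup>2 * (t - r) * c * (4 / sqrt (t - r))"
      using tr c pi_less_4 by (intro mult_left_mono divide_right_mono) auto
    also have "\<dots> = (2 * sqrt c * p * (t - r) powr (1/4))\<^sup>2"
    proof -
      have "((t - r) powr (1/4))\<^sup>2 = sqrt (t - r)" using tr by (simp add: powr_power powr_half_sqrt)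
      moreover have "(t - r) / sqrt (t - r) = sqrt (t - r)" using tr by (simp add: real_div_sqrt)
      moreover have "p\<^sup>2 * (t - r) * c * (4 / sqrt (t - r)) = 4 * p\<^sup>2 * c * ((t - r) / sqrt (t - r))"
        by simp
      ultimately show ?thesis using c by (simp add: power_mult_distrib)
    qed
    also have "\<dots> \<le> (C * p * (t - r) powr (1/4))\<^sup>2"
      using C c p by (intro power_mono mult_right_mono) auto
    finally have L2: "(\<integral>\<xi>. (norm (duhamel H t r t \<xi>))\<^sup>2 \<partial>lborel) \<le> (C * Q / (1 + r) * (t - r) powr (1/4))\<^sup>2"
      by (simp add: p_def)
    have "L12 (duhamel H t r t) (C * Q * (1 + r) powr (-5/4) * (t - r) powr (1/4)) (C * Q / (1 + r) * (t - r) powr (1/4))"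
      unfolding L12_def using iD sD L1 L2 C Q r by auto
    with pair show "integrable (lborel \<Otimes>\<^sub>M lborel) (\<lambda>(\<tau>, \<xi>). indicator {r..<t} \<tau> *\<^sub>R (\<i> * complex_of_real \<xi> * propagator (t - \<tau>) \<xi> * H \<tau> \<xi>))
     \<and> L12 (duhamel H t r t) (C * Q * (1 + r) powr (-5/4) * (t - r) powr (1/4)) (C * Q / (1 + r) * (t - r) powr (1/4))"
      unfolding \<phi>_def by simp
  qed
qed

text \<open>Fubini, licensed by the joint integrability in \<open>duhamel_tail\<close> with r = 0.
  The nonlinear term of the mild equation becomes the inverse transform of a single symbol.\<close>

lemma inv_fourier_duhamel:
  assumes H: "source_bound H Q t" and t: "t > 0"
  shows "(LINT \<tau>:{0..<t}|lborel. Re (inv_fourier (\<lambda>\<xi>. \<i> * complex_of_real \<xi> * propagator (t - \<tau>) \<xi> * H \<tau> \<xi>) x))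
    = Re (inv_fourier (duhamel H t 0 t) x)"
proof -
  define \<phi> where "\<phi> \<tau> \<xi> = indicator {0..<t} \<tau> *\<^sub>R (\<i> * complex_of_real \<xi> * propagator (t - \<tau>) \<xi> * H \<tau> \<xi>)" for \<tau> \<xi>
  have pair: "integrable (lborel \<Otimes>\<^sub>M lborel) (case_prod \<phi>)"
  proof (rule duhamel_tail)
    fix C assume "C > 0" and *: "\<And>H Q t r. 0 \<le> r \<Longrightarrow> r < t \<Longrightarrow> source_bound H Q t \<Longrightarrow>
       integrable (lborel \<Otimes>\<^sub>M lborel) (\<lambda>(\<tau>, \<xi>). indicator {r..<t} \<tau> *\<^sub>R (\<i> * complex_of_real \<xi> * propagator (t - \<tau>) \<xi> * H \<tau> \<xi>))
     \<and> L12 (duhamel H t r t) (C * Q * (1 + r) powr (-5/4) * (t - r) powr (1/4)) (C * Q / (1 + r) * (t - r) powr (1/4))"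
    from *[OF order_refl t H] show ?thesis unfolding \<phi>_def by blast
  qed
  define \<psi> where "\<psi> \<tau> \<xi> = exp (\<i> * complex_of_real x * complex_of_real \<xi>) * \<phi> \<tau> \<xi>" for \<tau> \<xi>
  have pm: "case_prod \<phi> \<in> borel_measurable (lborel \<Otimes>\<^sub>M lborel)" using pair by (rule borel_measurable_integrable)
  have pair': "integrable (lborel \<Otimes>\<^sub>M lborel) (case_prod \<psi>)"
  proof (rule Bochner_Integration.integrable_bound[OF pair])
    have [measurable]: "(\<lambda>p. \<phi> (fst p) (snd p)) \<in> borel_measurable (lborel \<Otimes>\<^sub>M lborel)"
      using pm by (simp add: split_beta')
    have "(\<lambda>p. \<psi> (fst p) (snd p)) \<in> borel_measurable (lborel \<Otimes>\<^sub>M lborel)" unfolding \<psi>_def by measurable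
    then show "case_prod \<psi> \<in> borel_measurable (lborel \<Otimes>\<^sub>M lborel)" by (simp add: split_beta')
  qed (auto simp: \<psi>_def norm_mult)
  define c where "c = complex_of_real (1 / sqrt (2 * pi))"
  have a: "indicator {0..<t} \<tau> *\<^sub>R Re (inv_fourier (\<lambda>\<xi>. \<i> * complex_of_real \<xi> * propagator (t - \<tau>) \<xi> * H \<tau> \<xi>) x)
      = Re (c * (\<integral>\<xi>. \<psi> \<tau> \<xi> \<partial>lborel))" for \<tau>
    unfolding inv_fourier_def \<psi>_def \<phi>_def c_def by (cases "\<tau> \<in> {0..<t}") auto
  have "(LINT \<tau>:{0..<t}|lborel. Re (inv_fourier (\<lambda>\<xi>. \<i> * complex_of_real \<xi> * propagator (t - \<tau>) \<xi> * H \<tau> \<xi>) x))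
     = Re (c * (\<integral>\<tau>. \<integral>\<xi>. \<psi> \<tau> \<xi> \<partial>lborel \<partial>lborel))"
    unfolding set_lebesgue_integral_def a
    by (subst integral_Re) (intro integrable_mult_right lborel_pair.integrable_fst[OF pair'], simp only: integral_mult_right_zero)
  also have "(\<integral>\<tau>. \<integral>\<xi>. \<psi> \<tau> \<xi> \<partial>lborel \<partial>lborel) = (\<integral>\<xi>. \<integral>\<tau>. \<psi> \<tau> \<xi> \<partial>lborel \<partial>lborel)"
    by (rule lborel_pair.Fubini_integral[OF pair', symmetric])
  also have "\<dots> = (\<integral>\<xi>. exp (\<i> * complex_of_real x * complex_of_real \<xi>) * duhamel H t 0 t \<xi> \<partial>lborel)"
    unfolding \<psi>_def duhamel_def set_lebesgue_integral_def \<phi>_def by (simp only: integral_mult_right_zero)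
  finally show ?thesis unfolding inv_fourier_def c_def .
qed

end

section \<open>Elementary estimates for powers, logarithms and cubes\<close>

lemma powr_minus_half_le:
  assumes "(t::real) \<ge> 1" shows "t powr (-1/2) \<le> 2 * (1 + t) powr (-1/2)"
proof -
  have "t powr (-1/2) \<le> ((1 + t) / 4) powr (-1/2)"
    using assms by (intro powr_mono2') auto
  also have "\<dots> = 2 * (1 + t) powr (-1/2)"
    using assms by (simp add: powr_divide powr_minus_divide powr_half_sqrt)
  finally show ?thesis .
qed

text \<open>From ln y <= y - 1 with y = t^(1/4). The decay estimate of the first half of the Duhamel
  integral can afford the loss of t^(1/4).\<close>

lemma ln_le_4_root:
  assumes t: "(t::real) \<ge> 2"
  shows "ln (1 + t / 2) \<le> 4 * t powr (1/4)"
proof -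
  have "ln (1 + t / 2) \<le> ln t" using t by (subst ln_le_cancel_iff) auto
  also have "\<dots> = 4 * ln (t powr (1/4))" using t by (simp add: ln_powr)
  also have "\<dots> \<le> 4 * t powr (1/4)" using t ln_le_minus_one[of "t powr (1/4)"] by simp
  finally show ?thesis .
qed

lemma integral_inverse_1_plus:
  assumes "0 \<le> (s::real)"
  shows "integrable lborel (\<lambda>\<tau>. indicator {0..<s} \<tau> * (1 / (1 + \<tau>)))"
    "(\<integral>\<tau>. indicator {0..<s} \<tau> * (1 / (1 + \<tau>)) \<partial>lborel) = ln (1 + s)"
proof -
  have hb: "has_bochner_integral lborel (\<lambda>\<tau>. (1 / (1 + \<tau>)) * indicator {0..s} \<tau>) (ln (1 + s) - ln (1 + 0))"
    using assms by (intro has_bochner_integral_FTC_Icc_real)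
      (auto intro!: derivative_eq_intros continuous_intros)
  have ae: "AE \<tau> in lborel. (1 / (1 + \<tau>)) * indicator {0..s} \<tau> = (indicator {0..<s} \<tau> * (1 / (1 + \<tau>)) :: real)"
    using AE_lborel_singleton[of s] by eventually_elim (auto simp: indicator_def)
  have "has_bochner_integral lborel (\<lambda>\<tau>. indicator {0..<s} \<tau> * (1 / (1 + \<tau>))) (ln (1 + s) - ln (1 + 0))"
    by (rule has_bochner_integral_cong_AE[THEN iffD1, OF _ _ ae hb]) auto
  then show "integrable lborel (\<lambda>\<tau>. indicator {0..<s} \<tau> * (1 / (1 + \<tau>)))"
    "(\<integral>\<tau>. indicator {0..<s} \<tau> * (1 / (1 + \<tau>)) \<partial>lborel) = ln (1 + s)"
    by (simp_all add: has_bochner_integral_iff)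
qed

text \<open>Needed, together with continuity in time, for the joint measurability of the
  source.\<close>

lemma isCont_fourier:
  assumes f: "integrable lborel f"
  shows "isCont (fourier f) \<xi>"
  unfolding continuous_at_sequentially
proof (intro allI impI)
  note [measurable] = borel_measurable_integrable[OF f]
  fix X :: "nat \<Rightarrow> real" assume X: "X \<longlonglongrightarrow> \<xi>"
  have "(\<lambda>n. \<integral>x. exp (- (\<i> * complex_of_real x * complex_of_real (X n))) * f x \<partial>lborel)
     \<longlonglongrightarrow> (\<integral>x. exp (- (\<i> * complex_of_real x * complex_of_real \<xi>)) * f x \<partial>lborel)"
  proof (rule Bochner_Integration.integral_dominated_convergence)
    show "integrable lborel (\<lambda>x. norm (f x))" using f by (rule integrable_norm)
    show "AE x in lborel. (\<lambda>n. exp (- (\<i> * complex_of_real x * complex_of_real (X n))) * f x)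
        \<longlonglongrightarrow> exp (- (\<i> * complex_of_real x * complex_of_real \<xi>)) * f x"
      by (intro AE_I2 tendsto_intros X)
  qed (auto simp: norm_mult)
  then show "(fourier f \<circ> X) \<longlonglongrightarrow> fourier f \<xi>"
    unfolding comp_def fourier_def by (intro tendsto_intros)
qed

text \<open>Pointwise |v^3| <= A v^2 and v^6 <= A^4 v^2. The resulting A D^2 and A^2 D are the
  origin of the two rates in \<open>source_bound\<close>.\<close>

lemma cube_bounds:
  fixes v :: "real \<Rightarrow> real"
  assumes v: "sq_integrable v" and A: "AE x in lborel. \<bar>v x\<bar> \<le> A" "0 \<le> A" and D: "(\<integral>x. (v x)\<^sup>2 \<partial>lborel) \<le> D\<^sup>2" "0 \<le> D"
  shows "integrable lborel (\<lambda>x. v x ^ 3)" "(\<integral>x. \<bar>v x ^ 3\<bar> \<partial>lborel) \<le> A * D\<^sup>2"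
    "sq_integrable (\<lambda>x. v x ^ 3)" "(\<integral>x. (v x ^ 3)\<^sup>2 \<partial>lborel) \<le> (A\<^sup>2 * D)\<^sup>2"
proof -
  note [measurable] = sq_integrable_measurable[OF v]
  have i2: "integrable lborel (\<lambda>x. (v x)\<^sup>2)" using sq_integrableD[OF v] by simp
  have le: "AE x in lborel. \<bar>v x ^ 3\<bar> \<le> A * (v x)\<^sup>2" using A(1)
  proof eventually_elim
    fix x assume "\<bar>v x\<bar> \<le> A"
    from mult_right_mono[OF this, of "(v x)\<^sup>2"] show "\<bar>v x ^ 3\<bar> \<le> A * (v x)\<^sup>2"
      by (simp add: power3_eq_cube power2_eq_square abs_mult mult.assoc)
  qed
  show i: "integrable lborel (\<lambda>x. v x ^ 3)"
    by (rule Bochner_Integration.integrable_bound[OF integrable_mult_right[OF i2, of A]])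
       (use le A in \<open>auto simp: abs_mult\<close>)
  have "(\<integral>x. \<bar>v x ^ 3\<bar> \<partial>lborel) \<le> (\<integral>x. A * (v x)\<^sup>2 \<partial>lborel)"
    using i by (intro integral_mono_AE integrable_mult_right[OF i2] le) auto
  also have "\<dots> \<le> A * D\<^sup>2" using A D by (simp add: mult_left_mono)
  finally show "(\<integral>x. \<bar>v x ^ 3\<bar> \<partial>lborel) \<le> A * D\<^sup>2" .
  have le2: "AE x in lborel. (v x ^ 3)\<^sup>2 \<le> (A\<^sup>2)\<^sup>2 * (v x)\<^sup>2" using A(1)
  proof eventually_elim
    fix x assume "\<bar>v x\<bar> \<le> A"
    then have "(\<bar>v x\<bar> ^ 2)\<^sup>2 \<le> (A\<^sup>2)\<^sup>2" by (intro power_mono) auto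
    from mult_right_mono[OF this, of "(v x)\<^sup>2"] show "(v x ^ 3)\<^sup>2 \<le> (A\<^sup>2)\<^sup>2 * (v x)\<^sup>2"
      by (simp add: power_mult[symmetric] power_add[symmetric])
  qed
  show s: "sq_integrable (\<lambda>x. v x ^ 3)"
    unfolding sq_integrable_def
  proof
    show "integrable lborel (\<lambda>x. (norm (v x ^ 3))\<^sup>2)"
      by (rule Bochner_Integration.integrable_bound[OF integrable_mult_right[OF i2, of "(A\<^sup>2)\<^sup>2"]])
         (use le2 in \<open>auto simp: abs_mult\<close>)
  qed simp
  have "(\<integral>x. (v x ^ 3)\<^sup>2 \<partial>lborel) \<le> (\<integral>x. (A\<^sup>2)\<^sup>2 * (v x)\<^sup>2 \<partial>lborel)"
    using sq_integrableD[OF s] by (intro integral_mono_AE integrable_mult_right[OF i2] le2) auto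
  also have "\<dots> \<le> (A\<^sup>2)\<^sup>2 * D\<^sup>2" using D by (simp add: mult_left_mono)
  finally show "(\<integral>x. (v x ^ 3)\<^sup>2 \<partial>lborel) \<le> (A\<^sup>2 * D)\<^sup>2" by (simp add: power_mult_distrib)
qed

text \<open>Factor a^3 - c^3 and use |a c| <= (a^2 + c^2)/2, whence 3/2. One factor A is pulled out,
  so that two factors remain for Cauchy-Schwarz.\<close>

lemma cube_diff_le:
  fixes a c :: real
  assumes "\<bar>a\<bar> \<le> A" "\<bar>c\<bar> \<le> A"
  shows "\<bar>a ^ 3 - c ^ 3\<bar> \<le> 3/2 * A * (\<bar>a - c\<bar> * (\<bar>a\<bar> + \<bar>c\<bar>))"
proof -
  have "a ^ 3 - c ^ 3 = (a - c) * (a\<^sup>2 + a * c + c\<^sup>2)"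
    by (simp add: power3_eq_cube power2_eq_square algebra_simps)
  then have "\<bar>a ^ 3 - c ^ 3\<bar> = \<bar>a - c\<bar> * \<bar>a\<^sup>2 + a * c + c\<^sup>2\<bar>" by (simp only: abs_mult)
  also have "\<dots> \<le> \<bar>a - c\<bar> * (3/2 * A * (\<bar>a\<bar> + \<bar>c\<bar>))"
  proof (rule mult_left_mono)
    have "2 * (a * c) \<le> a\<^sup>2 + c\<^sup>2" "- (2 * (a * c)) \<le> a\<^sup>2 + c\<^sup>2"
      using sum_squares_bound[of a c] sum_squares_bound[of a "- c"] by simp_all
    then have "a\<^sup>2 + a * c + c\<^sup>2 \<le> 3/2 * (a\<^sup>2 + c\<^sup>2)" "- (a\<^sup>2 + a * c + c\<^sup>2) \<le> 3/2 * (a\<^sup>2 + c\<^sup>2)"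
      using zero_le_power2[of a] zero_le_power2[of c] unfolding distrib_left by linarith+
    then have "\<bar>a\<^sup>2 + a * c + c\<^sup>2\<bar> \<le> 3/2 * (a\<^sup>2 + c\<^sup>2)" by (rule abs_leI)
    also have "a\<^sup>2 + c\<^sup>2 \<le> A * \<bar>a\<bar> + A * \<bar>c\<bar>"
      using mult_right_mono[OF assms(1), of "\<bar>a\<bar>"] mult_right_mono[OF assms(2), of "\<bar>c\<bar>"]
      by (simp add: power2_eq_square)
    finally show "\<bar>a\<^sup>2 + a * c + c\<^sup>2\<bar> \<le> 3/2 * A * (\<bar>a\<bar> + \<bar>c\<bar>)" by (simp add: algebra_simps)
  qed simp
  finally show ?thesis by (simp add: mult_ac)
qed

text \<open>One factor is measured in sup norm and two in L^2. The bound R on v - w is an L^2 bound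
  because L^2 is the norm in which u is known to be close to its Gaussian profile.\<close>

lemma cube_diff_bound:
  fixes v w :: "real \<Rightarrow> real"
  assumes v: "sq_integrable v" "AE x in lborel. \<bar>v x\<bar> \<le> A" "(\<integral>x. (v x)\<^sup>2 \<partial>lborel) \<le> D\<^sup>2"
    and w: "sq_integrable w" "AE x in lborel. \<bar>w x\<bar> \<le> A" "(\<integral>x. (w x)\<^sup>2 \<partial>lborel) \<le> D\<^sup>2"
    and R: "(\<integral>x. (v x - w x)\<^sup>2 \<partial>lborel) \<le> R\<^sup>2" and nn: "0 \<le> A" "0 \<le> D" "0 \<le> R"
  shows "(\<integral>x. \<bar>v x ^ 3 - w x ^ 3\<bar> \<partial>lborel) \<le> 3 * A * D * R"
proof -
  have sd: "sq_integrable (\<lambda>x. v x - w x)" by (intro sq_integrable_diff v w)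
  have sv: "sq_integrable (\<lambda>x. \<bar>v x\<bar>)" and sw: "sq_integrable (\<lambda>x. \<bar>w x\<bar>)" and sad: "sq_integrable (\<lambda>x. \<bar>v x - w x\<bar>)"
    using v w sd by (auto simp: sq_integrable_def)
  have ss: "sq_integrable (\<lambda>x. \<bar>v x\<bar> + \<bar>w x\<bar>)" by (intro sq_integrable_add sv sw)
  have ip: "integrable lborel (\<lambda>x. \<bar>v x - w x\<bar> * (\<bar>v x\<bar> + \<bar>w x\<bar>))" by (rule integrable_mult_sq[OF sad ss])
  have i3: "integrable lborel (\<lambda>x. \<bar>v x ^ 3 - w x ^ 3\<bar>)"
    using cube_bounds(1)[OF v(1,2) nn(1) v(3) nn(2)] cube_bounds(1)[OF w(1,2) nn(1) w(3) nn(2)] by auto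
  have "(\<integral>x. \<bar>v x ^ 3 - w x ^ 3\<bar> \<partial>lborel) \<le> (\<integral>x. 3/2 * A * (\<bar>v x - w x\<bar> * (\<bar>v x\<bar> + \<bar>w x\<bar>)) \<partial>lborel)"
  proof (rule integral_mono_AE[OF i3 integrable_mult_right[OF ip]])
    show "AE x in lborel. \<bar>v x ^ 3 - w x ^ 3\<bar> \<le> 3/2 * A * (\<bar>v x - w x\<bar> * (\<bar>v x\<bar> + \<bar>w x\<bar>))"
      using v(2) w(2) by eventually_elim (rule cube_diff_le)
  qed
  also have "\<dots> = 3/2 * A * (\<integral>x. norm (v x - w x) * norm (\<bar>v x\<bar> + \<bar>w x\<bar>) \<partial>lborel)"
    by (simp add: abs_of_nonneg)
  also have "\<dots> \<le> 3/2 * A * (R * (D + D))"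
  proof (rule mult_left_mono)
    have "(\<integral>x. norm (v x - w x) * norm (\<bar>v x\<bar> + \<bar>w x\<bar>) \<partial>lborel)
        \<le> sqrt (\<integral>x. (v x - w x)\<^sup>2 \<partial>lborel) * sqrt (\<integral>x. (\<bar>v x\<bar> + \<bar>w x\<bar>)\<^sup>2 \<partial>lborel)"
      using Cauchy_Schwarz_integral[OF sd ss] by simp
    also have "\<dots> \<le> R * (D + D)"
    proof (intro mult_mono)
      show "sqrt (\<integral>x. (v x - w x)\<^sup>2 \<partial>lborel) \<le> R" using R nn by (intro real_le_lsqrt) auto
      have "sqrt (\<integral>x. (\<bar>v x\<bar> + \<bar>w x\<bar>)\<^sup>2 \<partial>lborel) \<le> sqrt (\<integral>x. \<bar>v x\<bar>\<^sup>2 \<partial>lborel) + sqrt (\<integral>x. \<bar>w x\<bar>\<^sup>2 \<partial>lborel)"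
        by (rule L2_triangle[OF sv sw])
      also have "\<dots> \<le> D + D" using v(3) w(3) nn by (intro add_mono real_le_lsqrt) auto
      finally show "sqrt (\<integral>x. (\<bar>v x\<bar> + \<bar>w x\<bar>)\<^sup>2 \<partial>lborel) \<le> D + D" .
    qed (use nn in auto)
    finally show "(\<integral>x. norm (v x - w x) * norm (\<bar>v x\<bar> + \<bar>w x\<bar>) \<partial>lborel) \<le> R * (D + D)" .
  qed (use nn in auto)
  finally show ?thesis by (simp add: mult_ac)
qed

section \<open>The Duhamel term on the two halves of the time interval, and the linear flow\<close>

context dispersive begin

text \<open>\<open>duhamel_tail\<close> at r = t/2, where 1 + r and t - r are at least of order t:
  the rates are already those of the remainder, so the second half leaves no trace in the
  profile.\<close>

lemma duhamel_half_tail: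
  obtains C where "C > 0"
    "\<And>H Q t. t > 0 \<Longrightarrow> source_bound H Q t \<Longrightarrow>
      L12 (duhamel H t (t / 2) t) (C * Q * t powr (-1)) (C * Q * t powr (-3/4))"
proof (rule duhamel_tail)
  fix C assume C: "C > 0" and *: "\<And>H Q t r. 0 \<le> r \<Longrightarrow> r < t \<Longrightarrow> source_bound H Q t \<Longrightarrow>
       integrable (lborel \<Otimes>\<^sub>M lborel) (\<lambda>(\<tau>, \<xi>). indicator {r..<t} \<tau> *\<^sub>R (\<i> * complex_of_real \<xi> * propagator (t - \<tau>) \<xi> * H \<tau> \<xi>))
     \<and> L12 (duhamel H t r t) (C * Q * (1 + r) powr (-5/4) * (t - r) powr (1/4)) (C * Q / (1 + r) * (t - r) powr (1/4))"
  show thesis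
  proof (rule that[of "2 * C"])
    show "2 * C > 0" using C by simp
    fix H Q and t :: real assume t: "t > 0" and H: "source_bound H Q t"
    have CQ: "0 \<le> C * Q" using C H by (simp add: source_bound_def)
    have th: "t / 2 < t" "0 \<le> t / 2" "t - t / 2 = t / 2" using t by auto
    show "L12 (duhamel H t (t / 2) t) (2 * C * Q * t powr (-1)) (2 * C * Q * t powr (-3/4))"
    proof (rule L12_mono[OF conjunct2[OF *[OF th(2,1) H]]])
      have a: "(1 + t / 2) powr (-5/4) \<le> (t / 2) powr (-5/4)" using t by (intro powr_mono2') auto
      have "C * Q * (1 + t / 2) powr (-5/4) * (t - t / 2) powr (1/4) = C * Q * ((1 + t / 2) powr (-5/4) * (t / 2) powr (1/4))"
        using th by simp
      also have "\<dots> \<le> C * Q * ((t / 2) powr (-5/4) * (t / 2) powr (1/4))"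
        using CQ by (intro mult_left_mono mult_right_mono a) auto
      also have "\<dots> = C * Q * (t / 2) powr (-1)" using t by (simp flip: powr_add)
      also have "\<dots> = 2 * C * Q * t powr (-1)" using t by (simp add: powr_minus_divide)
      finally show "C * Q * (1 + t / 2) powr (-5/4) * (t - t / 2) powr (1/4) \<le> 2 * C * Q * t powr (-1)" .
      have "1 / (t / 2) * (t / 2) powr (1/4) = (t / 2) powr (-1 + 1/4)"
        unfolding powr_add using t by (simp add: powr_minus_divide)
      also have "\<dots> = t powr (-3/4) * 2 powr (3/4)"
        using t by (simp add: powr_divide powr_minus_divide)
      also have "\<dots> \<le> t powr (-3/4) * 2"
        using powr_mono[of "3/4" 1 "2::real"] by (intro mult_left_mono) auto
      finally have b: "1 / (t / 2) * (t / 2) powr (1/4) \<le> 2 * t powr (-3/4)" by (simp add: mult.commute)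
      have "C * Q / (1 + t / 2) * (t - t / 2) powr (1/4) = C * Q * (1 / (1 + t / 2) * (t / 2) powr (1/4))"
        using th by simp
      also have "\<dots> \<le> C * Q * (1 / (t / 2) * (t / 2) powr (1/4))"
        using CQ t by (intro mult_left_mono mult_right_mono divide_left_mono) auto
      also have "\<dots> \<le> C * Q * (2 * t powr (-3/4))"
        by (rule mult_left_mono[OF b CQ])
      finally show "C * Q / (1 + t / 2) * (t - t / 2) powr (1/4) \<le> 2 * C * Q * t powr (-3/4)"
        by (simp add: mult_ac)
    qed
  qed
qed

lemma exp_half_le:
  assumes "0 \<le> \<tau>" "\<tau> \<le> t / 2"
  shows "exp (- (\<mu> * (t - \<tau>) * \<xi>\<^sup>2)) \<le> exp (- (\<mu> / 2 * t * \<xi>\<^sup>2))"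
proof -
  have "\<mu> * (t / 2) * \<xi>\<^sup>2 \<le> \<mu> * (t - \<tau>) * \<xi>\<^sup>2"
    using assms \<mu>_pos by (intro mult_right_mono mult_left_mono) auto
  then show ?thesis by simp
qed

text \<open>Source times before t/2 leave the propagator at least t/2 to act, so its damping comes
  out of the time integral. The integral of 1/(1+\<tau>) gives a logarithm, absorbed into t^(1/4):
  too crude for the asymptotics, but enough for decay.\<close>

lemma duhamel_half_head:
  obtains C where "C > 0"
    "\<And>H Q t. t \<ge> 2 \<Longrightarrow> source_bound H Q t \<Longrightarrow>
      L12 (duhamel H t 0 (t / 2)) (C * Q * t powr (-1/2)) (C * Q * t powr (-1/2))"
proof -
  obtain C where C: "C > 0" "\<And>t \<xi>. t > 0 \<Longrightarrow> \<bar>\<xi>\<bar> ^ 1 * exp (- (\<mu> / 2 * t * \<xi>\<^sup>2)) \<le> C * (1 / sqrt t) ^ 1 / (1 + t * \<xi>\<^sup>2)"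
    using power_exp_bound[of "\<mu> / 2" 1] \<mu>_pos by auto
  show thesis
  proof (rule that[of "16 * C"])
    show "16 * C > 0" using C by simp
    fix H Q and t :: real assume t: "t \<ge> 2" and H: "source_bound H Q t"
    have Q: "0 \<le> Q" using H by (simp add: source_bound_def)
    define A where "A = 4 * C * Q * t powr (-1/4)"
    have A: "A \<ge> 0" unfolding A_def using C Q by simp
    have den: "0 < 1 + t * \<xi>\<^sup>2" for \<xi> using t by (simp add: add_pos_nonneg)
    have le: "norm (duhamel H t 0 (t / 2) \<xi>) \<le> A / (1 + t * \<xi>\<^sup>2)" for \<xi>
    proof -
      let ?e = "exp (- (\<mu> / 2 * t * \<xi>\<^sup>2))"
      note I = integral_inverse_1_plus[of "t / 2"]
      have "norm (duhamel H t 0 (t / 2) \<xi>) \<le> \<bar>\<xi>\<bar> * (\<integral>\<tau>. indicator {0..<t / 2} \<tau> * (?e * Q * (1 / (1 + \<tau>))) \<partial>lborel)"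
      proof (rule norm_duhamel_le[OF H])
        show "integrable lborel (\<lambda>\<tau>. indicator {0..<t / 2} \<tau> * (?e * Q * (1 / (1 + \<tau>))))"
          using integrable_mult_right[OF I(1), of "?e * Q"] t by (simp add: mult_ac)
        show "exp (- (\<mu> * (t - \<tau>) * \<xi>\<^sup>2)) * norm (H \<tau> \<xi>) \<le> ?e * Q * (1 / (1 + \<tau>))" if "0 \<le> \<tau>" "\<tau> < t / 2" for \<tau>
        proof -
          have "norm (H \<tau> \<xi>) \<le> Q / (1 + \<tau>)" using H that t by (simp add: source_bound_def)
          then have "exp (- (\<mu> * (t - \<tau>) * \<xi>\<^sup>2)) * norm (H \<tau> \<xi>) \<le> ?e * (Q / (1 + \<tau>))"
            using that exp_half_le[of \<tau> t \<xi>] by (intro mult_mono) auto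
          then show ?thesis by simp
        qed
      qed (use t in auto)
      also have "\<dots> = \<bar>\<xi>\<bar> * (?e * Q * ln (1 + t / 2))"
        using I(2) t by (simp only: mult.left_commute[of _ "?e * Q"] integral_mult_right_zero)
      also have "\<dots> = (\<bar>\<xi>\<bar> * ?e) * (Q * ln (1 + t / 2))" by (simp add: mult_ac)
      also have "\<dots> \<le> (C * (1 / sqrt t) / (1 + t * \<xi>\<^sup>2)) * (Q * (4 * t powr (1/4)))"
        using C(2)[of t \<xi>] t Q C(1) den[of \<xi>] by (intro mult_mono mult_left_mono ln_le_4_root) auto
      also have "\<dots> = 4 * C * Q * (t powr (-1/2) * t powr (1/4)) / (1 + t * \<xi>\<^sup>2)"
        using powr_sqrt(1)[of t] t by (simp add: mult_ac)
      also have "t powr (-1/2) * t powr (1/4) = t powr (-1/4)" by (simp flip: powr_add)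
      finally show ?thesis by (simp add: A_def)
    qed
    have "L12 (duhamel H t 0 (t / 2)) (4 * A * t powr (-1/2)) (2 * A * t powr (-1/4))"
      by (rule L12_dominated[OF measurable_duhamel[OF H] _ A le]) (use t in auto)
    then show "L12 (duhamel H t 0 (t / 2)) (16 * C * Q * t powr (-1/2)) (16 * C * Q * t powr (-1/2))"
    proof (rule L12_mono)
      have "t powr (-1/4) \<le> 1" using t powr_mono[of "-1/4" 0 t] by simp
      then have "16 * C * Q * (t powr (-1/2)) * t powr (-1/4) \<le> 16 * C * Q * (t powr (-1/2)) * 1"
        using C Q by (intro mult_left_mono) auto
      then show "4 * A * t powr (-1/2) \<le> 16 * C * Q * t powr (-1/2)" by (simp add: A_def mult_ac)
      have "2 * A * t powr (-1/4) = 8 * C * Q * (t powr (-1/4) * t powr (-1/4))" by (simp add: A_def)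
      also have "\<dots> = 8 * C * Q * t powr (-1/2)" by (simp flip: powr_add)
      also have "\<dots> \<le> 16 * C * Q * t powr (-1/2)" using C Q by (intro mult_right_mono) auto
      finally show "2 * A * t powr (-1/4) \<le> 16 * C * Q * t powr (-1/2)" .
    qed
  qed
qed

lemma duhamel_full:
  obtains C where "C > 0"
    "\<And>H Q t. t > 0 \<Longrightarrow> source_bound H Q t \<Longrightarrow>
      L12 (duhamel H t 0 t) (C * Q * (1 + t) powr (-1/2)) (C * Q * (1 + t) powr (-1/2))"
proof -
  obtain C0 where C0: "C0 > 0" "\<And>H Q t r. 0 \<le> r \<Longrightarrow> r < t \<Longrightarrow> source_bound H Q t \<Longrightarrow>
       integrable (lborel \<Otimes>\<^sub>M lborel) (\<lambda>(\<tau>, \<xi>). indicator {r..<t} \<tau> *\<^sub>R (\<i> * complex_of_real \<xi> * propagator (t - \<tau>) \<xi> * H \<tau> \<xi>))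
     \<and> L12 (duhamel H t r t) (C0 * Q * (1 + r) powr (-5/4) * (t - r) powr (1/4)) (C0 * Q / (1 + r) * (t - r) powr (1/4))"
    using duhamel_tail by blast
  obtain C1 where C1: "C1 > 0" "\<And>H Q t. t > 0 \<Longrightarrow> source_bound H Q t \<Longrightarrow>
      L12 (duhamel H t (t / 2) t) (C1 * Q * t powr (-1)) (C1 * Q * t powr (-3/4))"
    using duhamel_half_tail by blast
  obtain C2 where C2: "C2 > 0" "\<And>H Q t. t \<ge> 2 \<Longrightarrow> source_bound H Q t \<Longrightarrow>
      L12 (duhamel H t 0 (t / 2)) (C2 * Q * t powr (-1/2)) (C2 * Q * t powr (-1/2))"
    using duhamel_half_head by blast
  define C where "C = 4 * C0 + 2 * (C1 + C2)"
  show thesis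
  proof (rule that[of C])
    show "C > 0" unfolding C_def using C0 C1 C2 by simp
    fix H Q and t :: real assume t: "t > 0" and H: "source_bound H Q t"
    have Q: "0 \<le> Q" using H by (simp add: source_bound_def)
    show "L12 (duhamel H t 0 t) (C * Q * (1 + t) powr (-1/2)) (C * Q * (1 + t) powr (-1/2))"
    proof (cases "t \<le> 2")
      case True
      have a: "t powr (1/4) \<le> 2"
      proof -
        have "t powr (1/4) \<le> 2 powr (1/4)" using t True by (intro powr_mono2) auto
        also have "\<dots> \<le> 2 powr 1" by (intro powr_mono) auto
        finally show ?thesis by simp
      qed
      have b: "1/2 \<le> (1 + t) powr (-1/2)"
      proof -
        have "(4::real) powr (-1/2) \<le> (1 + t) powr (-1/2)" using t True by (intro powr_mono2') auto
        then show ?thesis by (simp add: powr_minus_divide powr_half_sqrt)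
      qed
      have "C0 * Q * t powr (1/4) \<le> C0 * Q * 2" using C0 Q by (intro mult_left_mono a) auto
      also have "\<dots> = 4 * C0 * Q * (1/2)" by simp
      also have "\<dots> \<le> C * Q * (1 + t) powr (-1/2)"
        unfolding C_def using C0 C1 C2 Q by (intro mult_mono b mult_right_mono) auto
      finally have c: "C0 * Q * t powr (1/4) \<le> C * Q * (1 + t) powr (-1/2)" .
      show ?thesis
        by (rule L12_mono[OF conjunct2[OF C0(2)[OF order_refl t H]]]) (use c in simp_all)
    next
      case False
      then have t2: "t \<ge> 2" by simp
      have "duhamel H t 0 t = (\<lambda>\<xi>. duhamel H t 0 (t / 2) \<xi> + duhamel H t (t / 2) t \<xi>)"
        using t by (intro ext duhamel_split[OF H]) auto
      moreover have "L12 (\<lambda>\<xi>. duhamel H t 0 (t / 2) \<xi> + duhamel H t (t / 2) t \<xi>)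
         (C2 * Q * t powr (-1/2) + C1 * Q * t powr (-1)) (C2 * Q * t powr (-1/2) + C1 * Q * t powr (-3/4))"
        by (intro L12_add C1 C2 H t t2)
      ultimately have L: "L12 (duhamel H t 0 t)
         (C2 * Q * t powr (-1/2) + C1 * Q * t powr (-1)) (C2 * Q * t powr (-1/2) + C1 * Q * t powr (-3/4))" by simp
      have x: "C2 * Q * t powr (-1/2) + C1 * Q * t powr z \<le> C * Q * (1 + t) powr (-1/2)" if "z \<le> -1/2" for z
      proof -
        have "t powr z \<le> t powr (-1/2)" using t2 that by (intro powr_mono) auto
        then have "C2 * Q * t powr (-1/2) + C1 * Q * t powr z \<le> C2 * Q * t powr (-1/2) + C1 * Q * t powr (-1/2)"
          using C1 Q by (intro add_left_mono mult_left_mono) auto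
        also have "\<dots> = (C1 + C2) * Q * t powr (-1/2)" by (simp add: algebra_simps)
        also have "\<dots> \<le> (C1 + C2) * Q * (2 * (1 + t) powr (-1/2))"
          using C1 C2 Q t2 by (intro mult_left_mono powr_minus_half_le) auto
        also have "\<dots> = (2 * (C1 + C2)) * Q * (1 + t) powr (-1/2)" by simp
        also have "\<dots> \<le> C * Q * (1 + t) powr (-1/2)"
          unfolding C_def using C0 Q by (intro mult_right_mono) auto
        finally show ?thesis .
      qed
      show ?thesis by (rule L12_mono[OF L x x]) auto
    qed
  qed
qed

text \<open>Up to t = 2 the H^1 norm controls the transform of the data in L^1 and L^2; afterwards
  the transform is bounded by the L^1 norm of the data and the damping gives the decay. The bound C
  >= 2 is recorded for time 0, where the embedding constant 2 has to be covered.\<close>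

lemma linear_bound:
  obtains C where "C \<ge> 2"
    "\<And>u\<^sub>0 E t. t \<ge> 0 \<Longrightarrow> u\<^sub>0 \<in> sobolev 1 \<Longrightarrow> integrable lborel u\<^sub>0 \<Longrightarrow>
       sobolev_norm 1 u\<^sub>0 + (\<integral>x. \<bar>u\<^sub>0 x\<bar> \<partial>lborel) \<le> E \<Longrightarrow>
       L12 (\<lambda>\<xi>. propagator t \<xi> * fourier (\<lambda>x. complex_of_real (u\<^sub>0 x)) \<xi>)
         (C * E * (1 + t) powr (-1/2)) (C * E * (1 + t) powr (-1/4))"
proof -
  obtain C where C: "C > 0" "\<And>t \<xi>. t > 0 \<Longrightarrow> \<bar>\<xi>\<bar> ^ 0 * exp (- (\<mu> * t * \<xi>\<^sup>2)) \<le> C * (1 / sqrt t) ^ 0 / (1 + t * \<xi>\<^sup>2)"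
    using power_exp_bound[of "\<mu>" 0] \<mu>_pos by auto
  define C' where "C' = 4 + 8 * C"
  show thesis
  proof (rule that[of C'])
    show "C' \<ge> 2" unfolding C'_def using C by simp
    fix u\<^sub>0 :: "real \<Rightarrow> real" and E t :: real
    assume t: "t \<ge> 0" and u: "u\<^sub>0 \<in> sobolev 1" and i: "integrable lborel u\<^sub>0"
      and E: "sobolev_norm 1 u\<^sub>0 + (\<integral>x. \<bar>u\<^sub>0 x\<bar> \<partial>lborel) \<le> E"
    define g where "g = fourier (\<lambda>x. complex_of_real (u\<^sub>0 x))"
    note D = sobolevD[OF u]
    have ic: "integrable lborel (\<lambda>x. complex_of_real (u\<^sub>0 x))" using i by simp
    have "is_fourier_L2 (\<lambda>x. complex_of_real (u\<^sub>0 x)) g"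
      unfolding g_def using i D(2) by (intro is_fourier_L2_L1 sq_integrable_of_real) auto
    \<comment> \<open>\<open>sobolev_norm\<close> speaks of the chosen L^2 transform,
      \<open>g\<close> is the convergent integral; for integrable data they agree almost
      everywhere.\<close>
    from is_fourier_L2_unique[OF this D(1)]
    have ae: "AE \<xi> in lborel. g \<xi> = fourier_L2 (\<lambda>x. complex_of_real (u\<^sub>0 x)) \<xi>" .
    have [measurable]: "g \<in> borel_measurable borel"
      unfolding g_def using borel_measurable_integrable[OF ic] by measurable
    have n: "0 \<le> (\<integral>x. \<bar>u\<^sub>0 x\<bar> \<partial>lborel)" by simp
    have E0: "E \<ge> 0" "sobolev_norm 1 u\<^sub>0 \<le> E" using E n D(5) by linarith+
    note [measurable] = sq_integrable_measurable[OF D(8)]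
    have gi: "integrable lborel g"
      by (rule integrable_cong_AE_imp[OF D(6)]) (use ae in auto)
    have g1: "(\<integral>\<xi>. norm (g \<xi>) \<partial>lborel) \<le> 2 * E"
    proof -
      have "(\<integral>\<xi>. norm (g \<xi>) \<partial>lborel) = (\<integral>\<xi>. norm (fourier_L2 (\<lambda>x. complex_of_real (u\<^sub>0 x)) \<xi>) \<partial>lborel)"
        by (rule integral_cong_AE) (use ae in auto)
      with D(7) E0 show ?thesis by linarith
    qed
    have "is_fourier_L2 (\<lambda>x. complex_of_real (u\<^sub>0 x)) g" by fact
    then have gs: "sq_integrable g" by (simp add: is_fourier_L2_def)
    have g2: "(\<integral>\<xi>. (norm (g \<xi>))\<^sup>2 \<partial>lborel) \<le> E\<^sup>2"
    proof -
      have "(\<integral>\<xi>. (norm (g \<xi>))\<^sup>2 \<partial>lborel) = (\<integral>\<xi>. (norm (fourier_L2 (\<lambda>x. complex_of_real (u\<^sub>0 x)) \<xi>))\<^sup>2 \<partial>lborel)"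
        by (rule integral_cong_AE) (use ae in auto)
      also note D(9)
      also have "(sobolev_norm 1 u\<^sub>0)\<^sup>2 \<le> E\<^sup>2" using E0 D(5) by (intro power_mono) auto
      finally show ?thesis .
    qed
    have gsup: "norm (g \<xi>) \<le> E" for \<xi>
      using norm_fourier_le[of "\<lambda>x. complex_of_real (u\<^sub>0 x)" \<xi>] E D(5) unfolding g_def by simp
    have m1: "norm (propagator t \<xi> * g \<xi>) \<le> norm (g \<xi>)" for \<xi>
      using \<mu>_pos t by (simp add: norm_mult mult_left_le_one_le)
    show "L12 (\<lambda>\<xi>. propagator t \<xi> * g \<xi>) (C' * E * (1 + t) powr (-1/2)) (C' * E * (1 + t) powr (-1/4))"
    proof (cases "t \<le> 2")
      case True
      have im: "integrable lborel (\<lambda>\<xi>. propagator t \<xi> * g \<xi>)"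
        by (rule Bochner_Integration.integrable_bound[OF gi]) (use m1 in auto)
      have sm: "sq_integrable (\<lambda>\<xi>. propagator t \<xi> * g \<xi>)"
        by (rule sq_integrable_bound[OF gs]) (use m1 in auto)
      have "(\<integral>\<xi>. norm (propagator t \<xi> * g \<xi>) \<partial>lborel) \<le> (\<integral>\<xi>. norm (g \<xi>) \<partial>lborel)"
        using im gi m1 by (intro integral_mono) auto
      moreover have "(\<integral>\<xi>. (norm (propagator t \<xi> * g \<xi>))\<^sup>2 \<partial>lborel) \<le> (\<integral>\<xi>. (norm (g \<xi>))\<^sup>2 \<partial>lborel)"
        by (rule integral_mono[OF sq_integrableD[OF sm] sq_integrableD[OF gs]]) (intro power_mono m1 norm_ge_zero)
      ultimately have L: "L12 (\<lambda>\<xi>. propagator t \<xi> * g \<xi>) (2 * E) E"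
        unfolding L12_def using im sm g1 g2 E0 by auto
      have b: "1/2 \<le> (1 + t) powr z" if "- 1/2 \<le> z" for z
      proof -
        have "(4::real) powr (-1/2) \<le> (1 + t) powr (-1/2)" using t True by (intro powr_mono2') auto
        also have "\<dots> \<le> (1 + t) powr z" using t that by (intro powr_mono) auto
        finally show ?thesis by (simp add: powr_minus_divide powr_half_sqrt)
      qed
      have c: "2 * E \<le> C' * E * (1 + t) powr z" if "- 1/2 \<le> z" for z
      proof -
        have "2 * E = 4 * E * (1/2)" by simp
        also have "\<dots> \<le> C' * E * (1 + t) powr z"
          unfolding C'_def using C E0 that by (intro mult_mono b mult_right_mono) auto
        finally show ?thesis .
      qed
      show ?thesis by (rule L12_mono[OF L c order_trans[OF _ c]]) (use E0 in auto)
    next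
      case False
      then have t1: "t \<ge> 1" "t > 0" by auto
      have "norm (propagator t \<xi> * g \<xi>) \<le> (C * E) / (1 + t * \<xi>\<^sup>2)" for \<xi>
        using mult_mono[OF C(2)[OF t1(2), of \<xi>] gsup[of \<xi>]] C(1) t E0
        by (simp add: norm_mult add_nonneg_nonneg)
      then have L: "L12 (\<lambda>\<xi>. propagator t \<xi> * g \<xi>) (4 * (C * E) * t powr (-1/2)) (2 * (C * E) * t powr (-1/4))"
        using t1 C E0 by (intro L12_dominated) auto
      show ?thesis
      proof (rule L12_mono[OF L])
        have "4 * (C * E) * t powr (-1/2) \<le> 4 * (C * E) * (2 * (1 + t) powr (-1/2))"
          using C E0 t1 by (intro mult_left_mono powr_minus_half_le) auto
        also have "\<dots> = (8 * C) * E * (1 + t) powr (-1/2)" by simp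
        also have "\<dots> \<le> C' * E * (1 + t) powr (-1/2)"
          unfolding C'_def using E0 by (intro mult_right_mono) auto
        finally show "4 * (C * E) * t powr (-1/2) \<le> C' * E * (1 + t) powr (-1/2)" .
        have "t powr (-1/4) \<le> ((1 + t) / 2) powr (-1/4)" using t1 by (intro powr_mono2') auto
        also have "\<dots> = 2 powr (1/4) * (1 + t) powr (-1/4)"
          using t1 by (simp add: powr_divide powr_minus_divide)
        also have "\<dots> \<le> 2 * (1 + t) powr (-1/4)"
          using powr_mono[of "1/4" 1 "2::real"] by (intro mult_right_mono) auto
        finally have "2 * (C * E) * t powr (-1/4) \<le> 2 * (C * E) * (2 * (1 + t) powr (-1/4))"
          using C E0 by (intro mult_left_mono) auto
        also have "\<dots> = (4 * C) * E * (1 + t) powr (-1/4)" by simp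
        also have "\<dots> \<le> C' * E * (1 + t) powr (-1/4)"
          unfolding C'_def using C E0 by (intro mult_right_mono) auto
        finally show "2 * (C * E) * t powr (-1/4) \<le> C' * E * (1 + t) powr (-1/4)" .
      qed
    qed
  qed
qed

end

section \<open>Decay of mild solutions\<close>

text \<open>Not immediate, since \<open>fourier_L2\<close> of 0 is a choice that vanishes only
  almost everywhere. It lets the limit in \<open>continuous_sobolev\<close> include the point
  itself.\<close>

lemma sobolev_norm_zero: "sobolev_norm 1 (\<lambda>x. 0) = 0"
proof -
  have z: "sq_integrable (\<lambda>x::real. 0::complex)" by (simp add: sq_integrable_def)
  define g where "g = fourier_L2 (\<lambda>x. 0)"
  have F: "is_fourier_L2 (\<lambda>x. 0) g" unfolding g_def by (rule is_fourier_L2_fourier_L2[OF z])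
  have "is_fourier_L2 (\<lambda>x. 0) (\<lambda>\<xi>. 0)" using is_fourier_L2_diff[OF F F] by simp
  from is_fourier_L2_unique[OF F this] have ae: "AE \<xi> in lborel. g \<xi> = 0" .
  have [measurable]: "g \<in> borel_measurable borel"
    using F by (auto simp: is_fourier_L2_def sq_integrable_def)
  have "(\<integral>\<xi>. (1 + \<xi>\<^sup>2) powr 1 * (norm (g \<xi>))\<^sup>2 \<partial>lborel) = 0"
    by (rule integral_eq_zero_AE) (use ae in auto)
  then show ?thesis unfolding sobolev_norm_def g_def by simp
qed

lemma sobolev_triangle_bounds:
  assumes f: "f \<in> sobolev 1" and h: "h \<in> sobolev 1"
    and A: "AE x in lborel. \<bar>h x\<bar> \<le> A" and D: "(\<integral>x. (h x)\<^sup>2 \<partial>lborel) \<le> D\<^sup>2" "0 \<le> D"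
  defines "n \<equiv> sobolev_norm 1 (\<lambda>x. f x - h x)"
  shows "AE x in lborel. \<bar>f x\<bar> \<le> A + 2 * n" "(\<integral>x. (f x)\<^sup>2 \<partial>lborel) \<le> (D + n)\<^sup>2" "0 \<le> n"
    "(\<integral>x. (f x - h x)\<^sup>2 \<partial>lborel) \<le> n\<^sup>2"
proof -
  have d: "(\<lambda>x. f x - h x) \<in> sobolev 1" by (rule sobolev_diff[OF f h])
  note d1 = sobolev_embedding[OF d, folded n_def]
  show n0: "0 \<le> n" unfolding n_def by (rule sobolevD(5)[OF d])
  show "AE x in lborel. \<bar>f x\<bar> \<le> A + 2 * n"
    using A d1(1) by eventually_elim linarith
  show d2: "(\<integral>x. (f x - h x)\<^sup>2 \<partial>lborel) \<le> n\<^sup>2" by (rule d1(2))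
  have "sqrt (\<integral>x. (h x + (f x - h x))\<^sup>2 \<partial>lborel) \<le> sqrt (\<integral>x. (h x)\<^sup>2 \<partial>lborel) + sqrt (\<integral>x. (f x - h x)\<^sup>2 \<partial>lborel)"
    by (rule L2_triangle[OF sobolevD(2)[OF h] sobolevD(2)[OF d]])
  also have "\<dots> \<le> D + n" using D d2 n0 by (intro add_mono real_le_lsqrt) auto
  finally have "sqrt (\<integral>x. (f x)\<^sup>2 \<partial>lborel) \<le> D + n" by simp
  then show "(\<integral>x. (f x)\<^sup>2 \<partial>lborel) \<le> (D + n)\<^sup>2" by (rule sqrt_le_D)
qed

text \<open>Freezing u at its initial value for negative times gives continuity on the whole line,
  without one-sided limits.\<close>

lemma continuous_sobolev_max_0:
  assumes u: "continuous_sobolev 1 u"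
  shows "((\<lambda>\<tau>. sobolev_norm 1 (\<lambda>x. u (max 0 \<tau>) x - u (max 0 \<sigma>) x)) \<longlongrightarrow> 0) (nhds \<sigma>)"
proof -
  define t where "t = max 0 \<sigma>"
  define S where "S r = sobolev_norm 1 (\<lambda>x. u r x - u t x)" for r
  have S0: "S t = 0" by (simp add: S_def sobolev_norm_zero)
  have "(S \<longlongrightarrow> 0) (at t within {0..})"
    using u unfolding continuous_sobolev_def S_def t_def by auto
  then have "(S \<longlongrightarrow> S t) (inf (nhds t) (principal {0..}))"
    unfolding S0[symmetric] tendsto_at_within_iff_tendsto_nhds .
  moreover have "filterlim (\<lambda>\<tau>. max 0 \<tau>) (inf (nhds t) (principal {0..})) (nhds \<sigma>)"
    unfolding t_def by (auto simp: filterlim_inf filterlim_principal intro!: tendsto_intros filterlim_ident)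
  ultimately have "((\<lambda>\<tau>. S (max 0 \<tau>)) \<longlongrightarrow> S t) (nhds \<sigma>)" by (rule filterlim_compose)
  then show ?thesis unfolding S0 by (simp add: S_def t_def)
qed

text \<open>Time is clamped at 0 so that the function is continuous, hence Borel, on the whole
  plane.\<close>

definition cube_hat :: "(real \<Rightarrow> real \<Rightarrow> real) \<Rightarrow> real \<Rightarrow> real \<Rightarrow> complex" where
  "cube_hat u \<tau> \<xi> = fourier (\<lambda>x. complex_of_real (u (max 0 \<tau>) x ^ 3)) \<xi>"

lemma sobolev_cube:
  assumes "f \<in> sobolev 1"
  shows "integrable lborel (\<lambda>x. f x ^ 3)" "sq_integrable (\<lambda>x. f x ^ 3)"
  using cube_bounds(1,3)[OF sobolevD(2)[OF assms] sobolev_embedding(1)[OF assms] _ sobolev_embedding(2)[OF assms]]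
    sobolevD(5)[OF assms] by auto

text \<open>Joint continuity: in \<tau> uniformly in \<xi>, because the transforms differ by at most
  the L^1 distance of the cubes, and in \<xi> at fixed \<tau>.\<close>

lemma measurable_cube_hat:
  assumes u: "continuous_sobolev 1 u"
  shows "case_prod (cube_hat u) \<in> borel_measurable (borel \<Otimes>\<^sub>M borel)"
proof -
  have us: "u (max 0 \<tau>) \<in> sobolev 1" for \<tau> using u by (auto simp: continuous_sobolev_def)
  have ci: "integrable lborel (\<lambda>x. complex_of_real (u (max 0 \<tau>) x ^ 3))" for \<tau>
    using sobolev_cube(1)[OF us[of \<tau>]] by (simp del: of_real_power)
  have "isCont (case_prod (cube_hat u)) (\<sigma>, \<zeta>)" for \<sigma> \<zeta>
  proof -
    define N0 where "N0 = sobolev_norm 1 (u (max 0 \<sigma>))"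
    define n where "n \<tau> = sobolev_norm 1 (\<lambda>x. u (max 0 \<tau>) x - u (max 0 \<sigma>) x)" for \<tau>
    define g where "g \<tau> = 3 * (2 * N0 + 2 * n \<tau>) * (N0 + n \<tau>) * n \<tau>" for \<tau>
    have N0: "0 \<le> N0" unfolding N0_def by (rule sobolevD(5)[OF us])
    note emb = sobolev_embedding[OF us[of \<sigma>], folded N0_def]
    have le: "norm (cube_hat u \<tau> \<xi> - cube_hat u \<sigma> \<xi>) \<le> g \<tau>" for \<tau> \<xi>
    proof -
      note tr = sobolev_triangle_bounds[OF us[of \<tau>] us[of \<sigma>] emb N0, folded n_def]
      have "norm (cube_hat u \<tau> \<xi> - cube_hat u \<sigma> \<xi>)
          = norm (fourier (\<lambda>x. complex_of_real (u (max 0 \<tau>) x ^ 3) - complex_of_real (u (max 0 \<sigma>) x ^ 3)) \<xi>)"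
        unfolding cube_hat_def fourier_diff[OF ci ci] ..
      also have "\<dots> \<le> (\<integral>x. norm (complex_of_real (u (max 0 \<tau>) x ^ 3) - complex_of_real (u (max 0 \<sigma>) x ^ 3)) \<partial>lborel)"
        by (rule norm_fourier_le)
      also have "\<dots> = (\<integral>x. \<bar>u (max 0 \<tau>) x ^ 3 - u (max 0 \<sigma>) x ^ 3\<bar> \<partial>lborel)"
        by (simp only: of_real_diff[symmetric] norm_of_real)
      also have "\<dots> \<le> g \<tau>"
        unfolding g_def
      proof (rule cube_diff_bound[OF sobolevD(2)[OF us] tr(1,2) sobolevD(2)[OF us] _ _ tr(4)])
        show "AE x in lborel. \<bar>u (max 0 \<sigma>) x\<bar> \<le> 2 * N0 + 2 * n \<tau>"
          using emb(1) by eventually_elim (use tr(3) in linarith)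
        have "N0\<^sup>2 \<le> (N0 + n \<tau>)\<^sup>2" using tr(3) N0 by (intro power_mono) auto
        with emb(2) show "(\<integral>x. (u (max 0 \<sigma>) x)\<^sup>2 \<partial>lborel) \<le> (N0 + n \<tau>)\<^sup>2" by linarith
      qed (use tr(3) N0 in auto)
      finally show ?thesis .
    qed
    have "(n \<longlongrightarrow> 0) (nhds \<sigma>)" unfolding n_def by (rule continuous_sobolev_max_0[OF u])
    then have "(g \<longlongrightarrow> 3 * (2 * N0 + 2 * 0) * (N0 + 0) * 0) (nhds \<sigma>)"
      unfolding g_def by (intro tendsto_intros)
    then have "(g \<longlongrightarrow> 0) (nhds \<sigma>)" by simp
    then have g: "((\<lambda>p. g (fst p)) \<longlongrightarrow> 0) (at (\<sigma>, \<zeta>))"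
      by (rule filterlim_compose) (use tendsto_fst[OF tendsto_ident_at, of "(\<sigma>, \<zeta>)" UNIV] in simp)
    have "((\<lambda>p. fourier (\<lambda>x. complex_of_real (u (max 0 \<sigma>) x ^ 3)) (snd p)) \<longlongrightarrow> cube_hat u \<sigma> \<zeta>) (at (\<sigma>, \<zeta>))"
      unfolding cube_hat_def
      by (rule isCont_tendsto_compose[OF isCont_fourier[OF ci]]) (use tendsto_snd[OF tendsto_ident_at, of "(\<sigma>, \<zeta>)" UNIV] in simp)
    then have f: "((\<lambda>p. cube_hat u \<sigma> (snd p)) \<longlongrightarrow> cube_hat u \<sigma> \<zeta>) (at (\<sigma>, \<zeta>))"
      by (simp add: cube_hat_def)
    have "((\<lambda>p. cube_hat u (fst p) (snd p) - cube_hat u \<sigma> (snd p)) \<longlongrightarrow> 0) (at (\<sigma>, \<zeta>))"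
      by (rule Lim_null_comparison[OF always_eventually g]) (use le in auto)
    from tendsto_add[OF this f] show ?thesis
      unfolding isCont_def by (simp add: split_beta')
  qed
  then have "continuous_on UNIV (case_prod (cube_hat u))"
    by (intro continuous_at_imp_continuous_on) auto
  then show ?thesis unfolding borel_prod by (rule borel_measurable_continuous_onI)
qed

text \<open>The exponents are those of the heat flow from integrable data, in sup norm and in
  L^2.\<close>

definition decay_bound :: "(real \<Rightarrow> real \<Rightarrow> real) \<Rightarrow> real \<Rightarrow> real \<Rightarrow> bool" where
  "decay_bound u \<kappa> t \<longleftrightarrow> (AE x in lborel. \<bar>u t x\<bar> \<le> \<kappa> * (1 + t) powr (-1/2)) \<and>
     (\<integral>x. (u t x)\<^sup>2 \<partial>lborel) \<le> (\<kappa> * (1 + t) powr (-1/4))\<^sup>2"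

lemma decay_bound_mono:
  assumes "decay_bound u \<kappa> t" "0 \<le> \<kappa>" "\<kappa> \<le> \<kappa>'"
  shows "decay_bound u \<kappa>' t"
proof -
  have a: "\<kappa> * (1 + t) powr (-1/2) \<le> \<kappa>' * (1 + t) powr (-1/2)" using assms by (intro mult_right_mono) auto
  have b: "(\<kappa> * (1 + t) powr (-1/4))\<^sup>2 \<le> (\<kappa>' * (1 + t) powr (-1/4))\<^sup>2" using assms by (intro power_mono mult_right_mono) auto
  have "AE x in lborel. \<bar>u t x\<bar> \<le> \<kappa> * (1 + t) powr (-1/2)" using assms by (simp add: decay_bound_def)
  then have "AE x in lborel. \<bar>u t x\<bar> \<le> \<kappa>' * (1 + t) powr (-1/2)"
    by eventually_elim (use a in linarith)
  with assms b show ?thesis unfolding decay_bound_def by linarith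
qed

text \<open>The gap between \<kappa>' and \<kappa> absorbs the H^1 change of u over a short time,
  since H^1 controls both norms. This is the openness half of the continuity argument.\<close>

lemma decay_bound_right_open:
  assumes u: "continuous_sobolev 1 u" and t: "0 \<le> t" and d: "decay_bound u \<kappa>' t" and \<kappa>: "0 \<le> \<kappa>'" "\<kappa>' < \<kappa>"
  obtains \<eta> where "\<eta> > 0" "\<And>r. t \<le> r \<Longrightarrow> r < t + \<eta> \<Longrightarrow> decay_bound u \<kappa> r"
proof -
  define n where "n r = sobolev_norm 1 (\<lambda>x. u (max 0 r) x - u (max 0 t) x)" for r
  have n: "(n \<longlongrightarrow> 0) (nhds t)" unfolding n_def by (rule continuous_sobolev_max_0[OF u])
  have w: "((\<lambda>r. \<kappa> * (1 + r) powr z - 2 * n r) \<longlongrightarrow> \<kappa> * (1 + t) powr z - 2 * 0) (nhds t)" for z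
    using t by (intro tendsto_intros n filterlim_ident) auto
  have "\<kappa>' * (1 + t) powr z < \<kappa> * (1 + t) powr z - 2 * 0" for z
    using \<kappa> t by simp
  then have ev: "eventually (\<lambda>r. \<kappa>' * (1 + t) powr z < \<kappa> * (1 + r) powr z - 2 * n r) (nhds t)" for z
    using order_tendstoD(1)[OF w] by blast
  from eventually_conj[OF ev[of "-1/2"] ev[of "-1/4"]]
  obtain \<eta> where \<eta>: "\<eta> > 0" "\<And>r. dist r t < \<eta> \<Longrightarrow> \<kappa>' * (1 + t) powr (-1/2) < \<kappa> * (1 + r) powr (-1/2) - 2 * n r \<and>
      \<kappa>' * (1 + t) powr (-1/4) < \<kappa> * (1 + r) powr (-1/4) - 2 * n r"
    unfolding eventually_nhds_metric by blast
  show thesis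
  proof (rule that[OF \<eta>(1)])
    fix r assume r: "t \<le> r" "r < t + \<eta>"
    then have m: "max 0 r = r" "max 0 t = t" using t by auto
    have us: "u r \<in> sobolev 1" "u t \<in> sobolev 1" using u t r by (auto simp: continuous_sobolev_def)
    have dt: "AE x in lborel. \<bar>u t x\<bar> \<le> \<kappa>' * (1 + t) powr (-1/2)"
      "(\<integral>x. (u t x)\<^sup>2 \<partial>lborel) \<le> (\<kappa>' * (1 + t) powr (-1/4))\<^sup>2" using d by (auto simp: decay_bound_def)
    have nr: "n r = sobolev_norm 1 (\<lambda>x. u r x - u t x)" by (simp add: n_def m)
    note tr = sobolev_triangle_bounds[OF us dt, folded nr]
    have pos: "0 \<le> \<kappa>' * (1 + t) powr (-1/4)" using \<kappa> by simp
    have e: "\<kappa>' * (1 + t) powr (-1/2) + 2 * n r \<le> \<kappa> * (1 + r) powr (-1/2)"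
      "\<kappa>' * (1 + t) powr (-1/4) + n r \<le> \<kappa> * (1 + r) powr (-1/4)"
      using \<eta>(2)[of r] r tr(3)[OF pos] by (auto simp: dist_real_def)
    have "AE x in lborel. \<bar>u r x\<bar> \<le> \<kappa> * (1 + r) powr (-1/2)"
      using tr(1)[OF pos] by eventually_elim (use e(1) in linarith)
    moreover have "(\<kappa>' * (1 + t) powr (-1/4) + n r)\<^sup>2 \<le> (\<kappa> * (1 + r) powr (-1/4))\<^sup>2"
      using e(2) pos tr(3)[OF pos] by (intro power_mono) auto
    ultimately show "decay_bound u \<kappa> r"
      using tr(2)[OF pos] unfolding decay_bound_def by linarith
  qed
qed

lemma L12_uminus: "L12 k \<alpha> \<beta> \<Longrightarrow> L12 (\<lambda>\<xi>. - k \<xi>) \<alpha> \<beta>"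
  unfolding L12_def by (auto intro: sq_integrable_minus)

lemma L12_diff: "L12 k \<alpha> \<beta> \<Longrightarrow> L12 k' \<alpha>' \<beta>' \<Longrightarrow> L12 (\<lambda>\<xi>. k \<xi> - k' \<xi>) (\<alpha> + \<alpha>') (\<beta> + \<beta>')"
  using L12_add[OF _ L12_uminus] by fastforce

lemma L12_Re_inv_fourier:
  assumes k: "L12 k \<alpha> \<beta>" and f: "AE x in lborel. f x = Re (inv_fourier k x)" and [measurable]: "f \<in> borel_measurable borel"
  shows "AE x in lborel. \<bar>f x\<bar> \<le> \<alpha>" "sq_integrable f" "(\<integral>x. (f x)\<^sup>2 \<partial>lborel) \<le> \<beta>\<^sup>2"
proof -
  have k': "integrable lborel k" "sq_integrable k" "(\<integral>\<xi>. norm (k \<xi>) \<partial>lborel) \<le> \<alpha>" "(\<integral>\<xi>. (norm (k \<xi>))\<^sup>2 \<partial>lborel) \<le> \<beta>\<^sup>2"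
    using k by (auto simp: L12_def)
  note R = Re_inv_fourier_bounds[OF k'(1,2)]
  note [measurable] = sq_integrable_measurable[OF R(2)]
  show "AE x in lborel. \<bar>f x\<bar> \<le> \<alpha>" using f by eventually_elim (use R(1) k'(3) in \<open>auto intro: order_trans\<close>)
  show "sq_integrable f"
    by (rule sq_integrable_bound[OF R(2)]) (use f in auto)
  have "(\<integral>x. (f x)\<^sup>2 \<partial>lborel) = (\<integral>x. (Re (inv_fourier k x))\<^sup>2 \<partial>lborel)"
    by (rule integral_cong_AE) (use f in auto)
  with R(3) k'(4) show "(\<integral>x. (f x)\<^sup>2 \<partial>lborel) \<le> \<beta>\<^sup>2" by linarith
qed

context dispersive begin

lemma source_bound_cube_hat:
  assumes u: "continuous_sobolev 1 u" and \<kappa>: "0 \<le> \<kappa>" and d: "\<And>\<tau>. 0 \<le> \<tau> \<Longrightarrow> \<tau> < t \<Longrightarrow> decay_bound u \<kappa> \<tau>"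
  shows "source_bound (cube_hat u) (\<kappa> ^ 3) t"
  unfolding source_bound_def
proof (intro conjI ballI allI measurable_cube_hat u)
  show "0 \<le> \<kappa> ^ 3" using \<kappa> by simp
  fix \<tau> assume "\<tau> \<in> {0..<t}"
  then have \<tau>: "0 \<le> \<tau>" "\<tau> < t" by auto
  then have us: "u \<tau> \<in> sobolev 1" using u by (auto simp: continuous_sobolev_def)
  have m: "max 0 \<tau> = \<tau>" using \<tau> by simp
  have dt: "AE x in lborel. \<bar>u \<tau> x\<bar> \<le> \<kappa> * (1 + \<tau>) powr (-1/2)"
      "(\<integral>x. (u \<tau> x)\<^sup>2 \<partial>lborel) \<le> (\<kappa> * (1 + \<tau>) powr (-1/4))\<^sup>2" using d[OF \<tau>] by (auto simp: decay_bound_def)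
  note cb = cube_bounds[OF sobolevD(2)[OF us] dt(1) _ dt(2)]
  have pos: "0 \<le> \<kappa> * (1 + \<tau>) powr (-1/2)" "0 \<le> \<kappa> * (1 + \<tau>) powr (-1/4)" using \<kappa> by auto
  have ci: "integrable lborel (\<lambda>x. complex_of_real (u \<tau> x ^ 3))" "sq_integrable (\<lambda>x. complex_of_real (u \<tau> x ^ 3))"
    using cb(1,3)[OF pos] by (simp_all add: sq_integrable_of_real del: of_real_power)
  note B = Bessel[OF ci]
  have eq: "cube_hat u \<tau> = fourier (\<lambda>x. complex_of_real (u \<tau> x ^ 3))"
    by (simp add: cube_hat_def[abs_def] m)
  show "sq_integrable (cube_hat u \<tau>)" unfolding eq by (rule B(1))
  show "norm (cube_hat u \<tau> \<xi>) \<le> \<kappa> ^ 3 / (1 + \<tau>)" for \<xi>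
  proof -
    have "norm (cube_hat u \<tau> \<xi>) \<le> (\<integral>x. \<bar>u \<tau> x ^ 3\<bar> \<partial>lborel)"
      unfolding eq using norm_fourier_le[of "\<lambda>x. complex_of_real (u \<tau> x ^ 3)" \<xi>] by (simp only: norm_of_real)
    also note cb(2)[OF pos]
    also have "\<kappa> * (1 + \<tau>) powr (-1/2) * (\<kappa> * (1 + \<tau>) powr (-1/4))\<^sup>2 = \<kappa> ^ 3 * ((1 + \<tau>) powr (-1/2) * ((1 + \<tau>) powr (-1/4))\<^sup>2)"
      by (simp add: power_mult_distrib power3_eq_cube power2_eq_square mult_ac)
    also have "(1 + \<tau>) powr (-1/2) * ((1 + \<tau>) powr (-1/4))\<^sup>2 = (1 + \<tau>) powr (-1)"
      using \<tau> by (simp add: powr_power flip: powr_add)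
    finally show ?thesis using \<tau> by (simp add: powr_minus_divide)
  qed
  show "(\<integral>\<xi>. (norm (cube_hat u \<tau> \<xi>))\<^sup>2 \<partial>lborel) \<le> (\<kappa> ^ 3 * (1 + \<tau>) powr (-5/4))\<^sup>2"
  proof -
    have "(\<integral>\<xi>. (norm (cube_hat u \<tau> \<xi>))\<^sup>2 \<partial>lborel) \<le> (\<integral>x. (u \<tau> x ^ 3)\<^sup>2 \<partial>lborel)"
      unfolding eq using B(2) by (simp only: norm_of_real power2_abs)
    also note cb(4)[OF pos]
    also have "(\<kappa> * (1 + \<tau>) powr (-1/2))\<^sup>2 * (\<kappa> * (1 + \<tau>) powr (-1/4)) = \<kappa> ^ 3 * (((1 + \<tau>) powr (-1/2))\<^sup>2 * (1 + \<tau>) powr (-1/4))"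
      by (simp add: power_mult_distrib power3_eq_cube power2_eq_square mult_ac)
    also have "((1 + \<tau>) powr (-1/2))\<^sup>2 * (1 + \<tau>) powr (-1/4) = (1 + \<tau>) powr (-5/4)"
      by (simp only: power2_eq_square powr_add[symmetric]) simp
    finally show ?thesis .
  qed
qed

text \<open>The right side of the mild equation on the Fourier side;
  \<open>mild_solution_fourier\<close> identifies its inverse transform with u at time t.\<close>

definition solution_hat :: "(real \<Rightarrow> real) \<Rightarrow> (real \<Rightarrow> real \<Rightarrow> real) \<Rightarrow> real \<Rightarrow> real \<Rightarrow> complex" where
  "solution_hat u\<^sub>0 u t \<xi> = propagator t \<xi> * fourier (\<lambda>x. complex_of_real (u\<^sub>0 x)) \<xi> - duhamel (cube_hat u) t 0 t \<xi>"

lemma mild_solution_fourier: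
  assumes mild: "mild_solution B b \<mu> u\<^sub>0 u" and u0: "integrable lborel u\<^sub>0"
    and H: "source_bound (cube_hat u) Q t" and t: "t > 0"
  shows "AE x in lborel. u t x = Re (inv_fourier (solution_hat u\<^sub>0 u t) x)"
proof -
  have u: "continuous_sobolev 1 u" using mild by (simp add: mild_solution_def)
  have us: "u \<tau> \<in> sobolev 1" if "0 \<le> \<tau>" for \<tau> using u that by (auto simp: continuous_sobolev_def)
  have nonlin: "(LINT \<tau>:{0..t}|lborel. convol (\<lambda>y. deriv (\<lambda>z. T_kernel B b \<mu> z (t - \<tau>)) y) (\<lambda>y. (u \<tau> y) ^ 3) x)
      = Re (inv_fourier (duhamel (cube_hat u) t 0 t) x)" for x
  proof -
    let ?c = "\<lambda>\<tau>. convol (\<lambda>y. deriv (\<lambda>z. T_kernel B b \<mu> z (t - \<tau>)) y) (\<lambda>y. (u \<tau> y) ^ 3) x"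
    let ?r = "\<lambda>\<tau>. Re (inv_fourier (\<lambda>\<xi>. \<i> * complex_of_real \<xi> * propagator (t - \<tau>) \<xi> * cube_hat u \<tau> \<xi>) x)"
    have eq: "?c \<tau> = ?r \<tau>" if \<tau>: "0 \<le> \<tau>" "\<tau> < t" for \<tau>
    proof -
      have "t - \<tau> > 0" "max 0 \<tau> = \<tau>" using \<tau> by auto
      then show ?thesis
        using convol_T_kernel(2)[OF _ sobolev_cube(1)[OF us[OF \<tau>(1)]], of "t - \<tau>" x]
        by (simp only: cube_hat_def)
    qed
    have [measurable]: "(\<lambda>p. cube_hat u (f p) (g p)) \<in> borel_measurable M"
      if "f \<in> borel_measurable M" "g \<in> borel_measurable M" for f g and M :: "'a measure"
      using source_bound_measurable[OF H that] .
    have [measurable]: "(\<lambda>p. cube_hat u (fst p) (snd p)) \<in> borel_measurable (borel \<Otimes>\<^sub>M lborel)"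
      by (rule source_bound_measurable[OF H]) auto
    have "(\<lambda>\<tau>. inv_fourier (\<lambda>\<xi>. \<i> * complex_of_real \<xi> * propagator (t - \<tau>) \<xi> * cube_hat u \<tau> \<xi>) x) \<in> borel_measurable borel"
      unfolding inv_fourier_def by measurable
    then have rm [measurable]: "?r \<in> borel_measurable borel" by simp
    \<comment> \<open>The mild equation integrates over the closed interval. At \<tau> = t the
      kernel formula has no meaning as a function, but this is a single point, which is also
      isolated to obtain measurability in \<tau>.\<close>
    have ae: "AE \<tau> in lborel. indicator {0..t} \<tau> *\<^sub>R ?c \<tau> = indicator {0..<t} \<tau> *\<^sub>R ?r \<tau>"
      using AE_lborel_singleton[of t] by eventually_elim (auto simp: indicator_def eq)
    have "(\<lambda>\<tau>. indicator {0..t} \<tau> *\<^sub>R ?c \<tau>) = (\<lambda>\<tau>. indicator {0..<t} \<tau> *\<^sub>R ?r \<tau> + indicator {t} \<tau> *\<^sub>R ?c t)"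
      using t by (auto simp: indicator_def eq fun_eq_iff)
    then have cm: "(\<lambda>\<tau>. indicator {0..t} \<tau> *\<^sub>R ?c \<tau>) \<in> borel_measurable lborel" by simp
    have "(LINT \<tau>:{0..t}|lborel. ?c \<tau>) = (LINT \<tau>:{0..<t}|lborel. ?r \<tau>)"
      unfolding set_lebesgue_integral_def by (rule integral_cong_AE[OF cm _ ae]) measurable
    then show ?thesis using inv_fourier_duhamel[OF H t] by simp
  qed
  have i1: "integrable lborel (\<lambda>\<xi>. propagator t \<xi> * fourier (\<lambda>x. complex_of_real (u\<^sub>0 x)) \<xi>)"
  proof (rule Bochner_Integration.integrable_bound[OF integrable_mult_right[OF integrable_propagator(1)[OF t], of "complex_of_real (\<integral>x. norm (complex_of_real (u\<^sub>0 x)) \<partial>lborel)"]])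
    have "(\<lambda>x. complex_of_real (u\<^sub>0 x)) \<in> borel_measurable borel" using u0 by auto
    then show "(\<lambda>\<xi>. propagator t \<xi> * fourier (\<lambda>x. complex_of_real (u\<^sub>0 x)) \<xi>) \<in> borel_measurable lborel" by measurable
    show "AE \<xi> in lborel. norm (propagator t \<xi> * fourier (\<lambda>x. complex_of_real (u\<^sub>0 x)) \<xi>)
       \<le> norm (complex_of_real (\<integral>x. norm (complex_of_real (u\<^sub>0 x)) \<partial>lborel) * propagator t \<xi>)"
      using norm_fourier_le[of "\<lambda>x. complex_of_real (u\<^sub>0 x)"]
      by (intro AE_I2) (simp add: norm_mult mult.commute[of "exp _"] mult_right_mono)
  qed
  have i2: "integrable lborel (duhamel (cube_hat u) t 0 t)"
  proof (rule duhamel_full)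
    fix C assume "C > 0" and *: "\<And>H Q t. t > 0 \<Longrightarrow> source_bound H Q t \<Longrightarrow>
      L12 (duhamel H t 0 t) (C * Q * (1 + t) powr (-1/2)) (C * Q * (1 + t) powr (-1/2))"
    show ?thesis using *[OF t H] by (simp add: L12_def)
  qed
  have "AE x in lborel. u t x = convol (\<lambda>y. T_kernel B b \<mu> y t) u\<^sub>0 x
          - (LINT \<tau>:{0..t}|lborel. convol (\<lambda>y. deriv (\<lambda>z. T_kernel B b \<mu> z (t - \<tau>)) y) (\<lambda>y. (u \<tau> y) ^ 3) x)"
    using mild t by (simp add: mild_solution_def)
  then show ?thesis
  proof eventually_elim
    case (elim x)
    have "solution_hat u\<^sub>0 u t = (\<lambda>\<xi>. propagator t \<xi> * fourier (\<lambda>x. complex_of_real (u\<^sub>0 x)) \<xi> - duhamel (cube_hat u) t 0 t \<xi>)"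
      by (rule ext) (simp add: solution_hat_def)
    then show ?case
      using elim unfolding nonlin convol_T_kernel(1)[OF t u0]
      by (simp only: inv_fourier_diff[OF i1 i2] minus_complex.sel)
  qed
qed

text \<open>The bound at time t uses decay strictly before t only, because the source enters through
  [0, t). The linear part is of size e and the source of size \<kappa>^3, so the bootstrap closes
  for small e.\<close>

lemma decay_step:
  obtains C\<^sub>1 C\<^sub>2 where "C\<^sub>1 \<ge> 2" "C\<^sub>2 > 0"
    "\<And>u\<^sub>0 u e \<kappa> t. mild_solution B b \<mu> u\<^sub>0 u \<Longrightarrow> u\<^sub>0 \<in> sobolev 1 \<Longrightarrow> integrable lborel u\<^sub>0 \<Longrightarrow>
       sobolev_norm 1 u\<^sub>0 + (\<integral>x. \<bar>u\<^sub>0 x\<bar> \<partial>lborel) \<le> e \<Longrightarrow> 0 \<le> \<kappa> \<Longrightarrow> 0 \<le> t \<Longrightarrow>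
       (\<And>\<tau>. 0 \<le> \<tau> \<Longrightarrow> \<tau> < t \<Longrightarrow> decay_bound u \<kappa> \<tau>) \<Longrightarrow> decay_bound u (C\<^sub>1 * e + C\<^sub>2 * \<kappa> ^ 3) t"
proof -
  obtain C1 where C1: "C1 \<ge> 2"
    "\<And>u\<^sub>0 E t. t \<ge> 0 \<Longrightarrow> u\<^sub>0 \<in> sobolev 1 \<Longrightarrow> integrable lborel u\<^sub>0 \<Longrightarrow>
       sobolev_norm 1 u\<^sub>0 + (\<integral>x. \<bar>u\<^sub>0 x\<bar> \<partial>lborel) \<le> E \<Longrightarrow>
       L12 (\<lambda>\<xi>. propagator t \<xi> * fourier (\<lambda>x. complex_of_real (u\<^sub>0 x)) \<xi>)
         (C1 * E * (1 + t) powr (-1/2)) (C1 * E * (1 + t) powr (-1/4))"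
    using linear_bound by blast
  obtain C2 where C2: "C2 > 0"
    "\<And>H Q t. t > 0 \<Longrightarrow> source_bound H Q t \<Longrightarrow>
      L12 (duhamel H t 0 t) (C2 * Q * (1 + t) powr (-1/2)) (C2 * Q * (1 + t) powr (-1/2))"
    using duhamel_full by blast
  show thesis
  proof (rule that[OF C1(1) C2(1)])
    fix u\<^sub>0 u e \<kappa> and t :: real
    assume mild: "mild_solution B b \<mu> u\<^sub>0 u" and u0: "u\<^sub>0 \<in> sobolev 1" "integrable lborel u\<^sub>0"
      and e: "sobolev_norm 1 u\<^sub>0 + (\<integral>x. \<bar>u\<^sub>0 x\<bar> \<partial>lborel) \<le> e" and \<kappa>: "0 \<le> \<kappa>" and t: "0 \<le> t"
      and d: "\<And>\<tau>. 0 \<le> \<tau> \<Longrightarrow> \<tau> < t \<Longrightarrow> decay_bound u \<kappa> \<tau>"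
    have u: "continuous_sobolev 1 u" using mild by (simp add: mild_solution_def)
    have us: "u \<tau> \<in> sobolev 1" if "0 \<le> \<tau>" for \<tau> using u that by (auto simp: continuous_sobolev_def)
    have n0: "0 \<le> sobolev_norm 1 u\<^sub>0" by (rule sobolevD(5)[OF u0(1)])
    have "0 \<le> (\<integral>x. \<bar>u\<^sub>0 x\<bar> \<partial>lborel)" by simp
    with e n0 have e0: "sobolev_norm 1 u\<^sub>0 \<le> e" "0 \<le> e" by linarith+
    have K: "0 \<le> C1 * e" "0 \<le> C2 * \<kappa> ^ 3" using C1 C2 e0 \<kappa> by auto
    show "decay_bound u (C1 * e + C2 * \<kappa> ^ 3) t"
    proof (cases "t = 0")
      case True
      \<comment> \<open>At time 0 only the initial condition is available; the Sobolev embedding,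
        with constant 2 <= \<open>C1\<close>, gives both bounds.\<close>
      note emb = sobolev_embedding[OF u0(1)]
      have ae: "AE x in lborel. u 0 x = u\<^sub>0 x" using mild by (simp add: mild_solution_def)
      have "2 * e \<le> C1 * e" using C1 e0 by (intro mult_right_mono) auto
      then have le: "2 * sobolev_norm 1 u\<^sub>0 \<le> C1 * e + C2 * \<kappa> ^ 3" using e0 K by linarith
      have a: "AE x in lborel. \<bar>u 0 x\<bar> \<le> C1 * e + C2 * \<kappa> ^ 3"
        using ae emb(1) by eventually_elim (use le in linarith)
      have "(\<integral>x. (u 0 x)\<^sup>2 \<partial>lborel) = (\<integral>x. (u\<^sub>0 x)\<^sup>2 \<partial>lborel)"
        by (rule integral_cong_AE)
           (use ae sq_integrable_measurable[OF sobolevD(2)[OF us[of 0]]] sq_integrable_measurable[OF sobolevD(2)[OF u0(1)]] in auto)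
      also note emb(2)
      also have "(sobolev_norm 1 u\<^sub>0)\<^sup>2 \<le> (C1 * e + C2 * \<kappa> ^ 3)\<^sup>2"
        using le n0 by (intro power_mono) auto
      finally show ?thesis using a True by (simp add: decay_bound_def)
    next
      case False
      with t have t0: "t > 0" by simp
      have H: "source_bound (cube_hat u) (\<kappa> ^ 3) t" by (rule source_bound_cube_hat[OF u \<kappa> d])
      have "solution_hat u\<^sub>0 u t = (\<lambda>\<xi>. propagator t \<xi> * fourier (\<lambda>x. complex_of_real (u\<^sub>0 x)) \<xi> - duhamel (cube_hat u) t 0 t \<xi>)"
        by (rule ext) (simp add: solution_hat_def)
      with L12_diff[OF C1(2)[OF t u0 e] C2(2)[OF t0 H]]
      have L: "L12 (solution_hat u\<^sub>0 u t) (C1 * e * (1 + t) powr (-1/2) + C2 * \<kappa> ^ 3 * (1 + t) powr (-1/2))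
         (C1 * e * (1 + t) powr (-1/4) + C2 * \<kappa> ^ 3 * (1 + t) powr (-1/2))" by simp
      have p: "(1 + t) powr (-1/2) \<le> (1 + t) powr (-1/4)" using t by (intro powr_mono) auto
      have "L12 (solution_hat u\<^sub>0 u t) ((C1 * e + C2 * \<kappa> ^ 3) * (1 + t) powr (-1/2)) ((C1 * e + C2 * \<kappa> ^ 3) * (1 + t) powr (-1/4))"
        by (rule L12_mono[OF L]) (use mult_left_mono[OF p K(2)] in \<open>simp_all add: distrib_right\<close>)
      from L12_Re_inv_fourier[OF this mild_solution_fourier[OF mild u0(2) H t0] sq_integrable_measurable[OF sobolevD(2)[OF us[OF t]]]]
      show ?thesis unfolding decay_bound_def by auto
    qed
  qed
qed

text \<open>A continuity argument: at the first time where the decay estimate could fail, the mild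
  equation still gives it with a strictly smaller constant.\<close>

lemma solution_decay:
  obtains C \<delta> where "C > 0" "\<delta> > 0"
    "\<And>u\<^sub>0 u e t. mild_solution B b \<mu> u\<^sub>0 u \<Longrightarrow> u\<^sub>0 \<in> sobolev 1 \<Longrightarrow> integrable lborel u\<^sub>0 \<Longrightarrow>
       sobolev_norm 1 u\<^sub>0 + (\<integral>x. \<bar>u\<^sub>0 x\<bar> \<partial>lborel) \<le> e \<Longrightarrow> 0 < e \<Longrightarrow> e \<le> \<delta> \<Longrightarrow> 0 \<le> t \<Longrightarrow>
       decay_bound u (C * e) t"
proof -
  obtain C1 C2 where C: "C1 \<ge> 2" "C2 > 0"
    "\<And>u\<^sub>0 u e \<kappa> t. mild_solution B b \<mu> u\<^sub>0 u \<Longrightarrow> u\<^sub>0 \<in> sobolev 1 \<Longrightarrow> integrable lborel u\<^sub>0 \<Longrightarrow>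
       sobolev_norm 1 u\<^sub>0 + (\<integral>x. \<bar>u\<^sub>0 x\<bar> \<partial>lborel) \<le> e \<Longrightarrow> 0 \<le> \<kappa> \<Longrightarrow> 0 \<le> t \<Longrightarrow>
       (\<And>\<tau>. 0 \<le> \<tau> \<Longrightarrow> \<tau> < t \<Longrightarrow> decay_bound u \<kappa> \<tau>) \<Longrightarrow> decay_bound u (C1 * e + C2 * \<kappa> ^ 3) t"
    using decay_step by blast
  \<comment> \<open>Chosen so that \<kappa> = 2 C1 e satisfies C2 \<kappa>^2 < 1/2: the linear part
    is half of \<kappa> and the cubic part less than the other half.\<close>
  define \<delta> where "\<delta> = 1 / (4 * C1 * (1 + C2))"
  show thesis
  proof (rule that[of "2 * C1" \<delta>])
    show "2 * C1 > 0" using C by simp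
    show "\<delta> > 0" unfolding \<delta>_def using C by simp
    fix u\<^sub>0 u e and t :: real
    assume mild: "mild_solution B b \<mu> u\<^sub>0 u" and u0: "u\<^sub>0 \<in> sobolev 1" "integrable lborel u\<^sub>0"
      and e: "sobolev_norm 1 u\<^sub>0 + (\<integral>x. \<bar>u\<^sub>0 x\<bar> \<partial>lborel) \<le> e" "0 < e" "e \<le> \<delta>" and t: "0 \<le> t"
    have u: "continuous_sobolev 1 u" using mild by (simp add: mild_solution_def)
    define \<kappa> where "\<kappa> = 2 * C1 * e"
    define \<kappa>' where "\<kappa>' = C1 * e + C2 * \<kappa> ^ 3"
    have \<kappa>0: "0 < \<kappa>" unfolding \<kappa>_def using C e by simp
    have \<kappa>'0: "0 \<le> \<kappa>'" unfolding \<kappa>'_def using C e \<kappa>0 by simp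
    have "\<kappa> * (2 * (1 + C2)) \<le> 1"
    proof -
      have X: "0 < 4 * C1 * (1 + C2)" using C(1,2) by simp
      have "e * (4 * C1 * (1 + C2)) \<le> \<delta> * (4 * C1 * (1 + C2))"
        using e(3) X by (intro mult_right_mono) auto
      also have "\<dots> = 1" using C(1,2) by (simp add: \<delta>_def)
      finally have "e * (4 * C1 * (1 + C2)) \<le> 1" .
      then show ?thesis by (simp add: \<kappa>_def mult_ac)
    qed
    then have "(\<kappa> * (2 * (1 + C2)))\<^sup>2 \<le> 1" using \<kappa>0 C by (simp add: power_le_one)
    moreover have "4 * C2 * \<kappa>\<^sup>2 \<le> (\<kappa> * (2 * (1 + C2)))\<^sup>2"
    proof -
      have "C2 \<le> (1 + C2)\<^sup>2" using C(1,2) by (simp add: power2_eq_square algebra_simps)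
      moreover have "(\<kappa> * (2 * (1 + C2)))\<^sup>2 = 4 * \<kappa>\<^sup>2 * (1 + C2)\<^sup>2"
        by (simp only: power_mult_distrib) simp
      ultimately show ?thesis using mult_left_mono[of C2 "(1 + C2)\<^sup>2" "4 * \<kappa>\<^sup>2"] by (simp add: mult_ac)
    qed
    ultimately have "C2 * \<kappa>\<^sup>2 < 1/2" by linarith
    from mult_strict_right_mono[OF this \<kappa>0]
    have "C2 * \<kappa> ^ 3 < 1/2 * \<kappa>" by (simp add: power3_eq_cube power2_eq_square mult.assoc)
    moreover have "C1 * e = 1/2 * \<kappa>" by (simp add: \<kappa>_def)
    ultimately have \<kappa>': "\<kappa>' < \<kappa>" unfolding \<kappa>'_def by linarith
    note step = C(3)[OF mild u0 e(1) less_imp_le[OF \<kappa>0], folded \<kappa>'_def]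
    show "decay_bound u (2 * C1 * e) t"
    proof (rule ccontr)
      assume "\<not> decay_bound u (2 * C1 * e) t"
      \<comment> \<open>The times of failure. Decay holds before their infimum T, the step improves
        the constant at T, and the improved bound spreads to the right of T, where it meets an
        element of S.\<close>
      define S where "S = {s. 0 \<le> s \<and> \<not> decay_bound u \<kappa> s}"
      have tS: "t \<in> S" using t \<open>\<not> _\<close> unfolding S_def \<kappa>_def by simp
      have bdd: "bdd_below S" unfolding S_def by (auto intro: bdd_belowI[of _ 0])
      define T where "T = Inf S"
      have T0: "0 \<le> T" unfolding T_def using tS by (intro cInf_greatest) (auto simp: S_def)
      have "decay_bound u \<kappa> \<tau>" if "0 \<le> \<tau>" "\<tau> < T" for \<tau>
      proof (rule ccontr)
        assume "\<not> decay_bound u \<kappa> \<tau>"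
        then have "\<tau> \<in> S" using that by (simp add: S_def)
        then have "T \<le> \<tau>" unfolding T_def using bdd by (rule cInf_lower)
        with that show False by simp
      qed
      then have "decay_bound u \<kappa>' T" by (rule step[OF T0])
      then obtain \<eta> where \<eta>: "\<eta> > 0" "\<And>r. T \<le> r \<Longrightarrow> r < T + \<eta> \<Longrightarrow> decay_bound u \<kappa> r"
        using decay_bound_right_open[OF u T0 _ \<kappa>'0 \<kappa>'] by blast
      have "\<exists>s\<in>S. s < T + \<eta>"
        using cInf_lessD[of S "T + \<eta>"] tS \<eta>(1) unfolding T_def by auto
      then obtain s where s: "s \<in> S" "s < T + \<eta>" by blast
      have "T \<le> s" unfolding T_def using s(1) bdd by (rule cInf_lower)
      with \<eta>(2)[OF this s(2)] s(1) show False by (simp add: S_def)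
    qed
  qed
qed

end

section \<open>Asymptotic profile\<close>

text \<open>From |exp(-i x \<xi>) - 1| <= |x \<xi>|: the first moment buys one power of |\<xi>|,
  that is, a factor t^(-1/2). This is how the weight x enters the remainder.\<close>

lemma fourier_0_diff:
  fixes f :: "real \<Rightarrow> real"
  assumes f: "integrable lborel f" and xf: "integrable lborel (\<lambda>x. x * f x)"
  shows "norm (fourier (\<lambda>x. complex_of_real (f x)) \<xi> - complex_of_real ((\<integral>x. f x \<partial>lborel) / sqrt (2 * pi)))
    \<le> \<bar>\<xi>\<bar> * (\<integral>x. \<bar>x * f x\<bar> \<partial>lborel)"
proof -
  let ?f = "\<lambda>x. complex_of_real (f x)"
  have fc: "integrable lborel ?f" using f by simp
  define I where "I = (\<integral>x. (exp (- (\<i> * complex_of_real x * complex_of_real \<xi>)) - 1) * ?f x \<partial>lborel)"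
  have "I = (\<integral>x. exp (- (\<i> * complex_of_real x * complex_of_real \<xi>)) * ?f x \<partial>lborel) - complex_of_real (\<integral>x. f x \<partial>lborel)"
    unfolding I_def left_diff_distrib mult_1_left
    by (subst Bochner_Integration.integral_diff[OF integrable_fourier[OF fc] fc]) simp
  then have "fourier ?f \<xi> - complex_of_real ((\<integral>x. f x \<partial>lborel) / sqrt (2 * pi)) = complex_of_real (1 / sqrt (2 * pi)) * I"
    unfolding fourier_def by (simp add: right_diff_distrib)
  then have "norm (fourier ?f \<xi> - complex_of_real ((\<integral>x. f x \<partial>lborel) / sqrt (2 * pi))) = 1 / sqrt (2 * pi) * norm I"
    by (simp only: norm_mult norm_of_real) simp
  also have "\<dots> \<le> 1 * norm I"
    using sqrt_2pi_ge_1 by (intro mult_right_mono) (auto simp: divide_le_eq_1)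
  also have "1 * norm I \<le> (\<integral>x. norm ((exp (- (\<i> * complex_of_real x * complex_of_real \<xi>)) - 1) * ?f x) \<partial>lborel)"
    unfolding I_def mult_1_left by (rule integral_norm_bound)
  also have "\<dots> \<le> (\<integral>x. \<bar>\<xi>\<bar> * \<bar>x * f x\<bar> \<partial>lborel)"
  proof (rule integral_mono_AE')
    show "integrable lborel (\<lambda>x. \<bar>\<xi>\<bar> * \<bar>x * f x\<bar>)" using xf by (intro integrable_mult_right) auto
    have "norm ((exp (- (\<i> * complex_of_real x * complex_of_real \<xi>)) - 1) * ?f x) \<le> \<bar>\<xi>\<bar> * \<bar>x * f x\<bar>" for x
    proof -
      have "norm (exp (\<i> * complex_of_real (- (x * \<xi>))) - 1) \<le> \<bar>- (x * \<xi>)\<bar>"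
        using iexp_approx1[of "- (x * \<xi>)" 0] by simp
      then have "norm (exp (- (\<i> * complex_of_real x * complex_of_real \<xi>)) - 1) \<le> \<bar>x\<bar> * \<bar>\<xi>\<bar>"
        by (simp add: abs_mult mult.assoc)
      from mult_right_mono[OF this, of "\<bar>f x\<bar>"] show ?thesis by (simp add: norm_mult abs_mult mult_ac)
    qed
    then show "AE x in lborel. norm ((exp (- (\<i> * complex_of_real x * complex_of_real \<xi>)) - 1) * ?f x) \<le> \<bar>\<xi>\<bar> * \<bar>x * f x\<bar>"
      by (rule AE_I2)
  qed auto
  also have "\<dots> = \<bar>\<xi>\<bar> * (\<integral>x. \<bar>x * f x\<bar> \<partial>lborel)" by (rule integral_mult_right_zero)
  finally show ?thesis .
qed

context dispersive begin

text \<open>Two replacements: the transform of the data by its value at 0, at the cost of |\<xi>|,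
  and the phase by its tangent, at the cost of t |\<xi>|^3. After damping both are O(t^(-1/2)) times
  1/(1 + t \<xi>^2).\<close>

lemma linear_asymptotics:
  obtains C where "C > 0"
    "\<And>u\<^sub>0 K t. t > 0 \<Longrightarrow> integrable lborel u\<^sub>0 \<Longrightarrow> integrable lborel (\<lambda>x. x * u\<^sub>0 x) \<Longrightarrow>
       (\<integral>x. \<bar>u\<^sub>0 x\<bar> \<partial>lborel) + (\<integral>x. \<bar>x * u\<^sub>0 x\<bar> \<partial>lborel) \<le> K \<Longrightarrow>
       L12 (\<lambda>\<xi>. propagator t \<xi> * fourier (\<lambda>x. complex_of_real (u\<^sub>0 x)) \<xi> - complex_of_real ((\<integral>x. u\<^sub>0 x \<partial>lborel) / sqrt (2 * pi)) * propagator\<^sub>0 t \<xi>)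
         (C * K * t powr (-1)) (C * K * t powr (-3/4))"
proof -
  obtain C1 where C1: "C1 > 0" "\<And>t \<xi>. t > 0 \<Longrightarrow> \<bar>\<xi>\<bar> ^ 1 * exp (- (\<mu> * t * \<xi>\<^sup>2)) \<le> C1 * (1 / sqrt t) ^ 1 / (1 + t * \<xi>\<^sup>2)"
    using power_exp_bound[of "\<mu>" 1] \<mu>_pos by auto
  obtain C3 where C3: "C3 > 0" "\<And>t \<xi>. t > 0 \<Longrightarrow> \<bar>\<xi>\<bar> ^ 3 * exp (- (\<mu> * t * \<xi>\<^sup>2)) \<le> C3 * (1 / sqrt t) ^ 3 / (1 + t * \<xi>\<^sup>2)"
    using power_exp_bound[of "\<mu>" 3] \<mu>_pos by auto
  define C where "C = C1 + 2 * B / b ^ 3 * C3"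
  have Bb: "2 * B / b ^ 3 * C3 > 0" using B_pos b_pos C3 by simp
  have C: "C > 0" unfolding C_def using C1 Bb by simp
  show thesis
  proof (rule that[of "4 * C"])
    show "4 * C > 0" using C by simp
    fix u\<^sub>0 :: "real \<Rightarrow> real" and K t :: real
    assume t: "t > 0" and u0: "integrable lborel u\<^sub>0" and xu0: "integrable lborel (\<lambda>x. x * u\<^sub>0 x)"
      and K: "(\<integral>x. \<bar>u\<^sub>0 x\<bar> \<partial>lborel) + (\<integral>x. \<bar>x * u\<^sub>0 x\<bar> \<partial>lborel) \<le> K"
    define g where "g = fourier (\<lambda>x. complex_of_real (u\<^sub>0 x))"
    define m where "m = complex_of_real ((\<integral>x. u\<^sub>0 x \<partial>lborel) / sqrt (2 * pi))"
    have "0 \<le> (\<integral>x. \<bar>u\<^sub>0 x\<bar> \<partial>lborel)" "0 \<le> (\<integral>x. \<bar>x * u\<^sub>0 x\<bar> \<partial>lborel)" by simp_all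
    with K have K': "(\<integral>x. \<bar>u\<^sub>0 x\<bar> \<partial>lborel) \<le> K" "(\<integral>x. \<bar>x * u\<^sub>0 x\<bar> \<partial>lborel) \<le> K" "0 \<le> K" by linarith+
    have "norm m \<le> \<bar>\<integral>x. u\<^sub>0 x \<partial>lborel\<bar>"
      using sqrt_2pi_ge_1 unfolding m_def norm_of_real by (simp add: divide_le_eq mult_le_cancel_left1)
    also have "\<dots> \<le> (\<integral>x. \<bar>u\<^sub>0 x\<bar> \<partial>lborel)" by (rule integral_abs_bound)
    finally have m: "norm m \<le> K" using K' by linarith
    have gm: "norm (g \<xi> - m) \<le> \<bar>\<xi>\<bar> * K" for \<xi>
      using fourier_0_diff[OF u0 xu0, of \<xi>] mult_left_mono[OF K'(2), of "\<bar>\<xi>\<bar>"] unfolding g_def m_def by linarith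
    have [measurable]: "g \<in> borel_measurable borel"
    proof -
      have "(\<lambda>x. complex_of_real (u\<^sub>0 x)) \<in> borel_measurable borel" using u0 by auto
      then show ?thesis unfolding g_def by measurable
    qed
    define A where "A = C * K * (1 / sqrt t)"
    have A: "A \<ge> 0" unfolding A_def using C K' t by simp
    have le: "norm (propagator t \<xi> * g \<xi> - m * propagator\<^sub>0 t \<xi>) \<le> A / (1 + t * \<xi>\<^sup>2)" for \<xi>
    proof -
      have den: "0 < 1 + t * \<xi>\<^sup>2" using t by (simp add: add_pos_nonneg)
      have "propagator t \<xi> * g \<xi> - m * propagator\<^sub>0 t \<xi> = propagator t \<xi> * (g \<xi> - m) + m * (propagator t \<xi> - propagator\<^sub>0 t \<xi>)"
        by (simp add: algebra_simps)
      then have "norm (propagator t \<xi> * g \<xi> - m * propagator\<^sub>0 t \<xi>) \<le> norm (propagator t \<xi>) * norm (g \<xi> - m) + norm m * norm (propagator t \<xi> - propagator\<^sub>0 t \<xi>)"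
        by (metis norm_mult norm_triangle_ineq)
      also have "\<dots> \<le> exp (- (\<mu> * t * \<xi>\<^sup>2)) * (\<bar>\<xi>\<bar> * K) + K * (2 * B / b ^ 3 * t * (\<bar>\<xi>\<bar> ^ 3 * exp (- (\<mu> * t * \<xi>\<^sup>2))))"
        using gm m propagator_diff[of t \<xi>] t K' by (intro add_mono mult_mono) auto
      also have "\<dots> = K * (\<bar>\<xi>\<bar> ^ 1 * exp (- (\<mu> * t * \<xi>\<^sup>2))) + K * (2 * B / b ^ 3) * t * (\<bar>\<xi>\<bar> ^ 3 * exp (- (\<mu> * t * \<xi>\<^sup>2)))"
        by (simp add: mult_ac)
      also have "\<dots> \<le> K * (C1 * (1 / sqrt t) ^ 1 / (1 + t * \<xi>\<^sup>2)) + K * (2 * B / b ^ 3) * t * (C3 * (1 / sqrt t) ^ 3 / (1 + t * \<xi>\<^sup>2))"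
        using K' B_pos b_pos t by (intro add_mono mult_left_mono C1 C3) auto
      also have "\<dots> = A / (1 + t * \<xi>\<^sup>2)"
      proof -
        define p where "p = 1 / sqrt t"
        define q where "q = 2 * B / b ^ 3"
        define D where "D = 1 + t * \<xi>\<^sup>2"
        have tp: "t * p ^ 3 = p" using t by (simp add: p_def power3_eq_cube power_divide)
        have "K * (C1 * p ^ 1 / D) + K * q * t * (C3 * p ^ 3 / D) = (K * C1 * p + K * q * C3 * (t * p ^ 3)) / D"
          by (simp add: add_divide_distrib mult_ac)
        also have "\<dots> = (C1 + q * C3) * K * p / D" unfolding tp by (simp add: algebra_simps)
        finally show ?thesis unfolding A_def C_def p_def q_def D_def .
      qed
      finally show ?thesis .
    qed
    have L: "L12 (\<lambda>\<xi>. propagator t \<xi> * g \<xi> - m * propagator\<^sub>0 t \<xi>) (4 * A * t powr (-1/2)) (2 * A * t powr (-1/4))"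
      by (rule L12_dominated[OF _ t A le]) measurable
    have A': "A = C * K * t powr (-1/2)" unfolding A_def powr_sqrt(1)[OF t] ..
    show "L12 (\<lambda>\<xi>. propagator t \<xi> * g \<xi> - m * propagator\<^sub>0 t \<xi>) (4 * C * K * t powr (-1)) (4 * C * K * t powr (-3/4))"
    proof (rule L12_mono[OF L])
      have "4 * A * t powr (-1/2) = 4 * C * K * (t powr (-1/2) * t powr (-1/2))" unfolding A' by simp
      also have "t powr (-1/2) * t powr (-1/2) = t powr (-1)" by (simp flip: powr_add)
      finally show "4 * A * t powr (-1/2) \<le> 4 * C * K * t powr (-1)" by simp
      have "2 * A * t powr (-1/4) = 2 * C * K * (t powr (-1/2) * t powr (-1/4))" unfolding A' by simp
      also have "t powr (-1/2) * t powr (-1/4) = t powr (-3/4)" by (simp flip: powr_add)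
      also have "2 * C * K * t powr (-3/4) \<le> 4 * C * K * t powr (-3/4)" using C K' by (intro mult_right_mono) auto
      finally show "2 * A * t powr (-1/4) \<le> 4 * C * K * t powr (-3/4)" .
    qed
  qed
qed

lemma propagator\<^sub>0_add: "propagator\<^sub>0 s \<xi> * propagator\<^sub>0 t \<xi> = propagator\<^sub>0 (s + t) \<xi>"
  unfolding propagator\<^sub>0_def exp_add[symmetric] by (simp add: algebra_simps add_divide_distrib)

lemma G\<^sub>0_fourier:
  assumes t: "t > 0"
  shows "G\<^sub>0 B b \<mu> x t = Re (inv_fourier (\<lambda>\<xi>. complex_of_real (1 / sqrt (2 * pi)) * propagator\<^sub>0 t \<xi>) x)"
proof -
  define a where "a = 2 * B / b"
  have mt: "\<mu> * t > 0" using \<mu>_pos t by simp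
  have "exp (\<i> * complex_of_real x * complex_of_real \<xi>) * (complex_of_real (1 / sqrt (2 * pi)) * propagator\<^sub>0 t \<xi>)
     = complex_of_real (1 / sqrt (2 * pi)) * (exp (\<i> * complex_of_real \<xi> * complex_of_real (x - a * t)) * complex_of_real (exp (- (\<mu> * t * \<xi>\<^sup>2))))" for \<xi>
    unfolding propagator_polar exp_of_real[symmetric] a_def
    by (simp add: mult.left_commute[of "exp _"] exp_add[symmetric] algebra_simps)
  then have "inv_fourier (\<lambda>\<xi>. complex_of_real (1 / sqrt (2 * pi)) * propagator\<^sub>0 t \<xi>) x
    = complex_of_real (1 / sqrt (2 * pi)) * (complex_of_real (1 / sqrt (2 * pi)) *
        complex_of_real (sqrt (pi / (\<mu> * t)) * exp (- ((x - a * t)\<^sup>2 / (4 * (\<mu> * t))))))"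
    unfolding inv_fourier_def by (simp only: integral_mult_right_zero gaussian_fourier_integral(2)[OF mt])
  also have "\<dots> = complex_of_real (1 / sqrt (2 * pi) * (1 / sqrt (2 * pi)) * sqrt (pi / (\<mu> * t)) * exp (- ((x - a * t)\<^sup>2 / (4 * (\<mu> * t)))))"
    by (simp only: of_real_mult mult.assoc)
  also have "1 / sqrt (2 * pi) * (1 / sqrt (2 * pi)) * sqrt (pi / (\<mu> * t)) = 1 / sqrt (4 * pi * \<mu> * t)"
  proof -
    have "1 / sqrt (2 * pi) * (1 / sqrt (2 * pi)) * sqrt (pi / (\<mu> * t)) = sqrt ((1 / (2 * pi)) * (1 / (2 * pi)) * (pi / (\<mu> * t)))"
      by (simp add: real_sqrt_mult real_sqrt_divide)
    also have "(1 / (2 * pi)) * (1 / (2 * pi)) * (pi / (\<mu> * t)) = 1 / (4 * pi * \<mu> * t)" by (simp add: field_simps)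
    finally show ?thesis by (simp add: real_sqrt_divide)
  qed
  finally show ?thesis
    unfolding G\<^sub>0_def G_def a_def by (simp only: Re_complex_of_real mult.assoc)
qed

lemma deriv_G\<^sub>0_fourier:
  assumes t: "t > 0"
  shows "deriv (\<lambda>y. G\<^sub>0 B b \<mu> y t) x
    = Re (inv_fourier (\<lambda>\<xi>. \<i> * complex_of_real \<xi> * (complex_of_real (1 / sqrt (2 * pi)) * propagator\<^sub>0 t \<xi>)) x)"
proof -
  have eq: "(\<lambda>y. G\<^sub>0 B b \<mu> y t) = (\<lambda>y. Re (inv_fourier (\<lambda>\<xi>. complex_of_real (1 / sqrt (2 * pi)) * propagator\<^sub>0 t \<xi>) y))"
    by (rule ext) (rule G\<^sub>0_fourier[OF t])
  have "integrable lborel (\<lambda>\<xi>. complex_of_real (1 / sqrt (2 * pi)) * propagator\<^sub>0 t \<xi>)"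
    by (intro integrable_mult_right integrable_propagator t)
  moreover have "integrable lborel (\<lambda>\<xi>. complex_of_real \<xi> * (complex_of_real (1 / sqrt (2 * pi)) * propagator\<^sub>0 t \<xi>))"
    using integrable_mult_right[OF integrable_propagator(4)[OF t], of "complex_of_real (1 / sqrt (2 * pi))"]
    by (simp only: mult.left_commute)
  ultimately show ?thesis
    unfolding eq by (intro DERIV_imp_deriv DERIV_inv_fourier)
qed

text \<open>The first factor is \<tau> times the integral of the cubed profile at time \<tau>, the
  second the constant of the Fourier transform. So \<open>cube_coeff M / \<tau>\<close> is the
  transform of the cubed profile at frequency 0.\<close>

definition cube_coeff :: "real \<Rightarrow> real" where
  "cube_coeff M = M ^ 3 / (4 * sqrt 3 * pi * \<mu>) * (1 / sqrt (2 * pi))"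

text \<open>Cubing a Gaussian divides its variance by 3, so the damping exponent acquires 1/3, while
  the translation phase is that of \<open>propagator\<^sub>0\<close>.\<close>

lemma fourier_G\<^sub>0_cube:
  assumes t: "t > 0"
  shows "fourier (\<lambda>x. complex_of_real ((M * G\<^sub>0 B b \<mu> x t) ^ 3)) \<xi>
    = complex_of_real (cube_coeff M / t * exp (- (\<mu> * t * \<xi>\<^sup>2 / 3))) * exp (\<i> * complex_of_real (- (2 * B / b * t * \<xi>)))"
proof -
  define a where "a = 2 * B / b * t"
  define s where "s = 3 / (4 * \<mu> * t)"
  define d where "d = M ^ 3 * (1 / sqrt (4 * pi * \<mu> * t)) ^ 3"
  have s: "s > 0" unfolding s_def using \<mu>_pos t by simp
  define f where "f x = exp (- (\<i> * complex_of_real x * complex_of_real \<xi>)) * complex_of_real ((M * G\<^sub>0 B b \<mu> x t) ^ 3)" for x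
  have e3: "exp (- z) ^ 3 = exp (- (3 * z))" for z :: real
    using exp_of_nat_mult[of 3 "- z"] by simp
  have v: "(M * G\<^sub>0 B b \<mu> (a + 1 * y) t) ^ 3 = d * exp (- (s * y\<^sup>2))" for y
    unfolding G\<^sub>0_def G_def d_def s_def a_def
    by (simp add: power_mult_distrib power_divide e3)
  have "f (a + 1 * y) = complex_of_real d * exp (\<i> * complex_of_real (- (a * \<xi>))) *
      (exp (\<i> * complex_of_real y * complex_of_real (- \<xi>)) * complex_of_real (exp (- (s * y\<^sup>2))))" for y
  proof -
    have e: "exp (- (\<i> * complex_of_real (a + 1 * y) * complex_of_real \<xi>))
        = exp (\<i> * complex_of_real (- (a * \<xi>))) * exp (\<i> * complex_of_real y * complex_of_real (- \<xi>))"
      unfolding exp_add[symmetric] by (simp add: algebra_simps)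
    show ?thesis unfolding f_def v e by (simp only: of_real_mult mult_ac)
  qed
  then have "(\<integral>x. f x \<partial>lborel) = complex_of_real d * exp (\<i> * complex_of_real (- (a * \<xi>))) *
      complex_of_real (sqrt (pi / s) * exp (- ((- \<xi>)\<^sup>2 / (4 * s))))"
    using lborel_integral_real_affine[of 1 f a]
    by (simp only: integral_mult_right_zero gaussian_fourier_integral(2)[OF s] abs_one scaleR_one)
  then have "fourier (\<lambda>x. complex_of_real ((M * G\<^sub>0 B b \<mu> x t) ^ 3)) \<xi>
    = complex_of_real (1 / sqrt (2 * pi)) * (complex_of_real d * exp (\<i> * complex_of_real (- (a * \<xi>))) *
      complex_of_real (sqrt (pi / s) * exp (- ((- \<xi>)\<^sup>2 / (4 * s)))))"
    unfolding fourier_def f_def by simp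
  also have "\<dots> = complex_of_real (1 / sqrt (2 * pi) * d * sqrt (pi / s) * exp (- ((- \<xi>)\<^sup>2 / (4 * s)))) * exp (\<i> * complex_of_real (- (a * \<xi>)))"
    by (simp only: of_real_mult mult_ac)
  also have "(- \<xi>)\<^sup>2 / (4 * s) = \<mu> * t * \<xi>\<^sup>2 / 3"
    unfolding s_def using \<mu>_pos t by simp
  also have "1 / sqrt (2 * pi) * d * sqrt (pi / s) = cube_coeff M / t"
  proof -
    define r where "r = sqrt (4 * pi * \<mu> * t)"
    have r: "r > 0" "r\<^sup>2 = 4 * pi * \<mu> * t" unfolding r_def using \<mu>_pos t by auto
    have "sqrt (pi / s) = r / sqrt 3"
      unfolding s_def r_def using \<mu>_pos t by (simp add: real_sqrt_divide[symmetric])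
    then have "d * sqrt (pi / s) = M ^ 3 / (r\<^sup>2 * sqrt 3)"
      unfolding d_def r_def[symmetric] using r(1) by (simp add: power3_eq_cube power2_eq_square)
    then show ?thesis unfolding r cube_coeff_def by (simp add: mult_ac)
  qed
  finally show ?thesis by (simp only: a_def mult.assoc)
qed

lemma G\<^sub>0_bounds:
  obtains C where "C > 0"
    "\<And>M t. t > 0 \<Longrightarrow> L12 (\<lambda>\<xi>. complex_of_real (M / sqrt (2 * pi)) * propagator\<^sub>0 t \<xi>) (C * \<bar>M\<bar> * t powr (-1/2)) (C * \<bar>M\<bar> * t powr (-1/4))"
proof -
  obtain C where C: "C > 0" "\<And>t \<xi>. t > 0 \<Longrightarrow> \<bar>\<xi>\<bar> ^ 0 * exp (- (\<mu> * t * \<xi>\<^sup>2)) \<le> C * (1 / sqrt t) ^ 0 / (1 + t * \<xi>\<^sup>2)"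
    using power_exp_bound[of "\<mu>" 0] \<mu>_pos by auto
  show thesis
  proof (rule that[of "4 * C"])
    show "4 * C > 0" using C by simp
    fix M t :: real assume t: "t > 0"
    have M: "\<bar>M / sqrt (2 * pi)\<bar> \<le> \<bar>M\<bar>" using sqrt_2pi_ge_1 by (simp add: divide_le_eq mult_le_cancel_left1)
    have le: "norm (complex_of_real (M / sqrt (2 * pi)) * propagator\<^sub>0 t \<xi>) \<le> (C * \<bar>M\<bar>) / (1 + t * \<xi>\<^sup>2)" for \<xi>
      using mult_mono[OF M C(2)[OF t, of \<xi>]] unfolding norm_mult norm_of_real norm_propagator by (simp add: mult_ac)
    have "L12 (\<lambda>\<xi>. complex_of_real (M / sqrt (2 * pi)) * propagator\<^sub>0 t \<xi>) (4 * (C * \<bar>M\<bar>) * t powr (-1/2)) (2 * (C * \<bar>M\<bar>) * t powr (-1/4))"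
      by (rule L12_dominated[OF _ t _ le]) (use C in auto)
    then show "L12 (\<lambda>\<xi>. complex_of_real (M / sqrt (2 * pi)) * propagator\<^sub>0 t \<xi>) (4 * C * \<bar>M\<bar> * t powr (-1/2)) (4 * C * \<bar>M\<bar> * t powr (-1/4))"
      by (rule L12_mono) (use C in \<open>auto simp: mult_right_mono\<close>)
  qed
qed

section \<open>Small solutions and the asymptotics of their cubic source\<close>

lemma source_bound_mono:
  assumes H: "source_bound H Q t" and Q: "Q \<le> Q'"
  shows "source_bound H Q' t"
  unfolding source_bound_def
proof (intro conjI ballI allI)
  have Q0: "0 \<le> Q" using H by (simp add: source_bound_def)
  show "case_prod H \<in> borel_measurable (borel \<Otimes>\<^sub>M borel)"
    using H unfolding source_bound_def by blast
  show "0 \<le> Q'" using Q0 Q by linarith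
  fix \<tau> assume \<tau>: "\<tau> \<in> {0..<t}"
  have "norm (H \<tau> \<xi>) \<le> Q / (1 + \<tau>)" for \<xi> using H \<tau> by (simp add: source_bound_def)
  moreover have "Q / (1 + \<tau>) \<le> Q' / (1 + \<tau>)" using Q \<tau> by (intro divide_right_mono) auto
  ultimately show "norm (H \<tau> \<xi>) \<le> Q' / (1 + \<tau>)" for \<xi> by (rule order_trans)
  show "sq_integrable (H \<tau>)" using H \<tau> by (simp add: source_bound_def)
  have "(\<integral>\<xi>. (norm (H \<tau> \<xi>))\<^sup>2 \<partial>lborel) \<le> (Q * (1 + \<tau>) powr (-5/4))\<^sup>2"
    using H \<tau> by (simp add: source_bound_def)
  also have "\<dots> \<le> (Q' * (1 + \<tau>) powr (-5/4))\<^sup>2" using Q Q0 by (intro power_mono mult_right_mono) auto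
  finally show "(\<integral>\<xi>. (norm (H \<tau> \<xi>))\<^sup>2 \<partial>lborel) \<le> (Q' * (1 + \<tau>) powr (-5/4))\<^sup>2" .
qed

text \<open>Here e is a positive upper bound for E_0 and not E_0 itself, so that e > 0 is available
  for vanishing data too. The bound e <= 1 lets e^3 be replaced by e, and K is an upper bound for
  E_1.\<close>

definition small_solution :: "real \<Rightarrow> (real \<Rightarrow> real) \<Rightarrow> (real \<Rightarrow> real \<Rightarrow> real) \<Rightarrow> real \<Rightarrow> real \<Rightarrow> bool" where
  "small_solution \<delta> u\<^sub>0 u e K \<longleftrightarrow> mild_solution B b \<mu> u\<^sub>0 u \<and> u\<^sub>0 \<in> sobolev 1 \<and> integrable lborel u\<^sub>0 \<and>
     integrable lborel (\<lambda>x. x * u\<^sub>0 x) \<and> sobolev_norm 1 u\<^sub>0 + (\<integral>x. \<bar>u\<^sub>0 x\<bar> \<partial>lborel) \<le> e \<and> 0 < e \<and> e \<le> \<delta> \<and> e \<le> 1 \<and>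
     e + (\<integral>x. \<bar>x * u\<^sub>0 x\<bar> \<partial>lborel) \<le> K"

lemma small_solutionD:
  assumes "small_solution \<delta> u\<^sub>0 u e K"
  shows "mild_solution B b \<mu> u\<^sub>0 u" "u\<^sub>0 \<in> sobolev 1" "integrable lborel u\<^sub>0" "integrable lborel (\<lambda>x. x * u\<^sub>0 x)"
    "sobolev_norm 1 u\<^sub>0 + (\<integral>x. \<bar>u\<^sub>0 x\<bar> \<partial>lborel) \<le> e" "0 < e" "e \<le> \<delta>" "e \<le> 1" "e \<le> K" "0 \<le> K"
    "(\<integral>x. \<bar>u\<^sub>0 x\<bar> \<partial>lborel) + (\<integral>x. \<bar>x * u\<^sub>0 x\<bar> \<partial>lborel) \<le> K" "\<bar>\<integral>x. u\<^sub>0 x \<partial>lborel\<bar> \<le> e"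
    "continuous_sobolev 1 u"
proof -
  show *: "mild_solution B b \<mu> u\<^sub>0 u" "u\<^sub>0 \<in> sobolev 1" "integrable lborel u\<^sub>0" "integrable lborel (\<lambda>x. x * u\<^sub>0 x)"
    "sobolev_norm 1 u\<^sub>0 + (\<integral>x. \<bar>u\<^sub>0 x\<bar> \<partial>lborel) \<le> e" "0 < e" "e \<le> \<delta>" "e \<le> 1"
    using assms by (simp_all add: small_solution_def)
  have K: "e + (\<integral>x. \<bar>x * u\<^sub>0 x\<bar> \<partial>lborel) \<le> K" using assms by (simp add: small_solution_def)
  have n: "0 \<le> (\<integral>x. \<bar>x * u\<^sub>0 x\<bar> \<partial>lborel)" "0 \<le> sobolev_norm 1 u\<^sub>0" using sobolevD(5)[OF *(2)] by simp_all
  show "e \<le> K" "0 \<le> K" using K n *(6) by linarith+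
  show "(\<integral>x. \<bar>u\<^sub>0 x\<bar> \<partial>lborel) + (\<integral>x. \<bar>x * u\<^sub>0 x\<bar> \<partial>lborel) \<le> K" using K n *(5) by linarith
  have "\<bar>\<integral>x. u\<^sub>0 x \<partial>lborel\<bar> \<le> (\<integral>x. \<bar>u\<^sub>0 x\<bar> \<partial>lborel)" by (rule integral_abs_bound)
  then show "\<bar>\<integral>x. u\<^sub>0 x \<partial>lborel\<bar> \<le> e" using n *(5) by linarith
  show "continuous_sobolev 1 u" using *(1) by (simp add: mild_solution_def)
qed

text \<open>The source is naturally cubic in e; e^3 <= e <= K makes its bound linear in K, the form
  in which E_1 occurs in the claim.\<close>

lemma solution_source_bound:
  obtains C \<delta> where "C > 0" "\<delta> > 0"
    "\<And>u\<^sub>0 u e K t. small_solution \<delta> u\<^sub>0 u e K \<Longrightarrow> 0 \<le> t \<Longrightarrow> decay_bound u (C * e) t"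
    "\<And>u\<^sub>0 u e K t. small_solution \<delta> u\<^sub>0 u e K \<Longrightarrow> source_bound (cube_hat u) (C * K) t"
proof -
  obtain C \<delta> where C: "C > 0" "\<delta> > 0"
    "\<And>u\<^sub>0 u e t. mild_solution B b \<mu> u\<^sub>0 u \<Longrightarrow> u\<^sub>0 \<in> sobolev 1 \<Longrightarrow> integrable lborel u\<^sub>0 \<Longrightarrow>
       sobolev_norm 1 u\<^sub>0 + (\<integral>x. \<bar>u\<^sub>0 x\<bar> \<partial>lborel) \<le> e \<Longrightarrow> 0 < e \<Longrightarrow> e \<le> \<delta> \<Longrightarrow> 0 \<le> t \<Longrightarrow>
       decay_bound u (C * e) t"
    using solution_decay by blast
  define C' where "C' = C + C ^ 3"
  have C': "C' > 0" "C \<le> C'" "C ^ 3 \<le> C'" unfolding C'_def using C(1) by (simp_all add: add_pos_pos)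
  show thesis
  proof (rule that[OF C'(1) C(2)])
    fix u\<^sub>0 u e K and t :: real
    assume s: "small_solution \<delta> u\<^sub>0 u e K"
    note D = small_solutionD[OF s]
    have d: "decay_bound u (C * e) t" if "0 \<le> t" for t
      using C(3)[OF D(1,2,3,5,6,7) that] .
    show "decay_bound u (C' * e) t" if "0 \<le> t"
      by (rule decay_bound_mono[OF d[OF that]]) (use C C' D(6) in \<open>auto intro: mult_right_mono\<close>)
    have e3: "e ^ 3 \<le> e" using power_decreasing[of 1 3 e] D(6,8) by simp
    have "source_bound (cube_hat u) ((C * e) ^ 3) t"
      by (rule source_bound_cube_hat[OF D(13) _ d]) (use C D(6) in auto)
    moreover have "(C * e) ^ 3 \<le> C' * K"
    proof -
      have "(C * e) ^ 3 = C ^ 3 * e ^ 3" by (simp add: power_mult_distrib)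
      also have "\<dots> \<le> C' * K" using C' C(1) e3 D(6,9) by (intro mult_mono) auto
      finally show ?thesis .
    qed
    ultimately show "source_bound (cube_hat u) (C' * K) t" by (rule source_bound_mono)
  qed
qed

end

lemma integral_powr_from_1:
  fixes s z :: real
  assumes s: "1 \<le> s" and z: "z \<noteq> -1"
  shows "integrable lborel (\<lambda>\<tau>. indicator {1..<s} \<tau> * \<tau> powr z)"
    "(\<integral>\<tau>. indicator {1..<s} \<tau> * \<tau> powr z \<partial>lborel) = (s powr (z + 1) - 1) / (z + 1)"
proof -
  have z1: "z + 1 \<noteq> 0" using z by simp
  have D: "((\<lambda>\<tau>. \<tau> powr (z + 1) / (z + 1)) has_real_derivative \<tau> powr z) (at \<tau>)" if "\<tau> > 0" for \<tau>
    using DERIV_cdivide[OF has_real_derivative_powr[OF that, of "z + 1"], of "z + 1"] z1 by simp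
  have hb: "has_bochner_integral lborel (\<lambda>\<tau>. \<tau> powr z * indicator {1..s} \<tau>) (s powr (z + 1) / (z + 1) - 1 powr (z + 1) / (z + 1))"
    by (rule has_bochner_integral_FTC_Icc_real[OF s]) (auto intro!: D continuous_intros)
  have ae: "AE \<tau> in lborel. \<tau> powr z * indicator {1..s} \<tau> = (indicator {1..<s} \<tau> * \<tau> powr z :: real)"
    using AE_lborel_singleton[of s] by eventually_elim (auto simp: indicator_def)
  have "has_bochner_integral lborel (\<lambda>\<tau>. indicator {1..<s} \<tau> * \<tau> powr z) (s powr (z + 1) / (z + 1) - 1 powr (z + 1) / (z + 1))"
    by (rule has_bochner_integral_cong_AE[THEN iffD1, OF _ _ ae hb]) auto
  then show "integrable lborel (\<lambda>\<tau>. indicator {1..<s} \<tau> * \<tau> powr z)"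
    "(\<integral>\<tau>. indicator {1..<s} \<tau> * \<tau> powr z \<partial>lborel) = (s powr (z + 1) - 1) / (z + 1)"
    by (simp_all add: has_bochner_integral_iff diff_divide_distrib)
qed

lemma integral_inverse_from_1:
  fixes s :: real
  assumes s: "1 \<le> s"
  shows "integrable lborel (\<lambda>\<tau>. indicator {1..<s} \<tau> * (1 / \<tau>))"
    "(\<integral>\<tau>. indicator {1..<s} \<tau> * (1 / \<tau>) \<partial>lborel) = ln s"
proof -
  have hb: "has_bochner_integral lborel (\<lambda>\<tau>. 1 / \<tau> * indicator {1..s} \<tau>) (ln s - ln 1)"
    using s by (intro has_bochner_integral_FTC_Icc_real)
      (auto intro!: derivative_eq_intros continuous_intros)
  have ae: "AE \<tau> in lborel. 1 / \<tau> * indicator {1..s} \<tau> = (indicator {1..<s} \<tau> * (1 / \<tau>) :: real)"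
    using AE_lborel_singleton[of s] by eventually_elim (auto simp: indicator_def)
  have "has_bochner_integral lborel (\<lambda>\<tau>. indicator {1..<s} \<tau> * (1 / \<tau>)) (ln s - ln 1)"
    by (rule has_bochner_integral_cong_AE[THEN iffD1, OF _ _ ae hb]) auto
  then show "integrable lborel (\<lambda>\<tau>. indicator {1..<s} \<tau> * (1 / \<tau>))"
    "(\<integral>\<tau>. indicator {1..<s} \<tau> * (1 / \<tau>) \<partial>lborel) = ln s"
    by (simp_all add: has_bochner_integral_iff)
qed

context dispersive begin

lemma cube_coeff_bound:
  assumes "\<bar>M\<bar> \<le> e" "e \<le> 1" "e \<le> K"
  shows "\<bar>cube_coeff M\<bar> \<le> 1 / \<mu> * K"
proof -
  have d: "1 \<le> 4 * sqrt 3 * pi"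
  proof -
    have "1 * 1 * 1 \<le> 4 * sqrt 3 * pi" using pi_gt3 by (intro mult_mono) auto
    then show ?thesis by simp
  qed
  have "\<bar>M\<bar> ^ 3 \<le> e ^ 3" using assms by (intro power_mono) auto
  also have "e ^ 3 \<le> e" using power_decreasing[of 1 3 e] assms by simp
  finally have M3: "\<bar>M ^ 3\<bar> \<le> K" using assms by (simp add: power_abs)
  have "\<bar>cube_coeff M\<bar> = \<bar>M ^ 3\<bar> * (1 / (4 * sqrt 3 * pi) * (1 / \<mu>)) * (1 / sqrt (2 * pi))"
    unfolding cube_coeff_def using \<mu>_pos by (simp add: abs_mult)
  also have "\<dots> \<le> K * (1 * (1 / \<mu>)) * 1"
    using M3 \<mu>_pos d sqrt_2pi_ge_1 by (intro mult_mono mult_nonneg_nonneg) (auto simp: divide_le_eq_1)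
  finally show ?thesis by simp
qed

text \<open>Two comparisons. Replacing u by v = M G_0 inside the cube costs \<tau>^(-1/2)
  \<tau>^(-1/4) \<tau>^(-1/2) = \<tau>^(-5/4): a sup norm, an L^2 norm and the L^2 distance of u and
  v. Replacing the transform of v^3 by c/\<tau> times the propagator costs \<xi>^2, because 1/\<tau>
  cancels the \<tau> in the exponent.\<close>

lemma cube_hat_asymptotics:
  obtains C \<delta> where "C > 0" "\<delta> > 0"
    "\<And>u\<^sub>0 u e K \<tau> \<xi>. small_solution \<delta> u\<^sub>0 u e K \<Longrightarrow> 1 \<le> \<tau> \<Longrightarrow>
      norm (cube_hat u \<tau> \<xi> - complex_of_real (cube_coeff (\<integral>x. u\<^sub>0 x \<partial>lborel) / \<tau>) * propagator\<^sub>0 \<tau> \<xi>)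
        \<le> C * K * (\<tau> powr (-5/4) + \<xi>\<^sup>2)"
    "\<And>u\<^sub>0 u e K t. small_solution \<delta> u\<^sub>0 u e K \<Longrightarrow> source_bound (cube_hat u) (C * K) t"
proof -
  obtain Cd \<delta> where Cd: "Cd > 0" "\<delta> > 0"
    "\<And>u\<^sub>0 u e K t. small_solution \<delta> u\<^sub>0 u e K \<Longrightarrow> 0 \<le> t \<Longrightarrow> decay_bound u (Cd * e) t"
    "\<And>u\<^sub>0 u e K t. small_solution \<delta> u\<^sub>0 u e K \<Longrightarrow> source_bound (cube_hat u) (Cd * K) t"
    using solution_source_bound by blast
  obtain C1 where C1: "C1 > 0"
    "\<And>u\<^sub>0 K t. t > 0 \<Longrightarrow> integrable lborel u\<^sub>0 \<Longrightarrow> integrable lborel (\<lambda>x. x * u\<^sub>0 x) \<Longrightarrow>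
       (\<integral>x. \<bar>u\<^sub>0 x\<bar> \<partial>lborel) + (\<integral>x. \<bar>x * u\<^sub>0 x\<bar> \<partial>lborel) \<le> K \<Longrightarrow>
       L12 (\<lambda>\<xi>. propagator t \<xi> * fourier (\<lambda>x. complex_of_real (u\<^sub>0 x)) \<xi> - complex_of_real ((\<integral>x. u\<^sub>0 x \<partial>lborel) / sqrt (2 * pi)) * propagator\<^sub>0 t \<xi>)
         (C1 * K * t powr (-1)) (C1 * K * t powr (-3/4))"
    using linear_asymptotics by blast
  obtain C2 where C2: "C2 > 0"
    "\<And>H Q t. t > 0 \<Longrightarrow> source_bound H Q t \<Longrightarrow>
      L12 (duhamel H t 0 t) (C2 * Q * (1 + t) powr (-1/2)) (C2 * Q * (1 + t) powr (-1/2))"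
    using duhamel_full by blast
  obtain C3 where C3: "C3 > 0"
    "\<And>M t. t > 0 \<Longrightarrow> L12 (\<lambda>\<xi>. complex_of_real (M / sqrt (2 * pi)) * propagator\<^sub>0 t \<xi>) (C3 * \<bar>M\<bar> * t powr (-1/2)) (C3 * \<bar>M\<bar> * t powr (-1/4))"
    using G\<^sub>0_bounds by blast
  \<comment> \<open>The constant a covers the sizes of u and of its profile, d their L^2
    distance.\<close>
  define a where "a = Cd + C3"
  define d where "d = C1 + C2 * Cd"
  have ad: "a > 0" "d > 0" "Cd \<le> a" "C3 \<le> a" unfolding a_def d_def using Cd(1) C1(1) C2(1) C3(1) by (auto intro: add_pos_pos)
  define C where "C = 3 * a * a * d + 1 + Cd"
  have p3: "3 * a * a * d > 0" using ad by simp
  have C: "C > 0" "3 * a * a * d \<le> C" "1 \<le> C" "Cd \<le> C" unfolding C_def using p3 Cd(1) by auto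
  show thesis
  proof (rule that[OF C(1) Cd(2)])
    fix u\<^sub>0 u e K and t :: real
    assume s: "small_solution \<delta> u\<^sub>0 u e K"
    note D = small_solutionD[OF s]
    note sb = Cd(4)[OF s, of t]
    show "source_bound (cube_hat u) (C * K) t"
      using source_bound_mono[OF sb] mult_right_mono[OF C(4) D(10)] by blast
  next
    fix u\<^sub>0 u e K and \<tau> \<xi> :: real
    assume s: "small_solution \<delta> u\<^sub>0 u e K" and \<tau>: "1 \<le> \<tau>"
    note D = small_solutionD[OF s]
    have \<tau>0: "\<tau> > 0" "0 \<le> \<tau>" using \<tau> by auto
    define M where "M = (\<integral>x. u\<^sub>0 x \<partial>lborel)"
    have M: "\<bar>M\<bar> \<le> e" "\<bar>M\<bar> \<le> 1" using D(8,12) unfolding M_def by auto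
    define k where "k \<xi> = complex_of_real (M / sqrt (2 * pi)) * propagator\<^sub>0 \<tau> \<xi>" for \<xi>
    define v where "v x = M * G\<^sub>0 B b \<mu> x \<tau>" for x
    define l where "l \<xi> = propagator \<tau> \<xi> * fourier (\<lambda>x. complex_of_real (u\<^sub>0 x)) \<xi> - k \<xi>" for \<xi>
    define sh where "sh \<xi> = l \<xi> - duhamel (cube_hat u) \<tau> 0 \<tau> \<xi>" for \<xi>
    note sb = Cd(4)[OF s, of \<tau>]
    have us: "u \<tau> \<in> sobolev 1" using D(13) \<tau>0 by (auto simp: continuous_sobolev_def)
    note um [measurable] = sq_integrable_measurable[OF sobolevD(2)[OF us]]
    have Ll: "L12 l (C1 * K * \<tau> powr (-1)) (C1 * K * \<tau> powr (-3/4))"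
      using C1(2)[OF \<tau>0(1) D(3,4,11)] unfolding l_def[abs_def] k_def M_def .
    have Lk: "L12 k (C3 * \<bar>M\<bar> * \<tau> powr (-1/2)) (C3 * \<bar>M\<bar> * \<tau> powr (-1/4))"
      using C3(2)[OF \<tau>0(1), of M] unfolding k_def[abs_def] .
    have Ls: "L12 sh (C1 * K * \<tau> powr (-1) + C2 * (Cd * K) * (1 + \<tau>) powr (-1/2))
        (C1 * K * \<tau> powr (-3/4) + C2 * (Cd * K) * (1 + \<tau>) powr (-1/2))"
      using L12_diff[OF Ll C2(2)[OF \<tau>0(1) sb]] unfolding sh_def[abs_def] .
    \<comment> \<open>The Duhamel term dictates the rate 1/2; the linear error is smaller, of order
      \<tau>^(-3/4).\<close>
    define R where "R = d * K * \<tau> powr (-1/2)"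
    have "L12 sh (C1 * K * \<tau> powr (-1) + C2 * (Cd * K) * (1 + \<tau>) powr (-1/2)) R"
    proof (rule L12_mono[OF Ls order_refl])
      have x: "\<tau> powr (-3/4) \<le> \<tau> powr (-1/2)" using \<tau> by (intro powr_mono) auto
      have y: "(1 + \<tau>) powr (-1/2) \<le> \<tau> powr (-1/2)" using \<tau> by (intro powr_mono2') auto
      have "C1 * K * \<tau> powr (-3/4) + C2 * (Cd * K) * (1 + \<tau>) powr (-1/2) \<le> C1 * K * \<tau> powr (-1/2) + C2 * (Cd * K) * \<tau> powr (-1/2)"
        using C1(1) C2(1) Cd(1) D(10) by (intro add_mono mult_left_mono x y) auto
      then show "C1 * K * \<tau> powr (-3/4) + C2 * (Cd * K) * (1 + \<tau>) powr (-1/2) \<le> R"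
        unfolding R_def d_def by (simp add: algebra_simps)
    qed
    note Ls = this
    have R0: "0 \<le> R" unfolding R_def using ad D(10) by simp
    have ik: "integrable lborel k" and ish: "integrable lborel sh" using Lk Ls by (auto simp: L12_def)
    have v_eq: "v x = Re (inv_fourier k x)" for x
    proof -
      have k': "k = (\<lambda>\<xi>. complex_of_real M * (complex_of_real (1 / sqrt (2 * pi)) * propagator\<^sub>0 \<tau> \<xi>))"
        by (rule ext) (simp add: k_def)
      show ?thesis unfolding v_def G\<^sub>0_fourier[OF \<tau>0(1)] k' inv_fourier_cmult by simp
    qed
    have vm [measurable]: "v \<in> borel_measurable borel" unfolding v_def G\<^sub>0_def G_def by measurable
    have sol: "solution_hat u\<^sub>0 u \<tau> = (\<lambda>\<xi>. sh \<xi> + k \<xi>)"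
      by (rule ext) (simp add: solution_hat_def sh_def l_def)
    have "AE x in lborel. u \<tau> x = Re (inv_fourier (solution_hat u\<^sub>0 u \<tau>) x)"
      by (rule mild_solution_fourier[OF D(1,3) sb \<tau>0(1)])
    then have uv: "AE x in lborel. u \<tau> x - v x = Re (inv_fourier sh x)"
      by eventually_elim (simp add: sol inv_fourier_add[OF ish ik] v_eq)
    have diff: "(\<integral>x. (u \<tau> x - v x)\<^sup>2 \<partial>lborel) \<le> R\<^sup>2"
      by (rule L12_Re_inv_fourier(3)[OF Ls uv]) measurable
    have "AE x in lborel. v x = Re (inv_fourier k x)" by (simp add: v_eq)
    note vb = L12_Re_inv_fourier[OF Lk this vm]
    define A where "A = a * \<tau> powr (-1/2)"
    define Dn where "Dn = a * \<tau> powr (-1/4)"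
    have AD: "0 \<le> A" "0 \<le> Dn" unfolding A_def Dn_def using ad by auto
    have z: "Cd * e * (1 + \<tau>) powr z \<le> a * \<tau> powr z" "C3 * \<bar>M\<bar> * \<tau> powr z \<le> a * \<tau> powr z" if "z \<le> 0" for z
    proof -
      have "(1 + \<tau>) powr z \<le> \<tau> powr z" using \<tau> that by (intro powr_mono2') auto
      moreover have "Cd * e \<le> a * 1" using ad Cd(1) D(6,8) by (intro mult_mono) auto
      ultimately show "Cd * e * (1 + \<tau>) powr z \<le> a * \<tau> powr z"
        using ad by (intro mult_mono) auto
      have "C3 * \<bar>M\<bar> \<le> a * 1" using ad C3(1) M by (intro mult_mono) auto
      then show "C3 * \<bar>M\<bar> * \<tau> powr z \<le> a * \<tau> powr z" by (intro mult_right_mono) auto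
    qed
    have du: "AE x in lborel. \<bar>u \<tau> x\<bar> \<le> Cd * e * (1 + \<tau>) powr (-1/2)"
      "(\<integral>x. (u \<tau> x)\<^sup>2 \<partial>lborel) \<le> (Cd * e * (1 + \<tau>) powr (-1/4))\<^sup>2"
      using Cd(3)[OF s \<tau>0(2)] by (auto simp: decay_bound_def)
    have uA: "AE x in lborel. \<bar>u \<tau> x\<bar> \<le> A" using du(1) by eventually_elim (use z(1)[of "-1/2"] in \<open>simp add: A_def\<close>)
    have vA: "AE x in lborel. \<bar>v x\<bar> \<le> A" using vb(1) by eventually_elim (use z(2)[of "-1/2"] in \<open>simp add: A_def\<close>)
    have uD: "(\<integral>x. (u \<tau> x)\<^sup>2 \<partial>lborel) \<le> Dn\<^sup>2"
      using du(2) by (rule order_trans) (use z(1)[of "-1/4"] Cd(1) D(6) in \<open>auto simp: Dn_def intro!: power_mono\<close>)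
    have vD: "(\<integral>x. (v x)\<^sup>2 \<partial>lborel) \<le> Dn\<^sup>2"
      using vb(3) by (rule order_trans) (use z(2)[of "-1/4"] C3(1) in \<open>auto simp: Dn_def intro!: power_mono\<close>)
    have cd: "(\<integral>x. \<bar>u \<tau> x ^ 3 - v x ^ 3\<bar> \<partial>lborel) \<le> 3 * A * Dn * R"
      by (rule cube_diff_bound[OF sobolevD(2)[OF us] uA uD vb(2) vA vD diff AD R0])
    have i3: "integrable lborel (\<lambda>x. complex_of_real (u \<tau> x ^ 3))" "integrable lborel (\<lambda>x. complex_of_real (v x ^ 3))"
      using sobolev_cube(1)[OF us] cube_bounds(1)[OF vb(2) vA AD(1) vD AD(2)] by (simp_all del: of_real_power)
    define c where "c = cube_coeff M"
    have m: "max 0 \<tau> = \<tau>" using \<tau>0 by simp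
    have 1: "norm (cube_hat u \<tau> \<xi> - fourier (\<lambda>x. complex_of_real (v x ^ 3)) \<xi>) \<le> 3 * a * a * d * K * \<tau> powr (-5/4)"
    proof -
      have "norm (cube_hat u \<tau> \<xi> - fourier (\<lambda>x. complex_of_real (v x ^ 3)) \<xi>)
        = norm (fourier (\<lambda>x. complex_of_real (u \<tau> x ^ 3) - complex_of_real (v x ^ 3)) \<xi>)"
        unfolding cube_hat_def m fourier_diff[OF i3] ..
      also have "\<dots> \<le> (\<integral>x. norm (complex_of_real (u \<tau> x ^ 3) - complex_of_real (v x ^ 3)) \<partial>lborel)"
        by (rule norm_fourier_le)
      also have "\<dots> = (\<integral>x. \<bar>u \<tau> x ^ 3 - v x ^ 3\<bar> \<partial>lborel)"
        by (simp only: of_real_diff[symmetric] norm_of_real)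
      also note cd
      also have "3 * A * Dn * R = 3 * a * a * d * K * (\<tau> powr (-1/2) * \<tau> powr (-1/4) * \<tau> powr (-1/2))"
        by (simp add: A_def Dn_def R_def)
      also have "\<tau> powr (-1/2) * \<tau> powr (-1/4) * \<tau> powr (-1/2) = \<tau> powr (-5/4)" by (simp flip: powr_add)
      finally show ?thesis .
    qed
    have 2: "norm (fourier (\<lambda>x. complex_of_real (v x ^ 3)) \<xi> - complex_of_real (c / \<tau>) * propagator\<^sub>0 \<tau> \<xi>) \<le> K * \<xi>\<^sup>2"
    proof -
      define y where "y = \<mu> * \<tau> * \<xi>\<^sup>2"
      have y: "0 \<le> y" unfolding y_def using \<mu>_pos \<tau>0 by simp
      let ?E = "exp (\<i> * complex_of_real (- (2 * B / b * \<tau> * \<xi>)))"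
      have "fourier (\<lambda>x. complex_of_real (v x ^ 3)) \<xi> - complex_of_real (c / \<tau>) * propagator\<^sub>0 \<tau> \<xi>
          = complex_of_real (c / \<tau> * (exp (- (y / 3)) - exp (- y))) * ?E"
        unfolding v_def fourier_G\<^sub>0_cube[OF \<tau>0(1)] propagator_polar c_def y_def
        by (simp only: of_real_mult of_real_diff right_diff_distrib left_diff_distrib mult.assoc)
      then have "norm (fourier (\<lambda>x. complex_of_real (v x ^ 3)) \<xi> - complex_of_real (c / \<tau>) * propagator\<^sub>0 \<tau> \<xi>)
          = \<bar>c / \<tau>\<bar> * \<bar>exp (- (y / 3)) - exp (- y)\<bar>"
        by (simp only: norm_mult norm_of_real norm_exp_i_times mult_1_right abs_mult)
      also have "\<dots> \<le> \<bar>c / \<tau>\<bar> * y"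
      proof (rule mult_left_mono)
        \<comment> \<open>The value exp(-y/3) lies between exp(-y) and 1, and 1 - exp(-y) <=
          y.\<close>
        have "exp (- y) \<le> exp (- (y / 3))" "exp (- (y / 3)) \<le> 1" "1 + (- y) \<le> exp (- y)"
          using y exp_ge_add_one_self[of "- y"] by auto
        then show "\<bar>exp (- (y / 3)) - exp (- y)\<bar> \<le> y" by linarith
      qed simp
      also have "\<bar>c / \<tau>\<bar> * y = \<bar>c\<bar> * \<mu> * \<xi>\<^sup>2"
        unfolding y_def using \<tau>0 by simp
      also have "\<dots> \<le> (1 / \<mu> * K) * \<mu> * \<xi>\<^sup>2"
        unfolding c_def using cube_coeff_bound[OF M(1) D(8,9)] \<mu>_pos by (intro mult_right_mono) auto
      also have "\<dots> = K * \<xi>\<^sup>2" using \<mu>_pos by simp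
      finally show ?thesis .
    qed
    have "norm (cube_hat u \<tau> \<xi> - complex_of_real (c / \<tau>) * propagator\<^sub>0 \<tau> \<xi>) \<le> 3 * a * a * d * K * \<tau> powr (-5/4) + K * \<xi>\<^sup>2"
      using norm_triangle_ineq[of "cube_hat u \<tau> \<xi> - fourier (\<lambda>x. complex_of_real (v x ^ 3)) \<xi>"
          "fourier (\<lambda>x. complex_of_real (v x ^ 3)) \<xi> - complex_of_real (c / \<tau>) * propagator\<^sub>0 \<tau> \<xi>"] 1 2 by simp
    also have "\<dots> \<le> C * K * \<tau> powr (-5/4) + C * K * \<xi>\<^sup>2"
    proof (rule add_mono)
      show "3 * a * a * d * K * \<tau> powr (-5/4) \<le> C * K * \<tau> powr (-5/4)"
        by (intro mult_right_mono[OF mult_right_mono[OF C(2) D(10)]]) simp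
      show "K * \<xi>\<^sup>2 \<le> C * K * \<xi>\<^sup>2"
        using mult_right_mono[OF mult_right_mono[OF C(3) D(10)], of "\<xi>\<^sup>2"] by simp
    qed
    finally show "norm (cube_hat u \<tau> \<xi> - complex_of_real (cube_coeff (\<integral>x. u\<^sub>0 x \<partial>lborel) / \<tau>) * propagator\<^sub>0 \<tau> \<xi>)
        \<le> C * K * (\<tau> powr (-5/4) + \<xi>\<^sup>2)"
      unfolding c_def M_def by (simp add: distrib_left)
  qed
qed

end

text \<open>Pointwise |w|^r <= a^(r-2) w^2, with a the sup bound. The powers of t add up to -(r - 2)
  - 3/2 = -r + 1/2, and the r-th root gives the claimed exponent; for q = \<infinity> the sup bound
  is the claim.\<close>

lemma sup_L2_interpolation:
  fixes w :: "real \<Rightarrow> real" and q :: ereal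
  assumes w: "sq_integrable w" and K: "K > 0" and t: "t > 0" and q: "2 \<le> q"
    and A: "AE x in lborel. \<bar>w x\<bar> \<le> K * t powr (-1)"
    and D: "(\<integral>x. (w x)\<^sup>2 \<partial>lborel) \<le> (K * t powr (-3/4))\<^sup>2"
  shows "w \<in> Lp q \<and> Lp_norm q w \<le> K * t powr (- (1/2) * (1 - real_of_ereal (1 / q)) - 1/2)"
proof (cases "q = \<infinity>")
  case True
  note [measurable] = sq_integrable_measurable[OF w]
  have le: "esssup lborel (\<lambda>x. ereal (norm (w x))) \<le> ereal (K * t powr (-1))"
    by (rule esssup_I) (use A in auto)
  have "real_of_ereal (esssup lborel (\<lambda>x. ereal (norm (w x)))) \<le> K * t powr (-1)"
    using le K by (cases "esssup lborel (\<lambda>x. ereal (norm (w x)))") auto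
  moreover have "esssup lborel (\<lambda>x. ereal (norm (w x))) < \<infinity>" using le_less_trans[OF le, of \<infinity>] by simp
  ultimately show ?thesis using True by (simp add: Lp_def Lp_norm_def)
next
  case False
  then obtain r where r: "q = ereal r" "2 \<le> r" using q by (cases q) auto
  note [measurable] = sq_integrable_measurable[OF w]
  define a where "a = K * t powr (-1)"
  have a: "a > 0" unfolding a_def using K t by simp
  have i2: "integrable lborel (\<lambda>x. (w x)\<^sup>2)" using sq_integrableD[OF w] by simp
  have le: "AE x in lborel. norm (w x) powr r \<le> a powr (r - 2) * (w x)\<^sup>2"
    using A
  proof eventually_elim
    fix x assume *: "\<bar>w x\<bar> \<le> K * t powr (-1)"
    have "norm (w x) powr r = norm (w x) powr (r - 2 + 2)" by simp
    also have "\<dots> = norm (w x) powr (r - 2) * norm (w x) powr 2" by (rule powr_add)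
    also have "norm (w x) powr 2 = (w x)\<^sup>2" by (simp add: powr_numeral)
    also have "norm (w x) powr (r - 2) * (w x)\<^sup>2 \<le> a powr (r - 2) * (w x)\<^sup>2"
      using * r unfolding a_def by (intro mult_right_mono powr_mono2) auto
    finally show "norm (w x) powr r \<le> a powr (r - 2) * (w x)\<^sup>2" .
  qed
  have i: "integrable lborel (\<lambda>x. norm (w x) powr r)"
    by (rule Bochner_Integration.integrable_bound[OF integrable_mult_right[OF i2, of "a powr (r - 2)"]])
       (use le in auto)
  have "(\<integral>x. norm (w x) powr r \<partial>lborel) \<le> (\<integral>x. a powr (r - 2) * (w x)\<^sup>2 \<partial>lborel)"
    by (rule integral_mono_AE[OF i integrable_mult_right[OF i2] le])
  also have "\<dots> \<le> a powr (r - 2) * (K * t powr (-3/4))\<^sup>2" using D by (simp add: mult_left_mono)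
  also have "\<dots> = K powr r * t powr (- r + 1/2)"
  proof -
    have "a powr (r - 2) = K powr (r - 2) * (t powr (-1)) powr (r - 2)"
      unfolding a_def using K by (simp only: powr_mult less_imp_le powr_ge_zero)
    then have "a powr (r - 2) = K powr (r - 2) * t powr (- (r - 2))"
      by (simp only: powr_powr mult_minus1)
    moreover have "(K * t powr (-3/4))\<^sup>2 = K powr 2 * t powr (-3/2)"
      using K t by (simp add: power_mult_distrib powr_numeral powr_power)
    ultimately have "a powr (r - 2) * (K * t powr (-3/4))\<^sup>2 = (K powr (r - 2) * K powr 2) * (t powr (- (r - 2)) * t powr (-3/2))"
      by (simp only: mult_ac)
    also have "\<dots> = K powr r * t powr (- r + 1/2)" unfolding powr_add[symmetric] by simp
    finally show ?thesis .
  qed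
  finally have "(\<integral>x. norm (w x) powr r \<partial>lborel) \<le> K powr r * t powr (- r + 1/2)" .
  then have "(\<integral>x. norm (w x) powr r \<partial>lborel) powr (1 / r) \<le> (K powr r * t powr (- r + 1/2)) powr (1 / r)"
    using r by (intro powr_mono2) auto
  also have "\<dots> = K * t powr ((- r + 1/2) * (1 / r))"
    using K t r by (simp add: powr_mult powr_powr)
  also have "(- r + 1/2) * (1 / r) = - (1/2) * (1 - 1 / r) - 1/2"
    using r by (simp add: field_simps)
  finally have "(\<integral>x. norm (w x) powr r \<partial>lborel) powr (1 / r) \<le> K * t powr (- (1/2) * (1 - 1 / r) - 1/2)" .
  moreover have "real_of_ereal (1 / ereal r) = 1 / r" using r by (simp add: one_ereal_def)
  ultimately show ?thesis using i r by (simp add: Lp_def Lp_norm_def)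
qed

section \<open>The logarithm and the complete remainder\<close>

context dispersive begin

text \<open>Since \<open>propagator\<^sub>0 (t - \<tau>)\<close> times
  \<open>propagator\<^sub>0 \<tau>\<close> is \<open>propagator\<^sub>0 t\<close>, the leading part
  of the integrand depends on \<tau> only through 1/\<tau> and integrates to c ln (t/2). Three
  errors remain: the linearised phase of the propagator and the two errors in the asymptotics of the
  source.\<close>

lemma duhamel_middle:
  obtains C \<delta> where "C > 0" "\<delta> > 0"
    "\<And>u\<^sub>0 u e K t \<xi>. small_solution \<delta> u\<^sub>0 u e K \<Longrightarrow> 2 \<le> t \<Longrightarrow>
      norm (duhamel (cube_hat u) t 1 (t / 2) \<xi>
         - \<i> * complex_of_real \<xi> * complex_of_real (cube_coeff (\<integral>x. u\<^sub>0 x \<partial>lborel) * ln (t / 2)) * propagator\<^sub>0 t \<xi>)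
       \<le> C * K * t powr (-1/2) / (1 + t * \<xi>\<^sup>2)"
    "\<And>u\<^sub>0 u e K t. small_solution \<delta> u\<^sub>0 u e K \<Longrightarrow> source_bound (cube_hat u) (C * K) t"
proof -
  obtain C \<delta> where C: "C > 0" "\<delta> > 0"
    "\<And>u\<^sub>0 u e K \<tau> \<xi>. small_solution \<delta> u\<^sub>0 u e K \<Longrightarrow> 1 \<le> \<tau> \<Longrightarrow>
      norm (cube_hat u \<tau> \<xi> - complex_of_real (cube_coeff (\<integral>x. u\<^sub>0 x \<partial>lborel) / \<tau>) * propagator\<^sub>0 \<tau> \<xi>)
        \<le> C * K * (\<tau> powr (-5/4) + \<xi>\<^sup>2)"
    "\<And>u\<^sub>0 u e K t. small_solution \<delta> u\<^sub>0 u e K \<Longrightarrow> source_bound (cube_hat u) (C * K) t"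
    using cube_hat_asymptotics by blast
  obtain C1 where C1: "C1 > 0" "\<And>t \<xi>. t > 0 \<Longrightarrow> \<bar>\<xi>\<bar> ^ 1 * exp (- (\<mu> / 2 * t * \<xi>\<^sup>2)) \<le> C1 * (1 / sqrt t) ^ 1 / (1 + t * \<xi>\<^sup>2)"
    using power_exp_bound[of "\<mu> / 2" 1] \<mu>_pos by auto
  obtain C3 where C3: "C3 > 0" "\<And>t \<xi>. t > 0 \<Longrightarrow> \<bar>\<xi>\<bar> ^ 3 * exp (- (\<mu> / 2 * t * \<xi>\<^sup>2)) \<le> C3 * (1 / sqrt t) ^ 3 / (1 + t * \<xi>\<^sup>2)"
    using power_exp_bound[of "\<mu> / 2" 3] \<mu>_pos by auto
  obtain C4 where C4: "C4 > 0" "\<And>t \<xi>. t > 0 \<Longrightarrow> \<bar>\<xi>\<bar> ^ 4 * exp (- (\<mu> / 2 * t * \<xi>\<^sup>2)) \<le> C4 * (1 / sqrt t) ^ 4 / (1 + t * \<xi>\<^sup>2)"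
    using power_exp_bound[of "\<mu> / 2" 4] \<mu>_pos by auto
  define a where "a = 2 * B / b ^ 3"
  have a: "a > 0" unfolding a_def using B_pos b_pos by simp
  \<comment> \<open>The 4 bounds the integral of \<tau>^(-5/4), and the 2 that of \<tau>^(-1/2)
    relative to sqrt t; the 1 ensures C <= C' for the source bound.\<close>
  define C' where "C' = C * (1 + 4 * C1 + C3 + 2 * a * C4)"
  have "1 \<le> 1 + 4 * C1 + C3 + 2 * a * C4" using C1(1) C3(1) C4(1) a by simp
  from mult_left_mono[OF this, of C] have C': "C' > 0" "C \<le> C'"
    unfolding C'_def using C(1) by linarith+
  show thesis
  proof (rule that[OF C'(1) C(2)])
    fix u\<^sub>0 u e K and t :: real
    assume s: "small_solution \<delta> u\<^sub>0 u e K"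
    show "source_bound (cube_hat u) (C' * K) t"
      by (rule source_bound_mono[OF C(4)[OF s]]) (rule mult_right_mono[OF C'(2) small_solutionD(10)[OF s]])
  next
    fix u\<^sub>0 u e K and t \<xi> :: real
    assume s: "small_solution \<delta> u\<^sub>0 u e K" and t: "2 \<le> t"
    note D = small_solutionD[OF s]
    have t0: "t > 0" and th: "1 \<le> t / 2" using t by auto
    define c where "c = cube_coeff (\<integral>x. u\<^sub>0 x \<partial>lborel)"
    note sb = C(4)[OF s, of t]
    define p where "p = 1 / sqrt t"
    have p: "p > 0" "t * p\<^sup>2 = 1" "sqrt t = t * p" unfolding p_def using t0 by (auto simp: power_divide real_div_sqrt)
    define E where "E = exp (- (\<mu> / 2 * t * \<xi>\<^sup>2))"
    have E: "E \<ge> 0" unfolding E_def by simp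
    define f where "f \<tau> = \<i> * complex_of_real \<xi> * propagator (t - \<tau>) \<xi> * cube_hat u \<tau> \<xi>" for \<tau>
    define g where "g \<tau> = \<i> * complex_of_real \<xi> * complex_of_real c * propagator\<^sub>0 t \<xi> * complex_of_real (1 / \<tau>)" for \<tau>
    have fi: "integrable lborel (\<lambda>\<tau>. indicator {1..<t / 2} \<tau> *\<^sub>R f \<tau>)"
      using duhamel_integrable_time[OF sb, of 1 "t / 2" \<xi>] t unfolding set_integrable_def f_def by simp
    have geq: "indicator {1..<t / 2} \<tau> *\<^sub>R g \<tau> = \<i> * complex_of_real \<xi> * complex_of_real c * propagator\<^sub>0 t \<xi> * complex_of_real (indicator {1..<t / 2} \<tau> * (1 / \<tau>))" for \<tau>
      unfolding g_def by (simp add: scaleR_conv_of_real)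
    note I1 = integral_inverse_from_1[OF th]
    have I1c: "integrable lborel (\<lambda>\<tau>. complex_of_real (indicator {1..<t / 2} \<tau> * (1 / \<tau>)))"
      "(\<integral>\<tau>. complex_of_real (indicator {1..<t / 2} \<tau> * (1 / \<tau>)) \<partial>lborel) = complex_of_real (ln (t / 2))"
      using I1 unfolding complex_of_real_integrable_eq integral_complex_of_real by simp_all
    have gi: "integrable lborel (\<lambda>\<tau>. indicator {1..<t / 2} \<tau> *\<^sub>R g \<tau>)"
      unfolding geq by (rule integrable_mult_right[OF I1c(1)])
    have gv: "(\<integral>\<tau>. indicator {1..<t / 2} \<tau> *\<^sub>R g \<tau> \<partial>lborel) = \<i> * complex_of_real \<xi> * complex_of_real (c * ln (t / 2)) * propagator\<^sub>0 t \<xi>"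
      unfolding geq integral_mult_right_zero I1c(2) by simp
    have eq: "duhamel (cube_hat u) t 1 (t / 2) \<xi> - \<i> * complex_of_real \<xi> * complex_of_real (c * ln (t / 2)) * propagator\<^sub>0 t \<xi>
       = (\<integral>\<tau>. indicator {1..<t / 2} \<tau> *\<^sub>R (f \<tau> - g \<tau>) \<partial>lborel)"
      unfolding gv[symmetric] duhamel_def set_lebesgue_integral_def f_def[symmetric] scaleR_diff_right
      by (rule Bochner_Integration.integral_diff[OF fi gi, symmetric])
    \<comment> \<open>The three errors in turn: linearised phase, u against its profile, damping
      mismatch of the cubed Gaussian. With \<open>\<tau> powr 0\<close> in the last one, a single
      integration lemma serves all three.\<close>
    define h where "h \<tau> = \<bar>\<xi>\<bar> * E * C * K * (a * t * \<bar>\<xi>\<bar> ^ 3 * \<tau> powr (-1/2) + \<tau> powr (-5/4) + \<xi>\<^sup>2 * \<tau> powr 0)" for \<tau>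
    have fg: "norm (f \<tau> - g \<tau>) \<le> h \<tau>" if \<tau>: "1 \<le> \<tau>" "\<tau> < t / 2" for \<tau>
    proof -
      have \<tau>t: "0 \<le> \<tau>" "\<tau> \<le> t / 2" "0 \<le> t - \<tau>" "\<tau> < t" using \<tau> t by auto
      define H where "H = cube_hat u \<tau> \<xi>"
      \<comment> \<open>Deliberately weaker than 1/(1+\<tau>): it integrates to a multiple of sqrt t
        instead of a second logarithm, and the factor t |\<xi>|^4 in front leaves exactly t^(-1/2)
        after damping.\<close>
      have H1: "norm H \<le> C * K * \<tau> powr (-1/2)"
      proof -
        have "norm H \<le> C * K / (1 + \<tau>)" using sb \<tau>t unfolding H_def source_bound_def by auto
        also have "\<dots> = C * K * (1 + \<tau>) powr (-1)" using \<tau> by (simp add: powr_minus_divide)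
        also have "\<dots> \<le> C * K * \<tau> powr (-1/2)"
        proof (rule mult_left_mono)
          have "(1 + \<tau>) powr (-1) \<le> \<tau> powr (-1)" using \<tau> by (intro powr_mono2') auto
          also have "\<dots> \<le> \<tau> powr (-1/2)" using \<tau> by (intro powr_mono) auto
          finally show "(1 + \<tau>) powr (-1) \<le> \<tau> powr (-1/2)" .
        qed (use C(1) D(10) in auto)
        finally show ?thesis .
      qed
      have eh: "exp (- (\<mu> * (t - \<tau>) * \<xi>\<^sup>2)) \<le> E" unfolding E_def by (rule exp_half_le[OF \<tau>t(1,2)])
      have "propagator\<^sub>0 t \<xi> = propagator\<^sub>0 (t - \<tau>) \<xi> * propagator\<^sub>0 \<tau> \<xi>" by (simp add: propagator\<^sub>0_add)
      then have "f \<tau> - g \<tau> = \<i> * complex_of_real \<xi> * ((propagator (t - \<tau>) \<xi> - propagator\<^sub>0 (t - \<tau>) \<xi>) * H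
          + propagator\<^sub>0 (t - \<tau>) \<xi> * (H - complex_of_real (c / \<tau>) * propagator\<^sub>0 \<tau> \<xi>))"
        unfolding f_def g_def H_def[symmetric] by (simp add: algebra_simps)
      then have "norm (f \<tau> - g \<tau>) = \<bar>\<xi>\<bar> * norm ((propagator (t - \<tau>) \<xi> - propagator\<^sub>0 (t - \<tau>) \<xi>) * H
          + propagator\<^sub>0 (t - \<tau>) \<xi> * (H - complex_of_real (c / \<tau>) * propagator\<^sub>0 \<tau> \<xi>))"
        by (simp only: norm_mult norm_ii norm_of_real mult_1_left)
      also have "\<dots> \<le> \<bar>\<xi>\<bar> * (norm (propagator (t - \<tau>) \<xi> - propagator\<^sub>0 (t - \<tau>) \<xi>) * norm H
          + norm (propagator\<^sub>0 (t - \<tau>) \<xi>) * norm (H - complex_of_real (c / \<tau>) * propagator\<^sub>0 \<tau> \<xi>))"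
        unfolding norm_mult[symmetric] by (intro mult_left_mono norm_triangle_ineq) simp
      also have "\<dots> \<le> \<bar>\<xi>\<bar> * ((a * t * (\<bar>\<xi>\<bar> ^ 3 * E)) * (C * K * \<tau> powr (-1/2)) + E * (C * K * (\<tau> powr (-5/4) + \<xi>\<^sup>2)))"
      proof (intro mult_left_mono add_mono mult_mono H1)
        have "norm (propagator (t - \<tau>) \<xi> - propagator\<^sub>0 (t - \<tau>) \<xi>) \<le> a * (t - \<tau>) * (\<bar>\<xi>\<bar> ^ 3 * exp (- (\<mu> * (t - \<tau>) * \<xi>\<^sup>2)))"
          unfolding a_def by (rule propagator_diff[OF \<tau>t(3)])
        also have "\<dots> \<le> a * t * (\<bar>\<xi>\<bar> ^ 3 * E)"
          using a \<tau>t eh E by (intro mult_mono) auto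
        finally show "norm (propagator (t - \<tau>) \<xi> - propagator\<^sub>0 (t - \<tau>) \<xi>) \<le> a * t * (\<bar>\<xi>\<bar> ^ 3 * E)" .
        show "norm (propagator\<^sub>0 (t - \<tau>) \<xi>) \<le> E" using eh by simp
        show "norm (H - complex_of_real (c / \<tau>) * propagator\<^sub>0 \<tau> \<xi>) \<le> C * K * (\<tau> powr (-5/4) + \<xi>\<^sup>2)"
          unfolding H_def c_def by (rule C(3)[OF s \<tau>(1)])
      qed (use a t0 E in auto)
      also have "\<dots> = h \<tau>" unfolding h_def using \<tau> by (simp add: algebra_simps)
      finally show ?thesis .
    qed
    have cond: "(-1/2::real) \<noteq> -1" "(-5/4::real) \<noteq> -1" "(0::real) \<noteq> -1" by auto
    note P1 = integral_powr_from_1[OF th cond(1)] and P2 = integral_powr_from_1[OF th cond(2)] and P3 = integral_powr_from_1[OF th cond(3)]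
    have heq: "indicator {1..<t / 2} \<tau> * h \<tau> = \<bar>\<xi>\<bar> * E * C * K * (a * t * \<bar>\<xi>\<bar> ^ 3 * (indicator {1..<t / 2} \<tau> * \<tau> powr (-1/2))
       + indicator {1..<t / 2} \<tau> * \<tau> powr (-5/4) + \<xi>\<^sup>2 * (indicator {1..<t / 2} \<tau> * \<tau> powr 0))" for \<tau>
      unfolding h_def by (cases "\<tau> \<in> {1..<t / 2}") auto
    have hi: "integrable lborel (\<lambda>\<tau>. indicator {1..<t / 2} \<tau> * h \<tau>)"
      unfolding heq by (intro integrable_mult_right Bochner_Integration.integrable_add P1 P2 P3)
    have hv: "(\<integral>\<tau>. indicator {1..<t / 2} \<tau> * h \<tau> \<partial>lborel) = \<bar>\<xi>\<bar> * E * C * K * (a * t * \<bar>\<xi>\<bar> ^ 3 * (((t / 2) powr (-1/2 + 1) - 1) / (-1/2 + 1))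
       + ((t / 2) powr (-5/4 + 1) - 1) / (-5/4 + 1) + \<xi>\<^sup>2 * (((t / 2) powr (0 + 1) - 1) / (0 + 1)))"
      unfolding heq integral_mult_right_zero
      by (subst Bochner_Integration.integral_add, intro integrable_mult_right Bochner_Integration.integrable_add P1(1) P2(1),
          intro integrable_mult_right P3(1),
          subst Bochner_Integration.integral_add, intro integrable_mult_right P1(1), rule P2(1))
         (simp only: integral_mult_right_zero P1(2) P2(2) P3(2))
    have "norm (duhamel (cube_hat u) t 1 (t / 2) \<xi> - \<i> * complex_of_real \<xi> * complex_of_real (c * ln (t / 2)) * propagator\<^sub>0 t \<xi>)
        \<le> (\<integral>\<tau>. norm (indicator {1..<t / 2} \<tau> *\<^sub>R (f \<tau> - g \<tau>)) \<partial>lborel)"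
      unfolding eq by (rule integral_norm_bound)
    also have "\<dots> \<le> (\<integral>\<tau>. indicator {1..<t / 2} \<tau> * h \<tau> \<partial>lborel)"
    proof (rule integral_mono[OF _ hi])
      show "integrable lborel (\<lambda>\<tau>. norm (indicator {1..<t / 2} \<tau> *\<^sub>R (f \<tau> - g \<tau>)))"
        unfolding scaleR_diff_right by (intro integrable_norm Bochner_Integration.integrable_diff fi gi)
      show "norm (indicator {1..<t / 2} \<tau> *\<^sub>R (f \<tau> - g \<tau>)) \<le> indicator {1..<t / 2} \<tau> * h \<tau>" for \<tau>
        using fg[of \<tau>] by (cases "\<tau> \<in> {1..<t / 2}") auto
    qed
    also have "\<dots> \<le> \<bar>\<xi>\<bar> * E * C * K * (a * t * \<bar>\<xi>\<bar> ^ 3 * (2 * (t * p)) + 4 + \<xi>\<^sup>2 * t)"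
      unfolding hv
    proof (intro mult_left_mono add_mono)
      have "(t / 2) powr (1/2) \<le> t powr (1/2)" using t0 by (intro powr_mono2) auto
      then show "((t / 2) powr (-1/2 + 1) - 1) / (-1/2 + 1) \<le> 2 * (t * p)"
        using p(3) t0 by (simp add: powr_half_sqrt)
      show "((t / 2) powr (-5/4 + 1) - 1) / (-5/4 + 1) \<le> 4" by simp
      show "((t / 2) powr (0 + 1) - 1) / (0 + 1) \<le> t" using t0 by simp
    qed (use a t0 E C(1) D(10) in auto)
    also have "\<dots> = C * K * (2 * a * t * t * p * (\<bar>\<xi>\<bar> ^ 4 * E) + 4 * (\<bar>\<xi>\<bar> ^ 1 * E) + t * (\<bar>\<xi>\<bar> ^ 3 * E))"
    proof -
      have "\<bar>\<xi>\<bar> ^ 4 = \<bar>\<xi>\<bar> * \<bar>\<xi>\<bar> ^ 3" "\<bar>\<xi>\<bar> ^ 3 = \<bar>\<xi>\<bar> * \<xi>\<^sup>2" by (simp_all add: power_numeral_reduce)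
      then show ?thesis by (simp add: algebra_simps)
    qed
    also have "\<dots> \<le> C * K * (2 * a * t * t * p * (C4 * p ^ 4 / (1 + t * \<xi>\<^sup>2)) + 4 * (C1 * p ^ 1 / (1 + t * \<xi>\<^sup>2)) + t * (C3 * p ^ 3 / (1 + t * \<xi>\<^sup>2)))"
      unfolding E_def p_def using C(1) D(10) a t0
      by (intro mult_left_mono add_mono C1(2)[OF t0] C3(2)[OF t0] C4(2)[OF t0]) auto
    \<comment> \<open>Every t pairs with a p^2, since t p^2 = 1, and a single p = t^(-1/2) survives
      in each term.\<close>
    also have "\<dots> = C * K * (2 * a * C4 * ((t * p\<^sup>2) * (t * p\<^sup>2) * p) + 4 * C1 * p + C3 * ((t * p\<^sup>2) * p)) / (1 + t * \<xi>\<^sup>2)"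
      by (simp add: power_numeral_reduce add_divide_distrib algebra_simps)
    also have "\<dots> = C * (4 * C1 + C3 + 2 * a * C4) * K * p / (1 + t * \<xi>\<^sup>2)"
      unfolding p(2) by (simp add: algebra_simps)
    also have "\<dots> \<le> C' * K * p / (1 + t * \<xi>\<^sup>2)"
      unfolding C'_def using C(1) D(10) p(1) t0
      by (intro divide_right_mono mult_right_mono mult_left_mono) (auto simp: add_nonneg_nonneg)
    finally show "norm (duhamel (cube_hat u) t 1 (t / 2) \<xi>
         - \<i> * complex_of_real \<xi> * complex_of_real (cube_coeff (\<integral>x. u\<^sub>0 x \<partial>lborel) * ln (t / 2)) * propagator\<^sub>0 t \<xi>)
       \<le> C' * K * t powr (-1/2) / (1 + t * \<xi>\<^sup>2)"
      unfolding c_def p_def powr_sqrt(1)[OF t0] .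
  qed
qed


definition asymptotic_error :: "(real \<Rightarrow> real) \<Rightarrow> (real \<Rightarrow> real \<Rightarrow> real) \<Rightarrow> real \<Rightarrow> real \<Rightarrow> real" where
  "asymptotic_error u\<^sub>0 u t x = u t x - (\<integral>x. u\<^sub>0 x \<partial>lborel) * G\<^sub>0 B b \<mu> x t
     + (\<integral>x. u\<^sub>0 x \<partial>lborel) ^ 3 / (4 * sqrt 3 * pi * \<mu>) * ln t * deriv (\<lambda>y. G\<^sub>0 B b \<mu> y t) x"

lemma measurable_G\<^sub>0 [measurable]: "(\<lambda>x. G\<^sub>0 B b \<mu> x t) \<in> borel_measurable borel"
  unfolding G\<^sub>0_def G_def by measurable

text \<open>The Duhamel integral is cut at 1 and at t/2. On [0, 1) a bounded source over unit time
  is enough, on [t/2, t) the tail estimate applies, and [1, t/2) carries the logarithm.\<close>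

lemma asymptotic_error_bounds:
  obtains C \<delta> where "C > 0" "\<delta> > 0"
    "\<And>u\<^sub>0 u e K t. small_solution \<delta> u\<^sub>0 u e K \<Longrightarrow> 2 \<le> t \<Longrightarrow>
      sq_integrable (asymptotic_error u\<^sub>0 u t) \<and>
      (AE x in lborel. \<bar>asymptotic_error u\<^sub>0 u t x\<bar> \<le> C * K * t powr (-1)) \<and>
      (\<integral>x. (asymptotic_error u\<^sub>0 u t x)\<^sup>2 \<partial>lborel) \<le> (C * K * t powr (-3/4))\<^sup>2"
proof -
  obtain Cm \<delta> where Cm: "Cm > 0" "\<delta> > 0"
    "\<And>u\<^sub>0 u e K t \<xi>. small_solution \<delta> u\<^sub>0 u e K \<Longrightarrow> 2 \<le> t \<Longrightarrow>
      norm (duhamel (cube_hat u) t 1 (t / 2) \<xi>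
         - \<i> * complex_of_real \<xi> * complex_of_real (cube_coeff (\<integral>x. u\<^sub>0 x \<partial>lborel) * ln (t / 2)) * propagator\<^sub>0 t \<xi>)
       \<le> Cm * K * t powr (-1/2) / (1 + t * \<xi>\<^sup>2)"
    "\<And>u\<^sub>0 u e K t. small_solution \<delta> u\<^sub>0 u e K \<Longrightarrow> source_bound (cube_hat u) (Cm * K) t"
    using duhamel_middle by blast
  obtain C1 where C1: "C1 > 0"
    "\<And>u\<^sub>0 K t. t > 0 \<Longrightarrow> integrable lborel u\<^sub>0 \<Longrightarrow> integrable lborel (\<lambda>x. x * u\<^sub>0 x) \<Longrightarrow>
       (\<integral>x. \<bar>u\<^sub>0 x\<bar> \<partial>lborel) + (\<integral>x. \<bar>x * u\<^sub>0 x\<bar> \<partial>lborel) \<le> K \<Longrightarrow>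
       L12 (\<lambda>\<xi>. propagator t \<xi> * fourier (\<lambda>x. complex_of_real (u\<^sub>0 x)) \<xi> - complex_of_real ((\<integral>x. u\<^sub>0 x \<partial>lborel) / sqrt (2 * pi)) * propagator\<^sub>0 t \<xi>)
         (C1 * K * t powr (-1)) (C1 * K * t powr (-3/4))"
    using linear_asymptotics by blast
  obtain C2 where C2: "C2 > 0"
    "\<And>H Q t. t > 0 \<Longrightarrow> source_bound H Q t \<Longrightarrow>
      L12 (duhamel H t (t / 2) t) (C2 * Q * t powr (-1)) (C2 * Q * t powr (-3/4))"
    using duhamel_half_tail by blast
  obtain C3 where C3: "C3 > 0" "\<And>t \<xi>. t > 0 \<Longrightarrow> \<bar>\<xi>\<bar> ^ 1 * exp (- (\<mu> / 2 * t * \<xi>\<^sup>2)) \<le> C3 * (1 / sqrt t) ^ 1 / (1 + t * \<xi>\<^sup>2)"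
    using power_exp_bound[of "\<mu> / 2" 1] \<mu>_pos by auto
  define a where "a = C3 * Cm + Cm + C3 / \<mu>"
  have a: "a > 0" unfolding a_def using C3(1) Cm(1) \<mu>_pos by (intro add_pos_pos) auto
  define C where "C = C1 + 4 * a + C2 * Cm"
  have C: "C > 0" unfolding C_def using C1(1) C2(1) Cm(1) a by (intro add_pos_pos) auto
  show thesis
  proof (rule that[OF C Cm(2)])
    fix u\<^sub>0 u e K and t :: real
    assume s: "small_solution \<delta> u\<^sub>0 u e K" and t: "2 \<le> t"
    note D = small_solutionD[OF s]
    have t0: "t > 0" "0 \<le> t" using t by auto
    define M where "M = (\<integral>x. u\<^sub>0 x \<partial>lborel)"
    define c where "c = cube_coeff M"
    define H where "H = cube_hat u"
    note sb = Cm(4)[OF s, of t, folded H_def]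
    define l where "l \<xi> = propagator t \<xi> * fourier (\<lambda>x. complex_of_real (u\<^sub>0 x)) \<xi> - complex_of_real (M / sqrt (2 * pi)) * propagator\<^sub>0 t \<xi>" for \<xi>
    have Ll: "L12 l (C1 * K * t powr (-1)) (C1 * K * t powr (-3/4))"
      using C1(2)[OF t0(1) D(3,4,11)] unfolding l_def[abs_def] M_def .
    have Lt: "L12 (duhamel H t (t / 2) t) (C2 * (Cm * K) * t powr (-1)) (C2 * (Cm * K) * t powr (-3/4))"
      by (rule C2(2)[OF t0(1) sb])
    define j where "j \<xi> = \<i> * complex_of_real \<xi> * propagator\<^sub>0 t \<xi>" for \<xi>
    \<comment> \<open>The middle piece produces ln (t/2), the claim has ln t = ln (t/2) + ln 2; the
      ln 2 part therefore goes into the error, where the derivative and the damping make it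
      O(t^(-1/2)).\<close>
    define P where "P \<xi> = duhamel H t 0 1 \<xi> + (duhamel H t 1 (t / 2) \<xi> - complex_of_real (c * ln (t / 2)) * j \<xi>) - complex_of_real (c * ln 2) * j \<xi>" for \<xi>
    have [measurable]: "duhamel H t r s \<in> borel_measurable borel" for r s by (rule measurable_duhamel[OF sb])
    have [measurable]: "j \<in> borel_measurable borel" unfolding j_def by measurable
    define A where "A = a * K * t powr (-1/2)"
    have A: "A \<ge> 0" unfolding A_def using a D(10) by simp
    have P_le: "norm (P \<xi>) \<le> A / (1 + t * \<xi>\<^sup>2)" for \<xi>
    proof -
      define E where "E = exp (- (\<mu> / 2 * t * \<xi>\<^sup>2))"
      have E3: "\<bar>\<xi>\<bar> * E \<le> C3 * t powr (-1/2) / (1 + t * \<xi>\<^sup>2)"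
        using C3(2)[OF t0(1), of \<xi>] unfolding E_def powr_sqrt(1)[OF t0(1), symmetric] by simp
      have 1: "norm (duhamel H t 0 1 \<xi>) \<le> C3 * Cm * K * t powr (-1/2) / (1 + t * \<xi>\<^sup>2)"
      proof -
        have "norm (duhamel H t 0 1 \<xi>) \<le> \<bar>\<xi>\<bar> * (\<integral>\<tau>. indicator {0..<1::real} \<tau> * (E * (Cm * K)) \<partial>lborel)"
        proof (rule norm_duhamel_le[OF sb])
          show "integrable lborel (\<lambda>\<tau>. indicator {0..<1::real} \<tau> * (E * (Cm * K)))"
            by (rule integrable_mult_left[OF integrable_indicator_Ico])
          fix \<tau> :: real assume \<tau>: "0 \<le> \<tau>" "\<tau> < 1"
          show "exp (- (\<mu> * (t - \<tau>) * \<xi>\<^sup>2)) * norm (H \<tau> \<xi>) \<le> E * (Cm * K)"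
          proof (rule mult_mono)
            show "exp (- (\<mu> * (t - \<tau>) * \<xi>\<^sup>2)) \<le> E" unfolding E_def by (rule exp_half_le) (use \<tau> t in auto)
            have "norm (H \<tau> \<xi>) \<le> Cm * K / (1 + \<tau>)" using sb \<tau> t by (auto simp: source_bound_def)
            also have "\<dots> \<le> Cm * K / 1" using Cm(1) D(10) \<tau> by (intro divide_left_mono) auto
            finally show "norm (H \<tau> \<xi>) \<le> Cm * K" by simp
          qed (auto simp: E_def)
        qed (use t in auto)
        also have "\<dots> = (\<bar>\<xi>\<bar> * E) * (Cm * K)" by simp
        also have "\<dots> \<le> (C3 * t powr (-1/2) / (1 + t * \<xi>\<^sup>2)) * (Cm * K)"
          using Cm(1) D(10) by (intro mult_right_mono E3) auto
        finally show ?thesis by (simp add: mult_ac)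
      qed
      have 2: "norm (duhamel H t 1 (t / 2) \<xi> - complex_of_real (c * ln (t / 2)) * j \<xi>) \<le> Cm * K * t powr (-1/2) / (1 + t * \<xi>\<^sup>2)"
        using Cm(3)[OF s t, of \<xi>] unfolding j_def c_def M_def H_def by (simp only: mult_ac)
      have 3: "norm (complex_of_real (c * ln 2) * j \<xi>) \<le> C3 / \<mu> * K * t powr (-1/2) / (1 + t * \<xi>\<^sup>2)"
      proof -
        have cK: "\<bar>c\<bar> \<le> 1 / \<mu> * K" unfolding c_def by (rule cube_coeff_bound[OF D(12)[folded M_def] D(8,9)])
        have "ln 2 \<le> (1::real)" using ln_le_minus_one[of "2::real"] by simp
        then have "\<bar>c * ln 2\<bar> \<le> \<bar>c\<bar> * 1" unfolding abs_mult by (intro mult_left_mono) auto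
        then have cl: "\<bar>c * ln 2\<bar> \<le> 1 / \<mu> * K" using cK by linarith
        have "exp (- (\<mu> * t * \<xi>\<^sup>2)) \<le> E" using exp_half_le[of 0 t \<xi>] t unfolding E_def by simp
        then have "norm (j \<xi>) \<le> \<bar>\<xi>\<bar> * E" unfolding j_def by (simp add: norm_mult mult_left_mono)
        then have "norm (j \<xi>) \<le> C3 * t powr (-1/2) / (1 + t * \<xi>\<^sup>2)" using E3 by linarith
        then have "\<bar>c * ln 2\<bar> * norm (j \<xi>) \<le> (1 / \<mu> * K) * (C3 * t powr (-1/2) / (1 + t * \<xi>\<^sup>2))"
          using \<mu>_pos D(10) by (intro mult_mono cl) auto
        then show ?thesis unfolding norm_mult norm_of_real by (simp add: mult_ac)
      qed
      have "norm (P \<xi>) \<le> norm (duhamel H t 0 1 \<xi>) + norm (duhamel H t 1 (t / 2) \<xi> - complex_of_real (c * ln (t / 2)) * j \<xi>) + norm (complex_of_real (c * ln 2) * j \<xi>)"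
        unfolding P_def by (rule order_trans[OF norm_triangle_ineq4 add_right_mono[OF norm_triangle_ineq]])
      also have "\<dots> \<le> C3 * Cm * K * t powr (-1/2) / (1 + t * \<xi>\<^sup>2) + Cm * K * t powr (-1/2) / (1 + t * \<xi>\<^sup>2) + C3 / \<mu> * K * t powr (-1/2) / (1 + t * \<xi>\<^sup>2)"
        by (intro add_mono 1 2 3)
      also have "\<dots> = A / (1 + t * \<xi>\<^sup>2)"
        unfolding A_def a_def by (simp only: add_divide_distrib[symmetric] distrib_right[symmetric])
      finally show ?thesis .
    qed
    have "L12 P (4 * A * t powr (-1/2)) (2 * A * t powr (-1/4))"
      by (rule L12_dominated[OF _ t0(1) A P_le]) (unfold P_def, measurable)
    then have LP: "L12 P (4 * a * K * t powr (-1)) (4 * a * K * t powr (-3/4))"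
    proof (rule L12_mono)
      have "4 * A * t powr (-1/2) = 4 * a * K * (t powr (-1/2) * t powr (-1/2))" by (simp add: A_def)
      also have "t powr (-1/2) * t powr (-1/2) = t powr (-1)" unfolding powr_add[symmetric] by simp
      finally show "4 * A * t powr (-1/2) \<le> 4 * a * K * t powr (-1)" by simp
      have "2 * A * t powr (-1/4) = 2 * a * K * (t powr (-1/2) * t powr (-1/4))" by (simp add: A_def)
      also have "t powr (-1/2) * t powr (-1/4) = t powr (-3/4)" unfolding powr_add[symmetric] by simp
      also have "2 * a * K * t powr (-3/4) \<le> 4 * a * K * t powr (-3/4)" using a D(10) by (intro mult_right_mono) auto
      finally show "2 * A * t powr (-1/4) \<le> 4 * a * K * t powr (-3/4)" .
    qed
    define W where "W \<xi> = l \<xi> - P \<xi> - duhamel H t (t / 2) t \<xi>" for \<xi>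
    have LW0: "L12 W (C1 * K * t powr (-1) + 4 * a * K * t powr (-1) + C2 * (Cm * K) * t powr (-1))
        (C1 * K * t powr (-3/4) + 4 * a * K * t powr (-3/4) + C2 * (Cm * K) * t powr (-3/4))"
      unfolding W_def[abs_def] by (rule L12_diff[OF L12_diff[OF Ll LP] Lt])
    have LW: "L12 W (C * K * t powr (-1)) (C * K * t powr (-3/4))"
      by (rule L12_mono[OF LW0]) (simp_all add: C_def algebra_simps)
    define k where "k \<xi> = complex_of_real (1 / sqrt (2 * pi)) * propagator\<^sub>0 t \<xi>" for \<xi>
    define dk where "dk \<xi> = \<i> * complex_of_real \<xi> * (complex_of_real (1 / sqrt (2 * pi)) * propagator\<^sub>0 t \<xi>)" for \<xi>
    define N where "N = M ^ 3 / (4 * sqrt 3 * pi * \<mu>) * ln t"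
    have ki: "integrable lborel k" unfolding k_def by (intro integrable_mult_right integrable_propagator t0)
    have dki: "integrable lborel dk"
    proof -
      have "dk = (\<lambda>\<xi>. (\<i> * complex_of_real (1 / sqrt (2 * pi))) * (complex_of_real \<xi> * propagator\<^sub>0 t \<xi>))"
        by (rule ext) (simp only: dk_def mult_ac)
      then show ?thesis by (simp only:) (intro integrable_mult_right integrable_propagator t0)
    qed
    have Wi: "integrable lborel W" using LW by (simp add: L12_def)
    have sol: "solution_hat u\<^sub>0 u t = (\<lambda>\<xi>. (W \<xi> + complex_of_real M * k \<xi>) - complex_of_real N * dk \<xi>)"
    proof
      fix \<xi>
      have "duhamel H t 0 t \<xi> = duhamel H t 0 1 \<xi> + duhamel H t 1 (t / 2) \<xi> + duhamel H t (t / 2) t \<xi>"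
        using duhamel_split[OF sb, of 0 1 t \<xi>] duhamel_split[OF sb, of 1 "t / 2" t \<xi>] t by simp
      moreover have "complex_of_real N * dk \<xi> = complex_of_real (c * ln (t / 2)) * j \<xi> + complex_of_real (c * ln 2) * j \<xi>"
      proof -
        have lt: "ln t = ln (t / 2) + ln 2" using t by (simp add: ln_div)
        have "N * (1 / sqrt (2 * pi)) = c * ln t" by (simp add: N_def c_def cube_coeff_def)
        then have "N * (1 / sqrt (2 * pi)) = c * ln (t / 2) + c * ln 2"
          unfolding lt distrib_left .
        moreover have "complex_of_real N * dk \<xi> = complex_of_real (N * (1 / sqrt (2 * pi))) * j \<xi>"
          unfolding dk_def j_def by (simp only: of_real_mult mult_ac)
        ultimately show ?thesis by (simp only: of_real_add distrib_right)
      qed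
      moreover have "complex_of_real M * k \<xi> = complex_of_real (M / sqrt (2 * pi)) * propagator\<^sub>0 t \<xi>"
        by (simp add: k_def)
      ultimately show "solution_hat u\<^sub>0 u t \<xi> = (W \<xi> + complex_of_real M * k \<xi>) - complex_of_real N * dk \<xi>"
        unfolding solution_hat_def W_def P_def l_def H_def[symmetric] by (simp only:) (simp add: algebra_simps)
    qed
    have wW: "AE x in lborel. asymptotic_error u\<^sub>0 u t x = Re (inv_fourier W x)"
      using mild_solution_fourier[OF D(1,3) sb[unfolded H_def] t0(1)]
    proof eventually_elim
      case (elim x)
      have "inv_fourier (solution_hat u\<^sub>0 u t) x = inv_fourier W x + complex_of_real M * inv_fourier k x - complex_of_real N * inv_fourier dk x"
        unfolding sol
        by (simp only: inv_fourier_diff[OF Bochner_Integration.integrable_add[OF Wi integrable_mult_right[OF ki]] integrable_mult_right[OF dki]]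
            inv_fourier_add[OF Wi integrable_mult_right[OF ki]] inv_fourier_cmult)
      moreover have "G\<^sub>0 B b \<mu> x t = Re (inv_fourier k x)" unfolding k_def[abs_def] by (rule G\<^sub>0_fourier[OF t0(1)])
      moreover have "deriv (\<lambda>y. G\<^sub>0 B b \<mu> y t) x = Re (inv_fourier dk x)" unfolding dk_def[abs_def] by (rule deriv_G\<^sub>0_fourier[OF t0(1)])
      ultimately show ?case using elim unfolding asymptotic_error_def M_def[symmetric] N_def[symmetric] by simp
    qed
    have us: "u t \<in> sobolev 1" using D(13) t0 by (auto simp: continuous_sobolev_def)
    have [measurable]: "u t \<in> borel_measurable borel" by (rule sq_integrable_measurable[OF sobolevD(2)[OF us]])
    \<comment> \<open>Measurability of the derivative in x is read off its Fourier
      representation.\<close>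
    have dm: "(\<lambda>x. deriv (\<lambda>y. G\<^sub>0 B b \<mu> y t) x) = (\<lambda>x. Re (inv_fourier dk x))"
      unfolding dk_def[abs_def] by (rule ext) (rule deriv_G\<^sub>0_fourier[OF t0(1)])
    have "dk \<in> borel_measurable borel" using dki by auto
    then have [measurable]: "(\<lambda>x. deriv (\<lambda>y. G\<^sub>0 B b \<mu> y t) x) \<in> borel_measurable borel"
      unfolding dm using measurable_inv_fourier by measurable
    have "asymptotic_error u\<^sub>0 u t \<in> borel_measurable borel"
      unfolding asymptotic_error_def[abs_def] by measurable
    from L12_Re_inv_fourier[OF LW wW this]
    show "sq_integrable (asymptotic_error u\<^sub>0 u t) \<and>
      (AE x in lborel. \<bar>asymptotic_error u\<^sub>0 u t x\<bar> \<le> C * K * t powr (-1)) \<and>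
      (\<integral>x. (asymptotic_error u\<^sub>0 u t x)\<^sup>2 \<partial>lborel) \<le> (C * K * t powr (-3/4))\<^sup>2" by blast
  qed
qed

end

section \<open>From the estimates of the remainder to the theorem\<close>

lemma Lp_1_iff: "f \<in> Lp 1 \<longleftrightarrow> integrable lborel (f :: real \<Rightarrow> real)"
  unfolding Lp_def by (auto simp: one_ereal_def integrable_abs_iff)

lemma Lp_norm_1: "Lp_norm 1 f = (\<integral>x. \<bar>f x\<bar> \<partial>lborel)" for f :: "real \<Rightarrow> real"
  unfolding Lp_norm_def by (simp add: one_ereal_def)

theorem theorem4p3:
  fixes B b \<mu> :: real
  assumes "B > 0" "b > 0" "\<mu> > 0"
  shows "\<exists>\<delta>>0. \<forall>E\<^sub>0\<le>\<delta>. \<exists>C>0. \<forall>(u\<^sub>0 :: real \<Rightarrow> real) (u :: real \<Rightarrow> real \<Rightarrow> real).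
    u\<^sub>0 \<in> sobolev 1 \<inter> Lp 1 \<and> (\<lambda>x. x * u\<^sub>0 x) \<in> Lp 1 \<and>
    sobolev_norm 1 u\<^sub>0 + Lp_norm 1 u\<^sub>0 = E\<^sub>0 \<and>
    mild_solution B b \<mu> u\<^sub>0 u \<longrightarrow>
    (let M = (\<integral>x. u\<^sub>0 x \<partial>lborel);
         E\<^sub>1 = E\<^sub>0 + Lp_norm 1 (\<lambda>x. x * u\<^sub>0 x);
         w = (\<lambda>t x. u t x - M * G\<^sub>0 B b \<mu> x t
                + M ^ 3 / (4 * sqrt 3 * pi * \<mu>) * ln t * deriv (\<lambda>y. G\<^sub>0 B b \<mu> y t) x)
     in \<forall>(q :: ereal) (t :: real). 2 \<le> q \<and> 2 \<le> t \<longrightarrow>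
          w t \<in> Lp q \<and>
          Lp_norm q (w t)
            \<le> C * E\<^sub>1 * t powr (- (1/2) * (1 - real_of_ereal (1 / q)) - 1/2))"
proof -
  interpret dispersive B b \<mu> by unfold_locales (use assms in auto)
  obtain C \<delta> where C: "C > 0" "\<delta> > 0"
    "\<And>u\<^sub>0 u e K t. small_solution \<delta> u\<^sub>0 u e K \<Longrightarrow> 2 \<le> t \<Longrightarrow>
      sq_integrable (asymptotic_error u\<^sub>0 u t) \<and>
      (AE x in lborel. \<bar>asymptotic_error u\<^sub>0 u t x\<bar> \<le> C * K * t powr (-1)) \<and>
      (\<integral>x. (asymptotic_error u\<^sub>0 u t x)\<^sup>2 \<partial>lborel) \<le> (C * K * t powr (-3/4))\<^sup>2"
    using asymptotic_error_bounds by blast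
  \<comment> \<open>Half of the threshold, so that E_0 + \<eta> with \<eta> <= d is still at most
    \<delta> and at most 1.\<close>
  define d where "d = min \<delta> 1 / 2"
  have d: "d > 0" "2 * d \<le> \<delta>" "2 * d \<le> 1" unfolding d_def using C(2) by auto
  have main: "asymptotic_error u\<^sub>0 u t \<in> Lp q \<and> Lp_norm q (asymptotic_error u\<^sub>0 u t)
      \<le> C * (E\<^sub>0 + Lp_norm 1 (\<lambda>x. x * u\<^sub>0 x)) * t powr (- (1/2) * (1 - real_of_ereal (1 / q)) - 1/2)"
    if E0: "E\<^sub>0 \<le> d" and u0: "u\<^sub>0 \<in> sobolev 1" "u\<^sub>0 \<in> Lp 1" "(\<lambda>x. x * u\<^sub>0 x) \<in> Lp 1"
      and n: "sobolev_norm 1 u\<^sub>0 + Lp_norm 1 u\<^sub>0 = E\<^sub>0" and mild: "mild_solution B b \<mu> u\<^sub>0 u"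
      and q: "2 \<le> q" and t: "2 \<le> t" for E\<^sub>0 u\<^sub>0 u and q :: ereal and t :: real
  proof -
    define F where "F = Lp_norm 1 (\<lambda>x. x * u\<^sub>0 x)"
    define z where "z = t powr (- (1/2) * (1 - real_of_ereal (1 / q)) - 1/2)"
    have z: "z > 0" unfolding z_def using t by simp
    have nn: "0 \<le> E\<^sub>0" "0 \<le> F"
      using sobolevD(5)[OF u0(1)] n unfolding F_def Lp_norm_1 by (smt (verit) Bochner_Integration.integral_nonneg abs_ge_zero)+
    have small: "small_solution \<delta> u\<^sub>0 u (E\<^sub>0 + \<eta>) (E\<^sub>0 + \<eta> + F)" if "0 < \<eta>" "\<eta> \<le> d" for \<eta>
      unfolding small_solution_def
      using mild u0 n that nn d E0 by (auto simp: Lp_1_iff Lp_norm_1 F_def)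
    have est: "asymptotic_error u\<^sub>0 u t \<in> Lp q \<and> Lp_norm q (asymptotic_error u\<^sub>0 u t) \<le> C * (E\<^sub>0 + \<eta> + F) * z"
      if \<eta>: "0 < \<eta>" "\<eta> \<le> d" for \<eta>
      using C(3)[OF small[OF \<eta>] t] C(1) nn \<eta> t unfolding z_def by (intro sup_L2_interpolation q) auto
    \<comment> \<open>The estimates require e > 0. With e = E_0 + \<eta> and \<eta> tending to 0 the
      bound by E_1 follows, also when E_0 = 0.\<close>
    have "Lp_norm q (asymptotic_error u\<^sub>0 u t) \<le> C * (E\<^sub>0 + F) * z"
    proof (rule field_le_epsilon)
      fix \<epsilon> :: real assume \<epsilon>: "0 < \<epsilon>"
      define \<eta> where "\<eta> = min d (\<epsilon> / (C * z))"
      have Cz: "C * z > 0" using C(1) z by simp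
      have \<eta>: "0 < \<eta>" "\<eta> \<le> d" "\<eta> * (C * z) \<le> \<epsilon>"
        unfolding \<eta>_def using d(1) \<epsilon> Cz by (auto simp: min_def field_simps)
      have "Lp_norm q (asymptotic_error u\<^sub>0 u t) \<le> C * (E\<^sub>0 + \<eta> + F) * z" using est[OF \<eta>(1,2)] by blast
      also have "\<dots> = C * (E\<^sub>0 + F) * z + \<eta> * (C * z)" by (simp add: algebra_simps)
      finally show "Lp_norm q (asymptotic_error u\<^sub>0 u t) \<le> C * (E\<^sub>0 + F) * z + \<epsilon>" using \<eta>(3) by linarith
    qed
    with est[OF d(1) order_refl] show ?thesis unfolding F_def z_def by blast
  qed
  show ?thesis
  \<comment> \<open>The witness C is the same for all E_0 <= d and all data.\<close>
  proof (rule exI[of _ d], intro conjI d(1) allI impI, rule exI[of _ C], intro conjI C(1) allI impI)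
    fix E\<^sub>0 and u\<^sub>0 :: "real \<Rightarrow> real" and u :: "real \<Rightarrow> real \<Rightarrow> real"
    assume E0: "E\<^sub>0 \<le> d" and H: "u\<^sub>0 \<in> sobolev 1 \<inter> Lp 1 \<and> (\<lambda>x. x * u\<^sub>0 x) \<in> Lp 1 \<and>
      sobolev_norm 1 u\<^sub>0 + Lp_norm 1 u\<^sub>0 = E\<^sub>0 \<and> mild_solution B b \<mu> u\<^sub>0 u"
    show "let M = (\<integral>x. u\<^sub>0 x \<partial>lborel);
         E\<^sub>1 = E\<^sub>0 + Lp_norm 1 (\<lambda>x. x * u\<^sub>0 x);
         w = (\<lambda>t x. u t x - M * G\<^sub>0 B b \<mu> x t
                + M ^ 3 / (4 * sqrt 3 * pi * \<mu>) * ln t * deriv (\<lambda>y. G\<^sub>0 B b \<mu> y t) x)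
     in \<forall>(q :: ereal) (t :: real). 2 \<le> q \<and> 2 \<le> t \<longrightarrow>
          w t \<in> Lp q \<and>
          Lp_norm q (w t)
            \<le> C * E\<^sub>1 * t powr (- (1/2) * (1 - real_of_ereal (1 / q)) - 1/2)"
      unfolding Let_def asymptotic_error_def[symmetric, abs_def]
      using main[OF E0] H by blast
  qed
qed

end
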